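(* Let $M,N$ be smooth manifolds, $h$ a complete continuous Riemannian metric on $N$, $F:M\to N$ a local Lipeomorphism and $g=F^*h$ (a rough metric on $M$). Let $a\in L^\infty(M)$ be complex valued and let $A$ be an essentially bounded measurable section of endomorphisms of $\mathbb{C}\oplus T^*M$, such that for some $\kappa_1,\kappa_2>0$ $$\operatorname{Re}\langle AS_Mv,S_Mv\rangle_g\ge\kappa_1\|v\|^2_{W^{1,2}(M)},\qquad \operatorname{Re}\langle au,u\rangle_g\ge\kappa_2\|u\|_g^2$$ for all $v\in W^{1,2}(M)$, $u\in L^2(M)$. With $\Pi_{M,B}$ and $\Pi_{N,\tilde B}$ as defined in the context, the quadratic estimate $$\int_0^\infty\|t\Pi_{M,B}(I+t^2\Pi_{M,B}^2)^{-1}u\|_g^2\,\frac{dt}{t}\simeq\|u\|_g^2\quad\text{for all }u\in\overline{\mathcal{R}(\Pi_{M,B})}$$ holds if and only if $$\int_0^\infty\|t\Pi_{N,\tilde B}(I+t^2\Pi_{N,\tilde B}^2)^{-1}v\|_h^2\,\frac{dt}{t}\simeq\|v\|_h^2\quad\text{for all }v\in\overline{\mathcal{R}(\Pi_{N,\tilde B})}.$$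
   Context: A local Lipeomorphism $F:M\to N$ is a homeomorphism such that for all $x\in M$ there are charts $(U,\psi)$ near $x$ and $(V,\varphi)$ near $F(x)$ and $C\ge1$ with $C^{-1}|x'-y'|\le|(\varphi\circ F\circ\psi^{-1})(x')-(\varphi\circ F\circ\psi^{-1})(y')|\le C|x'-y'|$ for all $x', y'$ in the domain of $\varphi\circ F\circ\psi^{-1}$. Then $F$ is differentiable almost everywhere (in charts, with respect to Lebesgue measure $\mathcal{L}$) and $g=F^*h$ is defined almost everywhere; in charts $d\mu_g=\sqrt{\det(g_{ij})}\,d\mathcal{L}$, similarly for $h$. A rough metric is a measurable symmetric covariant $2$-tensor field which near every point is, in some chart, almost everywhere comparable (norms within a factor $C\geq 1$) to the Euclidean metric of the chart. $L^2$ spaces consist of complex functions or covector fields, square integrable with respect to the metric and its measure; $W^{1,2}(M)=W^{1,2}(M,g)$ is the closure of $\{u\in C^\infty\cap L^2(M):\nabla u\in L^2(T^*M)\}$ in the norm $\|u\|+\|\nabla u\|$, where $\nabla$ is the exterior derivative on functions. Let $S_M=(I,\overline{\nabla^M_c})$, where $\overline{\nabla^M_c}$ is the closure of $\nabla$ on $C_c^\infty(M)$; here its domain is $W^{1,2}(M)$. Define $S_N$ likewise on $(N,h)$. Let $\mathcal{H}_1=L^2(M)\oplus L^2(M)\oplus L^2(T^*M)$ (metric $g$), $\mathcal{H}_2=L^2(N)\oplus L^2(N)\oplus L^2(T^*N)$ (metric $h$), both viewed as $L^2\oplus(L^2\oplus L^2(T^* ))$, and $$\Gamma_M=\begin{pmatrix}0&0\\S_M&0\end{pmatrix},\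 \Gamma_N=\begin{pmatrix}0&0\\S_N&0\end{pmatrix},\ B_1=\begin{pmatrix}a&0\\0&0\end{pmatrix},\ B_2=\begin{pmatrix}0&0\\0&A\end{pmatrix}.$$ Let $\Phi:\mathcal{H}_1\to\mathcal{H}_2$, $\Phi(u,v,w)=((F^{-1})^*u,(F^{-1})^*v,(F^{-1})^*w)$ (an isometric isomorphism), $\tilde B_i=\Phi B_i\Phi^{-1}$, $\Pi_{M,B}=\Gamma_M+B_1\Gamma_M^*B_2$ and $\Pi_{N,\tilde B}=\Gamma_N+\tilde B_1\Gamma_N^*\tilde B_2$, adjoints being taken in $\mathcal{H}_1$, $\mathcal{H}_2$ respectively. $\mathcal{R}$ denotes range, and $\simeq$ means two-sided bounds with constants independent of $u$ (resp. $v$). *)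

theory Defs
  imports "HOL-Analysis.Analysis" "HOL-Library.Function_Algebras"
begin

section \<open>Smooth manifolds\<close>

text \<open>A manifold is (the whole of) a Hausdorff, second countable type \<open>'m\<close> together with a
  maximal smooth atlas. A chart \<open>(U, \<psi>)\<close> consists of its domain and a coordinate map that is
  only meaningful on \<open>U\<close>.\<close>

primrec Ck_on :: "nat \<Rightarrow> ('a::real_normed_vector) set \<Rightarrow> ('a \<Rightarrow> 'b::real_normed_vector) \<Rightarrow> bool" where
  "Ck_on 0 S f \<longleftrightarrow> continuous_on S f"
| "Ck_on (Suc k) S f \<longleftrightarrow> (\<forall>x\<in>S. f differentiable (at x)) \<and>
     (\<forall>v. Ck_on k S (\<lambda>x. frechet_derivative f (at x) v))"

definition smooth_on :: "('a::real_normed_vector) set \<Rightarrow> ('a \<Rightarrow> 'b::real_normed_vector) \<Rightarrow> bool" where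
  "smooth_on S f \<longleftrightarrow> (\<forall>k. Ck_on k S f)"

type_synonym ('m, 'n) chart = "'m set \<times> ('m \<Rightarrow> real ^ 'n)"

definition chart_inv :: "('m, 'n::finite) chart \<Rightarrow> real ^ 'n \<Rightarrow> 'm" where
  "chart_inv c = inv_into (fst c) (snd c)"

definition local_rep ::
  "('m \<Rightarrow> 'k) \<Rightarrow> ('m, 'n::finite) chart \<Rightarrow> ('k, 'n) chart \<Rightarrow> real ^ 'n \<Rightarrow> real ^ 'n" where
  "local_rep F c d = snd d \<circ> F \<circ> chart_inv c"

definition jacobian ::
  "('m \<Rightarrow> 'k) \<Rightarrow> ('m, 'n::finite) chart \<Rightarrow> ('k, 'n) chart \<Rightarrow> 'm \<Rightarrow> real ^ 'n ^ 'n" where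
  "jacobian F c d x = matrix (frechet_derivative (local_rep F c d) (at (snd c x)))"

definition is_chart :: "('m::topological_space, 'n::finite) chart \<Rightarrow> bool" where
  "is_chart c \<longleftrightarrow> open (fst c) \<and> open (snd c ` fst c) \<and>
     homeomorphism (fst c) (snd c ` fst c) (snd c) (chart_inv c)"

definition smooth_transition :: "('m, 'n::finite) chart \<Rightarrow> ('m, 'n) chart \<Rightarrow> bool" where
  "smooth_transition c d \<longleftrightarrow> smooth_on (snd c ` (fst c \<inter> fst d)) (local_rep id c d)"

definition smooth_structure ::
  "('m::{t2_space, second_countable_topology}, 'n::finite) chart set \<Rightarrow> bool" where
  "smooth_structure \<A> \<longleftrightarrow>
     (\<forall>c\<in>\<A>. is_chart c) \<and> (\<Union>c\<in>\<A>. fst c) = UNIV \<and>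
     (\<forall>c\<in>\<A>. \<forall>d\<in>\<A>. smooth_transition c d) \<and>
     (\<forall>c. is_chart c \<and> (\<forall>d\<in>\<A>. smooth_transition c d \<and> smooth_transition d c) \<longrightarrow> c \<in> \<A>)"

text \<open>An arbitrary chart around a point, used to evaluate pointwise quantities that do not depend
  on the chart.\<close>

definition chart_at :: "('m, 'n::finite) chart set \<Rightarrow> 'm \<Rightarrow> ('m, 'n) chart" where
  "chart_at \<A> x = (SOME c. c \<in> \<A> \<and> x \<in> fst c)"

section \<open>Tensor fields\<close>

text \<open>Tensor fields are given by their components in every chart of the atlas, subject to the
  usual transformation law. Components in chart \<open>c\<close> at \<open>x\<close> are meaningful only for
  \<open>c \<in> \<A>\<close> and \<open>x \<in> fst c\<close>. Covectors are complex, metrics real.\<close>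

type_synonym ('m, 'n) cofield = "('m, 'n) chart \<Rightarrow> 'm \<Rightarrow> complex ^ 'n"
type_synonym ('m, 'n) metric_field = "('m, 'n) chart \<Rightarrow> 'm \<Rightarrow> real ^ 'n ^ 'n"
type_synonym ('m, 'n) endo_field =
  "('m, 'n) chart \<Rightarrow> 'm \<Rightarrow> complex \<times> (complex ^ 'n) \<Rightarrow> complex \<times> (complex ^ 'n)"

definition pull_covector :: "real ^ 'n ^ 'n \<Rightarrow> complex ^ 'n \<Rightarrow> complex ^ ('n::finite)" where
  "pull_covector J \<zeta> = (\<chi> j. \<Sum>i\<in>UNIV. complex_of_real (J $ i $ j) * \<zeta> $ i)"

definition chart_measurable ::
  "('m, 'n::finite) chart \<Rightarrow> ('m \<Rightarrow> 'b::topological_space) \<Rightarrow> bool" where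
  "chart_measurable c f \<longleftrightarrow> (\<lambda>y. f (chart_inv c y)) \<in> borel_measurable (lebesgue_on (snd c ` fst c))"

definition measurable_cofield :: "('m, 'n::finite) chart set \<Rightarrow> ('m, 'n) cofield \<Rightarrow> bool" where
  "measurable_cofield \<A> \<omega> \<longleftrightarrow>
     (\<forall>c\<in>\<A>. \<forall>d\<in>\<A>. \<forall>x\<in>fst c \<inter> fst d. \<omega> c x = pull_covector (jacobian id c d x) (\<omega> d x)) \<and>
     (\<forall>c\<in>\<A>. chart_measurable c (\<omega> c))"

text \<open>Measurable sections of the endomorphisms of \<open>\<complex> \<oplus> T\<^sup>*M\<close>.\<close>

definition measurable_endo_field :: "('m, 'n::finite) chart set \<Rightarrow> ('m, 'n) endo_field \<Rightarrow> bool" where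
  "measurable_endo_field \<A> A \<longleftrightarrow>
     (\<forall>c\<in>\<A>. \<forall>x\<in>fst c. (\<forall>p q. A c x (p + q) = A c x p + A c x q) \<and>
        (\<forall>k z \<zeta>. A c x (k * z, k *s \<zeta>) = (k * fst (A c x (z, \<zeta>)), k *s snd (A c x (z, \<zeta>))))) \<and>
     (\<forall>c\<in>\<A>. \<forall>d\<in>\<A>. \<forall>x\<in>fst c \<inter> fst d. \<forall>z \<zeta>.
        A c x (z, pull_covector (jacobian id c d x) \<zeta>) =
          (fst (A d x (z, \<zeta>)), pull_covector (jacobian id c d x) (snd (A d x (z, \<zeta>))))) \<and>
     (\<forall>c\<in>\<A>. \<forall>p. chart_measurable c (\<lambda>x. A c x p))"

definition continuous_metric ::
  "('m::topological_space, 'n::finite) chart set \<Rightarrow> ('m, 'n) metric_field \<Rightarrow> bool" where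
  "continuous_metric \<A> h \<longleftrightarrow>
     (\<forall>c\<in>\<A>. \<forall>d\<in>\<A>. \<forall>x\<in>fst c \<inter> fst d.
        h c x = transpose (jacobian id c d x) ** h d x ** jacobian id c d x) \<and>
     (\<forall>c\<in>\<A>. continuous_on (fst c) (h c) \<and>
        (\<forall>x\<in>fst c. transpose (h c x) = h c x \<and> (\<forall>v. v \<noteq> 0 \<longrightarrow> v \<bullet> (h c x *v v) > 0)))"

subsection \<open>The Riemannian distance and completeness\<close>

definition piecewise_C1_curve ::
  "('m::topological_space, 'n::finite) chart set \<Rightarrow> (real \<Rightarrow> 'm) \<Rightarrow> bool" where
  "piecewise_C1_curve \<A> \<gamma> \<longleftrightarrow> path \<gamma> \<and>
     (\<exists>T. finite T \<and> (\<forall>c\<in>\<A>. (snd c \<circ> \<gamma>) C1_differentiable_on {t \<in> {0<..<1} - T. \<gamma> t \<in> fst c}))"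

definition riem_speed ::
  "('m, 'n::finite) chart set \<Rightarrow> ('m, 'n) metric_field \<Rightarrow> (real \<Rightarrow> 'm) \<Rightarrow> real \<Rightarrow> real" where
  "riem_speed \<A> h \<gamma> t =
     (let c = chart_at \<A> (\<gamma> t); v = vector_derivative (snd c \<circ> \<gamma>) (at t)
      in sqrt (v \<bullet> (h c (\<gamma> t) *v v)))"

text \<open>The distance is infinite between points of different components.\<close>

definition riem_dist ::
  "('m::topological_space, 'n::finite) chart set \<Rightarrow> ('m, 'n) metric_field \<Rightarrow> 'm \<Rightarrow> 'm \<Rightarrow> ennreal" where
  "riem_dist \<A> h x y =
     (INF \<gamma>\<in>{\<gamma>. piecewise_C1_curve \<A> \<gamma> \<and> \<gamma> 0 = x \<and> \<gamma> 1 = y}.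
        \<integral>\<^sup>+t\<in>{0..1}. ennreal (riem_speed \<A> h \<gamma> t) \<partial>lborel)"

definition complete_metric ::
  "('m::topological_space, 'n::finite) chart set \<Rightarrow> ('m, 'n) metric_field \<Rightarrow> bool" where
  "complete_metric \<A> h \<longleftrightarrow>
     (\<forall>X :: nat \<Rightarrow> 'm. (\<forall>e>0. \<exists>K. \<forall>m\<ge>K. \<forall>n\<ge>K. riem_dist \<A> h (X m) (X n) < e) \<longrightarrow>
        (\<exists>x. (\<lambda>n. riem_dist \<A> h (X n) x) \<longlonglongrightarrow> 0))"

subsection \<open>Local Lipeomorphisms and pullbacks\<close>

definition local_lipeomorphism ::
  "('m::topological_space, 'n::finite) chart set \<Rightarrow> ('k::topological_space, 'n) chart set \<Rightarrow>
   ('m \<Rightarrow> 'k) \<Rightarrow> bool" where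
  "local_lipeomorphism \<A> \<B> F \<longleftrightarrow>
     (\<exists>G. homeomorphism UNIV UNIV F G) \<and>
     (\<forall>x. \<exists>c\<in>\<A>. \<exists>d\<in>\<B>. x \<in> fst c \<and> F x \<in> fst d \<and>
        (\<exists>C\<ge>1. \<forall>x'\<in>snd c ` (fst c \<inter> F -` fst d). \<forall>y'\<in>snd c ` (fst c \<inter> F -` fst d).
           inverse C * norm (x' - y') \<le> norm (local_rep F c d x' - local_rep F c d y') \<and>
           norm (local_rep F c d x' - local_rep F c d y') \<le> C * norm (x' - y')))"

text \<open>Pullbacks under maps that are differentiable almost everywhere; they are set to \<open>0\<close> on the
  remaining null set.\<close>

definition pullback_metric ::
  "('k, 'n::finite) chart set \<Rightarrow> ('m \<Rightarrow> 'k) \<Rightarrow> ('k, 'n) metric_field \<Rightarrow> ('m, 'n) metric_field" where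
  "pullback_metric \<B> F h c x =
     (let d = chart_at \<B> (F x) in
      if local_rep F c d differentiable (at (snd c x))
      then transpose (jacobian F c d x) ** h d (F x) ** jacobian F c d x else 0)"

definition pullback_cofield ::
  "('k, 'n::finite) chart set \<Rightarrow> ('m \<Rightarrow> 'k) \<Rightarrow> ('k, 'n) cofield \<Rightarrow> ('m, 'n) cofield" where
  "pullback_cofield \<B> F \<omega> c x =
     (let d = chart_at \<B> (F x) in
      if local_rep F c d differentiable (at (snd c x))
      then pull_covector (jacobian F c d x) (\<omega> d (F x)) else 0)"

subsection \<open>The measure induced by a (rough) metric\<close>

definition lebesgue_sets :: "('m, 'n::finite) chart set \<Rightarrow> 'm set set" where
  "lebesgue_sets \<A> = {E. \<forall>c\<in>\<A>. snd c ` (E \<inter> fst c) \<in> sets lebesgue}"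

definition riem_measure :: "('m, 'n::finite) chart set \<Rightarrow> ('m, 'n) metric_field \<Rightarrow> 'm measure" where
  "riem_measure \<A> g = (THE \<mu>. space \<mu> = UNIV \<and> sets \<mu> = lebesgue_sets \<A> \<and>
     (\<forall>c\<in>\<A>. \<forall>E\<in>lebesgue_sets \<A>. E \<subseteq> fst c \<longrightarrow>
        emeasure \<mu> E = (\<integral>\<^sup>+y\<in>snd c ` E. ennreal (sqrt (det (g c (chart_inv c y)))) \<partial>lebesgue)))"

text \<open>The inner product on covectors induced by a metric with Gram matrix \<open>G\<close>.\<close>

definition cov_inner :: "real ^ 'n ^ 'n \<Rightarrow> complex ^ 'n \<Rightarrow> complex ^ ('n::finite) \<Rightarrow> complex" where
  "cov_inner G \<zeta> \<eta> =
     (\<Sum>i\<in>UNIV. \<Sum>j\<in>UNIV. complex_of_real (matrix_inv G $ i $ j) * \<zeta> $ i * cnj (\<eta> $ j))"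

definition field_inner ::
  "('m, 'n::finite) chart set \<Rightarrow> ('m, 'n) metric_field \<Rightarrow> ('m, 'n) cofield \<Rightarrow> ('m, 'n) cofield \<Rightarrow>
   'm \<Rightarrow> complex" where
  "field_inner \<A> g \<omega> \<eta> x = (let c = chart_at \<A> x in cov_inner (g c x) (\<omega> c x) (\<eta> c x))"

section \<open>Hilbert spaces of functions and unbounded operators\<close>

text \<open>\<open>L\<^sup>2\<close> spaces are modelled by square integrable functions (not classes), so that
  the inner product is only semidefinite and \<open>aeq\<close> plays the role of equality. An operator is
  represented by its graph, saturated under \<open>aeq\<close>: these graphs correspond exactly to the graphs
  of operators between the quotient Hilbert spaces. Composition of operators is relational
  composition (the operator applied first stands on the left), the inverse is the converse.\<close>

record 'v hspace =
  elems :: "'v set"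
  scal :: "complex \<Rightarrow> 'v \<Rightarrow> 'v"
  inn :: "'v \<Rightarrow> 'v \<Rightarrow> complex"

definition hnorm :: "'v hspace \<Rightarrow> 'v \<Rightarrow> real" where
  "hnorm H x = sqrt (Re (inn H x x))"

definition aeq :: "('v::ab_group_add) hspace \<Rightarrow> 'v \<Rightarrow> 'v \<Rightarrow> bool" where
  "aeq H x y \<longleftrightarrow> x \<in> elems H \<and> y \<in> elems H \<and> hnorm H (x - y) = 0"

definition hsum :: "'v hspace \<Rightarrow> 'w hspace \<Rightarrow> ('v \<times> 'w) hspace" where
  "hsum H K = \<lparr>elems = elems H \<times> elems K,
     scal = (\<lambda>k (x, y). (scal H k x, scal K k y)),
     inn = (\<lambda>(x, y) (x', y'). inn H x x' + inn K y y')\<rparr>"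

definition hclosure :: "('v::ab_group_add) hspace \<Rightarrow> 'v set \<Rightarrow> 'v set" where
  "hclosure H X = {x \<in> elems H. \<exists>s :: nat \<Rightarrow> 'v. range s \<subseteq> X \<inter> elems H \<and> (\<lambda>n. hnorm H (s n - x)) \<longlonglongrightarrow> 0}"

definition id_op :: "('v::ab_group_add) hspace \<Rightarrow> ('v \<times> 'v) set" where
  "id_op H = {(x, y). aeq H x y}"

definition plus_op :: "('v \<times> 'w::plus) set \<Rightarrow> ('v \<times> 'w) set \<Rightarrow> ('v \<times> 'w) set" where
  "plus_op S T = {(x, y + z) | x y z. (x, y) \<in> S \<and> (x, z) \<in> T}"

definition scale_op :: "'w hspace \<Rightarrow> real \<Rightarrow> ('v \<times> 'w) set \<Rightarrow> ('v \<times> 'w) set" where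
  "scale_op K r T = {(x, scal K (complex_of_real r) y) | x y. (x, y) \<in> T}"

definition adjoint_op :: "'v hspace \<Rightarrow> 'w hspace \<Rightarrow> ('v \<times> 'w) set \<Rightarrow> ('w \<times> 'v) set" where
  "adjoint_op H K T =
     {(y, z). y \<in> elems K \<and> z \<in> elems H \<and> (\<forall>(x, x')\<in>T. inn K x' y = inn H x z)}"

text \<open>The norm of \<open>T u\<close> (unspecified if \<open>T u\<close> is undefined).\<close>

definition value_norm :: "'w hspace \<Rightarrow> ('v \<times> 'w) set \<Rightarrow> 'v \<Rightarrow> real" where
  "value_norm K T u = (THE r. \<exists>y. (u, y) \<in> T \<and> hnorm K y = r)"

text \<open>\<open>t \<Pi> (I + t\<^sup>2 \<Pi>\<^sup>2)\<^sup>-\<^sup>1\<close>.\<close>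

definition Q_op :: "('v::ab_group_add) hspace \<Rightarrow> ('v \<times> 'v) set \<Rightarrow> real \<Rightarrow> ('v \<times> 'v) set" where
  "Q_op H T t = (plus_op (id_op H) (scale_op H (t\<^sup>2) (T O T)))\<inverse> O scale_op H t T"

definition quadratic_estimate :: "('v::ab_group_add) hspace \<Rightarrow> ('v \<times> 'v) set \<Rightarrow> bool" where
  "quadratic_estimate H T \<longleftrightarrow> (\<exists>C1>0. \<exists>C2>0. \<forall>u\<in>hclosure H (Range T).
     ennreal (C1 * (hnorm H u)\<^sup>2) \<le> (\<integral>\<^sup>+t\<in>{0<..}. ennreal ((value_norm H (Q_op H T t) u)\<^sup>2 / t) \<partial>lborel) \<and>
     (\<integral>\<^sup>+t\<in>{0<..}. ennreal ((value_norm H (Q_op H T t) u)\<^sup>2 / t) \<partial>lborel) \<le> ennreal (C2 * (hnorm H u)\<^sup>2))"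

section \<open>The first order operators on a manifold\<close>

definition L2 :: "('m, 'n::finite) chart set \<Rightarrow> ('m, 'n) metric_field \<Rightarrow> ('m \<Rightarrow> complex) hspace" where
  "L2 \<A> g = \<lparr>elems = {u \<in> borel_measurable (riem_measure \<A> g).
                       integrable (riem_measure \<A> g) (\<lambda>x. (cmod (u x))\<^sup>2)},
     scal = (\<lambda>k u x. k * u x),
     inn = (\<lambda>u v. LINT x|riem_measure \<A> g. u x * cnj (v x))\<rparr>"

definition L2cov :: "('m, 'n::finite) chart set \<Rightarrow> ('m, 'n) metric_field \<Rightarrow> ('m, 'n) cofield hspace" where
  "L2cov \<A> g = \<lparr>elems = {\<omega>. measurable_cofield \<A> \<omega> \<and>
                       integrable (riem_measure \<A> g) (\<lambda>x. Re (field_inner \<A> g \<omega> \<omega> x))},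
     scal = (\<lambda>k \<omega> c x. k *s \<omega> c x),
     inn = (\<lambda>\<omega> \<eta>. LINT x|riem_measure \<A> g. field_inner \<A> g \<omega> \<eta> x)\<rparr>"

abbreviation L2pair ::
  "('m, 'n::finite) chart set \<Rightarrow> ('m, 'n) metric_field \<Rightarrow> (('m \<Rightarrow> complex) \<times> ('m, 'n) cofield) hspace" where
  "L2pair \<A> g \<equiv> hsum (L2 \<A> g) (L2cov \<A> g)"

type_synonym ('m, 'n) triple = "('m \<Rightarrow> complex) \<times> ('m \<Rightarrow> complex) \<times> ('m, 'n) cofield"

definition HH :: "('m, 'n::finite) chart set \<Rightarrow> ('m, 'n) metric_field \<Rightarrow> ('m, 'n) triple hspace" where
  "HH \<A> g = hsum (L2 \<A> g) (L2pair \<A> g)"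

definition smooth_fun :: "('m, 'n::finite) chart set \<Rightarrow> ('m \<Rightarrow> complex) \<Rightarrow> bool" where
  "smooth_fun \<A> u \<longleftrightarrow> (\<forall>c\<in>\<A>. smooth_on (snd c ` fst c) (u \<circ> chart_inv c))"

definition ext_deriv :: "('m \<Rightarrow> complex) \<Rightarrow> ('m, 'n::finite) cofield" where
  "ext_deriv u c x = (\<chi> i. frechet_derivative (u \<circ> chart_inv c) (at (snd c x)) (axis i 1))"

text \<open>The graph of the closure of \<open>\<nabla>\<close> on \<open>{u \<in> C\<^sup>\<infinity> \<inter> L\<^sup>2. \<nabla>u \<in> L\<^sup>2}\<close>. Its
  domain, with the graph norm, is \<open>W\<^sup>1\<^sup>,\<^sup>2\<close>.\<close>

definition W12_grad ::
  "('m, 'n::finite) chart set \<Rightarrow> ('m, 'n) metric_field \<Rightarrow> (('m \<Rightarrow> complex) \<times> ('m, 'n) cofield) set" where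
  "W12_grad \<A> g = hclosure (L2pair \<A> g)
     {(u, ext_deriv u) | u. smooth_fun \<A> u \<and> u \<in> elems (L2 \<A> g) \<and> ext_deriv u \<in> elems (L2cov \<A> g)}"

definition W12 :: "('m, 'n::finite) chart set \<Rightarrow> ('m, 'n) metric_field \<Rightarrow> ('m \<Rightarrow> complex) set" where
  "W12 \<A> g = Domain (W12_grad \<A> g)"

definition W12_norm :: "('m, 'n::finite) chart set \<Rightarrow> ('m, 'n) metric_field \<Rightarrow> ('m \<Rightarrow> complex) \<Rightarrow> real" where
  "W12_norm \<A> g u = hnorm (L2 \<A> g) u + value_norm (L2cov \<A> g) (W12_grad \<A> g) u"

definition grad_c ::
  "('m::topological_space, 'n::finite) chart set \<Rightarrow> ('m, 'n) metric_field \<Rightarrow>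
   (('m \<Rightarrow> complex) \<times> ('m, 'n) cofield) set" where
  "grad_c \<A> g = hclosure (L2pair \<A> g)
     {(u, ext_deriv u) | u. smooth_fun \<A> u \<and> (\<exists>K. compact K \<and> (\<forall>x. x \<notin> K \<longrightarrow> u x = 0))}"

definition S_op ::
  "('m::topological_space, 'n::finite) chart set \<Rightarrow> ('m, 'n) metric_field \<Rightarrow>
   (('m \<Rightarrow> complex) \<times> ('m \<Rightarrow> complex) \<times> ('m, 'n) cofield) set" where
  "S_op \<A> g = {(u, v, w). aeq (L2 \<A> g) v u \<and> (u, w) \<in> grad_c \<A> g}"

definition Gamma_op ::
  "('m::topological_space, 'n::finite) chart set \<Rightarrow> ('m, 'n) metric_field \<Rightarrow>
   (('m, 'n) triple \<times> ('m, 'n) triple) set" where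
  "Gamma_op \<A> g = {((u, s), (p, q)). s \<in> elems (L2pair \<A> g) \<and> aeq (L2 \<A> g) p 0 \<and> (u, q) \<in> S_op \<A> g}"

definition endo_app ::
  "('m, 'n::finite) chart set \<Rightarrow> ('m, 'n) endo_field \<Rightarrow> ('m \<Rightarrow> complex) \<times> ('m, 'n) cofield \<Rightarrow>
   ('m \<Rightarrow> complex) \<times> ('m, 'n) cofield" where
  "endo_app \<A> A s =
     ((\<lambda>x. let c = chart_at \<A> x in fst (A c x (fst s x, snd s c x))),
      (\<lambda>c x. snd (A c x (fst s x, snd s c x))))"

definition B1_op ::
  "('m, 'n::finite) chart set \<Rightarrow> ('m, 'n) metric_field \<Rightarrow> ('m \<Rightarrow> complex) \<Rightarrow>
   (('m, 'n) triple \<times> ('m, 'n) triple) set" where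
  "B1_op \<A> g a = {((u, s), (p, q)). u \<in> elems (L2 \<A> g) \<and> s \<in> elems (L2pair \<A> g) \<and>
     aeq (L2 \<A> g) p (\<lambda>x. a x * u x) \<and> aeq (L2pair \<A> g) q 0}"

definition B2_op ::
  "('m, 'n::finite) chart set \<Rightarrow> ('m, 'n) metric_field \<Rightarrow> ('m, 'n) endo_field \<Rightarrow>
   (('m, 'n) triple \<times> ('m, 'n) triple) set" where
  "B2_op \<A> g A = {((u, s), (p, q)). u \<in> elems (L2 \<A> g) \<and> s \<in> elems (L2pair \<A> g) \<and>
     aeq (L2 \<A> g) p 0 \<and> aeq (L2pair \<A> g) q (endo_app \<A> A s)}"

text \<open>\<open>\<Gamma> + B\<^sub>1 \<Gamma>\<^sup>* B\<^sub>2\<close>.\<close>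

definition Pi_op ::
  "('m::topological_space, 'n::finite) chart set \<Rightarrow> ('m, 'n) metric_field \<Rightarrow>
   (('m, 'n) triple \<times> ('m, 'n) triple) set \<Rightarrow> (('m, 'n) triple \<times> ('m, 'n) triple) set \<Rightarrow>
   (('m, 'n) triple \<times> ('m, 'n) triple) set" where
  "Pi_op \<A> g B1 B2 =
     plus_op (Gamma_op \<A> g) (B2 O adjoint_op (HH \<A> g) (HH \<A> g) (Gamma_op \<A> g) O B1)"

text \<open>\<open>\<Phi>(u, v, w) = ((F\<^sup>-\<^sup>1)\<^sup>*u, (F\<^sup>-\<^sup>1)\<^sup>*v, (F\<^sup>-\<^sup>1)\<^sup>*w)\<close> and conjugation
  \<open>B \<mapsto> \<Phi> B \<Phi>\<^sup>-\<^sup>1\<close>.\<close>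

definition Phi_op ::
  "('m, 'n::finite) chart set \<Rightarrow> ('m, 'n) metric_field \<Rightarrow> ('k, 'n) chart set \<Rightarrow> ('k, 'n) metric_field \<Rightarrow>
   ('m \<Rightarrow> 'k) \<Rightarrow> (('m, 'n) triple \<times> ('k, 'n) triple) set" where
  "Phi_op \<A> g \<B> h F = {((u, v, w), y). (u, v, w) \<in> elems (HH \<A> g) \<and>
     aeq (HH \<B> h) y (u \<circ> inv F, v \<circ> inv F, pullback_cofield \<A> (inv F) w)}"

definition conj_op :: "('v \<times> 'w) set \<Rightarrow> ('v \<times> 'v) set \<Rightarrow> ('w \<times> 'w) set" where
  "conj_op \<Phi> B = \<Phi>\<inverse> O B O \<Phi>"

definition ess_bounded_fun ::
  "('m, 'n::finite) chart set \<Rightarrow> ('m, 'n) metric_field \<Rightarrow> ('m \<Rightarrow> complex) \<Rightarrow> bool" where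
  "ess_bounded_fun \<A> g a \<longleftrightarrow> a \<in> borel_measurable (riem_measure \<A> g) \<and>
     (\<exists>C. AE x in riem_measure \<A> g. cmod (a x) \<le> C)"

definition fibre_normsq :: "real ^ 'n ^ 'n \<Rightarrow> complex \<times> (complex ^ ('n::finite)) \<Rightarrow> real" where
  "fibre_normsq G p = (cmod (fst p))\<^sup>2 + Re (cov_inner G (snd p) (snd p))"

definition ess_bounded_endo ::
  "('m, 'n::finite) chart set \<Rightarrow> ('m, 'n) metric_field \<Rightarrow> ('m, 'n) endo_field \<Rightarrow> bool" where
  "ess_bounded_endo \<A> g A \<longleftrightarrow> (\<exists>C. AE x in riem_measure \<A> g.
     (let c = chart_at \<A> x in
      \<forall>p. sqrt (fibre_normsq (g c x) (A c x p)) \<le> C * sqrt (fibre_normsq (g c x) p)))"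

end

theory Submission
  imports Defs
begin

text \<open>Pulling back along \<open>F\<close> is unitary between the \<open>L\<^sup>2\<close> spaces of \<open>N\<close> and \<open>M\<close> because \<open>g = F\<^sup>*h\<close> almost
  everywhere: maps that are Lipschitz in charts are differentiable almost everywhere (Rademacher) and
  satisfy the change of variables formula. The point is that this unitary map carries the closure of
  \<open>\<nabla>\<close> on \<open>C\<^sub>c\<^sup>\<infinity>(N)\<close> to the closure of \<open>\<nabla>\<close> on \<open>C\<^sub>c\<^sup>\<infinity>(M)\<close>. Although \<open>F\<close> does not preserve smoothness, it
  preserves locally Lipschitz functions of compact support. Cut off to charts in which the rough metric
  is comparable with the Euclidean one and mollified there, such functions are seen to lie in the domain of the closure,
  which maps them to their almost everywhere derivative; the chain rule transports this derivative.
  Hence \<open>\<Gamma>\<close>, \<open>\<Gamma>\<^sup>*\<close>, the multipliers and finally \<open>\<Pi>\<close> correspond to each other, and a quadratic estimate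
  is invariant under unitary maps.\<close>

section \<open>Almost everywhere differentiability of Lipschitz functions\<close>

subsection \<open>Differentiability of Lipschitz functions on the line\<close>

text \<open>Elements of the \<open>L2\<close> spaces are functions, not classes, and pulling a
  covector field back along \<open>F\<close> and its inverse in turn restores it only almost
  everywhere. The unitary map is therefore handled as a relation \<open>U\<close> saturated under
  \<open>aeq\<close>, and operators are compared by \<open>corr\<close>, which survives every
  operation used in building \<open>Pi_op\<close> and \<open>Q_op\<close>; no resolvent has to be
  shown to exist. The two manifolds enter symmetrically: transport of the gradient is one inclusion,
  proved for an abstract almost everywhere isometry and applied to the map and to its inverse. The
  identity is such an isometry as well, and the same change of variables then says that densities
  agree on chart overlaps, which is what makes \<open>riem_measure\<close> exist. Rademacher's
  theorem rests on Vitali coverings on the line, Fubini along lines and a porosity argument, so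
  derivatives are pointwise throughout: mollified derivatives converge at every point of
  differentiability under a uniform bound, and dominated convergence takes the place of a theory of
  weak derivatives.\<close>

lemma Vitali_balls_in_open:
  fixes S :: "'a::euclidean_space set"
  assumes U: "open U" "S \<subseteq> U"
    and fine: "\<And>x d. x \<in> S \<Longrightarrow> d > 0 \<Longrightarrow> \<exists>a r. x \<in> ball a r \<and> r < d \<and> P a r"
  obtains C :: "('a \<times> real) set" where "countable C"
    "disjoint_family_on (\<lambda>(a, r). ball a r) C"
    "\<And>a r. (a, r) \<in> C \<Longrightarrow> ball a r \<subseteq> U \<and> P a r"
    "negligible (S - (\<Union>(a, r)\<in>C. ball a r))"
proof -
  let ?K = "{(a, r). ball a r \<subseteq> U \<and> P a r}"
  have ex: "\<exists>i. i \<in> ?K \<and> x \<in> ball (fst i) (snd i) \<and> snd i < d" if "x \<in> S" "0 < d" for x d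
  proof -
    obtain e where e: "e > 0" "ball x e \<subseteq> U"
      using U \<open>x \<in> S\<close> by (meson open_contains_ball subsetD)
    \<comment> \<open>A ball of radius below \<open>e/2\<close> that contains \<open>x\<close> stays
      inside \<open>ball x e\<close>, wherever its centre is.\<close>
    obtain a r where ar: "x \<in> ball a r" "r < min d (e/2)" "P a r"
      using fine[OF \<open>x \<in> S\<close>, of "min d (e/2)"] e \<open>0 < d\<close> by auto
    have "ball a r \<subseteq> ball x e"
    proof
      fix y assume "y \<in> ball a r"
      then have "dist x y < 2 * r"
        using ar(1) dist_triangle[of x y a] by (simp add: dist_commute)
      then show "y \<in> ball x e" using ar(2) by simp
    qed
    then show ?thesis using e ar by (intro exI[of _ "(a, r)"]) auto
  qed
  obtain C where C: "countable C" "C \<subseteq> ?K"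
     "pairwise (\<lambda>i j. disjnt (ball (fst i) (snd i)) (ball (fst j) (snd j))) C"
     "negligible (S - (\<Union>i\<in>C. ball (fst i) (snd i)))"
    using Vitali_covering_theorem_balls[of S ?K fst snd] ex by blast
  show thesis
  proof (rule that[of C])
    show "disjoint_family_on (\<lambda>(a, r). ball a r) C"
      using C(3) by (fastforce simp: disjoint_family_on_def pairwise_def disjnt_def case_prod_unfold)
    show "ball a r \<subseteq> U \<and> P a r" if "(a, r) \<in> C" for a r
      using C(2) that by auto
  qed (use C in \<open>auto simp: case_prod_unfold\<close>)
qed

text \<open>Continuity of \<open>f\<close> leaves no atoms at the two endpoints, so open and closed
  intervals have the same Stieltjes measure.\<close>

lemma emeasure_interval_measure_ball:
  fixes f :: "real \<Rightarrow> real"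
  assumes f: "mono f" "continuous_on UNIV f" and r: "r > 0"
  shows "emeasure (interval_measure f) (ball a r) = ennreal (f (a + r) - f (a - r))"
proof -
  let ?M = "interval_measure f"
  have m: "\<And>x y. x \<le> y \<Longrightarrow> f x \<le> f y" using f by (auto simp: mono_def)
  have Icc: "emeasure ?M {x..y} = ennreal (f y - f x)" if "x \<le> y" for x y
    using emeasure_interval_measure_Icc[OF that, of f] m f(2) by simp
  have "{a - r} \<in> null_sets ?M" "{a + r} \<in> null_sets ?M"
    using Icc[of "a - r" "a - r"] Icc[of "a + r" "a + r"] by (auto intro!: null_setsI)
  then have N: "{a - r, a + r} \<in> null_sets ?M"
    using null_sets.Un[of "{a - r}" ?M "{a + r}"] by (simp add: insert_commute)
  have "ball a r = {a - r..a + r} - {a - r, a + r}"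
    using r by (auto simp: ball_def dist_real_def)
  then have "emeasure ?M (ball a r) = emeasure ?M {a - r..a + r}"
    using N by (simp add: emeasure_Diff_null_set)
  then show ?thesis using Icc[of "a - r" "a + r"] r by simp
qed

lemma emeasure_real_ball: "r > 0 \<Longrightarrow> emeasure lborel (ball (a::real) r) = ennreal (2 * r)"
proof -
  assume "r > 0"
  moreover have "ball a r = {a - r<..<a + r}" by (auto simp: ball_def dist_real_def)
  ultimately show ?thesis by simp
qed

text \<open>Two nested Vitali coverings. Inside a tight open \<open>U\<close>, balls whose Stieltjes
  measure is at most \<open>p\<close> times their length cover almost all of \<open>S\<close>;
  inside their union, balls whose Stieltjes measure is at least \<open>q\<close> times their length
  again cover almost all of \<open>S\<close>. Thus \<open>q\<close> times the measure of
  \<open>S\<close> is at most \<open>p\<close> times that of \<open>U\<close>, which exceeds the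
  measure of \<open>S\<close> by at most \<open>e\<close>, and \<open>p < q\<close> leaves only
  measure zero.\<close>

lemma upper_lower_derivates_null:
  fixes f :: "real \<Rightarrow> real"
  assumes f: "mono f" "continuous_on UNIV f" and pq: "0 < p" "p < q"
    and S: "S \<in> sets borel" "bounded S"
    and lo: "\<And>x d. x \<in> S \<Longrightarrow> d > 0 \<Longrightarrow> \<exists>a r. x \<in> ball a r \<and> r < d \<and> f (a + r) - f (a - r) \<le> p * (2 * r)"
    and hi: "\<And>x d. x \<in> S \<Longrightarrow> d > 0 \<Longrightarrow> \<exists>a r. x \<in> ball a r \<and> r < d \<and> q * (2 * r) \<le> f (a + r) - f (a - r)"
  shows "S \<in> null_sets lborel"
proof -
  let ?m = "emeasure lborel" and ?n = "emeasure (interval_measure f)"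
  let ?B = "\<lambda>(a, r). ball a r :: real set"
  have fin: "?m S < \<infinity>" using S(2) emeasure_bounded_finite by blast
  have key: "ennreal q * ?m S \<le> ennreal p * (?m S + ennreal e)" if e: "e > 0" for e
  proof -
    obtain U where U: "open U" "S \<subseteq> U" "?m (U - S) < e"
      using outer_regular_lborel[of S e] S e by auto
    have mU: "?m U \<le> ?m S + ennreal e"
    proof -
      have "?m U = ?m S + ?m (U - S)"
        using U S by (subst plus_emeasure) (auto intro!: arg_cong[where f="?m"])
      then show ?thesis using U(3) by (auto intro: add_left_mono)
    qed
    obtain C1 where C1: "countable C1" "disjoint_family_on ?B C1"
      "\<And>a r. (a, r) \<in> C1 \<Longrightarrow> ball a r \<subseteq> U \<and> (r > 0 \<and> f (a + r) - f (a - r) \<le> p * (2 * r))"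
      "negligible (S - \<Union>(?B ` C1))"
    proof (rule Vitali_balls_in_open[OF U(1,2), of "\<lambda>a r. r > 0 \<and> f (a + r) - f (a - r) \<le> p * (2 * r)"])
      show "\<exists>a r. x \<in> ball a r \<and> r < d \<and> 0 < r \<and> f (a + r) - f (a - r) \<le> p * (2 * r)"
        if "x \<in> S" "d > 0" for x d
        using lo[OF that] by (metis ball_empty empty_iff not_le)
    qed blast
    let ?O = "\<Union>(?B ` C1)"
    have oO: "open ?O" by auto
    obtain C2 where C2: "countable C2" "disjoint_family_on ?B C2"
      "\<And>a r. (a, r) \<in> C2 \<Longrightarrow> ball a r \<subseteq> ?O \<and> (r > 0 \<and> q * (2 * r) \<le> f (a + r) - f (a - r))"
      "negligible (S \<inter> ?O - \<Union>(?B ` C2))"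
    proof (rule Vitali_balls_in_open[OF oO, of "S \<inter> ?O" "\<lambda>a r. r > 0 \<and> q * (2 * r) \<le> f (a + r) - f (a - r)"])
      show "\<exists>a r. x \<in> ball a r \<and> r < d \<and> 0 < r \<and> q * (2 * r) \<le> f (a + r) - f (a - r)"
        if "x \<in> S \<inter> ?O" "d > 0" for x d
        using hi[of x d] that by (metis IntD1 ball_empty empty_iff not_le)
    qed blast+
    have "?m S \<le> ?m (\<Union>(?B ` C2))"
    proof -
      have "S - \<Union>(?B ` C2) \<subseteq> (S - ?O) \<union> (S \<inter> ?O - \<Union>(?B ` C2))" by auto
      then have "negligible (S - \<Union>(?B ` C2))"
        using C1(4) C2(4) negligible_Un negligible_subset by blast
      then have N: "S - \<Union>(?B ` C2) \<in> null_sets lebesgue" by (simp add: negligible_iff_null_sets)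
      have o2: "\<Union>(?B ` C2) \<in> sets borel" by (intro borel_open) auto
      then have "S - \<Union>(?B ` C2) \<in> null_sets lborel"
        using N S by (auto simp: null_sets_def emeasure_completion)
      then have "?m S \<le> ?m (\<Union>(?B ` C2) \<union> (S - \<Union>(?B ` C2)))"
        using S o2 by (intro emeasure_mono) auto
      also have "\<dots> = ?m (\<Union>(?B ` C2))"
        using \<open>S - \<Union>(?B ` C2) \<in> null_sets lborel\<close> o2 by (intro emeasure_Un_null_set) auto
      finally show ?thesis .
    qed
    then have "ennreal q * ?m S \<le> ennreal q * ?m (\<Union>(?B ` C2))" by (rule mult_left_mono) simp
    also have "\<dots> = (\<integral>\<^sup>+i. ennreal q * ?m (?B i) \<partial>count_space C2)"
      using C2(1,2) by (subst emeasure_UN_countable) (auto simp: nn_integral_cmult)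
    also have "\<dots> \<le> (\<integral>\<^sup>+i. ?n (?B i) \<partial>count_space C2)"
    proof (rule nn_integral_mono)
      fix i assume "i \<in> space (count_space C2)"
      then obtain a r where i: "i = (a, r)" "(a, r) \<in> C2" by (cases i) auto
      then show "ennreal q * ?m (?B i) \<le> ?n (?B i)"
        using C2(3)[of a r] pq
        by (auto intro!: ennreal_leI simp: emeasure_real_ball emeasure_interval_measure_ball[OF f] ennreal_mult'[symmetric])
    qed
    also have "\<dots> = ?n (\<Union>(?B ` C2))"
      using C2(1,2) by (subst emeasure_UN_countable) auto
    also have "\<dots> \<le> ?n ?O"
      using C2(3) oO by (intro emeasure_mono) auto
    also have "\<dots> = (\<integral>\<^sup>+i. ?n (?B i) \<partial>count_space C1)"
      using C1(1,2) by (subst emeasure_UN_countable) auto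
    also have "\<dots> \<le> (\<integral>\<^sup>+i. ennreal p * ?m (?B i) \<partial>count_space C1)"
    proof (rule nn_integral_mono)
      fix i assume "i \<in> space (count_space C1)"
      then obtain a r where i: "i = (a, r)" "(a, r) \<in> C1" by (cases i) auto
      then show "?n (?B i) \<le> ennreal p * ?m (?B i)"
        using C1(3)[of a r] pq
        by (auto intro!: ennreal_leI simp: emeasure_real_ball emeasure_interval_measure_ball[OF f] ennreal_mult'[symmetric])
    qed
    also have "\<dots> = ennreal p * ?m ?O"
      using C1(1,2) by (subst emeasure_UN_countable) (auto simp: nn_integral_cmult)
    also have "\<dots> \<le> ennreal p * ?m U"
      using C1(3) U(1) by (intro mult_left_mono emeasure_mono) auto
    also have "\<dots> \<le> ennreal p * (?m S + ennreal e)" using mU by (rule mult_left_mono) simp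
    finally show ?thesis .
  qed
  obtain s where s: "?m S = ennreal s" "s \<ge> 0" using fin by (cases "?m S") auto
  have "q * s \<le> p * s + p * e" if "e > 0" for e
    using key[OF that] s pq that by (simp add: distrib_left flip: ennreal_mult ennreal_plus)
  then have "q * s \<le> p * s + e" if "e > 0" for e
    using that pq(1) by (metis divide_pos_pos mult.commute nonzero_divide_eq_eq less_irrefl)
  then have "q * s \<le> p * s" by (rule field_le_epsilon)
  then have "s = 0" using pq s(2) by (metis mult_le_cancel_right not_less order_antisym_conv)
  then show ?thesis using s S by (auto simp: null_sets_def)
qed

text \<open>The hypothesis speaks of open intervals around \<open>x\<close>, while a difference
  quotient has \<open>x\<close> as an endpoint. The interval from \<open>z\<close> to
  \<open>y\<close> is widened by \<open>s\<close> on both sides, and continuity of \<open>f\<close>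
  preserves the estimate as \<open>s\<close> tends to 0.\<close>

lemma derivative_of_interval_quotients:
  fixes f :: "real \<Rightarrow> real"
  assumes f: "continuous_on UNIV f"
    and lim: "\<And>e. e > 0 \<Longrightarrow> \<exists>d>0. \<forall>a r. x \<in> ball a r \<longrightarrow> r < d \<longrightarrow> \<bar>f (a + r) - f (a - r) - l * (2 * r)\<bar> \<le> e * (2 * r)"
  shows "(f has_field_derivative l) (at x)"
proof -
  have cf: "isCont f y" for y using f by (simp add: continuous_on_eq_continuous_at)
  have main: "\<bar>f y - f z - l * (y - z)\<bar> \<le> e * (y - z)"
    if d: "\<forall>a r. x \<in> ball a r \<longrightarrow> r < d \<longrightarrow> \<bar>f (a + r) - f (a - r) - l * (2 * r)\<bar> \<le> e * (2 * r)"
      and yz: "z < y" "y - z < d" "z \<le> x" "x \<le> y" for y z e d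
  proof -
    have A: "((\<lambda>s. \<bar>f (y + s) - f (z - s) - l * (y - z + 2 * s)\<bar>) \<longlongrightarrow> \<bar>f (y + 0) - f (z - 0) - l * (y - z + 2 * 0)\<bar>) (at_right 0)"
      by (intro tendsto_intros isCont_tendsto_compose[OF cf])
    have B: "((\<lambda>s. e * (y - z + 2 * s)) \<longlongrightarrow> e * (y - z + 2 * 0)) (at_right 0)"
      by (intro tendsto_intros)
    have "eventually (\<lambda>s. s \<in> {0<..<(d - (y - z))/2}) (at_right (0::real))"
      using yz by (intro eventually_at_right_real) auto
    then have "eventually (\<lambda>s. \<bar>f (y + s) - f (z - s) - l * (y - z + 2 * s)\<bar> \<le> e * (y - z + 2 * s)) (at_right 0)"
    proof eventually_elim
      case (elim s)
      let ?a = "(y + z) / 2" and ?r = "(y - z) / 2 + s"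
      have "x \<in> ball ?a ?r" using yz elim by (auto simp: ball_def dist_real_def abs_if field_simps)
      moreover have "?r < d" using yz elim by (auto simp: field_simps)
      ultimately have "\<bar>f (?a + ?r) - f (?a - ?r) - l * (2 * ?r)\<bar> \<le> e * (2 * ?r)" using d by blast
      moreover have "?a + ?r = y + s" "?a - ?r = z - s" "2 * ?r = y - z + 2 * s" by (auto simp: field_simps)
      ultimately show ?case by (simp only:)
    qed
    from tendsto_le[OF _ B A this] show ?thesis by simp
  qed
  show ?thesis
    unfolding has_field_derivative_iff
  proof (rule LIM_I)
    fix e :: real assume "e > 0"
    then obtain d where d: "d > 0" "\<forall>a r. x \<in> ball a r \<longrightarrow> r < d \<longrightarrow> \<bar>f (a + r) - f (a - r) - l * (2 * r)\<bar> \<le> e/2 * (2 * r)"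
      using lim[of "e/2"] by auto
    show "\<exists>s>0. \<forall>y. y \<noteq> x \<and> norm (y - x) < s \<longrightarrow> norm ((f y - f x) / (y - x) - l) < e"
    proof (intro exI conjI allI impI)
      fix y assume y: "y \<noteq> x \<and> norm (y - x) < d"
      have "\<bar>f y - f x - l * (y - x)\<bar> \<le> e/2 * \<bar>y - x\<bar>"
      proof (cases "y < x")
        case True
        have "f y - f x - l * (y - x) = - (f x - f y - l * (x - y))" by (simp add: algebra_simps)
        then have "\<bar>f y - f x - l * (y - x)\<bar> = \<bar>f x - f y - l * (x - y)\<bar>" by (simp only: abs_minus_cancel)
        then show ?thesis using main[OF d(2), of y x] y True by simp
      next
        case False then show ?thesis using main[OF d(2), of x y] y by simp
      qed
      then have "\<bar>f y - f x - l * (y - x)\<bar> / \<bar>y - x\<bar> \<le> e/2"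
        using y by (simp add: divide_le_eq)
      moreover have "(f y - f x) / (y - x) - l = (f y - f x - l * (y - x)) / (y - x)"
        using y by (simp add: field_simps)
      ultimately have "\<bar>(f y - f x) / (y - x) - l\<bar> \<le> e / 2"
        by (simp add: abs_divide)
      then show "norm ((f y - f x) / (y - x) - l) < e" using \<open>e > 0\<close> by simp
    qed (use d in auto)
  qed
qed

text \<open>Outside the sets \<open>E p q R\<close> with rational \<open>p < q\<close>, quotients
  cannot be at most \<open>p\<close> and at least \<open>q\<close> at arbitrarily small scales at
  once. This squeezes all quotients towards the lower derivate.\<close>

lemma lipschitz_mono_differentiable_null:
  fixes f :: "real \<Rightarrow> real"
  assumes f: "mono f" "L-lipschitz_on UNIV f"
  obtains N where "N \<in> null_sets lborel" "\<And>x. x \<notin> N \<Longrightarrow> f differentiable (at x)"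
proof -
  have cf: "continuous_on UNIV f" using f(2) lipschitz_on_continuous_on by blast
  \<comment> \<open>Balls containing the point, instead of balls centred at it, make
    \<open>lo p d\<close> and \<open>hi q d\<close> unions of open balls; this is why
    \<open>E\<close> is a Borel set.\<close>
  define lo where "lo p d = \<Union>{ball a r | a r. r < d \<and> f (a + r) - f (a - r) \<le> p * (2 * r)}" for p d
  define hi where "hi q d = \<Union>{ball a r | a r. r < d \<and> q * (2 * r) \<le> f (a + r) - f (a - r)}" for q d
  define E where "E p q R = (\<Inter>n. lo p (inverse (real (Suc n))) \<inter> hi q (inverse (real (Suc n)))) \<inter> ball 0 R" for p q R
  have op: "open (lo p d)" "open (hi p d)" for p d unfolding lo_def hi_def by (auto intro!: open_Union)
  have Eb: "E p q R \<in> sets borel" for p q R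
    unfolding E_def using op by (intro sets.Int sets.countable_INT) auto
  have sm: "\<exists>n. inverse (real (Suc n)) < d" if "d > 0" for d using that reals_Archimedean by blast
  have nullE: "E p q R \<in> null_sets lborel" if "0 < p" "p < q" for p q R
  proof (rule upper_lower_derivates_null[OF f(1) cf that Eb])
    show "bounded (E p q R)" unfolding E_def by (meson bounded_Int bounded_ball)
    fix x and d :: real assume x: "x \<in> E p q R" "d > 0"
    obtain n where n: "inverse (real (Suc n)) < d" using sm x by auto
    have "x \<in> lo p (inverse (real (Suc n)))" "x \<in> hi q (inverse (real (Suc n)))"
      using x by (auto simp: E_def)
    then show "\<exists>a r. x \<in> ball a r \<and> r < d \<and> f (a + r) - f (a - r) \<le> p * (2 * r)"
      "\<exists>a r. x \<in> ball a r \<and> r < d \<and> q * (2 * r) \<le> f (a + r) - f (a - r)"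
      using n unfolding lo_def hi_def by (blast intro: less_trans)+
  qed
  define N where "N = (\<Union>(p, q)\<in>{(p, q). p \<in> \<rat> \<and> q \<in> \<rat> \<and> 0 < p \<and> p < q}. \<Union>n. E p q (real n))"
  have "countable (\<rat> \<times> \<rat> :: (real \<times> real) set)" by (simp add: countable_rat)
  then have "countable {(p::real, q). p \<in> \<rat> \<and> q \<in> \<rat> \<and> 0 < p \<and> p < q}"
    by (rule countable_subset[rotated]) auto
  then have N0: "N \<in> null_sets lborel"
    unfolding N_def using nullE by (intro null_sets_UN') (auto intro!: null_sets_UN)
  have L0: "L \<ge> 0" using f(2) lipschitz_on_nonneg by blast
  have fb: "0 \<le> f (a + r) - f (a - r) \<and> f (a + r) - f (a - r) \<le> L * (2 * r)" if "r > 0" for a r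
    using that f(1) lipschitz_onD[OF f(2), of "a + r" "a - r"]
    by (auto simp: mono_def dist_real_def abs_le_iff)
  have "f differentiable (at x)" if "x \<notin> N" for x
  proof -
    define small where "small p \<longleftrightarrow> (\<forall>d>0. x \<in> lo p d)" for p
    define A where "A = {p \<in> \<rat>. 0 < p \<and> small p}"
    have notE: "\<exists>d>0. x \<notin> hi q d" if p: "p \<in> A" and q: "q \<in> \<rat>" "p < q" for p q
    proof (rule ccontr)
      assume *: "\<not> ?thesis"
      obtain n where "norm x < real n" using reals_Archimedean2 by blast
      then have "x \<in> E p q (real n)" using p * unfolding E_def A_def small_def by (auto simp: dist_norm)
      then show False using \<open>x \<notin> N\<close> p q unfolding N_def A_def by blast
    qed
    \<comment> \<open>The Lipschitz constant bounds every quotient, so each rational above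
      \<open>L\<close> belongs to \<open>A\<close> and the infimum below is taken over a nonempty
      set.\<close>
    obtain k where k: "k \<in> \<rat>" "L < k" "k < L + 1" using Rats_dense_in_real[of L "L+1"] by auto
    have "x \<in> lo k d" if "d > 0" for d
      unfolding lo_def
    proof (intro UnionI[of "ball x (d/2)"] CollectI exI conjI)
      show "f (x + d/2) - f (x - d/2) \<le> k * (2 * (d/2))"
        using fb[of "d/2" x] that k by (smt (verit, ccfv_SIG) mult_right_mono half_gt_zero)
    qed (use that in auto)
    then have kA: "k \<in> A" using k L0 by (auto simp: A_def small_def)
    have bdd: "bdd_below A" by (rule bdd_belowI[of _ 0]) (auto simp: A_def)
    \<comment> \<open>The lower derivate at \<open>x\<close>, which is the candidate for the
      derivative.\<close>
    define l where "l = Inf A"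
    have l0: "l \<ge> 0" unfolding l_def using kA by (intro cInf_greatest) (auto simp: A_def)
    have "(f has_field_derivative l) (at x)"
    proof (rule derivative_of_interval_quotients[OF cf])
      fix e :: real assume e: "e > 0"
      have "\<exists>p\<in>A. p < l + e/2" using kA e cInf_less_iff[OF _ bdd, of "l + e/2"] by (auto simp: l_def)
      then obtain p where p: "p \<in> A" "p < l + e/2" by blast
      obtain q where q: "q \<in> \<rat>" "p < q" "q < l + e" using p e Rats_dense_in_real[of p "l + e"] by auto
      obtain d1 where d1: "d1 > 0" "x \<notin> hi q d1" using notE p q by blast
      have "\<exists>d>0. \<forall>a r. x \<in> ball a r \<longrightarrow> r < d \<longrightarrow> (l - e) * (2 * r) \<le> f (a + r) - f (a - r)"
      \<comment> \<open>Members of \<open>A\<close> are positive by definition, so a rational below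
        \<open>l\<close> refutes smallness only if it is positive. When \<open>l - e\<close> is
        negative, monotonicity of \<open>f\<close> gives the lower bound directly.\<close>
      proof (cases "l - e < 0")
        case True
        have "(l - e) * (2 * r) \<le> f (a + r) - f (a - r)" if "x \<in> ball a r" for a r
        proof -
          have "r > 0" using that by (metis ball_empty empty_iff not_le)
          then have "(l - e) * (2 * r) \<le> 0" using True by (simp add: mult_le_0_iff)
          then show ?thesis using fb[OF \<open>r > 0\<close>, of a] by linarith
        qed
        then show ?thesis by (intro exI[of _ 1]) auto
      next
        case False
        obtain p' where p': "p' \<in> \<rat>" "l - e < p'" "p' < l" using e Rats_dense_in_real[of "l - e" l] by auto
        have "p' \<notin> A" using p' cInf_lower[OF _ bdd, of p'] by (auto simp: l_def)
        then have "\<not> small p'" using p' False by (auto simp: A_def)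
        then obtain d where d: "d > 0" "x \<notin> lo p' d" by (auto simp: small_def)
        have "(l - e) * (2 * r) \<le> f (a + r) - f (a - r)" if "x \<in> ball a r" "r < d" for a r
        proof -
          have "r > 0" using that by (metis ball_empty empty_iff not_le)
          have "p' * (2 * r) < f (a + r) - f (a - r)" using d(2) that unfolding lo_def by force
          moreover have "(l - e) * (2 * r) \<le> p' * (2 * r)" using p' \<open>r > 0\<close> by (intro mult_right_mono) auto
          ultimately show ?thesis by simp
        qed
        then show ?thesis using d by blast
      qed
      then obtain d2 where d2: "d2 > 0" "\<And>a r. x \<in> ball a r \<Longrightarrow> r < d2 \<Longrightarrow> (l - e) * (2 * r) \<le> f (a + r) - f (a - r)"
        by blast
      have "\<bar>f (a + r) - f (a - r) - l * (2 * r)\<bar> \<le> e * (2 * r)" if "x \<in> ball a r" "r < min d1 d2" for a r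
      proof -
        have "r > 0" using that by (metis ball_empty empty_iff not_le)
        have "f (a + r) - f (a - r) < q * (2 * r)" using d1(2) that unfolding hi_def by force
        moreover have "q * (2 * r) \<le> (l + e) * (2 * r)" using q \<open>r > 0\<close> by (intro mult_right_mono) auto
        ultimately show ?thesis using d2(2)[of a r] that by (auto simp: algebra_simps abs_le_iff)
      qed
      then show "\<exists>d>0. \<forall>a r. x \<in> ball a r \<longrightarrow> r < d \<longrightarrow> \<bar>f (a + r) - f (a - r) - l * (2 * r)\<bar> \<le> e * (2 * r)"
        using d1 d2 by (intro exI[of _ "min d1 d2"]) auto
    qed
    then show ?thesis using field_differentiable_def field_differentiable_imp_differentiable by blast
  qed
  then show thesis using that N0 by blast
qed

text \<open>Adding \<open>L * x\<close> makes an \<open>L\<close>-Lipschitz function monotone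
  without affecting where it is differentiable.\<close>

lemma lipschitz_real_differentiable_null:
  fixes f :: "real \<Rightarrow> real"
  assumes f: "L-lipschitz_on UNIV f"
  obtains N where "N \<in> null_sets lborel" "\<And>x. x \<notin> N \<Longrightarrow> f differentiable (at x)"
proof -
  let ?g = "\<lambda>x. f x + L * x"
  have L: "L \<ge> 0" using f lipschitz_on_nonneg by blast
  have "mono ?g"
  proof
    fix x y :: real assume "x \<le> y"
    then have "\<bar>f x - f y\<bar> \<le> L * (y - x)" using lipschitz_onD[OF f, of x y] by (simp add: dist_real_def)
    then show "?g x \<le> ?g y" by (simp add: algebra_simps abs_le_iff)
  qed
  moreover have "(L + \<bar>L\<bar> * 1)-lipschitz_on UNIV ?g"
    by (intro lipschitz_intros f)
  ultimately obtain N where N: "N \<in> null_sets lborel" "\<And>x. x \<notin> N \<Longrightarrow> ?g differentiable (at x)"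
    using lipschitz_mono_differentiable_null by blast
  have "f differentiable (at x)" if "x \<notin> N" for x
  proof -
    have "(\<lambda>x. ?g x - L * x) differentiable (at x)"
      using N(2)[OF that] by (rule differentiable_diff) (auto intro!: derivative_intros)
    moreover have "(\<lambda>x. ?g x - L * x) = f" by auto
    ultimately show ?thesis by (simp only:)
  qed
  then show thesis using that N(1) by blast
qed

subsection \<open>Rademacher's theorem\<close>

text \<open>By translation invariance the measure of \<open>E\<close> is its average over the
  translates by \<open>t *\<^sub>R e\<close> with \<open>t\<close> in the unit interval. Exchanging
  the integrals turns this average into an integral of slice measures, for any direction
  \<open>e\<close> and without choosing coordinates.\<close>

lemma null_set_if_line_slices:
  fixes E :: "'a::euclidean_space set" and e :: 'a
  assumes E: "E \<in> sets borel"
    and slice: "\<And>x. \<exists>N\<in>null_sets lborel. {t::real. x + t *\<^sub>R e \<in> E} \<subseteq> N"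
  shows "E \<in> null_sets lborel"
proof -
  have m: "{(t, x). x + t *\<^sub>R e \<in> E} \<in> sets (borel \<Otimes>\<^sub>M borel :: (real \<times> 'a) measure)"
  proof -
    have "(\<lambda>(t, x). x + t *\<^sub>R e) \<in> borel_measurable (borel \<Otimes>\<^sub>M borel :: (real \<times> 'a) measure)"
      unfolding borel_prod by (intro borel_measurable_continuous_onI) (auto simp: case_prod_unfold intro!: continuous_intros)
    from measurable_sets[OF this E] show ?thesis
      by (simp add: vimage_def space_pair_measure case_prod_unfold)
  qed
  have "emeasure lborel E = (\<integral>\<^sup>+t. indicator {0..1} t * emeasure lborel E \<partial>(lborel :: real measure))"
    by (simp add: nn_integral_multc)
  also have "\<dots> = (\<integral>\<^sup>+t. (\<integral>\<^sup>+x. indicator {0..1} t * indicator {(t, x). x + t *\<^sub>R e \<in> E} (t, x) \<partial>lborel) \<partial>(lborel :: real measure))"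
  proof (rule nn_integral_cong)
    fix t :: real
    have "emeasure lborel E = emeasure (distr lborel borel ((+) (t *\<^sub>R e))) E" by (simp add: lborel_distr_plus)
    also have "\<dots> = emeasure lborel ((+) (t *\<^sub>R e) -` E)" using E by (subst emeasure_distr) auto
    also have "\<dots> = (\<integral>\<^sup>+x. indicator ((+) (t *\<^sub>R e) -` E) x \<partial>lborel)"
      using measurable_sets_borel[of "(+) (t *\<^sub>R e)" borel E] E by (subst nn_integral_indicator) auto
    also have "\<dots> = (\<integral>\<^sup>+x. indicator {(t, x). x + t *\<^sub>R e \<in> E} (t, x) \<partial>lborel)"
      by (intro nn_integral_cong) (auto simp: indicator_def add.commute)
    finally have *: "emeasure lborel E = \<dots>" .
    show "indicator {0..1} t * emeasure lborel E = (\<integral>\<^sup>+x. indicator {0..1} t * indicator {(t, x). x + t *\<^sub>R e \<in> E} (t, x) \<partial>lborel)"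
      using m by (subst nn_integral_cmult) (auto simp: *)
  qed
  also have "\<dots> = (\<integral>\<^sup>+x. (\<integral>\<^sup>+t. indicator {0..1} t * indicator {(t, x). x + t *\<^sub>R e \<in> E} (t, x) \<partial>(lborel :: real measure)) \<partial>lborel)"
    using m by (intro lborel_pair.Fubini') (auto simp: case_prod_unfold intro!: borel_measurable_times borel_measurable_indicator)
  also have "\<dots> = (\<integral>\<^sup>+x. 0 \<partial>(lborel :: 'a measure))"
  proof (rule nn_integral_cong)
    fix x :: 'a
    obtain N where N: "N \<in> null_sets lborel" "{t::real. x + t *\<^sub>R e \<in> E} \<subseteq> N" using slice by blast
    have "AE t in lborel. t \<notin> N" using N(1) by (rule AE_not_in)
    then have "AE t in lborel. indicator {0..1} t * indicator {(t, x). x + t *\<^sub>R e \<in> E} (t, x) = (0::ennreal)"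
      by eventually_elim (use N(2) in \<open>auto simp: indicator_def\<close>)
    then have "(\<integral>\<^sup>+t. indicator {0..1} t * indicator {(t, x). x + t *\<^sub>R e \<in> E} (t, x) \<partial>lborel) = (\<integral>\<^sup>+t. 0 \<partial>(lborel :: real measure))"
      by (rule nn_integral_cong_AE)
    then show "(\<integral>\<^sup>+t. indicator {0..1} t * indicator {(t, x). x + t *\<^sub>R e \<in> E} (t, x) \<partial>(lborel :: real measure)) = 0"
      by simp
  qed
  finally show ?thesis using E by (simp add: null_sets_def)
qed

text \<open>A point of a set \<open>G\<close> outside a null set is not the centre of balls with proportionally large
  holes in \<open>G\<close>, hence every nearby point is relatively close to \<open>G\<close>.\<close>

lemma porous_part_null:
  fixes G :: "'a::euclidean_space set"
  assumes G: "closed G" and \<delta>: "0 < \<delta>" "\<delta> \<le> 1/2"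
  obtains N where "N \<in> null_sets lborel"
    "\<And>x. x \<in> G - N \<Longrightarrow> \<exists>s>0. \<forall>p. dist p x < s \<longrightarrow> (\<exists>z\<in>G. dist z p \<le> 2 * \<delta> * dist p x)"
proof -
  define hole where "hole a r \<longleftrightarrow> r > 0 \<and> (\<exists>y. ball y (\<delta> * r) \<subseteq> ball a r - G)" for a r
  define W where "W n = \<Union>{ball a r | a r. r < inverse (real (Suc n)) \<and> hole a r}" for n
  define N where "N = G \<inter> (\<Inter>n. W n)"
  have oW: "open (W n)" for n unfolding W_def by (auto intro!: open_Union)
  have Nb: "N \<in> sets borel" unfolding N_def using G oW by (intro sets.Int sets.countable_INT) auto
  let ?m = "emeasure lborel :: 'a set \<Rightarrow> ennreal" and ?B = "\<lambda>(a, r). ball a r :: 'a set"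
  \<comment> \<open>The fraction of the volume of a ball occupied by a hole of relative radius
    \<delta>. Inside such balls \<open>G\<close> fills at most the fraction \<open>1 - c\<close>,
    and covering the porous part by them yields a measure at most \<open>1 - c\<close> times
    itself.\<close>
  define c where "c = \<delta> ^ DIM('a)"
  have c: "0 < c" "c \<le> 1" unfolding c_def using \<delta> by (auto intro!: power_le_one)
  have mb: "?m (ball a r) = ennreal (r ^ DIM('a) * measure lborel (ball (0::'a) 1))" if "r \<ge> 0" for a r
    using that emeasure_lborel_ball_finite[of a r] content_ball_conv_unit_ball[OF that, of a]
    by (simp add: emeasure_eq_ennreal_measure measure_completion)
  have null: "N \<inter> ball 0 R \<in> null_sets lborel" for R
  proof -
    let ?S = "N \<inter> ball 0 R"
    have Sb: "?S \<in> sets borel" using Nb by auto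
    have "bounded ?S" by (meson bounded_Int bounded_ball)
    then have fin: "?m ?S < \<infinity>" using emeasure_bounded_finite by blast
    then obtain s where s: "?m ?S = ennreal s" "s \<ge> 0" by (cases "?m ?S") auto
    have key: "?m ?S \<le> ennreal (1 - c) * (?m ?S + ennreal e)" if e: "e > 0" for e
    proof -
      obtain U where U: "open U" "?S \<subseteq> U" "?m (U - ?S) < e"
        using outer_regular_lborel[of ?S e] Sb e by auto
      have mU: "?m U \<le> ?m ?S + ennreal e"
      proof -
        have "?m U = ?m ?S + ?m (U - ?S)"
          using U Sb by (subst plus_emeasure) (auto intro!: arg_cong[where f="?m"])
        then show ?thesis using U(3) by (auto intro: add_left_mono)
      qed
      obtain C where C: "countable C" "disjoint_family_on ?B C"
        "\<And>a r. (a, r) \<in> C \<Longrightarrow> ball a r \<subseteq> U \<and> hole a r" "negligible (?S - \<Union>(?B ` C))"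
      proof (rule Vitali_balls_in_open[OF U(1,2), of hole])
        fix x and d :: real assume x: "x \<in> ?S" "d > 0"
        obtain n where "inverse (real (Suc n)) < d" using reals_Archimedean x(2) by blast
        moreover have "x \<in> W n" using x by (auto simp: N_def)
        ultimately show "\<exists>a r. x \<in> ball a r \<and> r < d \<and> hole a r"
          unfolding W_def by (blast intro: less_trans)
      qed blast
      have oC: "\<Union>(?B ` C) \<in> sets borel" by (intro borel_open) auto
      have Nn: "?S - \<Union>(?B ` C) \<in> null_sets lborel"
        using C(4) Sb oC by (auto simp: negligible_iff_null_sets null_sets_def emeasure_completion)
      have "?m ?S = ?m (?S \<inter> \<Union>(?B ` C))"
      proof -
        have "?m ?S = ?m (?S - (?S - \<Union>(?B ` C)))"
          using Nn Sb by (subst emeasure_Diff_null_set) auto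
        moreover have "?S - (?S - \<Union>(?B ` C)) = ?S \<inter> \<Union>(?B ` C)" by blast
        ultimately show ?thesis by simp
      qed
      also have "?S \<inter> \<Union>(?B ` C) = (\<Union>i\<in>C. ?S \<inter> ?B i)" by blast
      also have "?m (\<Union>i\<in>C. ?S \<inter> ?B i) = (\<integral>\<^sup>+i. ?m (?S \<inter> ?B i) \<partial>count_space C)"
      proof (rule emeasure_UN_countable)
        show "disjoint_family_on (\<lambda>i. ?S \<inter> ?B i) C"
          using C(2) unfolding disjoint_family_on_def by blast
      qed (use C Sb in auto)
      also have "\<dots> \<le> (\<integral>\<^sup>+i. ennreal (1 - c) * ?m (?B i) \<partial>count_space C)"
      proof (rule nn_integral_mono)
        fix i assume "i \<in> space (count_space C)"
        then obtain a r where i: "i = (a, r)" "hole a r" using C(3) by (cases i) auto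
        then obtain y where y: "ball y (\<delta> * r) \<subseteq> ball a r - G" and r: "r > 0" by (auto simp: hole_def)
        have "?m (?S \<inter> ball a r) \<le> ?m (ball a r - ball y (\<delta> * r))"
          using y by (intro emeasure_mono) (auto simp: N_def)
        also have "\<dots> = ?m (ball a r) - ?m (ball y (\<delta> * r))"
          using y emeasure_lborel_ball_finite[of y "\<delta> * r"] by (intro emeasure_Diff) auto
        also have "\<dots> = ennreal (1 - c) * ?m (ball a r)"
          using r \<delta> c by (simp add: mb ennreal_minus power_mult_distrib c_def algebra_simps flip: ennreal_mult')
        finally show "?m (?S \<inter> ?B i) \<le> ennreal (1 - c) * ?m (?B i)" using i by simp
      qed
      also have "\<dots> = ennreal (1 - c) * ?m (\<Union>(?B ` C))"
        using C(1,2) by (subst emeasure_UN_countable) (auto simp: nn_integral_cmult)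
      also have "\<dots> \<le> ennreal (1 - c) * ?m U"
        using C(3) U(1) by (intro mult_left_mono emeasure_mono) auto
      also have "\<dots> \<le> ennreal (1 - c) * (?m ?S + ennreal e)" using mU by (rule mult_left_mono) simp
      finally show ?thesis .
    qed
    have "s \<le> (1 - c) * s + e" if "e > 0" for e
    proof -
      have "ennreal s \<le> ennreal ((1 - c) * (s + e))"
        using key[OF that] s c that by (simp flip: ennreal_plus ennreal_mult)
      then have "s \<le> (1 - c) * (s + e)" using c s that by (subst (asm) ennreal_le_iff) auto
      also have "\<dots> \<le> (1 - c) * s + 1 * e" unfolding distrib_left using c that by (intro add_left_mono mult_right_mono) auto
      finally show ?thesis by simp
    qed
    then have "s \<le> (1 - c) * s" by (rule field_le_epsilon)
    then have "c * s \<le> 0" by (simp add: algebra_simps)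
    then have "s = 0" using c s(2) by (simp add: mult_le_0_iff)
    then show ?thesis using s Sb by (auto simp: null_sets_def)
  qed
  have "N = (\<Union>n. N \<inter> ball 0 (real n))"
  proof -
    have "\<exists>n. x \<in> ball 0 (real n)" for x :: 'a using reals_Archimedean2[of "norm x"] by auto
    then show ?thesis by blast
  qed
  then have "N \<in> null_sets lborel" using null by (metis null_sets_UN)
  moreover have "\<exists>s>0. \<forall>p. dist p x < s \<longrightarrow> (\<exists>z\<in>G. dist z p \<le> 2 * \<delta> * dist p x)" if x: "x \<in> G - N" for x
  proof -
    obtain n where n: "x \<notin> W n" using x by (auto simp: N_def)
    have "\<exists>z\<in>G. dist z p \<le> 2 * \<delta> * dist p x" if p: "dist p x < inverse (real (Suc n)) / 2" for p
    proof (cases "p = x")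
      case True then show ?thesis using x by auto
    next
      case False
      \<comment> \<open>With this radius \<delta> at most 1/2 keeps the ball of radius
        \<open>\<delta> * ?r\<close> around \<open>p\<close> inside \<open>ball x ?r\<close>. As
        there is no hole, that ball meets \<open>G\<close>; this is the origin of the factor 2 in
        the conclusion.\<close>
      let ?r = "2 * dist p x"
      have r: "?r > 0" "?r < inverse (real (Suc n))" using False p by auto
      have "ball p (\<delta> * ?r) \<subseteq> ball x ?r"
      proof
        fix z assume "z \<in> ball p (\<delta> * ?r)"
        then have "dist p z < \<delta> * ?r" by simp
        also have "\<dots> \<le> 1/2 * ?r" using \<delta> r by (intro mult_right_mono) auto
        finally have "dist p z < dist p x" by simp
        then show "z \<in> ball x ?r" using dist_triangle[of x z p] by (simp add: dist_commute)
      qed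
      moreover have "\<not> hole x ?r" using n r unfolding W_def by force
      ultimately obtain z where "z \<in> ball p (\<delta> * ?r)" "z \<in> G" using r unfolding hole_def by blast
      then show ?thesis by (intro bexI[of _ z]) (auto simp: dist_commute)
    qed
    then show ?thesis by (intro exI[of _ "inverse (real (Suc n)) / 2"]) auto
  qed
  ultimately show thesis using that by blast
qed

text \<open>Walking from \<open>x\<close> along the coordinate directions, each corner is replaced by a nearby point
  of \<open>G\<close>, where the next difference quotient is controlled uniformly.\<close>

lemma differentiable_of_partial_approximations:
  fixes f :: "'a::euclidean_space \<Rightarrow> real"
  assumes L: "L-lipschitz_on UNIV f"
    and approx: "\<And>i \<eta>. i \<in> Basis \<Longrightarrow> \<eta> > 0 \<Longrightarrow> \<exists>G s. s > 0 \<and>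
      (\<forall>z\<in>G. \<forall>t. \<bar>t\<bar> < s \<longrightarrow> \<bar>f (z + t *\<^sub>R i) - f z - t * D i\<bar> \<le> \<eta> * \<bar>t\<bar>) \<and>
      (\<forall>p. dist p x < s \<longrightarrow> (\<exists>z\<in>G. dist z p \<le> \<eta> * dist p x))"
  shows "(f has_derivative (\<lambda>h. \<Sum>i\<in>Basis. (h \<bullet> i) * D i)) (at x)"
proof -
  have L0: "L \<ge> 0" using L lipschitz_on_nonneg by blast
  have Lf: "\<bar>f y - f z\<bar> \<le> L * dist y z" for y z using lipschitz_onD[OF L, of y z] by (simp add: dist_real_def)
  have part: "norm (\<Sum>i\<in>J. (h \<bullet> i) *\<^sub>R i) \<le> norm h" if "J \<subseteq> Basis" for J and h :: 'a
  proof (rule norm_le_componentwise)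
    fix b :: 'a assume "b \<in> Basis"
    then have "(\<Sum>i\<in>J. (h \<bullet> i) *\<^sub>R i) \<bullet> b = (\<Sum>i\<in>J. if i = b then h \<bullet> b else 0)"
      using that by (auto simp: inner_sum_left inner_Basis intro!: sum.cong)
    also have "\<dots> = (if b \<in> J then h \<bullet> b else 0)"
      using that finite_subset[OF that finite_Basis] by (simp add: sum.delta)
    finally show "\<bar>(\<Sum>i\<in>J. (h \<bullet> i) *\<^sub>R i) \<bullet> b\<bar> \<le> \<bar>h \<bullet> b\<bar>" by simp
  qed
  have step: "J \<subseteq> Basis \<Longrightarrow> \<forall>\<eta>>0. \<exists>d>0. \<forall>h. norm h < d \<longrightarrow>
      \<bar>f (x + (\<Sum>i\<in>J. (h \<bullet> i) *\<^sub>R i)) - f x - (\<Sum>i\<in>J. (h \<bullet> i) * D i)\<bar> \<le> \<eta> * norm h" if "finite J" for J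
    using that
  proof induction
    case empty then show ?case by (auto intro!: exI[of _ 1])
  next
    case (insert j J)
    show ?case
    proof (intro allI impI)
      fix \<eta> :: real assume \<eta>: "\<eta> > 0"
      obtain d where d: "d > 0" "\<And>h. norm h < d \<Longrightarrow>
          \<bar>f (x + (\<Sum>i\<in>J. (h \<bullet> i) *\<^sub>R i)) - f x - (\<Sum>i\<in>J. (h \<bullet> i) * D i)\<bar> \<le> \<eta>/2 * norm h"
        using insert.IH[THEN spec, of "\<eta>/2"] insert.prems \<eta> by auto
      \<comment> \<open>Replacing the corner by a point of \<open>G\<close> costs \<open>L\<close>
        times \<open>\<mu> * norm h\<close> at each end of the step, and the quotient there costs
        \<open>\<mu> * norm h\<close> once more. The total is half of the allowed error; the
        induction hypothesis uses the other half.\<close>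
      define \<mu> where "\<mu> = \<eta> / (2 * (2 * L + 1))"
      have \<mu>: "\<mu> > 0" "(2 * L + 1) * \<mu> = \<eta>/2" unfolding \<mu>_def using \<eta> L0 by (auto simp: field_simps)
      obtain G s where G: "s > 0" "\<And>z t. z \<in> G \<Longrightarrow> \<bar>t\<bar> < s \<Longrightarrow> \<bar>f (z + t *\<^sub>R j) - f z - t * D j\<bar> \<le> \<mu> * \<bar>t\<bar>"
        "\<And>p. dist p x < s \<Longrightarrow> \<exists>z\<in>G. dist z p \<le> \<mu> * dist p x"
        using approx[of j \<mu>] insert.prems \<mu>(1) by (metis insert_subset)
      have jB: "j \<in> Basis" using insert.prems by auto
      have "\<bar>f (x + (\<Sum>i\<in>insert j J. (h \<bullet> i) *\<^sub>R i)) - f x - (\<Sum>i\<in>insert j J. (h \<bullet> i) * D i)\<bar> \<le> \<eta> * norm h"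
        if h: "norm h < min d s" for h
      proof -
        define p where "p = x + (\<Sum>i\<in>J. (h \<bullet> i) *\<^sub>R i)"
        define t where "t = h \<bullet> j"
        have dp: "dist p x \<le> norm h" using part[of J h] insert.prems by (auto simp: p_def dist_norm)
        then obtain z where z: "z \<in> G" "dist z p \<le> \<mu> * norm h"
          using G(3)[of p] h \<mu> by (smt (verit, ccfv_SIG) min_less_iff_conj mult_left_mono)
        have t: "\<bar>t\<bar> \<le> norm h" unfolding t_def using jB by (rule Basis_le_norm)
        have "\<bar>f (z + t *\<^sub>R j) - f z - t * D j\<bar> \<le> \<mu> * norm h"
          using G(2)[OF z(1), of t] t h \<mu>(1) by (smt (verit) min_less_iff_conj mult_left_mono)
        moreover have "\<bar>f (p + t *\<^sub>R j) - f (z + t *\<^sub>R j)\<bar> \<le> L * (\<mu> * norm h)"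
          using Lf[of "p + t *\<^sub>R j" "z + t *\<^sub>R j"] z(2) L0 mult_left_mono[OF z(2) L0] by (simp add: dist_commute)
        moreover have "\<bar>f z - f p\<bar> \<le> L * (\<mu> * norm h)"
          using Lf[of z p] z(2) mult_left_mono[OF z(2) L0] by simp
        ultimately have "\<bar>f (p + t *\<^sub>R j) - f p - t * D j\<bar> \<le> L * (\<mu> * norm h) + L * (\<mu> * norm h) + \<mu> * norm h"
          by linarith
        also have "\<dots> = (2 * L + 1) * \<mu> * norm h" by (simp add: algebra_simps)
        also have "\<dots> = \<eta>/2 * norm h" by (simp add: \<mu>)
        finally have "\<bar>f (p + t *\<^sub>R j) - f p - t * D j\<bar> \<le> \<eta>/2 * norm h" .
        moreover have "\<eta>/2 * norm h + \<eta>/2 * norm h = \<eta> * norm h" by simp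
        moreover have "\<bar>f p - f x - (\<Sum>i\<in>J. (h \<bullet> i) * D i)\<bar> \<le> \<eta>/2 * norm h"
          using d(2)[of h] h by (simp add: p_def)
        moreover have eqs: "x + (\<Sum>i\<in>insert j J. (h \<bullet> i) *\<^sub>R i) = p + t *\<^sub>R j"
          "(\<Sum>i\<in>insert j J. (h \<bullet> i) * D i) = (\<Sum>i\<in>J. (h \<bullet> i) * D i) + t * D j"
          using insert by (auto simp: p_def t_def)
        ultimately show ?thesis unfolding eqs by linarith
      qed
      then show "\<exists>d>0. \<forall>h. norm h < d \<longrightarrow>
          \<bar>f (x + (\<Sum>i\<in>insert j J. (h \<bullet> i) *\<^sub>R i)) - f x - (\<Sum>i\<in>insert j J. (h \<bullet> i) * D i)\<bar> \<le> \<eta> * norm h"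
        using d G by (intro exI[of _ "min d s"]) auto
    qed
  qed
  show ?thesis
    unfolding has_derivative_at_alt
  proof (intro conjI allI impI)
    show "bounded_linear (\<lambda>h. \<Sum>i\<in>Basis. (h \<bullet> i) * D i)"
      by (intro bounded_linear_sum bounded_linear_mult_const bounded_linear_inner_left)
    fix \<eta> :: real assume "\<eta> > 0"
    then obtain d where d: "d > 0" "\<And>h. norm h < d \<Longrightarrow>
          \<bar>f (x + (\<Sum>i\<in>Basis. (h \<bullet> i) *\<^sub>R i)) - f x - (\<Sum>i\<in>Basis. (h \<bullet> i) * D i)\<bar> \<le> \<eta> * norm h"
      using step[of Basis] by auto
    show "\<exists>d>0. \<forall>y. norm (y - x) < d \<longrightarrow> norm (f y - f x - (\<Sum>i\<in>Basis. (y - x) \<bullet> i * D i)) \<le> \<eta> * norm (y - x)"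
      using d(1) d(2)[of "y - x" for y] by (intro exI[of _ d]) (auto simp: euclidean_representation)
  qed
qed

text \<open>Any two of the approximate slopes are compared with the same quotient, so they form a
  Cauchy sequence with an explicit rate. The hypothesis has this discrete form because it is what
  membership in countably many sets \<open>G j m n r\<close> provides.\<close>

lemma convergent_difference_quotient:
  fixes q :: "real \<Rightarrow> real"
  assumes "\<And>m::nat. \<exists>n::nat. \<exists>r. \<forall>t. 0 < \<bar>t\<bar> \<and> \<bar>t\<bar> < inverse (real (Suc n)) \<longrightarrow> \<bar>q t - r\<bar> \<le> inverse (real (Suc m))"
  shows "\<exists>D. (q \<longlongrightarrow> D) (at 0)"
proof -
  obtain n r where nr: "\<And>m t. 0 < \<bar>t\<bar> \<Longrightarrow> \<bar>t\<bar> < inverse (real (Suc (n m))) \<Longrightarrow> \<bar>q t - r m\<bar> \<le> inverse (real (Suc m))"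
    using assms by metis
  have rr: "\<bar>r m - r k\<bar> \<le> inverse (real (Suc m)) + inverse (real (Suc k))" for m k
  proof -
    obtain t where "0 < t" "t < inverse (real (Suc (n m)))" "t < inverse (real (Suc (n k)))"
      using field_lbound_gt_zero[of "inverse (real (Suc (n m)))" "inverse (real (Suc (n k)))"] by auto
    then have "\<bar>q t - r m\<bar> \<le> inverse (real (Suc m))" "\<bar>q t - r k\<bar> \<le> inverse (real (Suc k))"
      using nr[of t m] nr[of t k] by auto
    then show ?thesis by linarith
  qed
  have sm: "\<exists>m. inverse (real (Suc m)) < e" if "e > 0" for e using that reals_Archimedean by blast
  have mono: "inverse (real (Suc k)) \<le> inverse (real (Suc m))" if "m \<le> k" for m k using that by auto
  have "Cauchy r"
  proof (rule metric_CauchyI)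
    fix e :: real assume "e > 0"
    then obtain M where M: "inverse (real (Suc M)) < e/2" using sm[of "e/2"] by auto
    have "dist (r m) (r k) < e" if "m \<ge> M" "k \<ge> M" for m k
      unfolding dist_real_def using rr[of m k] mono[OF that(1)] mono[OF that(2)] M by linarith
    then show "\<exists>M. \<forall>m\<ge>M. \<forall>k\<ge>M. dist (r m) (r k) < e" by blast
  qed
  then obtain D where D: "r \<longlonglongrightarrow> D" using convergent_eq_Cauchy by blast
  have rD: "\<bar>r m - D\<bar> \<le> inverse (real (Suc m))" for m
  proof (rule LIMSEQ_le)
    show "(\<lambda>k. \<bar>r m - r k\<bar>) \<longlonglongrightarrow> \<bar>r m - D\<bar>" by (intro tendsto_intros D)
    show "(\<lambda>k. inverse (real (Suc m)) + inverse (real (Suc k))) \<longlonglongrightarrow> inverse (real (Suc m))"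
      using LIMSEQ_inverse_real_of_nat_add[of "inverse (real (Suc m))"] by simp
  qed (use rr in auto)
  have "(q \<longlongrightarrow> D) (at 0)"
  proof (rule LIM_I)
    fix e :: real assume "e > 0"
    then obtain m where m: "inverse (real (Suc m)) < e/2" using sm[of "e/2"] by auto
    have "\<bar>q t - D\<bar> < e" if "t \<noteq> 0" "\<bar>t\<bar> < inverse (real (Suc (n m)))" for t
      using nr[of t m] rD[of m] m that by (simp del: of_nat_Suc)
    then show "\<exists>s>0. \<forall>x. x \<noteq> 0 \<and> norm (x - 0) < s \<longrightarrow> norm (q x - D) < e"
      by (intro exI[of _ "inverse (real (Suc (n m)))"]) auto
  qed
  then show ?thesis by blast
qed

text \<open>The set \<open>G j m n r\<close> asks for one slope \<open>r\<close> and one scale for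
  all small steps, which makes it closed. Countable unions and intersections keep the bad set Borel,
  and on every line in direction \<open>j\<close> it is null by the one-dimensional theorem.
  Uniformity of the scale over \<open>G j m n r\<close> is also what later allows one point to be
  replaced by a neighbour.\<close>

lemma lipschitz_partial_quotients:
  fixes f :: "'a::euclidean_space \<Rightarrow> real"
  defines "G \<equiv> \<lambda>j m n r. {x. \<forall>t. \<bar>t\<bar> < inverse (real (Suc n)) \<longrightarrow> \<bar>f (x + t *\<^sub>R j) - f x - t * r\<bar> \<le> inverse (real (Suc m)) * \<bar>t\<bar>}"
  assumes L: "L-lipschitz_on UNIV f"
  shows "closed (G j m n r)" and "- (\<Inter>m. \<Union>n. \<Union>r\<in>\<rat>. G j m n r) \<in> null_sets lborel"
proof -
  have cf: "continuous_on UNIV f" using L lipschitz_on_continuous_on by blast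
  have cf': "continuous_on UNIV (\<lambda>x. f (x + a))" for a
    by (rule continuous_on_compose2[OF cf]) (auto intro!: continuous_intros)
  show cl: "closed (G j m n r)" for j m n r
    unfolding G_def
    by (intro closed_Collect_all closed_Collect_imp closed_Collect_le continuous_intros cf cf') auto
  show "- (\<Inter>m. \<Union>n. \<Union>r\<in>\<rat>. G j m n r) \<in> null_sets lborel"
  proof (rule null_set_if_line_slices[where e = j])
    show "- (\<Inter>m. \<Union>n. \<Union>r\<in>\<rat>. G j m n r) \<in> sets borel"
    proof -
      have "(\<Union>r\<in>\<rat>. G j m n r) \<in> sets borel" for m n
        using cl by (intro sets.countable_UN' countable_rat) auto
      then have "(\<Union>n. \<Union>r\<in>\<rat>. G j m n r) \<in> sets borel" for m
        by (intro sets.countable_UN) auto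
      then show ?thesis by (intro borel_comp sets.countable_INT) auto
    qed
    fix x :: 'a
    let ?\<phi> = "\<lambda>t::real. f (x + t *\<^sub>R j)"
    have "(L * norm j)-lipschitz_on UNIV ?\<phi>"
    proof (rule lipschitz_onI)
      show "dist (?\<phi> s) (?\<phi> t) \<le> L * norm j * dist s t" for s t
        using lipschitz_onD[OF L, of "x + s *\<^sub>R j" "x + t *\<^sub>R j"]
        by (simp add: dist_norm mult_ac flip: scaleR_diff_left)
    qed (use lipschitz_on_nonneg[OF L] in auto)
    then obtain N where N: "N \<in> null_sets lborel" "\<And>t. t \<notin> N \<Longrightarrow> ?\<phi> differentiable (at t)"
      using lipschitz_real_differentiable_null by blast
    have "x + t *\<^sub>R j \<in> (\<Union>n. \<Union>r\<in>\<rat>. G j m n r)" if "t \<notin> N" for t m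
    proof -
      \<comment> \<open>One half of the tolerance for the derivative, the other half for rounding it
        to a rational slope.\<close>
      let ?e = "inverse (real (Suc m)) / 2"
      have "?\<phi> differentiable (at t)" using N(2)[OF that] .
      then obtain D where "(?\<phi> has_field_derivative D) (at t)"
        by (auto simp: real_differentiable_def)
      then have "(?\<phi> has_derivative (*) D) (at t)" by (simp add: has_field_derivative_def)
      then obtain d where d: "d > 0" "\<And>y. norm (y - t) < d \<Longrightarrow> norm (?\<phi> y - ?\<phi> t - D * (y - t)) \<le> ?e * norm (y - t)"
        unfolding has_derivative_at_alt by (metis half_gt_zero inverse_positive_iff_positive of_nat_0_less_iff zero_less_Suc)
      obtain n where n: "inverse (real (Suc n)) < d" using reals_Archimedean d(1) by blast
      obtain r where r: "r \<in> \<rat>" "D < r" "r < D + ?e" using Rats_dense_in_real[of D "D + ?e"] by auto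
      have "x + t *\<^sub>R j \<in> G j m n r"
        unfolding G_def
      proof (intro CollectI allI impI)
        fix s assume s: "\<bar>s\<bar> < inverse (real (Suc n))"
        have "\<bar>?\<phi> (t + s) - ?\<phi> t - D * s\<bar> \<le> ?e * \<bar>s\<bar>" using d(2)[of "t + s"] s n by simp
        moreover have "\<bar>D * s - r * s\<bar> \<le> ?e * \<bar>s\<bar>"
          unfolding left_diff_distrib[symmetric] abs_mult using r by (intro mult_right_mono) auto
        moreover have "?e * \<bar>s\<bar> + ?e * \<bar>s\<bar> = inverse (real (Suc m)) * \<bar>s\<bar>" by simp
        ultimately have "\<bar>?\<phi> (t + s) - ?\<phi> t - r * s\<bar> \<le> inverse (real (Suc m)) * \<bar>s\<bar>" by linarith
        then show "\<bar>f (x + t *\<^sub>R j + s *\<^sub>R j) - f (x + t *\<^sub>R j) - s * r\<bar> \<le> inverse (real (Suc m)) * \<bar>s\<bar>"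
          by (simp add: scaleR_add_left add.assoc mult.commute)
      qed
      then show ?thesis using r by blast
    qed
    then have "{t. x + t *\<^sub>R j \<in> - (\<Inter>m. \<Union>n. \<Union>r\<in>\<rat>. G j m n r)} \<subseteq> N" by blast
    then show "\<exists>N\<in>null_sets lborel. {t. x + t *\<^sub>R j \<in> - (\<Inter>m. \<Union>n. \<Union>r\<in>\<rat>. G j m n r)} \<subseteq> N"
      using N(1) by blast
  qed
qed

text \<open>Existence of partial derivatives alone does not give differentiability. The porous parts
  of the countably many sets \<open>G j m n r\<close> are therefore discarded as well, so that at a
  remaining point nearby corners can be shifted into the same \<open>G j m n r\<close>.\<close>

theorem Rademacher_real:
  fixes f :: "'a::euclidean_space \<Rightarrow> real"
  assumes L: "L-lipschitz_on UNIV f"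
  obtains N where "N \<in> null_sets lborel" "\<And>x. x \<notin> N \<Longrightarrow> f differentiable (at x)"
proof -
  define G where "G = (\<lambda>(j::'a) m n r. {x. \<forall>t. \<bar>t\<bar> < inverse (real (Suc n)) \<longrightarrow> \<bar>f (x + t *\<^sub>R j) - f x - t * r\<bar> \<le> inverse (real (Suc m)) * \<bar>t\<bar>})"
  have cl: "closed (G j m n r)" for j m n r unfolding G_def by (rule lipschitz_partial_quotients(1)[OF L])
  define N1 where "N1 = (\<Union>j\<in>Basis. - (\<Inter>m. \<Union>n. \<Union>r\<in>\<rat>. G j m n r))"
  have N1: "N1 \<in> null_sets lborel"
    unfolding N1_def G_def by (intro null_sets_UN' lipschitz_partial_quotients(2)[OF L]) (auto simp: countable_finite)
  \<comment> \<open>Starting at 1/2 meets the requirement of \<open>porous_part_null\<close>;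
    tending to 0 makes the relative distance to \<open>G j m n r\<close> arbitrarily small.\<close>
  define \<delta> where "\<delta> k = inverse (real (Suc (Suc k)))" for k
  have "\<exists>N\<in>null_sets lborel. \<forall>x\<in>G j m n r - N. \<exists>s>0. \<forall>p. dist p x < s \<longrightarrow> (\<exists>z\<in>G j m n r. dist z p \<le> 2 * \<delta> k * dist p x)" for j m n r k
  proof -
    have "0 < \<delta> k" "\<delta> k \<le> 1/2" unfolding \<delta>_def by (auto simp: field_simps)
    from porous_part_null[OF cl this, of j m n r] show ?thesis by metis
  qed
  then obtain P where P: "\<And>j m n r k. P j m n r k \<in> null_sets lborel"
    "\<And>j m n r k x. x \<in> G j m n r - P j m n r k \<Longrightarrow> \<exists>s>0. \<forall>p. dist p x < s \<longrightarrow> (\<exists>z\<in>G j m n r. dist z p \<le> 2 * \<delta> k * dist p x)"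
    by metis
  define N2 where "N2 = (\<Union>j\<in>Basis. \<Union>m. \<Union>n. \<Union>r\<in>\<rat>. \<Union>k. P j m n r k)"
  have N2: "N2 \<in> null_sets lborel"
    unfolding N2_def by (intro null_sets_UN' P(1)) (auto simp: countable_rat countable_finite)
  have "f differentiable (at x)" if x: "x \<notin> N1 \<union> N2" for x
  proof -
    have xG: "\<exists>n. \<exists>r\<in>\<rat>. x \<in> G j m n r" if "j \<in> Basis" for j m using x that by (auto simp: N1_def)
    have "\<exists>D. ((\<lambda>t. (f (x + t *\<^sub>R j) - f x) / t) \<longlongrightarrow> D) (at 0)" if j: "j \<in> Basis" for j
    proof (rule convergent_difference_quotient)
      fix m
      obtain n r where nr: "x \<in> G j m n r" using xG[OF j, of m] by blast
      have "\<bar>(f (x + t *\<^sub>R j) - f x) / t - r\<bar> \<le> inverse (real (Suc m))" if "0 < \<bar>t\<bar> \<and> \<bar>t\<bar> < inverse (real (Suc n))" for t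
      proof -
        have "(f (x + t *\<^sub>R j) - f x) / t - r = (f (x + t *\<^sub>R j) - f x - t * r) / t" using that by (auto simp: field_simps)
        then show ?thesis using nr that unfolding G_def by (simp add: abs_divide divide_le_eq)
      qed
      then show "\<exists>n r. \<forall>t. 0 < \<bar>t\<bar> \<and> \<bar>t\<bar> < inverse (real (Suc n)) \<longrightarrow> \<bar>(f (x + t *\<^sub>R j) - f x) / t - r\<bar> \<le> inverse (real (Suc m))"
        by blast
    qed
    then obtain D where D: "\<And>j. j \<in> Basis \<Longrightarrow> ((\<lambda>t. (f (x + t *\<^sub>R j) - f x) / t) \<longlongrightarrow> D j) (at 0)" by metis
    have "(f has_derivative (\<lambda>h. \<Sum>i\<in>Basis. (h \<bullet> i) * D i)) (at x)"
    proof (rule differentiable_of_partial_approximations[OF L])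
      fix j :: 'a and \<eta> :: real assume j: "j \<in> Basis" and \<eta>: "\<eta> > 0"
      obtain m where m: "inverse (real (Suc m)) < \<eta>/2" using reals_Archimedean[of "\<eta>/2"] \<eta> by auto
      obtain n r where nr: "r \<in> \<rat>" "x \<in> G j m n r" using xG[OF j, of m] by blast
      \<comment> \<open>The rational slope of the set \<open>G j m n r\<close> containing
        \<open>x\<close> is close to the true partial derivative, so the estimates on that set can
        be restated with \<open>D j\<close>.\<close>
      have rD: "\<bar>D j - r\<bar> \<le> inverse (real (Suc m))"
      proof (rule tendsto_upperbound)
        show "((\<lambda>t. \<bar>(f (x + t *\<^sub>R j) - f x) / t - r\<bar>) \<longlongrightarrow> \<bar>D j - r\<bar>) (at 0)" by (intro tendsto_intros D j)
        have "\<bar>(f (x + t *\<^sub>R j) - f x) / t - r\<bar> \<le> inverse (real (Suc m))" if "t \<noteq> 0" "\<bar>t\<bar> < inverse (real (Suc n))" for t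
        proof -
          have "(f (x + t *\<^sub>R j) - f x) / t - r = (f (x + t *\<^sub>R j) - f x - t * r) / t" using that by (auto simp: field_simps)
          then show ?thesis using nr that unfolding G_def by (simp add: abs_divide divide_le_eq)
        qed
        then show "\<forall>\<^sub>F t in at 0. \<bar>(f (x + t *\<^sub>R j) - f x) / t - r\<bar> \<le> inverse (real (Suc m))"
          unfolding eventually_at by (intro exI[of _ "inverse (real (Suc n))"]) auto
      qed auto
      obtain k where k: "inverse (real (Suc k)) < \<eta>/2" using reals_Archimedean[of "\<eta>/2"] \<eta> by auto
      have "\<delta> k \<le> inverse (real (Suc k))" unfolding \<delta>_def by auto
      then have k': "2 * \<delta> k \<le> \<eta>" using k by linarith
      have "P j m n r k \<subseteq> N2" unfolding N2_def using nr(1) j by fast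
      then have "x \<in> G j m n r - P j m n r k" using x nr(2) by blast
      then obtain s where s: "s > 0" "\<And>p. dist p x < s \<Longrightarrow> \<exists>z\<in>G j m n r. dist z p \<le> 2 * \<delta> k * dist p x"
        using P(2) by metis
      let ?s = "min s (inverse (real (Suc n)))"
      have "\<bar>f (z + t *\<^sub>R j) - f z - t * D j\<bar> \<le> \<eta> * \<bar>t\<bar>" if "z \<in> G j m n r" "\<bar>t\<bar> < ?s" for z t
      proof -
        have "\<bar>f (z + t *\<^sub>R j) - f z - t * r\<bar> \<le> inverse (real (Suc m)) * \<bar>t\<bar>" using that by (auto simp: G_def)
        moreover have "\<bar>t * D j - t * r\<bar> \<le> inverse (real (Suc m)) * \<bar>t\<bar>"
          unfolding right_diff_distrib[symmetric] abs_mult by (subst mult.commute) (intro mult_right_mono rD, auto)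
        moreover have "inverse (real (Suc m)) * \<bar>t\<bar> \<le> \<eta>/2 * \<bar>t\<bar>" using m by (intro mult_right_mono) auto
        ultimately show ?thesis by linarith
      qed
      moreover have "\<exists>z\<in>G j m n r. dist z p \<le> \<eta> * dist p x" if "dist p x < ?s" for p
      proof -
        have "dist p x < s" using that by (simp only: min_less_iff_conj)
        then obtain z where "z \<in> G j m n r" "dist z p \<le> 2 * \<delta> k * dist p x" using s(2)[of p] by blast
        moreover have "2 * \<delta> k * dist p x \<le> \<eta> * dist p x" using k' by (intro mult_right_mono) auto
        ultimately show ?thesis by force
      qed
      moreover have "?s > 0" using s by auto
      ultimately show "\<exists>G s. s > 0 \<and> (\<forall>z\<in>G. \<forall>t. \<bar>t\<bar> < s \<longrightarrow> \<bar>f (z + t *\<^sub>R j) - f z - t * D j\<bar> \<le> \<eta> * \<bar>t\<bar>) \<and>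
        (\<forall>p. dist p x < s \<longrightarrow> (\<exists>z\<in>G. dist z p \<le> \<eta> * dist p x))"
        by blast
    qed
    then show ?thesis by (auto simp: differentiable_def)
  qed
  then show thesis using that[of "N1 \<union> N2"] N1 N2 by blast
qed

text \<open>A condition at a point, so that it can be used for coordinate representatives, which
  have arbitrary values outside their domains.\<close>

definition lipschitz_near :: "('a::metric_space \<Rightarrow> 'b::metric_space) \<Rightarrow> 'a \<Rightarrow> bool" where
  "lipschitz_near f x \<longleftrightarrow> (\<exists>r>0. \<exists>L. L-lipschitz_on (ball x r) f)"

text \<open>The nearest-point projection onto a closed ball of half the radius is 1-Lipschitz and
  extends each component to a global Lipschitz function that agrees with it inside the ball.
  Negligibility is a local property.\<close>

theorem Rademacher:
  fixes f :: "'a::euclidean_space \<Rightarrow> 'b::euclidean_space"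
  assumes f: "\<And>x. x \<in> S \<Longrightarrow> lipschitz_near f x"
  shows "negligible {x\<in>S. \<not> f differentiable (at x)}"
proof (subst locally_negligible_alt, rule ballI)
  fix x assume x: "x \<in> {x\<in>S. \<not> f differentiable (at x)}"
  let ?B = "{x\<in>S. \<not> f differentiable (at x)}"
  obtain r L where r: "r > 0" "L-lipschitz_on (ball x r) f" using f[of x] x by (auto simp: lipschitz_near_def)
  let ?C = "cball x (r/2)"
  let ?p = "closest_point ?C"
  have C: "closed ?C" "convex ?C" "?C \<noteq> {}" using r by auto
  have Lp: "L-lipschitz_on UNIV (\<lambda>y. f (?p y) \<bullet> b)" if "b \<in> Basis" for b
  proof (rule lipschitz_onI)
    fix y z :: 'a
    have "?p y \<in> ball x r" "?p z \<in> ball x r"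
      using closest_point_in_set[of ?C y] closest_point_in_set[of ?C z] C r by auto
    then have "dist (f (?p y)) (f (?p z)) \<le> L * dist (?p y) (?p z)" using r(2) by (rule lipschitz_onD[rotated])
    also have "\<dots> \<le> L * dist y z"
      using closest_point_lipschitz[of ?C y z] C lipschitz_on_nonneg[OF r(2)] by (intro mult_left_mono) auto
    finally show "dist (f (?p y) \<bullet> b) (f (?p z) \<bullet> b) \<le> L * dist y z"
      using Basis_le_norm[OF that, of "f (?p y) - f (?p z)"] by (simp add: dist_norm dist_real_def inner_diff_left)
  qed (rule lipschitz_on_nonneg[OF r(2)])
  have "\<exists>N\<in>null_sets lborel. \<forall>y. y \<notin> N \<longrightarrow> (\<lambda>y. f (?p y) \<bullet> b) differentiable (at y)" if "b \<in> Basis" for b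
    using Rademacher_real[OF Lp[OF that]] by metis
  then obtain N where N: "\<And>b. b \<in> Basis \<Longrightarrow> N b \<in> null_sets lborel"
    "\<And>b y. b \<in> Basis \<Longrightarrow> y \<notin> N b \<Longrightarrow> (\<lambda>y. f (?p y) \<bullet> b) differentiable (at y)" by metis
  have "f differentiable (at y)" if y: "y \<in> ball x (r/2)" "y \<notin> (\<Union>b\<in>Basis. N b)" for y
  proof -
    have "(\<lambda>y. f y \<bullet> b) differentiable (at y)" if "b \<in> Basis" for b
    proof (rule differentiable_transform_within)
      show "(\<lambda>y. f (?p y) \<bullet> b) differentiable (at y)" using N(2)[OF that] y that by blast
      show "0 < r/2 - dist x y" using y by simp
      show "f (?p z) \<bullet> b = f z \<bullet> b" if "dist z y < r/2 - dist x y" for z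
        using that dist_triangle[of x z y] by (subst closest_point_self) (auto simp: dist_commute)
    qed auto
    then show ?thesis by (subst differentiable_componentwise_within) auto
  qed
  then have "?B \<inter> ball x (r/2) \<subseteq> (\<Union>b\<in>Basis. N b)" by blast
  moreover have "negligible (\<Union>b\<in>Basis. N b)"
    using N(1) by (intro negligible_Union) (auto simp: negligible_iff_null_sets null_sets_completionI)
  ultimately have "negligible (?B \<inter> ball x (r/2))" using negligible_subset by blast
  then show "\<exists>U. openin (top_of_set ?B) U \<and> x \<in> U \<and> negligible U"
    using x r by (intro exI[of _ "?B \<inter> ball x (r/2)"]) (auto simp: openin_open_Int)
qed

section \<open>Spaces of representatives, unitary relations and operators between them\<close>

subsection \<open>Semi-inner product spaces and unitary maps\<close>

text \<open>Additivity of the inner product would involve the integrability of mixed products. The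
  estimate \<open>inn_quasi\<close> holds pointwise for quadratic forms and yields a triangle
  inequality up to the factor 2, which is enough for zero distances and for limits.
  \<open>inn_cong\<close> makes the inner product well defined on classes.\<close>

locale semi_hspace =
  fixes H :: "('v::ab_group_add) hspace"
  assumes zero_elems: "0 \<in> elems H"
    and add_elems: "x \<in> elems H \<Longrightarrow> y \<in> elems H \<Longrightarrow> x + y \<in> elems H"
    and diff_elems: "x \<in> elems H \<Longrightarrow> y \<in> elems H \<Longrightarrow> x - y \<in> elems H"
    and scal_elems: "x \<in> elems H \<Longrightarrow> scal H k x \<in> elems H"
    and inn_nonneg: "x \<in> elems H \<Longrightarrow> 0 \<le> Re (inn H x x)"
    and inn_zero: "inn H 0 0 = 0"
    and inn_quasi: "x \<in> elems H \<Longrightarrow> y \<in> elems H \<Longrightarrow>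
      Re (inn H (x + y) (x + y)) \<le> 2 * Re (inn H x x) + 2 * Re (inn H y y)"
    and inn_minus: "x \<in> elems H \<Longrightarrow> inn H (- x) (- x) = inn H x x"
    and inn_scal: "x \<in> elems H \<Longrightarrow> Re (inn H (scal H k x) (scal H k x)) = (cmod k)\<^sup>2 * Re (inn H x x)"
    and scal_diff: "x \<in> elems H \<Longrightarrow> y \<in> elems H \<Longrightarrow> scal H k (x - y) = scal H k x - scal H k y"
    and scal_scal: "x \<in> elems H \<Longrightarrow> scal H k (scal H l x) = scal H (k * l) x"
    and scal_one: "x \<in> elems H \<Longrightarrow> scal H 1 x = x"
    and inn_cong: "aeq H x x' \<Longrightarrow> aeq H y y' \<Longrightarrow> inn H x y = inn H x' y'"
begin

lemma hnorm_nonneg: "x \<in> elems H \<Longrightarrow> 0 \<le> hnorm H x"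
  by (simp add: hnorm_def inn_nonneg)

lemma hnorm_zero [simp]: "hnorm H 0 = 0"
  by (simp add: hnorm_def inn_zero)

lemma hnorm_minus_commute: "x \<in> elems H \<Longrightarrow> y \<in> elems H \<Longrightarrow> hnorm H (x - y) = hnorm H (y - x)"
  using inn_minus[of "y - x"] diff_elems[of y x] by (simp add: hnorm_def)

lemma hnorm_quasi:
  assumes "x \<in> elems H" "y \<in> elems H"
  shows "hnorm H (x + y) \<le> 2 * (hnorm H x + hnorm H y)"
proof -
  have n: "0 \<le> Re (inn H x x)" "0 \<le> Re (inn H y y)" using assms inn_nonneg by auto
  have "Re (inn H (x + y) (x + y)) \<le> 2 * (hnorm H x)\<^sup>2 + 2 * (hnorm H y)\<^sup>2"
    using inn_quasi[OF assms] n by (simp add: hnorm_def)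
  also have "\<dots> \<le> (2 * (hnorm H x + hnorm H y))\<^sup>2"
    using hnorm_nonneg assms by (simp add: power2_eq_square algebra_simps)
  finally show ?thesis
    unfolding hnorm_def[of H "x + y"] using hnorm_nonneg assms by (intro real_le_lsqrt) auto
qed

lemma hnorm_quasi_diff:
  assumes "x \<in> elems H" "y \<in> elems H" "z \<in> elems H"
  shows "hnorm H (x - z) \<le> 2 * (hnorm H (x - y) + hnorm H (y - z))"
  using hnorm_quasi[of "x - y" "y - z"] assms diff_elems by simp

lemma hnorm_scal: "x \<in> elems H \<Longrightarrow> hnorm H (scal H k x) = cmod k * hnorm H x"
  by (simp add: hnorm_def inn_scal real_sqrt_mult)

lemma aeq_refl: "x \<in> elems H \<Longrightarrow> aeq H x x"
  by (simp add: aeq_def)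

lemma aeq_sym: "aeq H x y \<Longrightarrow> aeq H y x"
  using hnorm_minus_commute by (auto simp: aeq_def)

lemma aeq_trans: "aeq H x y \<Longrightarrow> aeq H y z \<Longrightarrow> aeq H x z"
  using hnorm_quasi_diff[of x y z] hnorm_nonneg[of "x - z"] diff_elems[of x z] by (auto simp: aeq_def)

lemma aeq_elems: "aeq H x y \<Longrightarrow> x \<in> elems H" "aeq H x y \<Longrightarrow> y \<in> elems H"
  by (auto simp: aeq_def)

lemma hnorm_zero_add:
  assumes "x \<in> elems H" "y \<in> elems H" "hnorm H x = 0" "hnorm H y = 0"
  shows "hnorm H (x + y) = 0"
  using hnorm_quasi[of x y] hnorm_nonneg[of "x + y"] add_elems assms by auto

lemma aeq_minus: "aeq H x x' \<Longrightarrow> aeq H y y' \<Longrightarrow> aeq H (x - y) (x' - y')"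
proof -
  assume a: "aeq H x x'" "aeq H y y'"
  have "hnorm H ((x - x') + (y' - y)) = 0"
    using a hnorm_zero_add[of "x - x'" "y' - y"] diff_elems hnorm_minus_commute[of y y'] by (auto simp: aeq_def)
  then show ?thesis using a diff_elems by (auto simp: aeq_def algebra_simps)
qed

lemma aeq_scal: "aeq H x y \<Longrightarrow> aeq H (scal H k x) (scal H k y)"
  using hnorm_scal[of "x - y" k] by (auto simp: aeq_def scal_elems diff_elems scal_diff)

lemma aeq_hnorm: "aeq H x y \<Longrightarrow> hnorm H x = hnorm H y"
  using inn_cong[of x y x y] by (simp add: hnorm_def)

lemma hclosure_elems: "x \<in> hclosure H X \<Longrightarrow> x \<in> elems H"
  by (simp add: hclosure_def)

lemma hclosure_aeq:
  assumes "x \<in> hclosure H X" "aeq H x z"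
  shows "z \<in> hclosure H X"
proof -
  obtain s :: "nat \<Rightarrow> 'v" where s: "range s \<subseteq> X \<inter> elems H" "(\<lambda>n. hnorm H (s n - x)) \<longlonglongrightarrow> 0"
    using assms by (auto simp: hclosure_def)
  have "hnorm H (s n - z) = hnorm H (s n - x)" for n
    using s by (intro aeq_hnorm aeq_minus[OF aeq_refl aeq_sym[OF assms(2)]]) auto
  then have "(\<lambda>n. hnorm H (s n - z)) \<longlonglongrightarrow> 0" using s(2) by simp
  then show ?thesis using s(1) assms(2) unfolding hclosure_def aeq_def by blast
qed

text \<open>Closing twice adds nothing: the n-th approximant is itself approximated to within
  1/(n+1), and the quasi triangle inequality preserves the limit.\<close>

lemma hclosure_subset:
  assumes "\<And>x. x \<in> X \<Longrightarrow> x \<in> elems H \<Longrightarrow> x \<in> hclosure H Y"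
  shows "hclosure H X \<subseteq> hclosure H Y"
proof
  fix x assume x: "x \<in> hclosure H X"
  then obtain s :: "nat \<Rightarrow> 'v" where s: "range s \<subseteq> X \<inter> elems H" "(\<lambda>n. hnorm H (s n - x)) \<longlonglongrightarrow> 0"
    by (auto simp: hclosure_def)
  have "\<exists>y\<in>Y \<inter> elems H. hnorm H (y - s n) < inverse (real (Suc n))" for n
  proof -
    have "s n \<in> hclosure H Y" using s assms by blast
    then obtain r :: "nat \<Rightarrow> 'v" where r: "range r \<subseteq> Y \<inter> elems H" "(\<lambda>m. hnorm H (r m - s n)) \<longlonglongrightarrow> 0"
      by (auto simp: hclosure_def)
    have "\<forall>\<^sub>F m in sequentially. hnorm H (r m - s n) < inverse (real (Suc n))"
      using r(2) by (rule order_tendstoD) simp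
    then obtain m where "hnorm H (r m - s n) < inverse (real (Suc n))"
      using eventually_happens' sequentially_bot by blast
    then show ?thesis using r(1) by blast
  qed
  then obtain y where y: "\<And>n. y n \<in> Y \<inter> elems H" "\<And>n. hnorm H (y n - s n) < inverse (real (Suc n))" by metis
  have xE: "x \<in> elems H" using x by (rule hclosure_elems)
  have "(\<lambda>n. hnorm H (y n - x)) \<longlonglongrightarrow> 0"
  proof (rule tendsto_sandwich)
    show "\<forall>\<^sub>F n in sequentially. 0 \<le> hnorm H (y n - x)"
      using y xE by (auto intro!: always_eventually hnorm_nonneg diff_elems)
    show "\<forall>\<^sub>F n in sequentially. hnorm H (y n - x) \<le> 2 * (inverse (real (Suc n)) + hnorm H (s n - x))"
    proof (rule always_eventually, rule allI)
      fix n
      have "hnorm H (y n - x) \<le> 2 * (hnorm H (y n - s n) + hnorm H (s n - x))"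
        using y s xE by (intro hnorm_quasi_diff) auto
      then show "hnorm H (y n - x) \<le> 2 * (inverse (real (Suc n)) + hnorm H (s n - x))"
        using y(2)[of n] by (simp del: of_nat_Suc)
    qed
    have "(\<lambda>n. 2 * (inverse (real (Suc n)) + hnorm H (s n - x))) \<longlonglongrightarrow> 2 * (0 + 0)"
      by (intro tendsto_intros s(2) LIMSEQ_inverse_real_of_nat)
    then show "(\<lambda>n. 2 * (inverse (real (Suc n)) + hnorm H (s n - x))) \<longlonglongrightarrow> 0" by simp
  qed auto
  then show "x \<in> hclosure H Y" using y xE by (auto simp: hclosure_def)
qed

text \<open>A sum of two elements of \<open>Y\<close> need only agree with an element of
  \<open>Y\<close> up to \<open>aeq\<close>: for graphs of derivatives the two sides coincide only
  in charts of the atlas and at points of their domains.\<close>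

lemma hclosure_add:
  assumes x: "x \<in> hclosure H Y" and y: "y \<in> hclosure H Y"
    and add: "\<And>a b. a \<in> Y \<inter> elems H \<Longrightarrow> b \<in> Y \<inter> elems H \<Longrightarrow> \<exists>z\<in>Y. aeq H (a + b) z"
  shows "x + y \<in> hclosure H Y"
proof -
  obtain s :: "nat \<Rightarrow> 'v" where s: "range s \<subseteq> Y \<inter> elems H" "(\<lambda>n. hnorm H (s n - x)) \<longlonglongrightarrow> 0"
    using x by (auto simp: hclosure_def)
  obtain r :: "nat \<Rightarrow> 'v" where r: "range r \<subseteq> Y \<inter> elems H" "(\<lambda>n. hnorm H (r n - y)) \<longlonglongrightarrow> 0"
    using y by (auto simp: hclosure_def)
  have E: "x \<in> elems H" "y \<in> elems H" using x y by (auto simp: hclosure_def)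
  have "\<exists>z\<in>Y. aeq H (s n + r n) z" for n using s(1) r(1) by (intro add) auto
  then obtain z where z: "\<And>n. z n \<in> Y" "\<And>n. aeq H (s n + r n) (z n)" by metis
  have hz: "hnorm H (z n - (x + y)) = hnorm H ((s n - x) + (r n - y))" for n
  proof -
    have "aeq H (s n + r n - (x + y)) (z n - (x + y))" by (intro aeq_minus z(2) aeq_refl add_elems E)
    moreover have "s n + r n - (x + y) = (s n - x) + (r n - y)" by simp
    ultimately show ?thesis using aeq_hnorm by metis
  qed
  have "(\<lambda>n. hnorm H (z n - (x + y))) \<longlonglongrightarrow> 0"
  proof (rule tendsto_sandwich)
    show "\<forall>\<^sub>F n in sequentially. 0 \<le> hnorm H (z n - (x + y))"
      using aeq_elems(2)[OF z(2)] E by (auto intro!: always_eventually hnorm_nonneg diff_elems add_elems)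
    show "\<forall>\<^sub>F n in sequentially. hnorm H (z n - (x + y)) \<le> 2 * (hnorm H (s n - x) + hnorm H (r n - y))"
    proof (rule always_eventually, rule allI)
      fix n
      show "hnorm H (z n - (x + y)) \<le> 2 * (hnorm H (s n - x) + hnorm H (r n - y))"
        unfolding hz using s r E by (intro hnorm_quasi diff_elems) auto
    qed
    have "(\<lambda>n. 2 * (hnorm H (s n - x) + hnorm H (r n - y))) \<longlonglongrightarrow> 2 * (0 + 0)"
      by (intro tendsto_intros s(2) r(2))
    then show "(\<lambda>n. 2 * (hnorm H (s n - x) + hnorm H (r n - y))) \<longlonglongrightarrow> 0" by simp
  qed auto
  moreover have "range z \<subseteq> Y \<inter> elems H" using z(1) aeq_elems(2)[OF z(2)] by auto
  ultimately show ?thesis using E add_elems unfolding hclosure_def by blast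
qed

text \<open>Exactly the graphs that come from relations between classes.\<close>

definition saturated :: "('v \<times> 'v) set \<Rightarrow> bool" where
  "saturated B \<longleftrightarrow> B \<subseteq> elems H \<times> elems H \<and>
     (\<forall>x y x' y'. (x, y) \<in> B \<longrightarrow> aeq H x x' \<longrightarrow> aeq H y y' \<longrightarrow> (x', y') \<in> B)"

end

lemma elems_hsum [simp]: "elems (hsum H K) = elems H \<times> elems K"
  and scal_hsum [simp]: "scal (hsum H K) k (x, y) = (scal H k x, scal K k y)"
  and inn_hsum [simp]: "inn (hsum H K) (x, y) (x', y') = inn H x x' + inn K y y'"
  by (auto simp: hsum_def)

lemma aeq_hsum:
  assumes "semi_hspace H" "semi_hspace K"
  shows "aeq (hsum H K) (x, y) (x', y') \<longleftrightarrow> aeq H x x' \<and> aeq K y y'"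
proof -
  interpret H: semi_hspace H by fact
  interpret K: semi_hspace K by fact
  show ?thesis
  proof (cases "x \<in> elems H \<and> x' \<in> elems H \<and> y \<in> elems K \<and> y' \<in> elems K")
    case True
    then have "0 \<le> Re (inn H (x - x') (x - x'))" "0 \<le> Re (inn K (y - y') (y - y'))"
      by (auto intro!: H.inn_nonneg K.inn_nonneg H.diff_elems K.diff_elems)
    then show ?thesis using True by (auto simp: aeq_def hnorm_def)
  qed (auto simp: aeq_def)
qed

lemma semi_hspace_hsum:
  assumes "semi_hspace H" "semi_hspace K"
  shows "semi_hspace (hsum H K)"
proof -
  interpret H: semi_hspace H by fact
  interpret K: semi_hspace K by fact
  show ?thesis
  proof
    fix x y assume "x \<in> elems (hsum H K)" "y \<in> elems (hsum H K)"
    then show "Re (inn (hsum H K) (x + y) (x + y)) \<le> 2 * Re (inn (hsum H K) x x) + 2 * Re (inn (hsum H K) y y)"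
      using H.inn_quasi[of "fst x" "fst y"] K.inn_quasi[of "snd x" "snd y"] by (cases x; cases y) simp
  next
    fix x x' y y' assume "aeq (hsum H K) x x'" "aeq (hsum H K) y y'"
    then show "inn (hsum H K) x y = inn (hsum H K) x' y'"
      using H.inn_cong K.inn_cong by (cases x; cases y; cases x'; cases y') (auto simp: aeq_hsum[OF assms])
  qed (auto simp: zero_prod_def uminus_prod_def H.zero_elems K.zero_elems H.add_elems K.add_elems H.diff_elems K.diff_elems
      H.scal_elems K.scal_elems H.inn_nonneg K.inn_nonneg H.inn_zero K.inn_zero H.inn_minus K.inn_minus
      H.inn_scal K.inn_scal H.scal_diff K.scal_diff H.scal_scal K.scal_scal H.scal_one K.scal_one distrib_left)
qed

text \<open>Surjectivity up to \<open>aeq\<close> is given by \<psi> through \<open>map_inv\<close>;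
  injectivity up to \<open>aeq\<close> comes from preservation of the inner product, as in
  \<open>U_unique_left\<close>. Linearity of \<phi> holds exactly, since pullbacks are linear on
  representatives.\<close>

locale unitary_map = H: semi_hspace H + K: semi_hspace K
  for H :: "('v::ab_group_add) hspace" and K :: "('w::ab_group_add) hspace" +
  fixes \<phi> :: "'v \<Rightarrow> 'w" and \<psi> :: "'w \<Rightarrow> 'v"
  assumes map_elems: "x \<in> elems H \<Longrightarrow> \<phi> x \<in> elems K"
    and inv_elems: "y' \<in> elems K \<Longrightarrow> \<psi> y' \<in> elems H"
    and map_inv: "y' \<in> elems K \<Longrightarrow> aeq K (\<phi> (\<psi> y')) y'"
    and map_inn: "x \<in> elems H \<Longrightarrow> y \<in> elems H \<Longrightarrow> inn K (\<phi> x) (\<phi> y) = inn H x y"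
    and map_diff: "x \<in> elems H \<Longrightarrow> y \<in> elems H \<Longrightarrow> \<phi> (x - y) = \<phi> x - \<phi> y"
    and map_scal: "x \<in> elems H \<Longrightarrow> \<phi> (scal H k x) = scal K k (\<phi> x)"
begin

definition U :: "('v \<times> 'w) set" where
  "U = {(x, y). x \<in> elems H \<and> aeq K y (\<phi> x)}"

lemma map_hnorm: "x \<in> elems H \<Longrightarrow> hnorm K (\<phi> x) = hnorm H x"
  by (simp add: hnorm_def map_inn)

lemma U_elems: "(x, y) \<in> U \<Longrightarrow> x \<in> elems H" "(x, y) \<in> U \<Longrightarrow> y \<in> elems K"
  by (auto simp: U_def aeq_def)

lemma U_map: "x \<in> elems H \<Longrightarrow> (x, \<phi> x) \<in> U"
  by (simp add: U_def map_elems K.aeq_refl)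

lemma U_inv: "y \<in> elems K \<Longrightarrow> (\<psi> y, y) \<in> U"
  by (simp add: U_def inv_elems K.aeq_sym map_inv)

lemma U_unique_right: "(x, y) \<in> U \<Longrightarrow> (x, y') \<in> U \<Longrightarrow> aeq K y y'"
  by (auto simp: U_def intro: K.aeq_trans K.aeq_sym)

lemma U_unique_left: "(x, y) \<in> U \<Longrightarrow> (x', y) \<in> U \<Longrightarrow> aeq H x x'"
proof -
  assume a: "(x, y) \<in> U" "(x', y) \<in> U"
  then have "aeq K (\<phi> x) (\<phi> x')" by (auto simp: U_def intro: K.aeq_trans K.aeq_sym)
  then show ?thesis using a map_hnorm[of "x - x'"] by (auto simp: U_def aeq_def map_diff H.diff_elems)
qed

lemma U_diff: "(x, x') \<in> U \<Longrightarrow> (y, y') \<in> U \<Longrightarrow> (x - y, x' - y') \<in> U"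
  by (auto simp: U_def map_diff H.diff_elems K.aeq_minus)

lemma U_scal: "(x, x') \<in> U \<Longrightarrow> (scal H k x, scal K k x') \<in> U"
  by (auto simp: U_def map_scal H.scal_elems K.aeq_scal)

lemma U_inn: "(x, x') \<in> U \<Longrightarrow> (y, y') \<in> U \<Longrightarrow> inn K x' y' = inn H x y"
  using K.inn_cong[of x' "\<phi> x" y' "\<phi> y"] map_inn[of x y] by (auto simp: U_def)

lemma U_hnorm: "(x, x') \<in> U \<Longrightarrow> hnorm K x' = hnorm H x"
  by (simp add: hnorm_def U_inn)

lemma U_aeq: "(x, x') \<in> U \<Longrightarrow> (y, y') \<in> U \<Longrightarrow> aeq K x' y' \<longleftrightarrow> aeq H x y"
  using U_hnorm[OF U_diff, of x x' y y'] U_elems by (auto simp: aeq_def)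

text \<open>The definition forces both graphs to be saturated under \<open>aeq\<close>.\<close>

definition corr :: "('v \<times> 'v) set \<Rightarrow> ('w \<times> 'w) set \<Rightarrow> bool" where
  "corr T T' \<longleftrightarrow> T \<subseteq> elems H \<times> elems H \<and> T' \<subseteq> elems K \<times> elems K \<and>
     (\<forall>x x' y y'. (x, x') \<in> U \<longrightarrow> (y, y') \<in> U \<longrightarrow> ((x, y) \<in> T \<longleftrightarrow> (x', y') \<in> T'))"

lemma corrI:
  assumes "T \<subseteq> elems H \<times> elems H" "T' \<subseteq> elems K \<times> elems K"
    and "\<And>x x' y y'. (x, x') \<in> U \<Longrightarrow> (y, y') \<in> U \<Longrightarrow> (x, y) \<in> T \<Longrightarrow> (x', y') \<in> T'"
    and "\<And>x x' y y'. (x, x') \<in> U \<Longrightarrow> (y, y') \<in> U \<Longrightarrow> (x', y') \<in> T' \<Longrightarrow> (x, y) \<in> T"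
  shows "corr T T'"
  using assms unfolding corr_def by blast

lemma corr_elems:
  assumes "corr T T'"
  shows "(x, y) \<in> T \<Longrightarrow> x \<in> elems H \<and> y \<in> elems H" "(x', y') \<in> T' \<Longrightarrow> x' \<in> elems K \<and> y' \<in> elems K"
  using assms by (auto simp: corr_def)

lemma corrD:
  assumes "corr T T'" "(x, x') \<in> U" "(y, y') \<in> U"
  shows "(x, y) \<in> T \<longleftrightarrow> (x', y') \<in> T'"
  using assms unfolding corr_def by blast

lemma corr_relcomp:
  assumes T: "corr T T'" and S: "corr S S'"
  shows "corr (T O S) (T' O S')"
proof (rule corrI)
  fix x x' z z' assume U: "(x, x') \<in> U" "(z, z') \<in> U"
  { assume "(x, z) \<in> T O S"
    then obtain y where "(x, y) \<in> T" "(y, z) \<in> S" by blast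
    then show "(x', z') \<in> T' O S'"
      using U U_map[of y] corr_elems[OF T] corrD[OF T] corrD[OF S] by blast }
  { assume "(x', z') \<in> T' O S'"
    then obtain y where "(x', y) \<in> T'" "(y, z') \<in> S'" by blast
    then show "(x, z) \<in> T O S"
      using U U_inv[of y] corr_elems[OF T] corrD[OF T] corrD[OF S] by blast }
qed (use corr_elems[OF T] corr_elems[OF S] in auto)

lemma corr_converse: "corr T T' \<Longrightarrow> corr (T\<inverse>) (T'\<inverse>)"
  unfolding corr_def by blast

lemma corr_id: "corr (id_op H) (id_op K)"
  using U_aeq by (intro corrI) (auto simp: id_op_def aeq_def)

text \<open>Transporting both summands would recover the sum only up to \<open>aeq\<close>. One
  summand is transported and the other is obtained by subtraction, so that they add up exactly to
  the prescribed value.\<close>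

lemma corr_plus:
  assumes T: "corr T T'" and S: "corr S S'"
  shows "corr (plus_op T S) (plus_op T' S')"
proof (rule corrI)
  show "plus_op T S \<subseteq> elems H \<times> elems H" "plus_op T' S' \<subseteq> elems K \<times> elems K"
    using corr_elems[OF T] corr_elems[OF S] H.add_elems K.add_elems by (auto simp: plus_op_def)
  fix x x' w w' assume U: "(x, x') \<in> U" "(w, w') \<in> U"
  { assume "(x, w) \<in> plus_op T S"
    then obtain y z where yz: "(x, y) \<in> T" "(x, z) \<in> S" "w = y + z" by (auto simp: plus_op_def)
    have E: "y \<in> elems H" "z \<in> elems H" using yz corr_elems[OF T] corr_elems[OF S] by auto
    have "(w - y, w' - \<phi> y) \<in> U" using U E U_diff U_map by blast
    then have "(x', w' - \<phi> y) \<in> S'" using yz corrD[OF S U(1)] by simp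
    moreover have "(x', \<phi> y) \<in> T'" using yz E corrD[OF T U(1)] U_map by blast
    ultimately show "(x', w') \<in> plus_op T' S'" unfolding plus_op_def by force }
  { assume "(x', w') \<in> plus_op T' S'"
    then obtain y z where yz: "(x', y) \<in> T'" "(x', z) \<in> S'" "w' = y + z" by (auto simp: plus_op_def)
    have E: "y \<in> elems K" "z \<in> elems K" using yz corr_elems[OF T] corr_elems[OF S] by auto
    have "(w - \<psi> y, w' - y) \<in> U" using U E U_diff U_inv by blast
    then have "(x, w - \<psi> y) \<in> S" using yz corrD[OF S U(1)] by simp
    moreover have "(x, \<psi> y) \<in> T" using yz E corrD[OF T U(1)] U_inv by blast
    ultimately show "(x, w) \<in> plus_op T S" unfolding plus_op_def by force }
qed

text \<open>For \<open>r = 0\<close> the scaled graph would contain a single representative of zero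
  and would not be saturated. For other \<open>r\<close>, division recovers the value before
  scaling.\<close>

lemma corr_scale:
  assumes T: "corr T T'" and r: "r \<noteq> 0"
  shows "corr (scale_op H r T) (scale_op K r T')"
proof (rule corrI)
  show "scale_op H r T \<subseteq> elems H \<times> elems H" "scale_op K r T' \<subseteq> elems K \<times> elems K"
    using corr_elems[OF T] H.scal_elems K.scal_elems by (auto simp: scale_op_def)
  have inv: "scal H (complex_of_real r) (scal H (inverse (complex_of_real r)) w) = w" if "w \<in> elems H" for w
    using that r by (simp add: H.scal_scal H.scal_one)
  have inv': "scal K (complex_of_real r) (scal K (inverse (complex_of_real r)) w) = w" if "w \<in> elems K" for w
    using that r by (simp add: K.scal_scal K.scal_one)
  fix x x' w w' assume U: "(x, x') \<in> U" "(w, w') \<in> U"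
  have U': "(scal H (inverse (complex_of_real r)) w, scal K (inverse (complex_of_real r)) w') \<in> U"
    using U(2) by (rule U_scal)
  { assume "(x, w) \<in> scale_op H r T"
    then obtain y where y: "(x, y) \<in> T" "w = scal H (complex_of_real r) y" by (auto simp: scale_op_def)
    then have "scal H (inverse (complex_of_real r)) w = y"
      using corr_elems[OF T] r by (auto simp: H.scal_scal H.scal_one)
    then have "(x', scal K (inverse (complex_of_real r)) w') \<in> T'" using y corrD[OF T U(1) U'] by simp
    then show "(x', w') \<in> scale_op K r T'" using inv'[of w'] U_elems U unfolding scale_op_def by force }
  { assume "(x', w') \<in> scale_op K r T'"
    then obtain y where y: "(x', y) \<in> T'" "w' = scal K (complex_of_real r) y" by (auto simp: scale_op_def)
    then have "scal K (inverse (complex_of_real r)) w' = y"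
      using corr_elems[OF T] r by (auto simp: K.scal_scal K.scal_one)
    then have "(x, scal H (inverse (complex_of_real r)) w) \<in> T" using y corrD[OF T U(1) U'] by simp
    then show "(x, w) \<in> scale_op H r T" using inv[of w] U_elems U unfolding scale_op_def by force }
qed

lemma corr_adjoint:
  assumes T: "corr T T'"
  shows "corr (adjoint_op H H T) (adjoint_op K K T')"
proof (rule corrI)
  fix y y' z z' assume U: "(y, y') \<in> U" "(z, z') \<in> U"
  { assume a: "(y, z) \<in> adjoint_op H H T"
    have "inn K w' y' = inn K x' z'" if "(x', w') \<in> T'" for x' w'
    proof -
      have E: "(\<psi> x', x') \<in> U" "(\<psi> w', w') \<in> U" using that corr_elems[OF T] U_inv by auto
      then have "(\<psi> x', \<psi> w') \<in> T" using that corrD[OF T] by blast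
      then show ?thesis using a E U U_inn by (auto simp: adjoint_op_def)
    qed
    then show "(y', z') \<in> adjoint_op K K T'" using U U_elems by (auto simp: adjoint_op_def) }
  { assume a: "(y', z') \<in> adjoint_op K K T'"
    have "inn H w y = inn H x z" if "(x, w) \<in> T" for x w
    proof -
      have E: "(x, \<phi> x) \<in> U" "(w, \<phi> w) \<in> U" using that corr_elems[OF T] U_map by auto
      then have "(\<phi> x, \<phi> w) \<in> T'" using that corrD[OF T] by blast
      then have "inn K (\<phi> w) y' = inn K (\<phi> x) z'" using a by (auto simp: adjoint_op_def)
      then show ?thesis using E U U_inn by simp
    qed
    then show "(y, z) \<in> adjoint_op H H T" using U U_elems by (auto simp: adjoint_op_def) }
qed (auto simp: adjoint_op_def)

text \<open>Conjugation may use any related pair of representatives; saturation of \<open>B\<close>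
  makes the choice irrelevant.\<close>

lemma corr_conj:
  assumes "H.saturated B"
  shows "corr B (conj_op U B)"
proof (rule corrI)
  show "B \<subseteq> elems H \<times> elems H" using assms by (auto simp: H.saturated_def)
  show "conj_op U B \<subseteq> elems K \<times> elems K" using U_elems by (auto simp: conj_op_def)
  fix x x' y y' assume U: "(x, x') \<in> U" "(y, y') \<in> U"
  { assume "(x, y) \<in> B" then show "(x', y') \<in> conj_op U B" using U by (auto simp: conj_op_def) }
  { assume "(x', y') \<in> conj_op U B"
    then obtain x1 y1 where "(x1, x') \<in> U" "(x1, y1) \<in> B" "(y1, y') \<in> U" by (auto simp: conj_op_def)
    then show "(x, y) \<in> B" using assms U U_unique_left unfolding H.saturated_def by blast }
qed

lemma corr_hclosure:
  assumes X: "X \<subseteq> elems H" "X' \<subseteq> elems K" and xx: "\<And>x x'. (x, x') \<in> U \<Longrightarrow> x \<in> X \<longleftrightarrow> x' \<in> X'"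
    and u: "(u, u') \<in> U"
  shows "u \<in> hclosure H X \<longleftrightarrow> u' \<in> hclosure K X'"
proof
  assume "u \<in> hclosure H X"
  then obtain s :: "nat \<Rightarrow> 'v" where s: "range s \<subseteq> X \<inter> elems H" "(\<lambda>n. hnorm H (s n - u)) \<longlonglongrightarrow> 0"
    by (auto simp: hclosure_def)
  have U: "(s n, \<phi> (s n)) \<in> U" for n using s(1) by (intro U_map) auto
  have "hnorm K (\<phi> (s n) - u') = hnorm H (s n - u)" for n using U_hnorm[OF U_diff[OF U u]] .
  moreover have "\<phi> (s n) \<in> X'" for n using xx[OF U] s by auto
  ultimately show "u' \<in> hclosure K X'"
    using s u X U_elems by (auto simp: hclosure_def intro!: exI[of _ "\<lambda>n. \<phi> (s n)"])
next
  assume "u' \<in> hclosure K X'"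
  then obtain s :: "nat \<Rightarrow> 'w" where s: "range s \<subseteq> X' \<inter> elems K" "(\<lambda>n. hnorm K (s n - u')) \<longlonglongrightarrow> 0"
    by (auto simp: hclosure_def)
  have U: "(\<psi> (s n), s n) \<in> U" for n using s(1) by (intro U_inv) auto
  have "hnorm H (\<psi> (s n) - u) = hnorm K (s n - u')" for n using U_hnorm[OF U_diff[OF U u]] by simp
  moreover have "\<psi> (s n) \<in> X" for n using xx[OF U] s by auto
  ultimately show "u \<in> hclosure H X"
    using s u X U_elems by (auto simp: hclosure_def intro!: exI[of _ "\<lambda>n. \<psi> (s n)"])
qed

text \<open>The sets of possible norms coincide, hence so do the described values, even where the
  operator is undefined at \<open>u\<close>.\<close>

lemma corr_value_norm:
  assumes T: "corr T T'" and u: "(u, u') \<in> U"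
  shows "value_norm H T u = value_norm K T' u'"
proof -
  have "(\<exists>y. (u, y) \<in> T \<and> hnorm H y = r) \<longleftrightarrow> (\<exists>y. (u', y) \<in> T' \<and> hnorm K y = r)" for r
  proof
    assume "\<exists>y. (u, y) \<in> T \<and> hnorm H y = r"
    then obtain y where y: "(u, y) \<in> T" "hnorm H y = r" by blast
    then have "(y, \<phi> y) \<in> U" using corr_elems[OF T] U_map by blast
    then show "\<exists>y. (u', y) \<in> T' \<and> hnorm K y = r" using y corrD[OF T u] U_hnorm by metis
  next
    assume "\<exists>y. (u', y) \<in> T' \<and> hnorm K y = r"
    then obtain y where y: "(u', y) \<in> T'" "hnorm K y = r" by blast
    then have "(\<psi> y, y) \<in> U" using corr_elems[OF T] U_inv by blast
    then show "\<exists>y. (u, y) \<in> T \<and> hnorm H y = r" using y corrD[OF T u] U_hnorm by metis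
  qed
  then show ?thesis by (simp add: value_norm_def)
qed

lemma corr_Q:
  assumes "corr T T'" "t \<noteq> 0"
  shows "corr (Q_op H T t) (Q_op K T' t)"
  unfolding Q_op_def
  using assms by (intro corr_relcomp corr_converse corr_plus corr_id corr_scale) auto

text \<open>Norms, square functions and closed ranges all correspond under \<open>U\<close>, and
  every element on either side has a partner on the other.\<close>

lemma corr_quadratic_estimate:
  assumes T: "corr T T'"
  shows "quadratic_estimate H T \<longleftrightarrow> quadratic_estimate K T'"
proof -
  define I where "I u = (\<integral>\<^sup>+t\<in>{0<..}. ennreal ((value_norm H (Q_op H T t) u)\<^sup>2 / t) \<partial>lborel)" for u
  define I' where "I' u = (\<integral>\<^sup>+t\<in>{0<..}. ennreal ((value_norm K (Q_op K T' t) u)\<^sup>2 / t) \<partial>lborel)" for u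
  \<comment> \<open>The indicator removes the values \<open>t \<le> 0\<close>, so
    \<open>t \<noteq> 0\<close> is available for \<open>corr_Q\<close>.\<close>
  have II: "I u = I' u'" if "(u, u') \<in> U" for u u'
    unfolding I_def I'_def
    by (intro nn_integral_cong) (auto simp: indicator_def corr_value_norm[OF corr_Q[OF T] that])
  have cl: "u \<in> hclosure H (Range T) \<longleftrightarrow> u' \<in> hclosure K (Range T')" if "(u, u') \<in> U" for u u'
  proof (rule corr_hclosure[OF _ _ _ that])
    show "Range T \<subseteq> elems H" "Range T' \<subseteq> elems K" using corr_elems[OF T] by auto
    show "x \<in> Range T \<longleftrightarrow> x' \<in> Range T'" if x: "(x, x') \<in> U" for x x'
    proof
      assume "x \<in> Range T"
      then obtain y where y: "(y, x) \<in> T" by blast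
      then have "(y, \<phi> y) \<in> U" using corr_elems[OF T] U_map by blast
      then show "x' \<in> Range T'" using y corrD[OF T _ x] by blast
    next
      assume "x' \<in> Range T'"
      then obtain y where y: "(y, x') \<in> T'" by blast
      then have "(\<psi> y, y) \<in> U" using corr_elems[OF T] U_inv by blast
      then show "x \<in> Range T" using y corrD[OF T _ x] by blast
    qed
  qed
  \<comment> \<open>An arbitrary predicate of norm and integral carries both inequalities over with
    the same constants.\<close>
  have "(\<forall>u\<in>hclosure H (Range T). P (hnorm H u) (I u)) \<longleftrightarrow> (\<forall>u\<in>hclosure K (Range T'). P (hnorm K u) (I' u))" for P
  proof
    assume *: "\<forall>u\<in>hclosure H (Range T). P (hnorm H u) (I u)"
    show "\<forall>u\<in>hclosure K (Range T'). P (hnorm K u) (I' u)"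
    proof
      fix u assume u: "u \<in> hclosure K (Range T')"
      then have "(\<psi> u, u) \<in> U" using K.hclosure_elems U_inv by blast
      then show "P (hnorm K u) (I' u)" using * u cl II U_hnorm by metis
    qed
  next
    assume *: "\<forall>u\<in>hclosure K (Range T'). P (hnorm K u) (I' u)"
    show "\<forall>u\<in>hclosure H (Range T). P (hnorm H u) (I u)"
    proof
      fix u assume u: "u \<in> hclosure H (Range T)"
      then have "(u, \<phi> u) \<in> U" using H.hclosure_elems U_map by blast
      then show "P (hnorm H u) (I u)" using * u cl II U_hnorm by metis
    qed
  qed
  from this[of "\<lambda>n i. ennreal (C1 * n\<^sup>2) \<le> i \<and> i \<le> ennreal (C2 * n\<^sup>2)" for C1 C2]
  show ?thesis unfolding quadratic_estimate_def I_def I'_def by simp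
qed

end

lemma unitary_map_hsum:
  assumes "unitary_map H K \<phi> \<psi>" "unitary_map H' K' \<phi>' \<psi>'"
  shows "unitary_map (hsum H H') (hsum K K') (map_prod \<phi> \<phi>') (map_prod \<psi> \<psi>')"
proof -
  interpret U: unitary_map H K \<phi> \<psi> by fact
  interpret U': unitary_map H' K' \<phi>' \<psi>' by fact
  have sH: "semi_hspace H" "semi_hspace H'" "semi_hspace K" "semi_hspace K'" by unfold_locales
  interpret HH: semi_hspace "hsum H H'" using sH by (simp add: semi_hspace_hsum)
  interpret KK: semi_hspace "hsum K K'" using sH by (simp add: semi_hspace_hsum)
  show ?thesis
    by unfold_locales
      (auto simp: aeq_hsum sH U.map_elems U'.map_elems U.inv_elems U'.inv_elems U.map_inv U'.map_inv
        U.map_inn U'.map_inn U.map_diff U'.map_diff U.map_scal U'.map_scal)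
qed

section \<open>Smooth functions, bump functions and mollifiers\<close>

subsection \<open>Calculus of smooth functions\<close>

lemma frechet_derivative_eqI: "(f has_derivative D) (at x) \<Longrightarrow> frechet_derivative f (at x) = D"
  using frechet_derivative_at by metis

lemma frechet_derivative_cong_open:
  assumes "open S" "x \<in> S" "\<And>y. y \<in> S \<Longrightarrow> f y = g y" "f differentiable (at x)"
  shows "g differentiable (at x)" "frechet_derivative g (at x) = frechet_derivative f (at x)"
proof -
  have "(f has_derivative frechet_derivative f (at x)) (at x)" using assms(4) by (simp add: frechet_derivative_works)
  then have "(g has_derivative frechet_derivative f (at x)) (at x)"
    using assms by (metis has_derivative_transform_within_open)
  then show "g differentiable (at x)" "frechet_derivative g (at x) = frechet_derivative f (at x)"
    using frechet_derivative_eqI by (auto simp: differentiable_def)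
qed

lemma Ck_on_cong:
  assumes "open S" "\<And>x. x \<in> S \<Longrightarrow> f x = g x" "Ck_on k S f"
  shows "Ck_on k S g"
  using assms
proof (induction k arbitrary: f g)
  case 0 then show ?case using continuous_on_cong[of S S f g] by simp
next
  case (Suc k)
  note fd = frechet_derivative_cong_open[OF Suc.prems(1) _ Suc.prems(2)]
  show ?case unfolding Ck_on.simps
  proof (intro conjI ballI allI)
    show "g differentiable at x" if "x \<in> S" for x using fd(1)[OF that] Suc.prems(3) that by auto
    show "Ck_on k S (\<lambda>x. frechet_derivative g (at x) v)" for v
      by (rule Suc.IH[OF Suc.prems(1)]) (use fd(2) Suc.prems(3) in auto)
  qed
qed

text \<open>Lets the derivative be supplied by any rule of calculus: on the open set it agrees with
  \<open>frechet_derivative\<close>, and regularity passes along that equality.\<close>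

lemma Ck_on_Suc:
  assumes "open S" "\<And>x. x \<in> S \<Longrightarrow> (f has_derivative D x) (at x)" "\<And>v. Ck_on k S (\<lambda>x. D x v)"
  shows "Ck_on (Suc k) S f"
proof -
  have "frechet_derivative f (at x) = D x" if "x \<in> S" for x
    using frechet_derivative_eqI[OF assms(2)[OF that]] .
  then have "Ck_on k S (\<lambda>x. frechet_derivative f (at x) v)" for v
    by (intro Ck_on_cong[OF assms(1) _ assms(3)[of v]]) auto
  then show ?thesis using assms(2) by (auto simp: differentiable_def)
qed

lemma Ck_on_Suc_has_derivative:
  assumes "Ck_on (Suc k) S f" "x \<in> S"
  shows "(f has_derivative frechet_derivative f (at x)) (at x)"
  using assms by (simp add: frechet_derivative_works)

lemma Ck_on_continuous: "Ck_on k S f \<Longrightarrow> continuous_on S f"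
  by (cases k) (auto simp: continuous_at_imp_continuous_on differentiable_imp_continuous_within)

lemma Ck_on_lower: "Ck_on (Suc k) S f \<Longrightarrow> Ck_on k S f"
proof (induction k arbitrary: f)
  case 0 then show ?case using Ck_on_continuous[of "Suc 0"] by simp
qed auto

lemma Ck_on_Union:
  assumes "\<And>T. T \<in> \<T> \<Longrightarrow> open T" "\<And>T. T \<in> \<T> \<Longrightarrow> Ck_on k T f"
  shows "Ck_on k (\<Union>\<T>) f"
  using assms(2)
proof (induction k arbitrary: f)
  case 0 then show ?case using assms(1) by (simp add: continuous_on_open_Union)
qed auto

lemma Ck_on_const: "open S \<Longrightarrow> Ck_on k S (\<lambda>_. c)"
  by (induction k arbitrary: c) (auto intro: Ck_on_Suc[where D = "\<lambda>_ _. 0"] simp del: Ck_on.simps(2))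

lemma Ck_on_add:
  assumes "open S" "Ck_on k S f" "Ck_on k S g"
  shows "Ck_on k S (\<lambda>x. f x + g x)"
  using assms(2,3)
proof (induction k arbitrary: f g)
  case 0 then show ?case by (auto intro: continuous_intros)
next
  case (Suc k)
  show ?case
    by (rule Ck_on_Suc[OF assms(1) has_derivative_add[OF Ck_on_Suc_has_derivative[OF Suc.prems(1)] Ck_on_Suc_has_derivative[OF Suc.prems(2)]]])
      (use Suc in auto)
qed

lemma Ck_on_linear_compose:
  assumes "open S" "bounded_linear h" "Ck_on k S f"
  shows "Ck_on k S (\<lambda>x. h (f x))"
  using assms(3)
proof (induction k arbitrary: f)
  case 0 then show ?case using bounded_linear.continuous_on[OF assms(2)] by auto
next
  case (Suc k)
  show ?case
    by (rule Ck_on_Suc[OF assms(1) bounded_linear.has_derivative[OF assms(2) Ck_on_Suc_has_derivative[OF Suc.prems]]])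
      (use Suc in auto)
qed

lemma (in bounded_bilinear) Ck_on_prod:
  assumes "open S" "Ck_on k S f" "Ck_on k S g"
  shows "Ck_on k S (\<lambda>x. prod (f x) (g x))"
  using assms(2,3)
proof (induction k arbitrary: f g)
  case 0 then show ?case by (auto intro: continuous_on)
next
  case (Suc k)
  show ?case
  proof (rule Ck_on_Suc[OF assms(1) FDERIV[OF Ck_on_Suc_has_derivative[OF Suc.prems(1)] Ck_on_Suc_has_derivative[OF Suc.prems(2)]]])
    show "Ck_on k S (\<lambda>x. prod (f x) (frechet_derivative g (at x) v) + prod (frechet_derivative f (at x) v) (g x))" for v
      using Suc.prems by (intro Ck_on_add[OF assms(1)] Suc.IH) (auto dest: Ck_on_lower simp del: Ck_on.simps(2), auto)
  qed auto
qed

lemma Ck_on_sum: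
  assumes "open S" "\<And>i. i \<in> I \<Longrightarrow> Ck_on k S (f i)"
  shows "Ck_on k S (\<lambda>x. \<Sum>i\<in>I. f i x)"
proof (cases "finite I")
  case True
  then show ?thesis using assms(2)
    by (induction I) (auto intro: Ck_on_const Ck_on_add assms(1))
qed (auto intro: Ck_on_const assms(1))

text \<open>The derivative of the outer function is applied to a direction that also varies with the
  point. Expanding this direction in a basis turns the chain rule into a finite sum of products,
  each containing a composition with a partial derivative of \<open>g\<close>; hence the induction
  generalises over \<open>g\<close>.\<close>

lemma Ck_on_compose:
  fixes f :: "'a::real_normed_vector \<Rightarrow> 'b::euclidean_space" and g :: "'b \<Rightarrow> 'c::real_normed_vector"
  assumes S: "open S" and T: "open T" "f ` S \<subseteq> T" and f: "Ck_on k S f" and g: "Ck_on k T g"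
  shows "Ck_on k S (\<lambda>x. g (f x))"
  using f g
proof (induction k arbitrary: g)
  case 0 then show ?case using T continuous_on_compose2 by (metis Ck_on.simps(1))
next
  case (Suc k)
  let ?D = "\<lambda>x v. frechet_derivative g (at (f x)) (frechet_derivative f (at x) v)"
  have eq: "?D x v = (\<Sum>b\<in>Basis. (frechet_derivative f (at x) v \<bullet> b) *\<^sub>R frechet_derivative g (at (f x)) b)" if "x \<in> S" for x v
  proof -
    have "linear (frechet_derivative g (at (f x)))"
      using Ck_on_Suc_has_derivative[OF Suc.prems(2), of "f x"] T that by (auto intro: has_derivative_linear)
    then show ?thesis
      by (subst euclidean_representation[of "frechet_derivative f (at x) v", symmetric]) (simp add: linear_sum linear_scale)
  qed
  show ?case
  proof (rule Ck_on_Suc[OF S])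
    show "((\<lambda>x. g (f x)) has_derivative ?D x) (at x)" if "x \<in> S" for x
      using has_derivative_compose[OF Ck_on_Suc_has_derivative[OF Suc.prems(1) that] Ck_on_Suc_has_derivative[OF Suc.prems(2)]] T that
      by auto
    have "Ck_on k S (\<lambda>x. \<Sum>b\<in>Basis. (frechet_derivative f (at x) v \<bullet> b) *\<^sub>R frechet_derivative g (at (f x)) b)" for v
    proof (rule Ck_on_sum[OF S])
      fix b :: 'b
      have "Ck_on k S (\<lambda>x. frechet_derivative f (at x) v \<bullet> b)"
        using Suc.prems(1) by (intro Ck_on_linear_compose[OF S bounded_linear_inner_left]) auto
      moreover have "Ck_on k S (\<lambda>x. frechet_derivative g (at (f x)) b)"
        using Suc.prems Ck_on_lower by (intro Suc.IH) auto
      ultimately show "Ck_on k S (\<lambda>x. (frechet_derivative f (at x) v \<bullet> b) *\<^sub>R frechet_derivative g (at (f x)) b)"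
        by (rule bounded_bilinear.Ck_on_prod[OF bounded_bilinear_scaleR S])
    qed
    then show "Ck_on k S (\<lambda>x. ?D x v)" for v
      by (rule Ck_on_cong[OF S, rotated]) (simp add: eq)
  qed
qed

lemma Ck_on_bounded_linear: "open S \<Longrightarrow> bounded_linear h \<Longrightarrow> Ck_on k S h"
proof (cases k)
  case 0
  assume "open S" "bounded_linear h" then show ?thesis using 0 by (simp add: linear_continuous_on)
next
  case (Suc n)
  assume a: "open S" "bounded_linear h"
  show ?thesis unfolding Suc
    by (rule Ck_on_Suc[OF a(1) bounded_linear_imp_has_derivative[OF a(2)] Ck_on_const[OF a(1)]])
qed

lemma Ck_on_id: "open S \<Longrightarrow> Ck_on k S (\<lambda>x. x)"
  using Ck_on_bounded_linear bounded_linear_ident by blast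

lemma smooth_on_compose:
  fixes f :: "'a::real_normed_vector \<Rightarrow> 'b::euclidean_space" and g :: "'b \<Rightarrow> 'c::real_normed_vector"
  assumes "open S" "open T" "f ` S \<subseteq> T" "smooth_on S f" "smooth_on T g"
  shows "smooth_on S (\<lambda>x. g (f x))"
  using assms Ck_on_compose unfolding smooth_on_def by blast

lemma smooth_on_has_derivative:
  "smooth_on S f \<Longrightarrow> x \<in> S \<Longrightarrow> (f has_derivative frechet_derivative f (at x)) (at x)"
  unfolding smooth_on_def using Ck_on_Suc_has_derivative by blast

lemma smooth_on_frechet: "smooth_on S f \<Longrightarrow> smooth_on S (\<lambda>x. frechet_derivative f (at x) v)"
  unfolding smooth_on_def using Ck_on.simps(2) by blast

lemma smooth_on_continuous: "smooth_on S f \<Longrightarrow> continuous_on S f"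
  unfolding smooth_on_def using Ck_on_continuous by blast

lemma smooth_on_cong: "open S \<Longrightarrow> (\<And>x. x \<in> S \<Longrightarrow> f x = g x) \<Longrightarrow> smooth_on S f \<Longrightarrow> smooth_on S g"
  unfolding smooth_on_def using Ck_on_cong by blast

lemma smooth_on_Un: "open S \<Longrightarrow> open T \<Longrightarrow> smooth_on S f \<Longrightarrow> smooth_on T f \<Longrightarrow> smooth_on (S \<union> T) f"
  unfolding smooth_on_def using Ck_on_Union[of "{S, T}"] by fastforce

lemma smooth_on_add: "open S \<Longrightarrow> smooth_on S f \<Longrightarrow> smooth_on S g \<Longrightarrow> smooth_on S (\<lambda>x. f x + g x)"
  unfolding smooth_on_def using Ck_on_add by blast

lemma smooth_on_const: "open S \<Longrightarrow> smooth_on S (\<lambda>_. c)"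
  unfolding smooth_on_def using Ck_on_const by blast

subsection \<open>A smooth bump function\<close>

text \<open>The functions p(1/t) exp(-1/t), continued by zero, form a family closed under
  differentiation. The classical flat function is the case of the constant polynomial 1.\<close>

definition flat_poly :: "real poly \<Rightarrow> real \<Rightarrow> real" where
  "flat_poly p t = (if t \<le> 0 then 0 else poly p (1 / t) * exp (- (1 / t)))"

lemma tendsto_poly_times_exp: "((\<lambda>s::real. poly p s * exp (- s)) \<longlongrightarrow> 0) at_top"
proof -
  have "((\<lambda>s::real. \<Sum>i\<le>degree p. coeff p i * (s ^ i / exp s)) \<longlongrightarrow> (\<Sum>i\<le>degree p. coeff p i * 0)) at_top"
    by (intro tendsto_intros tendsto_power_div_exp_0)
  moreover have "(\<lambda>s. poly p s * exp (- s)) = (\<lambda>s. \<Sum>i\<le>degree p. coeff p i * (s ^ i / exp s))"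
    by (auto simp: poly_altdef sum_distrib_right sum_divide_distrib exp_minus field_simps)
  ultimately show ?thesis by simp
qed

lemma flat_poly_tendsto_0: "(flat_poly p \<longlongrightarrow> 0) (at_right 0)"
proof -
  have "((\<lambda>t. poly p (inverse t) * exp (- inverse t)) \<longlongrightarrow> 0) (at_right 0)"
    using filterlim_compose[OF tendsto_poly_times_exp filterlim_inverse_at_top_right] by simp
  moreover have "\<forall>\<^sub>F t in at_right 0. poly p (inverse t) * exp (- inverse t) = flat_poly p t"
    unfolding flat_poly_def by (auto simp: eventually_at_right_less inverse_eq_divide eventually_at intro!: exI[of _ 1])
  ultimately show ?thesis by (rule Lim_transform_eventually)
qed

lemma flat_poly_derivative:
  "(flat_poly p has_field_derivative flat_poly (monom 1 2 * (p - pderiv p)) t) (at t)"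
proof -
  consider "t < 0" | "t > 0" | "t = 0" by linarith
  then show ?thesis
  proof cases
    case 1
    have "((\<lambda>_. 0) has_field_derivative 0) (at t)" by simp
    then have "(flat_poly p has_field_derivative 0) (at t)"
      by (rule has_field_derivative_transform_within_open[of _ _ _ "{..<0}"]) (use 1 in \<open>auto simp: flat_poly_def\<close>)
    then show ?thesis using 1 by (simp add: flat_poly_def)
  next
    case 2
    have "((\<lambda>t. poly p (1 / t) * exp (- (1 / t))) has_field_derivative
       (poly (pderiv p) (1/t) * (- (1 / t^2)) * exp (- (1/t)) + poly p (1/t) * (exp (-(1/t)) * (1/t^2)))) (at t)"
      using 2 by (auto intro!: derivative_eq_intros DERIV_chain2[OF poly_DERIV] simp: power2_eq_square)
    moreover have "poly (pderiv p) (1/t) * (- (1 / t^2)) * exp (- (1/t)) + poly p (1/t) * (exp (-(1/t)) * (1/t^2)) =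
       flat_poly (monom 1 2 * (p - pderiv p)) t"
      using 2 by (simp add: flat_poly_def poly_monom field_simps)
    ultimately have "((\<lambda>t. poly p (1 / t) * exp (- (1 / t))) has_field_derivative flat_poly (monom 1 2 * (p - pderiv p)) t) (at t)"
      by simp
    then show ?thesis
      by (rule has_field_derivative_transform_within_open[of _ _ _ "{0<..}"]) (use 2 in \<open>auto simp: flat_poly_def\<close>)
  next
    case 3
    have "((\<lambda>y. (flat_poly p y - flat_poly p 0) / (y - 0)) \<longlongrightarrow> 0) (at 0)"
    proof (rule filterlim_split_at_real)
      have "\<forall>\<^sub>F y in at_left 0. 0 = (flat_poly p y - flat_poly p 0) / (y - 0)"
        by (auto simp: flat_poly_def eventually_at intro!: exI[of _ 1])
      then show "((\<lambda>y. (flat_poly p y - flat_poly p 0) / (y - 0)) \<longlongrightarrow> 0) (at_left 0)"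
        by (rule Lim_transform_eventually[OF tendsto_const])
      \<comment> \<open>The difference quotient at 0 is again a member of the family, for the
        polynomial multiplied by the variable, and every member tends to 0.\<close>
      have "\<forall>\<^sub>F y in at_right 0. flat_poly (monom 1 1 * p) y = (flat_poly p y - flat_poly p 0) / (y - 0)"
        by (auto simp: flat_poly_def eventually_at poly_monom intro!: exI[of _ 1])
      then show "((\<lambda>y. (flat_poly p y - flat_poly p 0) / (y - 0)) \<longlongrightarrow> 0) (at_right 0)"
        by (rule Lim_transform_eventually[OF flat_poly_tendsto_0])
    qed
    then show ?thesis using 3 by (simp add: has_field_derivative_iff flat_poly_def)
  qed
qed

lemma smooth_flat_poly: "smooth_on UNIV (flat_poly p)"
  unfolding smooth_on_def
proof
  fix k show "Ck_on k UNIV (flat_poly p)"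
  proof (induction k arbitrary: p)
    case 0
    show ?case by (auto intro!: continuous_at_imp_continuous_on DERIV_isCont[OF flat_poly_derivative])
  next
    case (Suc k)
    show ?case
      by (rule Ck_on_Suc[OF open_UNIV flat_poly_derivative[unfolded has_field_derivative_def]])
        (intro bounded_bilinear.Ck_on_prod[OF bounded_bilinear_mult] Ck_on_const Suc open_UNIV)
  qed
qed

text \<open>The function exp(-1/(1 - |x|^2)) on the open unit ball, zero elsewhere.\<close>

definition bump :: "'a::euclidean_space \<Rightarrow> real" where
  "bump x = flat_poly 1 (1 - x \<bullet> x)"

lemma smooth_bump: "smooth_on UNIV (bump :: 'a::euclidean_space \<Rightarrow> real)"
proof -
  have "smooth_on UNIV (\<lambda>x::'a. 1 + (- 1) *\<^sub>R (x \<bullet> x))"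
    unfolding smooth_on_def
    by (intro allI Ck_on_add Ck_on_const Ck_on_linear_compose[OF _ bounded_linear_scaleR_right]
        bounded_bilinear.Ck_on_prod[OF bounded_bilinear_inner] Ck_on_id open_UNIV)
  then have "smooth_on UNIV (\<lambda>x::'a. flat_poly 1 (1 + (- 1) *\<^sub>R (x \<bullet> x)))"
    by (rule smooth_on_compose[OF open_UNIV open_UNIV subset_UNIV _ smooth_flat_poly])
  then show ?thesis unfolding bump_def[abs_def] by simp
qed

lemma bump_nonneg: "bump x \<ge> 0" and bump_pos: "norm x < 1 \<Longrightarrow> bump x > 0" and bump_zero: "norm x \<ge> 1 \<Longrightarrow> bump x = 0"
proof -
  show "bump x \<ge> 0" by (auto simp: bump_def flat_poly_def)
  have "norm x < 1 \<longleftrightarrow> x \<bullet> x < 1" by (metis norm_lt_square inner_commute norm_eq_sqrt_inner real_sqrt_less_iff real_sqrt_one)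
  then show "norm x < 1 \<Longrightarrow> bump x > 0" "norm x \<ge> 1 \<Longrightarrow> bump x = 0"
    by (auto simp: bump_def flat_poly_def)
qed

subsection \<open>Mollification\<close>

definition mollify :: "('a::euclidean_space \<Rightarrow> real) \<Rightarrow> ('a \<Rightarrow> 'b::euclidean_space) \<Rightarrow> 'a \<Rightarrow> 'b" where
  "mollify K f x = (\<integral>y. K (x - y) *\<^sub>R f y \<partial>lborel)"

lemma integrable_compact_support:
  fixes g :: "'a::euclidean_space \<Rightarrow> 'b::{banach, second_countable_topology}"
  assumes "continuous_on UNIV g" "bounded S" "\<And>y. y \<notin> S \<Longrightarrow> g y = 0"
  shows "integrable lborel g"
proof -
  obtain a b where ab: "S \<subseteq> cbox a b" using assms(2) bounded_subset_cbox_symmetric by blast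
  have "indicator (cbox a b) x *\<^sub>R g x = g x" for x
    using ab assms(3)[of x] by (cases "x \<in> cbox a b") auto
  then have "(\<lambda>x. indicator (cbox a b) x *\<^sub>R g x) = g" by auto
  then show ?thesis
    using borel_integrable_compact[of "cbox a b" g] continuous_on_subset[OF assms(1)] by auto
qed

lemma lborel_integral_eq_cbox:
  fixes g :: "'a::euclidean_space \<Rightarrow> 'b::euclidean_space"
  assumes "integrable lborel g" "\<And>y. y \<notin> cbox a b \<Longrightarrow> g y = 0"
  shows "(\<integral>y. g y \<partial>lborel) = integral (cbox a b) g"
proof -
  have "(\<lambda>x. if x \<in> cbox a b then g x else 0) = g" using assms(2) by auto
  then show ?thesis
    using integral_lborel[OF assms(1)] integral_restrict_UNIV[of "cbox a b" g] by simp
qed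

lemma lborel_integral_reflect:
  fixes g :: "'a::euclidean_space \<Rightarrow> 'b::{banach, second_countable_topology}"
  assumes "integrable lborel g"
  shows "integrable lborel (\<lambda>y. g (x - y))" "(\<integral>y. g (x - y) \<partial>lborel) = (\<integral>y. g y \<partial>lborel)"
proof -
  have "lborel = distr lborel borel (\<lambda>y. x - y :: 'a)"
    using lborel_affine[of "-1" x] by (simp add: density_1)
  then have "integrable (distr lborel borel (\<lambda>y. x - y)) g"
    "(\<integral>y. g y \<partial>lborel) = (\<integral>y. g y \<partial>distr lborel borel (\<lambda>y. x - y))" using assms by simp_all
  then show "integrable lborel (\<lambda>y. g (x - y))" "(\<integral>y. g (x - y) \<partial>lborel) = (\<integral>y. g y \<partial>lborel)"
    using assms by (auto simp: integrable_distr_eq integral_distr)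
qed

lemma lborel_integral_scale:
  fixes g :: "'a::euclidean_space \<Rightarrow> real"
  assumes "g \<in> borel_measurable borel" "e > 0"
  shows "(\<integral>y. g (y /\<^sub>R e) \<partial>lborel) = e ^ DIM('a) * (\<integral>y. g y \<partial>lborel)"
proof -
  have "lborel = density (distr lborel borel (\<lambda>y::'a. e *\<^sub>R y)) (\<lambda>_. ennreal (e ^ DIM('a)))"
    using lborel_affine[of e "0::'a"] assms(2) by simp
  then have "(\<integral>y. g (y /\<^sub>R e) \<partial>lborel) = (\<integral>y. g (y /\<^sub>R e) \<partial>density (distr lborel borel (\<lambda>y::'a. e *\<^sub>R y)) (\<lambda>_. ennreal (e ^ DIM('a))))"
    by simp
  also have "\<dots> = (\<integral>y. e ^ DIM('a) * g y \<partial>lborel)"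
    using assms by (subst integral_density) (auto simp: integral_distr)
  finally show ?thesis by simp
qed

text \<open>Neither sign nor total mass is prescribed, so that directional derivatives of a kernel
  are kernels of the same kind; smoothness of the mollification then follows by induction over all
  kernels.\<close>

locale mollifier =
  fixes K :: "'a::euclidean_space \<Rightarrow> real" and e :: real
  assumes smooth: "smooth_on UNIV K" and support: "norm z > e \<Longrightarrow> K z = 0" and e: "e > 0"
begin

lemma cont: "continuous_on S K"
  using smooth_on_continuous[OF smooth] continuous_on_subset by blast

lemma deriv_zero: "norm z > e \<Longrightarrow> frechet_derivative K (at z) v = 0"
proof -
  assume z: "norm z > e"
  have "((\<lambda>_. 0) has_derivative (\<lambda>_. 0)) (at z)" by simp
  then have "(K has_derivative (\<lambda>_. 0)) (at z)"
    by (rule has_derivative_transform_within_open[where s = "{z. e < norm z}"])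
      (use z support in \<open>auto intro!: open_Collect_less continuous_intros\<close>)
  then show ?thesis by (simp add: frechet_derivative_eqI)
qed

lemma deriv_mollifier: "mollifier (\<lambda>z. frechet_derivative K (at z) v) e"
  by unfold_locales (auto simp: deriv_zero e intro: smooth_on_frechet smooth)

lemma integrable: "integrable lborel K"
  by (rule integrable_compact_support[of _ "cball 0 e"]) (auto simp: cont support)

lemma integrand:
  fixes f :: "'a \<Rightarrow> 'b::euclidean_space"
  assumes "continuous_on UNIV f"
  shows "integrable lborel (\<lambda>y. K (x - y) *\<^sub>R f y)"
  by (rule integrable_compact_support[of _ "cball x e"])
    (auto simp: support dist_norm intro!: continuous_intros assms continuous_on_compose2[OF cont[of UNIV]])

lemma mollify_diff:
  fixes f g :: "'a \<Rightarrow> 'b::euclidean_space"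
  assumes "continuous_on UNIV f" "continuous_on UNIV g"
  shows "mollify K (\<lambda>y. f y - g y) x = mollify K f x - mollify K g x"
  unfolding mollify_def scaleR_diff_right by (intro Bochner_Integration.integral_diff integrand assms)

lemma norm_mollify:
  fixes f :: "'a \<Rightarrow> 'b::euclidean_space"
  assumes f: "continuous_on UNIV f" and M: "\<And>y. dist y x \<le> e \<Longrightarrow> norm (f y) \<le> M"
  shows "norm (mollify K f x) \<le> M * (\<integral>z. \<bar>K z\<bar> \<partial>lborel)"
proof -
  have "norm (mollify K f x) \<le> (\<integral>y. norm (K (x - y) *\<^sub>R f y) \<partial>lborel)"
    unfolding mollify_def by (rule integral_norm_bound)
  also have "\<dots> \<le> (\<integral>y. M * \<bar>K (x - y)\<bar> \<partial>lborel)"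
  proof (rule integral_mono)
    show "integrable lborel (\<lambda>y. norm (K (x - y) *\<^sub>R f y))" by (intro integrable_norm integrand f)
    show "integrable lborel (\<lambda>y. M * \<bar>K (x - y)\<bar>)"
      by (intro integrable_mult_right integrable_abs lborel_integral_reflect integrable)
    show "norm (K (x - y) *\<^sub>R f y) \<le> M * \<bar>K (x - y)\<bar>" for y
    proof (cases "dist y x \<le> e")
      case True then show ?thesis using mult_left_mono[OF M[OF True], of "\<bar>K (x - y)\<bar>"] by (simp add: mult.commute)
    next
      case False then show ?thesis using support[of "x - y"] by (simp add: dist_norm norm_minus_commute)
    qed
  qed
  also have "\<dots> = M * (\<integral>z. \<bar>K z\<bar> \<partial>lborel)"
    using lborel_integral_reflect(2)[OF integrable_abs[OF integrable], of x] by simp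
  finally show ?thesis .
qed

text \<open>Differentiation under the integral sign over a fixed box. The derivative of the
  integrand is packaged as a bounded linear map, whose joint continuity is checked one direction at
  a time.\<close>

lemma mollify_has_derivative:
  fixes f :: "'a \<Rightarrow> 'b::euclidean_space"
  assumes f: "continuous_on UNIV f"
  shows "(mollify K f has_derivative (\<lambda>v. mollify (\<lambda>z. frechet_derivative K (at z) v) f x)) (at x)"
proof -
  \<comment> \<open>The box contains \<open>cball x (1 + e)\<close>, so for every centre within
    distance 1 of \<open>x\<close> the kernel vanishes outside it and the domain of integration does
    not move.\<close>
  obtain b where b: "cball x (1 + e) \<subseteq> cbox (- b) b" using bounded_subset_cbox_symmetric[OF bounded_cball] by blast
  let ?D = "\<lambda>z. frechet_derivative K (at z)"
  define F where "F x y = Blinfun (\<lambda>v. ?D (x - y) v *\<^sub>R f y)" for x y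
  have KD: "(K has_derivative ?D z) (at z)" for z using smooth_on_has_derivative[OF smooth] by blast
  have bl: "bounded_linear (\<lambda>v. ?D (x - y) v *\<^sub>R f y)" for x y
    by (intro bounded_linear_scaleR_const has_derivative_bounded_linear[OF KD])
  have F: "blinfun_apply (F x y) v = ?D (x - y) v *\<^sub>R f y" for x y v
    unfolding F_def using bl by (simp add: bounded_linear_Blinfun_apply)
  have out: "norm (z - y) > e" if "z \<in> ball x 1" "y \<notin> cbox (- b) b" for z y
  proof (rule ccontr)
    assume "\<not> norm (z - y) > e"
    then have "dist x y \<le> 1 + e" using that(1) dist_triangle[of x y z] by (simp add: dist_norm norm_minus_commute)
    then show False using that(2) b by auto
  qed
  have contD: "continuous_on UNIV (\<lambda>z. ?D z v)" for v
    by (intro smooth_on_continuous smooth_on_frechet smooth)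
  have "((\<lambda>x. integral (cbox (- b) b) (\<lambda>y. K (x - y) *\<^sub>R f y)) has_derivative blinfun_apply (integral (cbox (- b) b) (F x))) (at x within ball x 1)"
  proof (rule leibniz_rule)
    show "((\<lambda>x. K (x - t) *\<^sub>R f t) has_derivative blinfun_apply (F z t)) (at z within ball x 1)" for z t
    proof -
      have "((\<lambda>x. K (x - t)) has_derivative (\<lambda>v. ?D (z - t) v)) (at z)"
        by (rule has_derivative_compose[OF _ KD, of "\<lambda>x. x - t" "\<lambda>v. v", simplified]) (auto intro!: derivative_eq_intros)
      then have "((\<lambda>x. K (x - t) *\<^sub>R f t) has_derivative (\<lambda>v. ?D (z - t) v *\<^sub>R f t)) (at z)"
        by (rule has_derivative_scaleR_left)
      moreover have "blinfun_apply (F z t) = (\<lambda>v. ?D (z - t) v *\<^sub>R f t)" using F by auto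
      ultimately show ?thesis by (simp add: has_derivative_at_withinI)
    qed
    show "(\<lambda>t. K (z - t) *\<^sub>R f t) integrable_on cbox (- b) b" for z
      by (intro integrable_continuous continuous_intros continuous_on_compose2[OF cont[of UNIV]] continuous_on_subset[OF f]) auto
    show "continuous_on (ball x 1 \<times> cbox (- b) b) (\<lambda>(x, t). F x t)"
      unfolding case_prod_unfold
      by (intro continuous_on_blinfun_componentwise)
        (auto simp: F intro!: continuous_intros continuous_on_compose2[OF contD] continuous_on_compose2[OF f])
  qed auto
  then have D0: "((\<lambda>x. integral (cbox (- b) b) (\<lambda>y. K (x - y) *\<^sub>R f y)) has_derivative blinfun_apply (integral (cbox (- b) b) (F x))) (at x)"
    by (simp only: at_within_open[OF centre_in_ball[THEN iffD2] open_ball] zero_less_one)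
  have eqC: "integral (cbox (- b) b) (\<lambda>y. K (z - y) *\<^sub>R f y) = mollify K f z" if "z \<in> ball x 1" for z
    unfolding mollify_def
    by (rule lborel_integral_eq_cbox[symmetric, OF integrand[OF f]]) (simp add: support[OF out[OF that]])
  have D: "(mollify K f has_derivative blinfun_apply (integral (cbox (- b) b) (F x))) (at x)"
    using has_derivative_transform_within_open[OF D0 open_ball[of x 1] _ eqC] by simp
  have "blinfun_apply (integral (cbox (- b) b) (F x)) v = mollify (\<lambda>z. ?D z v) f x" for v
  proof -
    have "F x integrable_on cbox (- b) b"
      by (intro integrable_continuous continuous_on_blinfun_componentwise)
        (auto simp: F intro!: continuous_intros continuous_on_compose2[OF contD] continuous_on_compose2[OF f])
    from integral_linear[OF this blinfun.bounded_linear_left, of v]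
    have "blinfun_apply (integral (cbox (- b) b) (F x)) v = integral (cbox (- b) b) (\<lambda>y. ?D (x - y) v *\<^sub>R f y)"
      by (simp add: o_def F)
    also have "\<dots> = mollify (\<lambda>z. ?D z v) f x"
      unfolding mollify_def
    proof (rule lborel_integral_eq_cbox[symmetric])
      interpret D: mollifier "\<lambda>z. ?D z v" e by (rule deriv_mollifier)
      show "integrable lborel (\<lambda>y. ?D (x - y) v *\<^sub>R f y)" by (rule D.integrand[OF f])
      show "?D (x - y) v *\<^sub>R f y = 0" if "y \<notin> cbox (- b) b" for y
        using out[of x y] that D.support[of "x - y"] by simp
    qed
    finally show ?thesis .
  qed
  then have "blinfun_apply (integral (cbox (- b) b) (F x)) = (\<lambda>v. mollify (\<lambda>z. ?D z v) f x)" by auto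
  then show ?thesis using D by simp
qed

end

lemma smooth_mollify:
  fixes f :: "'a::euclidean_space \<Rightarrow> 'b::euclidean_space"
  assumes "mollifier K e" and f: "continuous_on UNIV f"
  shows "smooth_on UNIV (mollify K f)"
  unfolding smooth_on_def
proof
  fix k show "Ck_on k UNIV (mollify K f)" using assms(1)
  proof (induction k arbitrary: K)
    case 0
    then show ?case
      by (auto intro!: continuous_at_imp_continuous_on has_derivative_continuous[OF mollifier.mollify_has_derivative[OF 0 f]])
  next
    case (Suc k)
    show ?case
      by (rule Ck_on_Suc[OF open_UNIV mollifier.mollify_has_derivative[OF Suc.prems f]])
        (intro Suc.IH mollifier.deriv_mollifier Suc.prems)
  qed
qed

lemma integral_bump_pos: "(\<integral>z. bump (z :: 'a::euclidean_space) \<partial>lborel) > 0" "integrable lborel (bump :: 'a::euclidean_space \<Rightarrow> real)"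
proof -
  have cb: "continuous_on UNIV (bump :: 'a \<Rightarrow> real)" by (rule smooth_on_continuous[OF smooth_bump])
  show ib: "integrable lborel (bump :: 'a \<Rightarrow> real)"
    by (rule integrable_compact_support[OF cb, of "cball 0 1"]) (auto intro: bump_zero)
  have "(\<integral>z. bump (z::'a) \<partial>lborel) \<noteq> 0"
  proof
    assume "(\<integral>z. bump (z::'a) \<partial>lborel) = 0"
    then have "AE z in lborel. bump (z::'a) = 0"
      using integral_nonneg_eq_0_iff_AE[OF ib AE_I2[OF bump_nonneg]] by simp
    then have "AE z in lborel. (z::'a) \<notin> ball 0 1"
      by eventually_elim (use bump_pos in force)
    then have "emeasure lborel (ball (0::'a) 1) = 0"
      using AE_iff_null_sets[of "ball (0::'a) 1" lborel] by (auto simp: null_sets_def)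
    then have "measure lborel (ball (0::'a) 1) = 0" by (simp add: measure_def)
    then show False using content_ball_pos[of 1 "0::'a"] by simp
  qed
  moreover have "(\<integral>z. bump (z::'a) \<partial>lborel) \<ge> 0" by (rule Bochner_Integration.integral_nonneg) (rule bump_nonneg)
  ultimately show "(\<integral>z. bump (z::'a) \<partial>lborel) > (0::real)" by simp
qed

text \<open>The last clause records the scaling of the derivative: the normalisation cancels the
  volume factor, and the inner derivative contributes \<open>1 / e\<close>.\<close>

lemma scaled_bump:
  assumes e: "e > 0"
  obtains K :: "'a::euclidean_space \<Rightarrow> real" where "mollifier K e" "(\<integral>z. K z \<partial>lborel) = 1" "\<And>z. K z \<ge> 0"
    "\<And>v. (\<integral>z. \<bar>frechet_derivative K (at z) v\<bar> \<partial>lborel)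
        = (\<integral>z. \<bar>frechet_derivative bump (at (z::'a)) v\<bar> \<partial>lborel) / (e * (\<integral>z. bump (z::'a) \<partial>lborel))"
proof -
  let ?N = "DIM('a)" and ?I = "\<integral>z. bump (z::'a) \<partial>lborel"
  have I: "?I > 0" by (rule integral_bump_pos)
  define s where "s = inverse (e ^ ?N * ?I)"
  have s: "s > 0" unfolding s_def using e I by simp
  define K where "K z = s *\<^sub>R bump (z /\<^sub>R e)" for z :: 'a
  have bd: "((\<lambda>z::'a. z /\<^sub>R e) has_derivative (\<lambda>v. v /\<^sub>R e)) (at z)" for z
    by (auto intro!: derivative_eq_intros)
  have BD: "(bump has_derivative frechet_derivative bump (at z)) (at z)" for z :: 'a
    using smooth_on_has_derivative[OF smooth_bump] by blast
  have KD: "(K has_derivative (\<lambda>v. s *\<^sub>R frechet_derivative bump (at (z /\<^sub>R e)) (v /\<^sub>R e))) (at z)" for z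
    unfolding K_def by (intro has_derivative_scaleR_right has_derivative_compose[OF bd BD])
  have sm: "smooth_on UNIV K"
    unfolding K_def smooth_on_def
  proof
    fix k
    have "Ck_on k UNIV (\<lambda>z::'a. z /\<^sub>R e)" by (intro Ck_on_bounded_linear bounded_linear_scaleR_right open_UNIV)
    then have "Ck_on k UNIV (\<lambda>z::'a. bump (z /\<^sub>R e))"
      using smooth_bump unfolding smooth_on_def
      by (intro Ck_on_compose[OF open_UNIV open_UNIV subset_UNIV, where f = "\<lambda>z::'a. z /\<^sub>R e" and g = bump]) auto
    then show "Ck_on k UNIV (\<lambda>z::'a. s *\<^sub>R bump (z /\<^sub>R e))"
      by (intro Ck_on_linear_compose[OF open_UNIV bounded_linear_scaleR_right])
  qed
  show thesis
  proof (rule that[of K])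
    show "mollifier K e"
    proof
      show "K z = 0" if "norm z > e" for z
      proof -
        have "norm (z /\<^sub>R e) \<ge> 1" using that e by (simp add: field_simps)
        then show ?thesis by (simp add: K_def bump_zero)
      qed
    qed (use sm e in auto)
    have m: "(bump :: 'a \<Rightarrow> real) \<in> borel_measurable borel"
      by (intro borel_measurable_continuous_onI smooth_on_continuous smooth_bump)
    show "(\<integral>z. K z \<partial>lborel) = 1"
      using lborel_integral_scale[OF m e] e I by (simp add: K_def s_def field_simps)
    show "K z \<ge> 0" for z using s by (simp add: K_def bump_nonneg)
    fix v :: 'a
    have m': "(\<lambda>z::'a. \<bar>frechet_derivative bump (at z) v\<bar>) \<in> borel_measurable borel"
      by (intro borel_measurable_continuous_onI continuous_intros smooth_on_continuous smooth_on_frechet smooth_bump)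
    have "frechet_derivative K (at z) v = s / e * frechet_derivative bump (at (z /\<^sub>R e)) v" for z
      unfolding frechet_derivative_eqI[OF KD]
      using linear_scale[OF has_derivative_linear[OF BD]] by (simp add: field_simps)
    then have "\<bar>frechet_derivative K (at z) v\<bar> = s / e * \<bar>frechet_derivative bump (at (z /\<^sub>R e)) v\<bar>" for z
      using s e by (simp add: abs_mult)
    then have "(\<integral>z. \<bar>frechet_derivative K (at z) v\<bar> \<partial>lborel) =
        s / e * (e ^ ?N * (\<integral>z. \<bar>frechet_derivative bump (at (z::'a)) v\<bar> \<partial>lborel))"
      using lborel_integral_scale[OF m' e] by simp
    then show "(\<integral>z. \<bar>frechet_derivative K (at z) v\<bar> \<partial>lborel)
        = (\<integral>z. \<bar>frechet_derivative bump (at (z::'a)) v\<bar> \<partial>lborel) / (e * ?I)"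
      using e I by (simp add: s_def field_simps)
  qed
qed

text \<open>For an affine function the mollification has the same derivative, so the error of the
  derivative at \<open>x\<close> is the derivative of the mollified remainder, which is small because the
  remainder is \<open>o(e)\<close> on the ball of radius \<open>e\<close>, while the \<open>L\<^sup>1\<close> norm of the derivative of the
  kernel is of order \<open>1/e\<close>.\<close>

lemma mollification_derivative_estimate:
  fixes \<phi> :: "'a::euclidean_space \<Rightarrow> 'b::euclidean_space"
  assumes K: "mollifier K e" "(\<integral>z. K z \<partial>lborel) = 1" and \<phi>: "continuous_on UNIV \<phi>"
    and l: "bounded_linear l"
    and M: "\<And>y. dist y x \<le> e \<Longrightarrow> norm (\<phi> y - \<phi> x - l (y - x)) \<le> M"
  shows "norm (frechet_derivative (mollify K \<phi>) (at x) v - l v) \<le> M * (\<integral>z. \<bar>frechet_derivative K (at z) v\<bar> \<partial>lborel)"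
proof -
  interpret mollifier K e by fact
  let ?D = "\<lambda>z. frechet_derivative K (at z) v"
  interpret D: mollifier ?D e by (rule deriv_mollifier)
  define f where "f y = \<phi> x + l (y - x)" for y
  have cf: "continuous_on UNIV f" unfolding f_def
    by (intro continuous_intros bounded_linear.continuous_on[OF l])
  have "mollify K f z = f z - (\<integral>y. K y *\<^sub>R l y \<partial>lborel)" for z
  proof -
    have i1: "integrable lborel (\<lambda>y. K y *\<^sub>R f (z - y))"
      using lborel_integral_reflect(1)[OF integrand[OF cf, of z], of z] by simp
    have "mollify K f z = (\<integral>y. K y *\<^sub>R f (z - y) \<partial>lborel)"
      unfolding mollify_def using lborel_integral_reflect(2)[OF integrand[OF cf, of z], of z] by simp
    also have "\<dots> = (\<integral>y. K y *\<^sub>R f z - K y *\<^sub>R l y \<partial>lborel)"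
    proof (intro Bochner_Integration.integral_cong refl)
      fix y
      have "l (z - y - x) = l (z - x - y)" by (simp add: algebra_simps)
      also have "\<dots> = l (z - x) - l y" by (rule linear_diff[OF bounded_linear.linear[OF l]])
      finally show "K y *\<^sub>R f (z - y) = K y *\<^sub>R f z - K y *\<^sub>R l y"
        by (simp add: f_def scaleR_right_diff_distrib scaleR_add_right)
    qed
    also have "\<dots> = (\<integral>y. K y *\<^sub>R f z \<partial>lborel) - (\<integral>y. K y *\<^sub>R l y \<partial>lborel)"
    proof (rule Bochner_Integration.integral_diff)
      show "integrable lborel (\<lambda>y. K y *\<^sub>R f z)" by (intro integrable_scaleR_left integrable)
      show "integrable lborel (\<lambda>y. K y *\<^sub>R l y)"
        by (rule integrable_compact_support[of _ "cball 0 e"])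
          (auto simp: support intro!: continuous_intros cont bounded_linear.continuous_on[OF l])
    qed
    also have "(\<integral>y. K y *\<^sub>R f z \<partial>lborel) = f z" using integrable K(2) by simp
    finally show ?thesis .
  qed
  then have eq: "mollify K f = (\<lambda>z. \<phi> x + l (z - x) - (\<integral>y. K y *\<^sub>R l y \<partial>lborel))" by (auto simp: f_def)
  have "(mollify K f has_derivative l) (at x)"
    unfolding eq using bounded_linear_imp_has_derivative[OF l]
    by (auto intro!: derivative_eq_intros bounded_linear.has_derivative[OF l])
  then have "mollify ?D f x = l v"
    using has_derivative_unique[OF mollify_has_derivative[OF cf]] by metis
  moreover have "frechet_derivative (mollify K \<phi>) (at x) v = mollify ?D \<phi> x"
    using frechet_derivative_eqI[OF mollify_has_derivative[OF \<phi>]] by metis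
  ultimately have "frechet_derivative (mollify K \<phi>) (at x) v - l v = mollify ?D (\<lambda>y. \<phi> y - f y) x"
    by (simp add: D.mollify_diff[OF \<phi> cf])
  then show ?thesis
    using D.norm_mollify[of "\<lambda>y. \<phi> y - f y" x M] M by (simp add: f_def continuous_on_diff[OF \<phi> cf, unfolded f_def] diff_diff_eq)
qed

text \<open>The list serves dominated convergence: uniform convergence of the functions, control of
  supports, a bound on derivatives uniform in index and point, and convergence of the derivative
  wherever \<open>\<phi>\<close> has one.\<close>

lemma mollification:
  fixes \<phi> :: "'a::euclidean_space \<Rightarrow> 'b::euclidean_space"
  assumes L: "L-lipschitz_on UNIV \<phi>"
  obtains \<Phi> :: "nat \<Rightarrow> 'a \<Rightarrow> 'b" and B :: "'a \<Rightarrow> real" where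
    "\<And>k. smooth_on UNIV (\<Phi> k)"
    "\<And>k x. norm (\<Phi> k x - \<phi> x) \<le> L * inverse (real (Suc k))"
    "\<And>k x. (\<And>y. dist y x \<le> inverse (real (Suc k)) \<Longrightarrow> \<phi> y = 0) \<Longrightarrow> \<Phi> k x = 0"
    "\<And>k x v. norm (frechet_derivative (\<Phi> k) (at x) v) \<le> B v"
    "\<And>x v. \<phi> differentiable (at x) \<Longrightarrow>
       (\<lambda>k. frechet_derivative (\<Phi> k) (at x) v) \<longlonglongrightarrow> frechet_derivative \<phi> (at x) v"
proof -
  define e where "e k = inverse (real (Suc k))" for k
  have e_pos: "e k > 0" for k by (simp add: e_def)
  let ?C = "\<lambda>v. (\<integral>z. \<bar>frechet_derivative bump (at (z::'a)) v\<bar> \<partial>lborel) / (\<integral>z. bump (z::'a) \<partial>lborel)"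
  have "\<exists>K :: 'a \<Rightarrow> real. mollifier K (e k) \<and> (\<integral>z. K z \<partial>lborel) = 1 \<and> (\<forall>z. K z \<ge> 0) \<and>
      (\<forall>v. (\<integral>z. \<bar>frechet_derivative K (at z) v\<bar> \<partial>lborel) = ?C v / e k)" for k
    using scaled_bump[OF e_pos, of k] by (metis divide_divide_eq_left')
  then obtain K where K: "\<And>k. mollifier (K k) (e k)" "\<And>k. (\<integral>z. K k z \<partial>lborel) = 1" "\<And>k z. K k z \<ge> 0"
    "\<And>k v. (\<integral>z. \<bar>frechet_derivative (K k) (at z) v\<bar> \<partial>lborel) = ?C v / e k" by metis
  have c\<phi>: "continuous_on UNIV \<phi>" using L lipschitz_on_continuous_on by blast
  have L0: "L \<ge> 0" using L lipschitz_on_nonneg by blast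
  have C0: "?C v \<ge> 0" for v using integral_bump_pos(1) by (intro divide_nonneg_pos integral_nonneg) auto
  have lip: "norm (\<phi> y - \<phi> x) \<le> L * e k" if "dist y x \<le> e k" for x y k
    using lipschitz_onD[OF L, of y x] mult_left_mono[OF that L0] by (simp add: dist_norm)
  show thesis
  proof (rule that[of "\<lambda>k. mollify (K k) \<phi>" "\<lambda>v. L * ?C v"])
    fix k x
    interpret mollifier "K k" "e k" by (rule K)
    show "smooth_on UNIV (mollify (K k) \<phi>)" by (rule smooth_mollify[OF K(1) c\<phi>])
    have "mollify (K k) (\<lambda>_. \<phi> x) x = \<phi> x"
      unfolding mollify_def
      using lborel_integral_reflect[OF integrable, of x] K(2)[of k] by simp
    then have "mollify (K k) \<phi> x - \<phi> x = mollify (K k) (\<lambda>y. \<phi> y - \<phi> x) x"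
      by (simp add: mollify_diff[OF c\<phi>])
    moreover have "norm (mollify (K k) (\<lambda>y. \<phi> y - \<phi> x) x) \<le> (L * e k) * (\<integral>z. \<bar>K k z\<bar> \<partial>lborel)"
      by (intro norm_mollify continuous_intros c\<phi> lip)
    ultimately show "norm (mollify (K k) \<phi> x - \<phi> x) \<le> L * inverse (real (Suc k))"
      using K(2,3) by (simp add: e_def)
    show "mollify (K k) \<phi> x = 0" if "\<And>y. dist y x \<le> inverse (real (Suc k)) \<Longrightarrow> \<phi> y = 0"
    proof -
      have "norm (mollify (K k) \<phi> x) \<le> 0 * (\<integral>z. \<bar>K k z\<bar> \<partial>lborel)"
        using that by (intro norm_mollify c\<phi>) (auto simp: e_def)
      then show ?thesis by simp
    qed
    fix v
    \<comment> \<open>The estimate is used with the zero linear map: the Lipschitz bound on the ball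
      of radius \<open>e k\<close> cancels the factor \<open>1 / e k\<close>.\<close>
    have "norm (frechet_derivative (mollify (K k) \<phi>) (at x) v - 0) \<le> (L * e k) * (\<integral>z. \<bar>frechet_derivative (K k) (at z) v\<bar> \<partial>lborel)"
      using lip by (intro mollification_derivative_estimate[OF K(1,2) c\<phi>, where l = "\<lambda>_. 0"]) auto
    then show "norm (frechet_derivative (mollify (K k) \<phi>) (at x) v) \<le> L * ?C v"
      using e_pos[of k] unfolding K(4) by simp
  next
    fix x v assume d: "\<phi> differentiable (at x)"
    let ?l = "frechet_derivative \<phi> (at x)"
    have D: "(\<phi> has_derivative ?l) (at x)" using d by (simp add: frechet_derivative_works)
    show "(\<lambda>k. frechet_derivative (mollify (K k) \<phi>) (at x) v) \<longlonglongrightarrow> ?l v"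
    proof (rule LIMSEQ_I)
      fix r :: real assume r: "r > 0"
      \<comment> \<open>A remainder of size \<open>\<delta> * e k\<close> times an integral of size
        \<open>?C v / e k\<close> leaves \<open>\<delta> * ?C v < r\<close>. The summand 1 guards
        against \<open>?C v = 0\<close>.\<close>
      define \<delta> where "\<delta> = r / (2 * (?C v + 1))"
      have \<delta>: "\<delta> > 0" "\<delta> * ?C v < r"
      proof -
        show "\<delta> > 0" unfolding \<delta>_def using r C0[of v] by (intro divide_pos_pos) auto
        have "\<delta> * ?C v \<le> \<delta> * (?C v + 1)" using \<open>\<delta> > 0\<close> by (intro mult_left_mono) auto
        also have "\<dots> = r / 2" unfolding \<delta>_def using C0[of v] by (simp add: field_simps add_nonneg_eq_0_iff)
        finally have "\<delta> * ?C v \<le> r / 2" .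
        moreover have "r / 2 < r" using r by simp
        ultimately show "\<delta> * ?C v < r" by (rule le_less_trans)
      qed
      obtain d where d: "d > 0" "\<And>y. norm (y - x) < d \<Longrightarrow> norm (\<phi> y - \<phi> x - ?l (y - x)) \<le> \<delta> * norm (y - x)"
        using D \<delta>(1) unfolding has_derivative_at_alt by blast
      obtain k0 where k0: "e k0 < d" using reals_Archimedean[OF d(1)] by (auto simp: e_def)
      have "norm (frechet_derivative (mollify (K k) \<phi>) (at x) v - ?l v) < r" if "k \<ge> k0" for k
      proof -
        have "e k \<le> e k0" unfolding e_def using that by simp
        then have ek: "e k < d" using k0 by simp
        have "norm (frechet_derivative (mollify (K k) \<phi>) (at x) v - ?l v) \<le> (\<delta> * e k) * (\<integral>z. \<bar>frechet_derivative (K k) (at z) v\<bar> \<partial>lborel)"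
        proof (rule mollification_derivative_estimate[OF K(1,2) c\<phi> has_derivative_bounded_linear[OF D]])
          fix y assume y: "dist y x \<le> e k"
          then have "norm (\<phi> y - \<phi> x - ?l (y - x)) \<le> \<delta> * norm (y - x)" using d(2)[of y] ek by (simp add: dist_norm)
          also have "\<dots> \<le> \<delta> * e k" using y \<delta> by (intro mult_left_mono) (auto simp: dist_norm)
          finally show "norm (\<phi> y - \<phi> x - ?l (y - x)) \<le> \<delta> * e k" .
        qed
        also have "\<dots> = \<delta> * ?C v" using e_pos[of k] unfolding K(4) by simp
        finally show ?thesis using \<delta>(2) by simp
      qed
      then show "\<exists>no. \<forall>n\<ge>no. norm (frechet_derivative (mollify (K n) \<phi>) (at x) v - ?l v) < r" by blast
    qed
  qed
qed

section \<open>Change of variables, charts and the Riemannian measure\<close>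

subsection \<open>Images under almost everywhere differentiable maps\<close>

text \<open>The library proves the change of variables formula for index types of class \<open>wellorder\<close> only.
  Every finite type has a well-ordered copy, to which the statement is transported.\<close>

declare emeasure_completion [simp del]

typedef 'a wcopy = "UNIV :: 'a set" morphisms of_wcopy to_wcopy by simp

lemma bij_to_wcopy: "bij to_wcopy" and bij_of_wcopy: "bij of_wcopy"
  by (auto intro!: o_bij[where g = of_wcopy] o_bij[where g = to_wcopy] simp: fun_eq_iff to_wcopy_inverse of_wcopy_inverse)

instance wcopy :: (finite) finite
proof
  have "(UNIV :: 'a wcopy set) = to_wcopy ` UNIV" using bij_is_surj[OF bij_to_wcopy] by (rule sym)
  then show "finite (UNIV :: 'a wcopy set)" by (metis finite_imageI finite)
qed

definition wcopy_index :: "'a::finite wcopy \<Rightarrow> nat" where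
  "wcopy_index = (SOME f. inj f)"

lemma inj_wcopy_index: "inj wcopy_index"
proof -
  have "\<exists>f :: 'a wcopy \<Rightarrow> nat. inj f"
    using finite_imp_inj_to_nat_seg[of "UNIV :: 'a wcopy set"] by auto
  then show ?thesis unfolding wcopy_index_def by (rule someI_ex)
qed

instantiation wcopy :: (finite) wellorder
begin

definition less_eq_wcopy :: "'a wcopy \<Rightarrow> 'a wcopy \<Rightarrow> bool" where
  "less_eq_wcopy x y \<longleftrightarrow> wcopy_index x \<le> wcopy_index y"

definition less_wcopy :: "'a wcopy \<Rightarrow> 'a wcopy \<Rightarrow> bool" where
  "less_wcopy x y \<longleftrightarrow> wcopy_index x < wcopy_index y"

instance
proof
  fix P :: "'a wcopy \<Rightarrow> bool" and a
  assume step: "\<And>x. (\<And>y. y < x \<Longrightarrow> P y) \<Longrightarrow> P x"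
  show "P a"
  proof (induction a rule: measure_induct_rule[of wcopy_index])
    case (less x) then show ?case using step less_wcopy_def by blast
  qed
qed (auto simp: less_eq_wcopy_def less_wcopy_def dest: injD[OF inj_wcopy_index])

end

definition reindex :: "('j \<Rightarrow> 'i) \<Rightarrow> real ^ 'i \<Rightarrow> real ^ 'j" where
  "reindex b x = (\<chi> j. x $ b j)"

lemma reindex_inverse: "bij b \<Longrightarrow> reindex (inv b) (reindex b x) = x"
  by (simp add: reindex_def vec_eq_iff bij_is_surj surj_f_inv_f)

lemma reindex_inverse': "bij b \<Longrightarrow> reindex b (reindex (inv b) x) = x"
  by (simp add: reindex_def vec_eq_iff bij_is_inj)

lemma linear_reindex: "linear (reindex b :: real ^ 'i::finite \<Rightarrow> real ^ 'j::finite)"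
  by (rule linearI) (auto simp: reindex_def vec_eq_iff)

lemma prod_Basis_cart: "(\<Prod>b\<in>Basis. (x :: real ^ 'n) \<bullet> b) = (\<Prod>i\<in>UNIV. x $ i)"
  by (simp add: Basis_vec_def cart_eq_inner_axis axis_eq_axis prod.UNION_disjoint)

lemma distr_reindex_lborel:
  fixes b :: "'j::finite \<Rightarrow> 'i::finite"
  assumes b: "bij b"
  shows "distr lborel borel (reindex b) = lborel"
proof (rule lborel_eqI[symmetric])
  have m: "(reindex b :: real ^ 'i \<Rightarrow> real ^ 'j) \<in> borel_measurable borel"
    by (intro borel_measurable_continuous_onI linear_continuous_on linear_conv_bounded_linear[THEN iffD1] linear_reindex)
  fix l u :: "real ^ 'j" assume le: "\<And>b. b \<in> Basis \<Longrightarrow> l \<bullet> b \<le> u \<bullet> b"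
  let ?r = "reindex (inv b)"
  have vim: "reindex b -` box l u = box (?r l) (?r u)"
    using b by (auto simp: mem_box_cart reindex_def bij_is_surj surj_f_inv_f) (metis bij_inv_eq_iff)+
  have le': "?r l \<bullet> c \<le> ?r u \<bullet> c" if "c \<in> Basis" for c
  proof -
    have "l $ j \<le> u $ j" for j using le[of "axis j 1"] by (auto simp: Basis_vec_def inner_axis)
    then show ?thesis using that by (auto simp: Basis_vec_def reindex_def inner_axis)
  qed
  have "emeasure (distr lborel borel (reindex b)) (box l u) = (\<Prod>c\<in>Basis. (?r u - ?r l) \<bullet> c)"
    using m le' by (simp add: emeasure_distr vim emeasure_lborel_box)
  also have "(\<Prod>c\<in>Basis. (?r u - ?r l) \<bullet> c) = (\<Prod>i\<in>UNIV. (u - l) $ inv b i)"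
    unfolding prod_Basis_cart by (simp add: reindex_def)
  also have "\<dots> = (\<Prod>j\<in>UNIV. (u - l) $ j)"
    using prod.reindex_bij_betw[OF bij_imp_bij_inv[OF b], of "\<lambda>j. (u - l) $ j"] by simp
  also have "\<dots> = (\<Prod>c\<in>Basis. (u - l) \<bullet> c)" by (simp only: prod_Basis_cart)
  finally show "emeasure (distr lborel borel (reindex b)) (box l u) = (\<Prod>c\<in>Basis. (u - l) \<bullet> c)" .
qed simp

text \<open>A Lebesgue set is a Borel set up to a subset of a Borel null set, and both parts are
  governed by the Borel statement.\<close>

lemma distr_reindex_lebesgue:
  fixes b :: "'j::finite \<Rightarrow> 'i::finite"
  assumes b: "bij b"
  shows "reindex b \<in> lebesgue \<rightarrow>\<^sub>M lebesgue" "distr lebesgue lebesgue (reindex b) = lebesgue"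
proof -
  let ?r = "reindex b :: real ^ 'i \<Rightarrow> real ^ 'j"
  have m: "?r \<in> borel_measurable borel"
    by (intro borel_measurable_continuous_onI linear_continuous_on linear_conv_bounded_linear[THEN iffD1] linear_reindex)
  have key: "?r -` E \<in> sets lebesgue \<and> emeasure lebesgue (?r -` E) = emeasure lebesgue E" if E0: "E \<in> sets lebesgue" for E
  proof -
    obtain S N N' where E: "E = S \<union> N" "N \<subseteq> N'" "N' \<in> null_sets lborel" "S \<in> sets lborel"
      using sets_completionE[OF E0] by blast
    have vs: "?r -` A \<in> sets borel" if "A \<in> sets borel" for A
      using measurable_sets_borel[OF m that] .
    have em: "emeasure lborel (?r -` A) = emeasure lborel A" if "A \<in> sets borel" for A
    proof -
      have "emeasure (distr lborel borel ?r) A = emeasure lborel (?r -` A)" using m that by (simp add: emeasure_distr)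
      then show ?thesis by (simp add: distr_reindex_lborel[OF b])
    qed
    have "?r -` N' \<in> null_sets lborel" using E(3) em[of N'] vs[of N'] by (auto simp: null_sets_def)
    then have nul: "?r -` N \<in> null_sets lebesgue" "N \<in> null_sets lebesgue"
      using E(2,3) null_sets_completionI null_sets_completion_subset[of N N' lborel] null_sets_completion_subset[of "?r -` N" "?r -` N'" lborel]
      by blast+
    have S: "S \<in> sets lebesgue" "?r -` S \<in> sets lebesgue" using E(4) vs by auto
    have "emeasure lebesgue (?r -` S) = emeasure lebesgue S" using E(4) vs em by (simp add: emeasure_completion)
    then show ?thesis using nul S unfolding E(1) by (auto simp: emeasure_Un_null_set)
  qed
  show ml: "?r \<in> lebesgue \<rightarrow>\<^sub>M lebesgue" using key by (intro measurableI) auto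
  show "distr lebesgue lebesgue ?r = lebesgue"
    by (rule measure_eqI) (auto simp: emeasure_distr[OF ml] key)
qed

text \<open>Conjugation by \<open>b\<close> is a bijection between the permutations of the two index
  types and preserves signs.\<close>

lemma det_reindex:
  fixes A :: "real ^ 'n ^ 'n" and b :: "'m::finite \<Rightarrow> 'n::finite"
  assumes b: "bij b"
  shows "det (\<chi> i j. A $ b i $ b j) = det A"
proof -
  let ?P = "{p. p permutes (UNIV :: 'n set)}" and ?Q = "{p. p permutes (UNIV :: 'm set)}"
  define f where "f p = b \<circ> p \<circ> inv b" for p :: "'m \<Rightarrow> 'm"
  have ib: "bij (inv b)" "inj b" "\<And>x. inv b (b x) = x" "\<And>y. b (inv b y) = y"
    using b by (auto simp: bij_imp_bij_inv bij_is_inj bij_is_surj surj_f_inv_f)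
  have fm: "f p = map_permutation UNIV b p" if "p permutes UNIV" for p
    using b by (auto simp: f_def map_permutation_def fun_eq_iff restrict_id_def bij_is_surj)
  have bb: "bij_betw f ?Q ?P"
  proof (rule bij_betwI[where g = "\<lambda>q. inv b \<circ> q \<circ> b"])
    show "f \<in> ?Q \<rightarrow> ?P" "(\<lambda>q. inv b \<circ> q \<circ> b) \<in> ?P \<rightarrow> ?Q"
      using b ib by (auto simp: f_def bij_imp_permutes permutes_bij intro!: bij_imp_permutes bij_comp)
  qed (use ib in \<open>auto simp: f_def fun_eq_iff\<close>)
  have "det A = (\<Sum>p\<in>?Q. of_int (sign (f p)) * (\<Prod>i\<in>UNIV. A $ i $ f p i))"
    unfolding det_def by (rule sum.reindex_bij_betw[OF bb, symmetric])
  also have "\<dots> = (\<Sum>p\<in>?Q. of_int (sign p) * (\<Prod>i\<in>UNIV. A $ b i $ b (p i)))"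
  proof (rule sum.cong[OF refl])
    fix p assume p: "p \<in> ?Q"
    have "sign (f p) = sign p" using p fm sign_map_permutation[OF ib(2), of p] by simp
    moreover have "(\<Prod>i\<in>UNIV. A $ i $ f p i) = (\<Prod>i\<in>UNIV. A $ b i $ f p (b i))"
      by (rule prod.reindex_bij_betw[OF b, symmetric])
    ultimately show "of_int (sign (f p)) * (\<Prod>i\<in>UNIV. A $ i $ f p i) = of_int (sign p) * (\<Prod>i\<in>UNIV. A $ b i $ b (p i))"
      by (simp add: f_def ib)
  qed
  finally show ?thesis by (simp add: det_def)
qed

text \<open>The change of variables formula enters as an equivalence between finite measure of the
  image and a finite integral of the Jacobian, with equal values.\<close>

lemma emeasure_differentiable_image_wellorder:
  fixes T :: "real ^ 'n::{finite,wellorder} \<Rightarrow> real ^ 'n::_"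
  assumes S: "S \<in> sets lebesgue" and T: "\<And>x. x \<in> S \<Longrightarrow> (T has_derivative T' x) (at x)" and inj: "inj_on T S"
  shows "T ` S \<in> sets lebesgue"
    "(\<lambda>x. if x \<in> S then \<bar>det (matrix (T' x))\<bar> else 0) \<in> borel_measurable lebesgue"
    "emeasure lebesgue (T ` S) = (\<integral>\<^sup>+x. ennreal (if x \<in> S then \<bar>det (matrix (T' x))\<bar> else 0) \<partial>lebesgue)"
proof -
  let ?f = "\<lambda>x. if x \<in> S then \<bar>det (matrix (T' x))\<bar> else 0"
  have T': "(T has_derivative T' x) (at x within S)" if "x \<in> S" for x using T[OF that] by (rule has_derivative_at_withinI)
  show TS: "T ` S \<in> sets lebesgue"
    using T' by (intro differentiable_image_in_sets_lebesgue[OF S]) (auto simp: differentiable_on_def differentiable_def)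
  have "(\<lambda>x. \<bar>det (matrix (T' x))\<bar>) \<in> borel_measurable (lebesgue_on S)"
    using borel_measurable_det_Jacobian[OF S T'] by simp
  then show fm: "?f \<in> borel_measurable lebesgue" using S by (subst borel_measurable_if) auto
  have iff: "T ` S \<in> lmeasurable \<and> measure lebesgue (T ` S) = m \<longleftrightarrow> integral\<^sup>N lebesgue ?f = ennreal m \<and> 0 \<le> m" for m
  proof -
    have "T ` S \<in> lmeasurable \<and> measure lebesgue (T ` S) = m \<longleftrightarrow> ((\<lambda>x. \<bar>det (matrix (T' x))\<bar>) has_integral m) S"
      by (rule has_measure_differentiable_image[OF S T' inj])
    also have "\<dots> \<longleftrightarrow> (?f has_integral m) UNIV" by (rule has_integral_restrict_UNIV[symmetric])
    also have "\<dots> \<longleftrightarrow> integral\<^sup>N lebesgue ?f = ennreal m \<and> 0 \<le> m"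
      using has_integral_iff_nn_integral_lebesgue[of ?f m] fm by auto
    finally show ?thesis .
  qed
  show "emeasure lebesgue (T ` S) = integral\<^sup>N lebesgue ?f"
  proof (cases "integral\<^sup>N lebesgue ?f")
    case (real m)
    then have "T ` S \<in> lmeasurable" "measure lebesgue (T ` S) = m" using iff[of m] by auto
    then show ?thesis using real by (simp add: emeasure_eq_measure2)
  next
    case top
    \<comment> \<open>A measurable image of finite measure would make the integral finite, so an
      infinite integral forces infinite measure.\<close>
    have "T ` S \<notin> lmeasurable" using iff[of "measure lebesgue (T ` S)"] top by auto
    then show ?thesis using TS top by (auto simp: fmeasurable_def top.not_eq_extremum[symmetric] simp del: emeasure_completion)
  qed
qed

text \<open>Conjugating \<open>T\<close> by a relabelling of coordinates changes neither the
  Lebesgue measure of the image nor the determinant of the derivative.\<close>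

theorem emeasure_differentiable_image:
  fixes T :: "real ^ 'n::finite \<Rightarrow> real ^ 'n::_"
  assumes S: "S \<in> sets lebesgue" and T: "\<And>x. x \<in> S \<Longrightarrow> (T has_derivative T' x) (at x)" and inj: "inj_on T S"
  shows "T ` S \<in> sets lebesgue"
    "(\<lambda>x. if x \<in> S then \<bar>det (matrix (T' x))\<bar> else 0) \<in> borel_measurable lebesgue"
    "emeasure lebesgue (T ` S) = (\<integral>\<^sup>+x. ennreal (if x \<in> S then \<bar>det (matrix (T' x))\<bar> else 0) \<partial>lebesgue)"
proof -
  let ?b = "of_wcopy :: 'n wcopy \<Rightarrow> 'n"
  define r where "r = reindex ?b"
  define r' where "r' = reindex (inv ?b)"
  have b: "bij ?b" by (rule bij_of_wcopy)
  have rr [simp]: "r' (r x) = x" "r (r' y) = y" for x y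
    using reindex_inverse[OF b] reindex_inverse'[OF b] by (auto simp: r_def r'_def)
  have rm: "r \<in> lebesgue \<rightarrow>\<^sub>M lebesgue" "distr lebesgue lebesgue r = lebesgue"
    "r' \<in> lebesgue \<rightarrow>\<^sub>M lebesgue" "distr lebesgue lebesgue r' = lebesgue"
    using distr_reindex_lebesgue[OF b] distr_reindex_lebesgue[OF bij_imp_bij_inv[OF b]] by (simp_all add: r_def r'_def)
  have lin: "linear r" "linear r'" unfolding r_def r'_def by (rule linear_reindex)+
  then have hd: "(r has_derivative r) (at x)" "(r' has_derivative r') (at y)" for x y
    by (simp_all add: linear_imp_has_derivative)
  let ?S = "r' -` S" and ?T = "\<lambda>y. r (T (r' y))" and ?T' = "\<lambda>y v. r (T' (r' y) (r' v))"
  have S1: "?S \<in> sets lebesgue" using measurable_sets[OF rm(3) S] by simp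
  have T1: "(?T has_derivative ?T' y) (at y)" if "y \<in> ?S" for y
    using has_derivative_compose[OF has_derivative_compose[OF hd(2) T] hd(1)] that by simp
  have inj1: "inj_on ?T ?S"
  proof (rule inj_onI)
    fix x y assume xy: "x \<in> ?S" "y \<in> ?S" "?T x = ?T y"
    then have "T (r' x) = T (r' y)" using rr(1) by metis
    then have "r' x = r' y" using inj xy by (auto dest: inj_onD)
    then show "x = y" using rr(2) by metis
  qed
  note W = emeasure_differentiable_image_wellorder[OF S1 T1 inj1]
  have img: "?T ` ?S = r' -` (T ` S)"
  proof (intro set_eqI iffI)
    fix y assume "y \<in> ?T ` ?S" then show "y \<in> r' -` (T ` S)" by auto
  next
    fix y assume "y \<in> r' -` (T ` S)"
    then obtain x where "r' y = T x" "x \<in> S" by auto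
    then have "y = ?T (r x)" "r x \<in> ?S" using rr(2)[of y] by auto
    then show "y \<in> ?T ` ?S" by blast
  qed
  have vv: "r -` (r' -` E) = E" for E by auto
  show TS: "T ` S \<in> sets lebesgue"
    using measurable_sets[OF rm(1) W(1)] by (simp add: img vv)
  have dd: "det (matrix (?T' y)) = det (matrix (T' (r' y)))" for y
  proof -
    have ax: "r' (axis j 1) = axis (?b j) 1" for j
      using b by (auto simp: r'_def reindex_def axis_def vec_eq_iff bij_is_inj bij_is_surj surj_f_inv_f)
    have "matrix (?T' y) = (\<chi> i j. matrix (T' (r' y)) $ ?b i $ ?b j)"
      by (simp add: matrix_def vec_eq_iff ax r_def reindex_def)
    then show ?thesis using det_reindex[OF b] by simp
  qed
  let ?f = "\<lambda>x. if x \<in> S then \<bar>det (matrix (T' x))\<bar> else 0"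
  have ff: "(\<lambda>y. if y \<in> ?S then \<bar>det (matrix (?T' y))\<bar> else 0) = (\<lambda>y. ?f (r' y))" by (auto simp: dd)
  have "(\<lambda>y. ?f (r' y)) \<in> borel_measurable lebesgue" using W(2) unfolding ff .
  from measurable_compose[OF rm(1) this] show fm: "?f \<in> borel_measurable lebesgue" by (simp cong: if_cong)
  have "emeasure lebesgue (T ` S) = emeasure (distr lebesgue lebesgue r') (T ` S)" by (simp add: rm)
  also have "\<dots> = emeasure lebesgue (?T ` ?S)" using emeasure_distr[OF rm(3) TS] by (simp add: img)
  also have "\<dots> = (\<integral>\<^sup>+y. ennreal (?f (r' y)) \<partial>lebesgue)" using W(3) unfolding ff[THEN fun_cong] .
  also have "\<dots> = (\<integral>\<^sup>+x. ennreal (?f x) \<partial>distr lebesgue lebesgue r')"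
    using fm rm by (subst nn_integral_distr) auto
  also have "\<dots> = (\<integral>\<^sup>+x. ennreal (?f x) \<partial>lebesgue)" by (simp only: rm)
  finally show "emeasure lebesgue (T ` S) = (\<integral>\<^sup>+x. ennreal (?f x) \<partial>lebesgue)" .
qed

subsection \<open>Maps that are Lipschitz near a point\<close>

lemma lipschitz_nearI: "L-lipschitz_on (ball x r) f \<Longrightarrow> r > 0 \<Longrightarrow> lipschitz_near f x"
  by (auto simp: lipschitz_near_def)

lemma lipschitz_near_continuous: "lipschitz_near f x \<Longrightarrow> isCont f x"
  unfolding lipschitz_near_def
  by (metis at_within_open centre_in_ball lipschitz_on_continuous_within open_ball)

lemma lipschitz_near_eventually:
  assumes "lipschitz_near f x" "open S" "x \<in> S" "\<And>y. y \<in> S \<Longrightarrow> f y = g y"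
  shows "lipschitz_near g x"
proof -
  obtain r L where r: "r > 0" "L-lipschitz_on (ball x r) f" using assms(1) by (auto simp: lipschitz_near_def)
  obtain s where s: "s > 0" "ball x s \<subseteq> S" using assms(2,3) open_contains_ball by blast
  have "L-lipschitz_on (ball x (min r s)) f" by (rule lipschitz_on_subset[OF r(2)]) auto
  then have "L-lipschitz_on (ball x (min r s)) g"
    by (rule lipschitz_on_transform) (use s assms(4) in auto)
  then show ?thesis using r s by (intro lipschitz_nearI[of L x "min r s"]) auto
qed

lemma lipschitz_near_compose:
  assumes f: "lipschitz_near f x" and g: "lipschitz_near g (f x)"
  shows "lipschitz_near (\<lambda>y. g (f y)) x"
proof -
  obtain r L where r: "r > 0" "L-lipschitz_on (ball x r) f" using f by (auto simp: lipschitz_near_def)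
  obtain s K where s: "s > 0" "K-lipschitz_on (ball (f x) s) g" using g by (auto simp: lipschitz_near_def)
  have "\<exists>d>0. \<forall>y. dist y x < d \<longrightarrow> dist (f y) (f x) < s"
    using lipschitz_near_continuous[OF f] s(1) by (simp add: continuous_at_eps_delta)
  then obtain d where d: "d > 0" "\<And>y. dist y x < d \<Longrightarrow> dist (f y) (f x) < s" by blast
  let ?B = "ball x (min r d)"
  have "L-lipschitz_on ?B f" by (rule lipschitz_on_subset[OF r(2)]) auto
  moreover have "K-lipschitz_on (f ` ?B) g"
    by (rule lipschitz_on_subset[OF s(2)]) (use d(2) in \<open>auto simp: dist_commute\<close>)
  ultimately have "(K * L)-lipschitz_on ?B (g \<circ> f)" by (rule lipschitz_on_compose)
  then show ?thesis using r d by (intro lipschitz_nearI[of "K * L" x "min r d"]) (auto simp: o_def)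
qed

lemma smooth_lipschitz_near:
  fixes f :: "'a::euclidean_space \<Rightarrow> 'b::real_normed_vector"
  assumes "open S" "x \<in> S" "smooth_on S f"
  shows "lipschitz_near f x"
proof -
  obtain r where r: "r > 0" "cball x r \<subseteq> S" using assms open_contains_cball by blast
  let ?D = "\<lambda>y. frechet_derivative f (at y)"
  have D: "(f has_derivative ?D y) (at y)" if "y \<in> S" for y using smooth_on_has_derivative[OF assms(3) that] .
  have "\<exists>M. \<forall>y\<in>cball x r. norm (?D y b) \<le> M" for b
  proof -
    have "continuous_on (cball x r) (\<lambda>y. ?D y b)"
      using smooth_on_continuous[OF smooth_on_frechet[OF assms(3)]] r(2) continuous_on_subset by blast
    then have "compact ((\<lambda>y. ?D y b) ` cball x r)" by (rule compact_continuous_image) simp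
    then have "bounded ((\<lambda>y. ?D y b) ` cball x r)" by (rule compact_imp_bounded)
    then show ?thesis unfolding bounded_iff by blast
  qed
  then obtain M where M: "\<And>b y. y \<in> cball x r \<Longrightarrow> norm (?D y b) \<le> M b" by metis
  let ?C = "\<Sum>b\<in>Basis. \<bar>M b\<bar>"
  have on: "onorm (?D y) \<le> ?C" if "y \<in> cball x r" for y
  proof (rule onorm_le)
    fix v
    have lin: "linear (?D y)" using D r that has_derivative_linear by blast
    have "norm (?D y v) = norm (\<Sum>b\<in>Basis. (v \<bullet> b) *\<^sub>R ?D y b)"
      by (subst euclidean_representation[of v, symmetric]) (simp add: linear_sum[OF lin] linear_scale[OF lin])
    also have "\<dots> \<le> (\<Sum>b\<in>Basis. norm v * \<bar>M b\<bar>)"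
    proof (rule sum_norm_le)
      fix b :: 'a assume b: "b \<in> Basis"
      have "norm (?D y b) \<le> \<bar>M b\<bar>" using M[OF that, of b] by simp
      then show "norm ((v \<bullet> b) *\<^sub>R ?D y b) \<le> norm v * \<bar>M b\<bar>"
        using Basis_le_norm[OF b, of v] by (simp add: mult_mono)
    qed
    finally show "norm (?D y v) \<le> ?C * norm v" by (simp add: sum_distrib_left mult.commute)
  qed
  have "?C-lipschitz_on (cball x r) f"
  proof (rule bounded_derivative_imp_lipschitz)
    show "(f has_derivative ?D y) (at y within cball x r)" if "y \<in> cball x r" for y
      using D r that by (blast intro: has_derivative_at_withinI)
  qed (use on in \<open>auto simp: sum_nonneg\<close>)
  then have "?C-lipschitz_on (ball x r) f" by (rule lipschitz_on_subset) auto
  then show ?thesis using r by (intro lipschitz_nearI) auto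
qed

lemma negligible_image_lipschitz_near:
  fixes f :: "'a::euclidean_space \<Rightarrow> 'a"
  assumes "negligible S" "\<And>x. x \<in> S \<Longrightarrow> lipschitz_near f x"
  shows "negligible (f ` S)"
proof (rule negligible_locally_Lipschitz_image[OF _ assms(1)])
  fix x assume "x \<in> S"
  then obtain r L where r: "r > 0" "L-lipschitz_on (ball x r) f" using assms(2) unfolding lipschitz_near_def by blast
  then show "\<exists>T B. open T \<and> x \<in> T \<and> (\<forall>y\<in>S \<inter> T. norm (f y - f x) \<le> B * norm (y - x))"
    by (intro exI[of _ "ball x r"] exI[of _ L]) (auto simp: lipschitz_on_def dist_norm)
qed simp

text \<open>Continuity alone would not preserve Lebesgue measurability; it does together with the
  fact that negligible subsets have negligible images.\<close>

lemma lebesgue_image_lipschitz_near: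
  fixes f :: "'a::euclidean_space \<Rightarrow> 'a"
  assumes "S \<in> sets lebesgue" "\<And>x. x \<in> S \<Longrightarrow> lipschitz_near f x"
  shows "f ` S \<in> sets lebesgue"
proof (rule sets_lebesgue_continuous_image[OF assms(1)])
  show "continuous_on S f"
    using assms(2) by (intro continuous_at_imp_continuous_on ballI lipschitz_near_continuous)
  show "negligible (f ` T)" if "negligible T" "T \<subseteq> S" for T
    using that assms(2) by (intro negligible_image_lipschitz_near) auto
qed simp

subsection \<open>Charts\<close>

lemma chart_inv_left [simp]: "is_chart c \<Longrightarrow> x \<in> fst c \<Longrightarrow> chart_inv c (snd c x) = x"
  and chart_inv_right [simp]: "is_chart c \<Longrightarrow> y \<in> snd c ` fst c \<Longrightarrow> snd c (chart_inv c y) = y"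
  and chart_inv_in [simp]: "is_chart c \<Longrightarrow> y \<in> snd c ` fst c \<Longrightarrow> chart_inv c y \<in> fst c"
  and chart_cont: "is_chart c \<Longrightarrow> continuous_on (fst c) (snd c)"
  and chart_inv_cont: "is_chart c \<Longrightarrow> continuous_on (snd c ` fst c) (chart_inv c)"
  and chart_open: "is_chart c \<Longrightarrow> open (fst c)"
  by (auto simp: is_chart_def homeomorphism_def)

lemma chart_inj: "is_chart c \<Longrightarrow> inj_on (snd c) (fst c)"
  by (rule inj_on_inverseI[of _ "chart_inv c"]) simp

lemma chart_open_image:
  assumes "is_chart c" "open V" "V \<subseteq> fst c"
  shows "open (snd c ` V)"
proof -
  have "openin (top_of_set (fst c)) V" using assms by (simp add: openin_open_eq chart_open)
  then have "openin (top_of_set (snd c ` fst c)) (snd c ` V)"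
    using homeomorphism_imp_open_map assms(1) unfolding is_chart_def by blast
  then show ?thesis using assms(1) by (simp add: openin_open_eq is_chart_def)
qed

lemma chart_open_vimage:
  assumes "is_chart c" "open W"
  shows "open (fst c \<inter> snd c -` W)"
  using continuous_open_preimage[OF chart_cont chart_open] assms by blast

lemma local_rep_apply: "is_chart c \<Longrightarrow> x \<in> fst c \<Longrightarrow> local_rep F c d (snd c x) = snd d (F x)"
  by (simp add: local_rep_def)

lemma local_rep_compose:
  assumes "is_chart c" "is_chart d" "y \<in> snd c ` (fst c \<inter> F -` fst d)"
  shows "local_rep (G \<circ> F) c e y = local_rep G d e (local_rep F c d y)"
  using assms by (auto simp: local_rep_def)

lemma open_chart_overlap:
  assumes "is_chart c" "is_chart d" "continuous_on UNIV F"
  shows "open (snd c ` (fst c \<inter> F -` fst d))"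
  using assms by (intro chart_open_image open_Int chart_open open_vimage) auto

lemma local_rep_compose_derivative:
  assumes c: "is_chart c" "is_chart d" "continuous_on UNIV F" "x \<in> fst c" "F x \<in> fst d"
    and D: "(local_rep F c d has_derivative D1) (at (snd c x))" "(local_rep G d e has_derivative D2) (at (snd d (F x)))"
  shows "(local_rep (G \<circ> F) c e has_derivative (\<lambda>v. D2 (D1 v))) (at (snd c x))"
proof -
  have "((\<lambda>y. local_rep G d e (local_rep F c d y)) has_derivative (\<lambda>v. D2 (D1 v))) (at (snd c x))"
    by (rule has_derivative_compose[OF D(1)]) (use c D(2) in \<open>simp add: local_rep_apply\<close>)
  then show ?thesis
    by (rule has_derivative_transform_within_open[OF _ open_chart_overlap[OF c(1-3)]])
      (use c in \<open>auto simp: local_rep_compose[OF c(1,2)]\<close>)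
qed

lemma local_rep_has_jacobian:
  "local_rep F c d differentiable (at (snd c x)) \<Longrightarrow> (local_rep F c d has_derivative (*v) (jacobian F c d x)) (at (snd c x))"
  unfolding jacobian_def
  by (simp add: frechet_derivative_works has_derivative_linear matrix_works matrix_vector_mul(2)[symmetric])

lemma jacobian_eqI:
  "(local_rep F c d has_derivative D) (at (snd c x)) \<Longrightarrow> jacobian F c d x = matrix D"
  unfolding jacobian_def by (simp add: frechet_derivative_eqI)

lemma jacobian_compose:
  assumes c: "is_chart c" "is_chart d" "continuous_on UNIV F" "x \<in> fst c" "F x \<in> fst d"
    and D: "local_rep F c d differentiable (at (snd c x))" "local_rep G d e differentiable (at (snd d (F x)))"
  shows "local_rep (G \<circ> F) c e differentiable (at (snd c x))"
    "jacobian (G \<circ> F) c e x = jacobian G d e (F x) ** jacobian F c d x"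
proof -
  have *: "(local_rep (G \<circ> F) c e has_derivative (\<lambda>v. jacobian G d e (F x) *v (jacobian F c d x *v v))) (at (snd c x))"
    using local_rep_compose_derivative[OF c local_rep_has_jacobian[OF D(1)] local_rep_has_jacobian[OF D(2)]] .
  then show "local_rep (G \<circ> F) c e differentiable (at (snd c x))" by (auto simp: differentiable_def)
  show "jacobian (G \<circ> F) c e x = jacobian G d e (F x) ** jacobian F c d x"
    using jacobian_eqI[OF *] by (simp add: matrix_vector_mul_assoc)
qed

locale smooth_manifold =
  fixes \<A> :: "('m::{t2_space, second_countable_topology}, 'n::finite) chart set"
  assumes smooth: "smooth_structure \<A>"
begin

lemma charts [simp]: "c \<in> \<A> \<Longrightarrow> is_chart c"
  using smooth[unfolded smooth_structure_def, THEN conjunct1] by simp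

lemma chart_ex: "\<exists>c\<in>\<A>. x \<in> fst c"
  using smooth[unfolded smooth_structure_def, THEN conjunct2, THEN conjunct1] by blast

lemma chart_at [simp]: "chart_at \<A> x \<in> \<A>" "x \<in> fst (chart_at \<A> x)"
proof -
  have "\<exists>c. c \<in> \<A> \<and> x \<in> fst c" using chart_ex by blast
  then have "chart_at \<A> x \<in> \<A> \<and> x \<in> fst (chart_at \<A> x)" unfolding chart_at_def by (rule someI_ex)
  then show "chart_at \<A> x \<in> \<A>" "x \<in> fst (chart_at \<A> x)" by auto
qed

lemma transition_smooth: "c \<in> \<A> \<Longrightarrow> d \<in> \<A> \<Longrightarrow> smooth_on (snd c ` (fst c \<inter> fst d)) (local_rep id c d)"
  using smooth[unfolded smooth_structure_def, THEN conjunct2, THEN conjunct2, THEN conjunct1]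
  by (simp add: smooth_transition_def)

lemma overlap_open: "c \<in> \<A> \<Longrightarrow> d \<in> \<A> \<Longrightarrow> open (snd c ` (fst c \<inter> fst d))"
  by (intro chart_open_image open_Int chart_open) auto

lemma transition_differentiable:
  "c \<in> \<A> \<Longrightarrow> d \<in> \<A> \<Longrightarrow> x \<in> fst c \<Longrightarrow> x \<in> fst d \<Longrightarrow> local_rep id c d differentiable (at (snd c x))"
  using smooth_on_has_derivative[OF transition_smooth, of c d "snd c x"] by (auto simp: differentiable_def)

lemma transition_lipschitz:
  "c \<in> \<A> \<Longrightarrow> d \<in> \<A> \<Longrightarrow> x \<in> fst c \<Longrightarrow> x \<in> fst d \<Longrightarrow> lipschitz_near (local_rep id c d) (snd c x)"
  by (rule smooth_lipschitz_near[OF overlap_open _ transition_smooth]) auto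

lemma jacobian_id_self: "c \<in> \<A> \<Longrightarrow> x \<in> fst c \<Longrightarrow> jacobian id c c x = mat 1"
proof -
  assume c: "c \<in> \<A>" "x \<in> fst c"
  have "((\<lambda>y. y) has_derivative (\<lambda>v. v)) (at (snd c x))" by simp
  then have "(local_rep id c c has_derivative (\<lambda>v. v)) (at (snd c x))"
    by (rule has_derivative_transform_within_open[OF _ overlap_open[OF c(1) c(1)]])
      (use c in \<open>auto simp: local_rep_def\<close>)
  then have "jacobian id c c x = matrix (\<lambda>v. v)" by (rule jacobian_eqI)
  then show ?thesis using matrix_id_mat_1 by (simp add: id_def)
qed

lemma jacobian_id_inverse:
  assumes "c \<in> \<A>" "d \<in> \<A>" "x \<in> fst c" "x \<in> fst d"
  shows "jacobian id d c x ** jacobian id c d x = mat 1"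
  using jacobian_compose(2)[of c d id x id c] assms jacobian_id_self[of c x] transition_differentiable by simp

text \<open>Lindelof's theorem for the second countable space. The family is indexed because the
  indices will be charts, pairs of charts, or charts with a neighbourhood.\<close>

lemma countable_atlas:
  assumes "\<And>x. \<exists>i\<in>I. open (V i) \<and> x \<in> V i"
  obtains J where "countable J" "J \<subseteq> I" "\<And>i. i \<in> J \<Longrightarrow> open (V i)" "(\<Union>i\<in>J. V i) = (UNIV :: 'm set)"
proof -
  have op: "open S" if "S \<in> V ` {i \<in> I. open (V i)}" for S using that by blast
  obtain \<F> where F: "\<F> \<subseteq> V ` {i \<in> I. open (V i)}" "countable \<F>" "\<Union>\<F> = \<Union>(V ` {i \<in> I. open (V i)})"
    by (rule Lindelof[OF op])
  obtain J where J: "countable J" "J \<subseteq> {i \<in> I. open (V i)}" "\<F> = V ` J"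
    using countable_subset_image[of \<F> V "{i \<in> I. open (V i)}"] F(1,2) by blast
  have "(\<Union>i\<in>J. V i) = \<Union>(V ` {i \<in> I. open (V i)})" using F(3) J(3) by simp
  also have "\<dots> = UNIV" using assms by fast
  finally have "(\<Union>i\<in>J. V i) = UNIV" .
  then show thesis using that[of J] J by auto
qed

end

text \<open>Null sets are determined by the smooth structure before any measure is available; for
  every rough metric they turn out to be the null sets of its measure.\<close>

definition mnull :: "('m, 'n::finite) chart set \<Rightarrow> 'm set \<Rightarrow> bool" where
  "mnull \<A> E \<longleftrightarrow> (\<forall>c\<in>\<A>. negligible (snd c ` (E \<inter> fst c)))"

lemma mnull_subset: "mnull \<A> E \<Longrightarrow> D \<subseteq> E \<Longrightarrow> mnull \<A> D"
  unfolding mnull_def by (meson image_mono Int_mono negligible_subset order_refl)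

lemma mnull_Un: "mnull \<A> D \<Longrightarrow> mnull \<A> E \<Longrightarrow> mnull \<A> (D \<union> E)"
  unfolding mnull_def by (auto simp: Int_Un_distrib2 image_Un)

lemma mnull_empty [simp]: "mnull \<A> {}"
  by (simp add: mnull_def)

text \<open>The Lipschitz condition ranges over all pairs of charts, and the inverse is a parameter
  of equal standing, so results for one direction can be instantiated for the other.\<close>

locale lip_homeo = M: smooth_manifold \<A> + N: smooth_manifold \<B>
  for \<A> :: "('m::{t2_space, second_countable_topology}, 'n::finite) chart set"
    and \<B> :: "('k::{t2_space, second_countable_topology}, 'n) chart set" +
  fixes F :: "'m \<Rightarrow> 'k" and G :: "'k \<Rightarrow> 'm"
  assumes cont_F: "continuous_on UNIV F" and cont_G: "continuous_on UNIV G"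
    and GF [simp]: "G (F x) = x" and FG [simp]: "F (G y) = y"
    and lip_F: "c \<in> \<A> \<Longrightarrow> d \<in> \<B> \<Longrightarrow> x \<in> fst c \<Longrightarrow> F x \<in> fst d \<Longrightarrow> lipschitz_near (local_rep F c d) (snd c x)"
    and lip_G: "c \<in> \<A> \<Longrightarrow> d \<in> \<B> \<Longrightarrow> y \<in> fst d \<Longrightarrow> G y \<in> fst c \<Longrightarrow> lipschitz_near (local_rep G d c) (snd d y)"
begin

lemma swap: "lip_homeo \<B> \<A> G F"
  by unfold_locales (auto intro: cont_F cont_G lip_F lip_G)

lemma image_chart:
  assumes "d \<in> \<B>" and J: "(\<Union>i\<in>J. V i) = UNIV" "\<And>i. i \<in> J \<Longrightarrow> C i \<in> \<A> \<and> V i \<subseteq> fst (C i)"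
  shows "snd d ` (F ` E \<inter> fst d) = (\<Union>i\<in>J. local_rep F (C i) d ` (snd (C i) ` (E \<inter> V i \<inter> F -` fst d)))"
proof -
  have "local_rep F (C i) d ` (snd (C i) ` (E \<inter> V i \<inter> F -` fst d)) = snd d ` F ` (E \<inter> V i \<inter> F -` fst d)" if "i \<in> J" for i
    unfolding image_image using J(2)[OF that] by (intro image_cong refl) (auto intro!: local_rep_apply)
  then have "(\<Union>i\<in>J. local_rep F (C i) d ` (snd (C i) ` (E \<inter> V i \<inter> F -` fst d))) = (\<Union>i\<in>J. snd d ` F ` (E \<inter> V i \<inter> F -` fst d))"
    by simp
  also have "\<dots> = snd d ` F ` (\<Union>i\<in>J. E \<inter> V i \<inter> F -` fst d)" by blast
  also have "(\<Union>i\<in>J. E \<inter> V i \<inter> F -` fst d) = E \<inter> F -` fst d" using J(1) by blast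
  also have "F ` (E \<inter> F -` fst d) = F ` E \<inter> fst d" by auto
  finally show ?thesis by simp
qed

text \<open>One chart neighbourhood around each point suffices, since countably many of them cover
  the manifold. For the identity map this says that \<open>mnull\<close> is a local
  property.\<close>

lemma mnull_image_local:
  assumes E: "\<And>x. \<exists>c\<in>\<A>. \<exists>V. open V \<and> x \<in> V \<and> V \<subseteq> fst c \<and> negligible (snd c ` (E \<inter> V))"
  shows "mnull \<B> (F ` E)"
  unfolding mnull_def
proof
  fix d assume d: "d \<in> \<B>"
  let ?I = "{(c, V). c \<in> \<A> \<and> V \<subseteq> fst c \<and> negligible (snd c ` (E \<inter> V))}"
  have "\<exists>i\<in>?I. open (snd i) \<and> x \<in> snd i" for x
  proof -
    obtain c V where "c \<in> \<A>" "open V" "x \<in> V" "V \<subseteq> fst c" "negligible (snd c ` (E \<inter> V))" using E[of x] by blast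
    then show ?thesis by (intro bexI[of _ "(c, V)"]) auto
  qed
  then obtain J where J: "countable J" "J \<subseteq> ?I" "(\<Union>i\<in>J. snd i) = UNIV"
    by (rule M.countable_atlas[of ?I snd])
  have "negligible (local_rep F (fst i) d ` (snd (fst i) ` (E \<inter> snd i \<inter> F -` fst d)))" if "i \<in> J" for i
  proof (rule negligible_image_lipschitz_near)
    have "i \<in> ?I" using that J(2) by blast
    then have i: "fst i \<in> \<A>" "snd i \<subseteq> fst (fst i)" "negligible (snd (fst i) ` (E \<inter> snd i))"
      by (auto simp: case_prod_unfold)
    show "negligible (snd (fst i) ` (E \<inter> snd i \<inter> F -` fst d))"
      by (rule negligible_subset[OF i(3)]) auto
    show "lipschitz_near (local_rep F (fst i) d) z" if "z \<in> snd (fst i) ` (E \<inter> snd i \<inter> F -` fst d)" for z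
      using that i d by (auto intro!: lip_F)
  qed
  then have "negligible (\<Union>i\<in>J. local_rep F (fst i) d ` (snd (fst i) ` (E \<inter> snd i \<inter> F -` fst d)))"
    using J(1) by (intro negligible_countable_Union) auto
  moreover have "snd d ` (F ` E \<inter> fst d) = (\<Union>i\<in>J. local_rep F (fst i) d ` (snd (fst i) ` (E \<inter> snd i \<inter> F -` fst d)))"
  proof (rule image_chart[OF d J(3)])
    fix i assume "i \<in> J"
    then have "i \<in> ?I" using J(2) by blast
    then show "fst i \<in> \<A> \<and> snd i \<subseteq> fst (fst i)" by (auto simp: case_prod_unfold)
  qed
  ultimately show "negligible (snd d ` (F ` E \<inter> fst d))" by simp
qed

lemma mnull_image: "mnull \<A> E \<Longrightarrow> mnull \<B> (F ` E)"
proof (rule mnull_image_local)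
  fix x assume "mnull \<A> E"
  then show "\<exists>c\<in>\<A>. \<exists>V. open V \<and> x \<in> V \<and> V \<subseteq> fst c \<and> negligible (snd c ` (E \<inter> V))"
    using M.chart_at[of x] chart_open[OF M.charts[OF M.chart_at(1)], of x] by (auto simp: mnull_def intro!: bexI[of _ "chart_at \<A> x"] exI[of _ "fst (chart_at \<A> x)"])
qed

text \<open>The image is a countable union over source charts, on each of which the representative
  of \<open>F\<close> preserves Lebesgue sets.\<close>

lemma lebesgue_sets_image:
  assumes "E \<in> lebesgue_sets \<A>"
  shows "F ` E \<in> lebesgue_sets \<B>"
  unfolding lebesgue_sets_def
proof (intro CollectI ballI)
  fix d assume d: "d \<in> \<B>"
  obtain J where J: "countable J" "J \<subseteq> \<A>" "(\<Union>c\<in>J. fst c) = UNIV"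
  proof (rule M.countable_atlas[of \<A> fst])
    show "\<exists>c\<in>\<A>. open (fst c) \<and> x \<in> fst c" for x using M.chart_ex[of x] chart_open[OF M.charts] by blast
  qed
  have "local_rep F c d ` (snd c ` (E \<inter> fst c \<inter> F -` fst d)) \<in> sets lebesgue" if "c \<in> J" for c
  proof (rule lebesgue_image_lipschitz_near)
    have c: "c \<in> \<A>" using that J by auto
    have "snd c ` (E \<inter> fst c) \<in> sets lebesgue" using assms c by (auto simp: lebesgue_sets_def)
    moreover have "snd c ` (fst c \<inter> F -` fst d) \<in> sets lebesgue"
      using open_chart_overlap[OF M.charts[OF c] N.charts[OF d] cont_F]
      by (simp add: borel_open sets_completionI_sets)
    ultimately have "snd c ` (E \<inter> fst c) \<inter> snd c ` (fst c \<inter> F -` fst d) \<in> sets lebesgue" by (rule sets.Int)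
    moreover have "snd c ` (E \<inter> fst c) \<inter> snd c ` (fst c \<inter> F -` fst d) = snd c ` (E \<inter> fst c \<inter> F -` fst d)"
      using chart_inj[OF M.charts[OF c]] by (auto simp: inj_on_def)
    ultimately show "snd c ` (E \<inter> fst c \<inter> F -` fst d) \<in> sets lebesgue" by simp
    show "lipschitz_near (local_rep F c d) z" if "z \<in> snd c ` (E \<inter> fst c \<inter> F -` fst d)" for z
      using that c d by (auto intro!: lip_F)
  qed
  then have "(\<Union>c\<in>J. local_rep F c d ` (snd c ` (E \<inter> fst c \<inter> F -` fst d))) \<in> sets lebesgue"
    using J(1) by (intro sets.countable_UN') auto
  moreover have "snd d ` (F ` E \<inter> fst d) = (\<Union>c\<in>J. local_rep F c d ` (snd c ` (E \<inter> fst c \<inter> F -` fst d)))"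
    by (rule image_chart[OF d J(3)]) (use J(2) in auto)
  ultimately show "snd d ` (F ` E \<inter> fst d) \<in> sets lebesgue" by simp
qed

definition diff_at :: "'m \<Rightarrow> bool" where
  "diff_at x \<longleftrightarrow> (\<forall>c\<in>\<A>. \<forall>d\<in>\<B>. x \<in> fst c \<longrightarrow> F x \<in> fst d \<longrightarrow> local_rep F c d differentiable (at (snd c x)))"

lemma change_charts:
  assumes c: "c \<in> \<A>" "c' \<in> \<A>" "x \<in> fst c" "x \<in> fst c'" and d: "d \<in> \<B>" "d' \<in> \<B>" "F x \<in> fst d" "F x \<in> fst d'"
    and D: "local_rep F c d differentiable (at (snd c x))"
  shows "local_rep F c' d' differentiable (at (snd c' x))"
    "jacobian F c' d' x = jacobian id d d' (F x) ** jacobian F c d x ** jacobian id c' c x"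
proof -
  have "local_rep (F \<circ> id) c' d differentiable (at (snd c' x))"
    "jacobian (F \<circ> id) c' d x = jacobian F c d (id x) ** jacobian id c' c x"
    using jacobian_compose[of c' c id x F d] c d D M.transition_differentiable[of c' c x] by auto
  then have 1: "local_rep F c' d differentiable (at (snd c' x))" "jacobian F c' d x = jacobian F c d x ** jacobian id c' c x"
    by simp_all
  have "local_rep (id \<circ> F) c' d' differentiable (at (snd c' x))"
    "jacobian (id \<circ> F) c' d' x = jacobian id d d' (F x) ** jacobian F c' d x"
    using jacobian_compose[of c' d F x id d'] c d 1(1) N.transition_differentiable[of d d' "F x"] cont_F by auto
  then show "local_rep F c' d' differentiable (at (snd c' x))"
    "jacobian F c' d' x = jacobian id d d' (F x) ** jacobian F c d x ** jacobian id c' c x"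
    using 1 by (simp_all add: matrix_mul_assoc)
qed

lemma diff_atI:
  "c \<in> \<A> \<Longrightarrow> x \<in> fst c \<Longrightarrow> d \<in> \<B> \<Longrightarrow> F x \<in> fst d \<Longrightarrow> local_rep F c d differentiable (at (snd c x)) \<Longrightarrow> diff_at x"
  unfolding diff_at_def using change_charts(1) by blast

lemma diff_atD:
  "diff_at x \<Longrightarrow> c \<in> \<A> \<Longrightarrow> x \<in> fst c \<Longrightarrow> d \<in> \<B> \<Longrightarrow> F x \<in> fst d \<Longrightarrow> local_rep F c d differentiable (at (snd c x))"
  unfolding diff_at_def by blast

end

text \<open>Smooth transition maps are locally Lipschitz, so independence of charts becomes the case
  of the identity map in the results on images.\<close>

sublocale smooth_manifold \<subseteq> ident: lip_homeo \<A> \<A> id id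
  by unfold_locales (auto intro: transition_lipschitz continuous_on_id)

context smooth_manifold
begin

lemma mnull_local:
  assumes "\<And>x. \<exists>c\<in>\<A>. \<exists>V. open V \<and> x \<in> V \<and> V \<subseteq> fst c \<and> negligible (snd c ` (E \<inter> V))"
  shows "mnull \<A> E"
  using ident.mnull_image_local[OF assms] by simp

end

context lip_homeo
begin

lemma mnull_not_diff: "mnull \<A> {x. \<not> diff_at x}"
proof (rule M.mnull_local)
  fix x
  let ?c = "chart_at \<A> x" and ?d = "chart_at \<B> (F x)"
  let ?V = "fst ?c \<inter> F -` fst ?d"
  have "open ?V" using cont_F by (intro open_Int open_vimage chart_open) auto
  moreover have "negligible (snd ?c ` ({x. \<not> diff_at x} \<inter> ?V))"
  proof (rule negligible_subset)
    show "negligible {y \<in> snd ?c ` ?V. \<not> local_rep F ?c ?d differentiable (at y)}"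
      by (rule Rademacher) (auto intro!: lip_F)
    show "snd ?c ` ({x. \<not> diff_at x} \<inter> ?V) \<subseteq> {y \<in> snd ?c ` ?V. \<not> local_rep F ?c ?d differentiable (at y)}"
      using diff_atI[of ?c _ ?d] by auto
  qed
  ultimately show "\<exists>c\<in>\<A>. \<exists>V. open V \<and> x \<in> V \<and> V \<subseteq> fst c \<and> negligible (snd c ` ({x. \<not> diff_at x} \<inter> V))"
    by (intro bexI[of _ ?c] exI[of _ ?V]) auto
qed

end

subsection \<open>Change of variables for locally Lipschitz maps\<close>

lemma nn_integral_lipschitz_image:
  fixes T T' :: "real ^ 'n \<Rightarrow> real ^ 'n::finite" and k :: "real ^ 'n \<Rightarrow> ennreal"
  assumes S: "S \<in> sets lebesgue" and inv: "\<And>x. x \<in> S \<Longrightarrow> T' (T x) = x"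
    and lip: "\<And>x. x \<in> S \<Longrightarrow> lipschitz_near T x" and lip': "\<And>y. y \<in> T ` S \<Longrightarrow> lipschitz_near T' y"
    and N: "negligible N" and D: "\<And>x. x \<in> S - N \<Longrightarrow> (T has_derivative D x) (at x)"
    and k: "(\<lambda>y. k y * indicator (T ` S) y) \<in> borel_measurable lebesgue"
  shows "(\<integral>\<^sup>+y. k y * indicator (T ` S) y \<partial>lebesgue)
    = (\<integral>\<^sup>+x. ennreal \<bar>det (matrix (D x))\<bar> * k (T x) * indicator (S - N) x \<partial>lebesgue)"
proof -
  define S0 where "S0 = S - N"
  have N': "N \<in> null_sets lebesgue" using N by (simp add: negligible_iff_null_sets)
  have S0: "S0 \<in> sets lebesgue" unfolding S0_def using S N' by auto
  define w where "w x = (if x \<in> S0 then \<bar>det (matrix (D x))\<bar> else 0)" for x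
  \<comment> \<open>A total map agreeing with \<open>T\<close> on \<open>S0\<close>, as needed for
    an image measure; the value 0 elsewhere carries no mass because \<open>w\<close> vanishes
    there.\<close>
  define U where "U x = (if x \<in> S0 then T x else 0)" for x
  have inj: "inj_on T S" using inv by (rule inj_on_inverseI)
  have sub: "S0 \<subseteq> S" by (auto simp: S0_def)
  note E = emeasure_differentiable_image[where T = T and T' = D]
  have w: "w \<in> borel_measurable lebesgue"
    unfolding w_def[abs_def] by (rule E(2)[OF S0]) (use D inj sub in \<open>auto simp: S0_def intro: inj_on_subset\<close>)
  have TS0: "T ` S0 \<in> sets lebesgue"
    by (rule lebesgue_image_lipschitz_near[OF S0]) (use lip sub in auto)
  \<comment> \<open>Preimages under \<open>T\<close> are images under the Lipschitz inverse
    \<open>T'\<close>, hence Lebesgue measurable, even for Lebesgue sets \<open>B\<close> that are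
    not Borel.\<close>
  have pre: "T' ` (B \<inter> T ` S0) \<in> sets lebesgue \<and> T' ` (B \<inter> T ` S0) = S0 \<inter> T -` B" if "B \<in> sets lebesgue" for B
  proof
    show "T' ` (B \<inter> T ` S0) \<in> sets lebesgue"
      by (rule lebesgue_image_lipschitz_near) (use that TS0 lip' sub in auto)
    show "T' ` (B \<inter> T ` S0) = S0 \<inter> T -` B"
    proof (intro set_eqI iffI)
      fix x assume "x \<in> S0 \<inter> T -` B"
      then show "x \<in> T' ` (B \<inter> T ` S0)" using inv[of x] sub by (intro image_eqI[of _ _ "T x"]) auto
    qed (use inv sub in auto)
  qed
  have U: "U \<in> lebesgue \<rightarrow>\<^sub>M lebesgue"
  proof (rule measurableI)
    fix B :: "(real ^ 'n) set" assume B: "B \<in> sets lebesgue"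
    have "U -` B = (S0 \<inter> T -` B) \<union> (if 0 \<in> B then - S0 else {})" by (auto simp: U_def split: if_splits)
    moreover have "\<dots> \<in> sets lebesgue" using pre[OF B] S0 by (auto simp: Compl_in_sets_lebesgue)
    ultimately show "U -` B \<inter> space lebesgue \<in> sets lebesgue" by simp
  qed simp
  have dist: "distr (density lebesgue (\<lambda>x. ennreal (w x))) lebesgue U = density lebesgue (indicator (T ` S0))"
  proof (rule measure_eqI)
    fix B assume "B \<in> sets (distr (density lebesgue (\<lambda>x. ennreal (w x))) lebesgue U)"
    then have B: "B \<in> sets lebesgue" by simp
    let ?P = "S0 \<inter> T -` B"
    have P: "?P \<in> sets lebesgue" using pre[OF B] by metis
    have "emeasure (distr (density lebesgue (\<lambda>x. ennreal (w x))) lebesgue U) B = (\<integral>\<^sup>+x. ennreal (w x) * indicator (U -` B) x \<partial>lebesgue)"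
      using B U w measurable_sets[OF U B] by (simp add: emeasure_distr emeasure_density)
    also have "\<dots> = (\<integral>\<^sup>+x. ennreal (if x \<in> ?P then \<bar>det (matrix (D x))\<bar> else 0) \<partial>lebesgue)"
      by (intro nn_integral_cong) (auto simp: w_def U_def indicator_def)
    also have "\<dots> = emeasure lebesgue (T ` ?P)"
      by (rule E(3)[OF P, symmetric]) (use D inj sub in \<open>auto simp: S0_def intro: inj_on_subset\<close>)
    also have "T ` ?P = T ` S0 \<inter> B" by auto
    also have "emeasure lebesgue (T ` S0 \<inter> B) = emeasure (density lebesgue (indicator (T ` S0))) B"
      using B TS0 by (simp add: emeasure_density nn_integral_indicator flip: indicator_inter_arith)
    finally show "emeasure (distr (density lebesgue (\<lambda>x. ennreal (w x))) lebesgue U) B = emeasure (density lebesgue (indicator (T ` S0))) B" .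
  qed simp
  let ?k = "\<lambda>y. k y * indicator (T ` S) y"
  have nul: "T ` (S \<inter> N) \<in> null_sets lebesgue"
    using negligible_image_lipschitz_near[of "S \<inter> N" T] lip N negligible_Int
    by (auto simp: negligible_iff_null_sets[symmetric])
  have "(\<integral>\<^sup>+y. ?k y \<partial>lebesgue) = (\<integral>\<^sup>+y. indicator (T ` S0) y * ?k y \<partial>lebesgue)"
  proof (rule nn_integral_cong_AE)
    have "AE y in lebesgue. y \<notin> T ` (S \<inter> N)" using nul by (rule AE_not_in)
    then show "AE y in lebesgue. ?k y = indicator (T ` S0) y * ?k y"
      by eventually_elim (auto simp: S0_def indicator_def)
  qed
  also have "\<dots> = (\<integral>\<^sup>+y. ?k y \<partial>density lebesgue (indicator (T ` S0)))"
    using k TS0 by (subst nn_integral_density) auto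
  also have "\<dots> = (\<integral>\<^sup>+y. ?k y \<partial>distr (density lebesgue (\<lambda>x. ennreal (w x))) lebesgue U)" by (simp only: dist)
  also have "\<dots> = (\<integral>\<^sup>+x. ?k (U x) \<partial>density lebesgue (\<lambda>x. ennreal (w x)))"
    using k U by (subst nn_integral_distr) auto
  also have "\<dots> = (\<integral>\<^sup>+x. ennreal (w x) * ?k (U x) \<partial>lebesgue)"
    using w measurable_compose[OF U k] by (subst nn_integral_density) auto
  also have "\<dots> = (\<integral>\<^sup>+x. ennreal \<bar>det (matrix (D x))\<bar> * k (T x) * indicator (S - N) x \<partial>lebesgue)"
    by (intro nn_integral_cong) (auto simp: w_def U_def S0_def indicator_def)
  finally show ?thesis .
qed

subsection \<open>Positive definite matrices\<close>

definition posdef :: "real ^ 'n ^ 'n \<Rightarrow> bool" where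
  "posdef G \<longleftrightarrow> transpose G = G \<and> (\<forall>v. v \<noteq> 0 \<longrightarrow> v \<bullet> (G *v v) > 0)"

lemma continuous_on_det: "continuous_on S f \<Longrightarrow> continuous_on S (\<lambda>x. det (f x :: real ^ 'n ^ 'n))"
  unfolding det_def by (intro continuous_intros)

lemma posdef_det_nonzero: "(\<And>v. v \<noteq> 0 \<Longrightarrow> v \<bullet> (G *v v) > 0) \<Longrightarrow> det (G :: real ^ 'n ^ 'n) \<noteq> 0"
proof -
  assume pos: "\<And>v. v \<noteq> 0 \<Longrightarrow> v \<bullet> (G *v v) > 0"
  have "invertible G" unfolding invertible_left_inverse matrix_left_invertible_ker using pos by force
  then show ?thesis by (simp add: invertible_det_nz)
qed

text \<open>The determinant does not vanish on the segment from the identity matrix.\<close>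

lemma posdef_det_pos:
  fixes G :: "real ^ 'n ^ 'n"
  assumes "posdef G" shows "det G > 0"
proof (rule ccontr)
  assume "\<not> det G > 0"
  define H where "H t = (1 - t) *\<^sub>R mat 1 + t *\<^sub>R G" for t :: real
  have pos: "v \<bullet> (H t *v v) > 0" if "0 \<le> t" "t \<le> 1" "v \<noteq> 0" for t v
  proof -
    have "v \<bullet> (H t *v v) = (1 - t) * (v \<bullet> v) + t * (v \<bullet> (G *v v))"
      by (simp add: H_def matrix_vector_mult_add_rdistrib scaleR_matrix_vector_assoc[symmetric] inner_add_right)
    moreover have "v \<bullet> v > 0" "v \<bullet> (G *v v) > 0" using assms that by (auto simp: posdef_def)
    ultimately show ?thesis using that
      by (cases "t = 0") (auto intro!: add_nonneg_pos mult_nonneg_nonneg)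
  qed
  have c: "continuous_on {0..1} (\<lambda>t. - det (H t))"
    unfolding H_def by (intro continuous_intros continuous_on_det)
  have "\<exists>t\<ge>0. t \<le> 1 \<and> - det (H t) = 0"
    by (rule IVT') (use c \<open>\<not> det G > 0\<close> in \<open>auto simp: H_def\<close>)
  then obtain t where "0 \<le> t" "t \<le> 1" "det (H t) = 0" by auto
  then show False using posdef_det_nonzero[of "H t"] pos by blast
qed

lemma posdef_invertible: "posdef G \<Longrightarrow> invertible (G :: real ^ 'n ^ 'n)"
  using posdef_det_pos[of G] by (simp add: invertible_det_nz)

lemma inner_transpose: "(x :: real ^ 'n) \<bullet> (A *v y) = (transpose A *v x) \<bullet> y"
  by (simp only: transpose_matrix_vector dot_lmul_matrix)

lemma congruence_quadratic: "v \<bullet> ((transpose J ** H ** J) *v v) = (J *v v) \<bullet> (H *v (J *v (v :: real ^ 'n)))"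
proof -
  have "v \<bullet> ((transpose J ** H ** J) *v v) = v \<bullet> (transpose J *v (H *v (J *v v)))"
    by (simp add: matrix_vector_mul_assoc matrix_mul_assoc)
  also have "\<dots> = (J *v v) \<bullet> (H *v (J *v v))"
    by (simp only: inner_transpose[of v "transpose J"] transpose_transpose)
  finally show ?thesis .
qed

lemma transpose_congruence: "transpose H = H \<Longrightarrow> transpose (transpose J ** H ** J) = transpose J ** H ** (J :: real ^ 'n ^ 'n)"
  by (simp add: matrix_transpose_mul transpose_transpose matrix_mul_assoc)

lemma posdef_congruence:
  fixes J :: "real ^ 'n ^ 'n"
  assumes "posdef H" "K ** J = mat 1"
  shows "posdef (transpose J ** H ** J)"
  unfolding posdef_def
proof (intro conjI allI impI)
  show "transpose (transpose J ** H ** J) = transpose J ** H ** J"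
    using assms by (intro transpose_congruence) (simp add: posdef_def)
  fix v :: "real ^ 'n" assume "v \<noteq> 0"
  have "K *v (J *v v) = v" using assms(2) by (simp add: matrix_vector_mul_assoc)
  then have "J *v v \<noteq> 0" using \<open>v \<noteq> 0\<close> by auto
  then show "v \<bullet> ((transpose J ** H ** J) *v v) > 0"
    unfolding congruence_quadratic using assms(1) by (simp add: posdef_def)
qed

lemma sqrt_det_congruence: "sqrt (det (transpose J ** H ** J)) = \<bar>det J\<bar> * sqrt (det (H :: real ^ 'n ^ 'n))"
proof -
  have "det (transpose J ** H ** J) = (det J)\<^sup>2 * det H" by (simp add: det_mul det_transpose power2_eq_square)
  then show ?thesis by (simp add: real_sqrt_mult)
qed

subsection \<open>The Riemannian measure\<close>

definition chart_density :: "('m, 'n::finite) metric_field \<Rightarrow> ('m, 'n) chart \<Rightarrow> 'm set \<Rightarrow> ennreal" where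
  "chart_density g c E = (\<integral>\<^sup>+y\<in>snd c ` E. ennreal (sqrt (det (g c (chart_inv c y)))) \<partial>lebesgue)"

definition is_riem_measure :: "('m, 'n::finite) chart set \<Rightarrow> ('m, 'n) metric_field \<Rightarrow> 'm measure \<Rightarrow> bool" where
  "is_riem_measure \<A> g \<mu> \<longleftrightarrow> space \<mu> = UNIV \<and> sets \<mu> = lebesgue_sets \<A> \<and>
     (\<forall>c\<in>\<A>. \<forall>E\<in>lebesgue_sets \<A>. E \<subseteq> fst c \<longrightarrow> emeasure \<mu> E = chart_density g c E)"

lemma is_riem_measureD:
  "is_riem_measure \<A> g \<mu> \<Longrightarrow> c \<in> \<A> \<Longrightarrow> E \<in> lebesgue_sets \<A> \<Longrightarrow> E \<subseteq> fst c \<Longrightarrow> emeasure \<mu> E = chart_density g c E"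
  by (simp add: is_riem_measure_def)

lemma riem_measure_THE: "riem_measure \<A> g = (THE \<mu>. is_riem_measure \<A> g \<mu>)"
  unfolding riem_measure_def is_riem_measure_def chart_density_def ..

text \<open>Positivity is not part of it: a pulled back metric is zero at points where the map is
  not differentiable.\<close>

definition tensorial :: "('m::topological_space, 'n::finite) chart set \<Rightarrow> ('m, 'n) metric_field \<Rightarrow> bool" where
  "tensorial \<A> g \<longleftrightarrow> (\<forall>c\<in>\<A>. \<forall>d\<in>\<A>. \<forall>x\<in>fst c \<inter> fst d.
     g c x = transpose (jacobian id c d x) ** g d x ** jacobian id c d x) \<and> (\<forall>c\<in>\<A>. chart_measurable c (g c))"

lemma chart_measurable_iff:
  fixes f :: "'m::topological_space \<Rightarrow> 'b::euclidean_space"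
  assumes c: "is_chart (c :: ('m, 'n::finite) chart)"
  shows "chart_measurable c f \<longleftrightarrow> (\<lambda>y. if y \<in> snd c ` fst c then f (chart_inv c y) else 0) \<in> borel_measurable lebesgue"
proof -
  have "open (snd c ` fst c)" using c by (simp add: is_chart_def)
  then have "snd c ` fst c \<in> sets lebesgue" by (simp add: borel_open sets_completionI_sets)
  then show ?thesis unfolding chart_measurable_def by (simp add: borel_measurable_if)
qed

lemma borel_measurable_det: "det \<in> borel_measurable (borel :: (real ^ 'n ^ 'n) measure)"
  using continuous_on_det[OF continuous_on_id] by (intro borel_measurable_continuous_onI) auto

lemma chart_density_measurable:
  assumes c: "is_chart c" and g: "chart_measurable c (g c)" and E: "E \<subseteq> fst c" "snd c ` E \<in> sets lebesgue"
  shows "(\<lambda>y. ennreal (sqrt (det (g c (chart_inv c y)))) * indicator (snd c ` E) y) \<in> borel_measurable lebesgue"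
proof -
  have "(\<lambda>y. if y \<in> snd c ` fst c then g c (chart_inv c y) else 0) \<in> borel_measurable lebesgue"
    using g chart_measurable_iff[OF c] by blast
  from measurable_compose[OF this borel_measurable_det]
  have "(\<lambda>y. ennreal (sqrt (det (if y \<in> snd c ` fst c then g c (chart_inv c y) else 0))) * indicator (snd c ` E) y) \<in> borel_measurable lebesgue"
    using E(2) by measurable
  moreover have "(\<lambda>y. ennreal (sqrt (det (if y \<in> snd c ` fst c then g c (chart_inv c y) else 0))) * indicator (snd c ` E) y)
      = (\<lambda>y. ennreal (sqrt (det (g c (chart_inv c y)))) * indicator (snd c ` E) y)"
    using E(1) by (auto simp: indicator_def fun_eq_iff)
  ultimately show ?thesis by simp
qed

text \<open>The exceptional null set is a parameter: it is empty for the identity, the set of points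
  of non-differentiability for a pulled back metric, and has to be adapted when the direction is
  reversed.\<close>

locale metric_iso = lip_homeo \<A> \<B> F G
  for \<A> :: "('m::{t2_space, second_countable_topology}, 'n::finite) chart set"
    and \<B> :: "('k::{t2_space, second_countable_topology}, 'n) chart set" and F G +
  fixes g :: "('m, 'n) metric_field" and h :: "('k, 'n) metric_field" and Z :: "'m set"
  assumes tensorial_g: "tensorial \<A> g" and tensorial_h: "tensorial \<B> h"
    and Z: "mnull \<A> Z" and diff_off_Z: "x \<notin> Z \<Longrightarrow> diff_at x"
    and isometry: "x \<notin> Z \<Longrightarrow> c \<in> \<A> \<Longrightarrow> d \<in> \<B> \<Longrightarrow> x \<in> fst c \<Longrightarrow> F x \<in> fst d \<Longrightarrow>
      g c x = transpose (jacobian F c d x) ** h d (F x) ** jacobian F c d x"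
begin

text \<open>The isometry relation makes the square root of the determinant of \<open>g\<close> equal
  to the Jacobian factor times that of \<open>h\<close>, which is the integrand in the change of
  variables.\<close>

lemma chart_density_image:
  assumes c: "c \<in> \<A>" and d: "d \<in> \<B>" and E: "E \<in> lebesgue_sets \<A>" "E \<subseteq> fst c" "F ` E \<subseteq> fst d"
  shows "chart_density h d (F ` E) = chart_density g c E"
proof -
  let ?T = "local_rep F c d" and ?T' = "local_rep G d c"
  let ?S = "snd c ` E" and ?N = "snd c ` (Z \<inter> fst c)"
  have S: "?S \<in> sets lebesgue" using E c unfolding lebesgue_sets_def by (metis (mono_tags, lifting) Int_absorb2 mem_Collect_eq)
  have N: "negligible ?N" using Z c by (simp add: mnull_def)
  have Tx: "?T (snd c x) = snd d (F x)" "?T' (snd d (F x)) = snd c x" if "x \<in> E" for x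
    using that E c d by (auto simp: local_rep_apply image_subset_iff subset_iff)
  have TS: "?T ` ?S = snd d ` F ` E" using Tx(1) by (simp add: image_image cong: image_cong)
  have img: "snd d ` F ` E \<in> sets lebesgue"
  proof -
    have "F ` E \<in> lebesgue_sets \<B>" by (rule lebesgue_sets_image[OF E(1)])
    then show ?thesis using d E(3) unfolding lebesgue_sets_def by (metis (mono_tags, lifting) Int_absorb2 mem_Collect_eq)
  qed
  let ?k = "\<lambda>y. ennreal (sqrt (det (h d (chart_inv d y))))"
  have offZ: "x \<notin> Z" if "x \<in> E" "snd c x \<notin> ?N" for x using that E by auto
  have "chart_density h d (F ` E) = (\<integral>\<^sup>+y. ?k y * indicator (?T ` ?S) y \<partial>lebesgue)"
    by (simp add: chart_density_def TS)
  also have "\<dots> = (\<integral>\<^sup>+y. ennreal \<bar>det (matrix ((*v) (jacobian F c d (chart_inv c y))))\<bar> * ?k (?T y) * indicator (?S - ?N) y \<partial>lebesgue)"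
  proof (rule nn_integral_lipschitz_image[OF S _ _ _ N])
    show "?T' (?T y) = y" if "y \<in> ?S" for y using that Tx by auto
    show "lipschitz_near ?T y" if "y \<in> ?S" for y using that E c d by (auto intro!: lip_F)
    show "lipschitz_near ?T' y" if "y \<in> ?T ` ?S" for y using that E c d unfolding TS by (auto intro!: lip_G)
    show "(?T has_derivative (*v) (jacobian F c d (chart_inv c y))) (at y)" if y: "y \<in> ?S - ?N" for y
    proof -
      obtain x where x: "x \<in> E" "y = snd c x" using y by auto
      then have "diff_at x" using y offZ diff_off_Z by blast
      then have "?T differentiable (at (snd c x))" using x E c d by (intro diff_atD) auto
      moreover have "chart_inv c y = x" using x E c by auto
      ultimately show ?thesis using local_rep_has_jacobian x by simp
    qed
    show "(\<lambda>y. ?k y * indicator (?T ` ?S) y) \<in> borel_measurable lebesgue"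
      unfolding TS using d E(3) img tensorial_h by (intro chart_density_measurable) (auto simp: tensorial_def)
  qed
  also have "\<dots> = chart_density g c E"
    unfolding chart_density_def
  proof (rule nn_integral_cong_AE)
    have "?N \<in> null_sets lebesgue" using N by (simp add: negligible_iff_null_sets)
    then have "AE y in lebesgue. y \<notin> ?N" by (rule AE_not_in)
    then show "AE y in lebesgue. ennreal \<bar>det (matrix ((*v) (jacobian F c d (chart_inv c y))))\<bar> * ?k (?T y) * indicator (?S - ?N) y
        = ennreal (sqrt (det (g c (chart_inv c y)))) * indicator ?S y"
    proof eventually_elim
      case (elim y)
      show ?case
      proof (cases "y \<in> ?S")
        case True
        then obtain x where x: "x \<in> E" "y = snd c x" by auto
        have ci: "chart_inv c y = x" "chart_inv d (?T y) = F x"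
          using x E c d Tx(1)[of x] by auto
        have "g c x = transpose (jacobian F c d x) ** h d (F x) ** jacobian F c d x"
          using x E c d elim offZ by (intro isometry) auto
        then have "sqrt (det (g c x)) = \<bar>det (jacobian F c d x)\<bar> * sqrt (det (h d (F x)))"
          by (simp add: sqrt_det_congruence)
        then show ?thesis using True elim by (simp add: ci ennreal_mult' indicator_def)
      qed (auto simp: indicator_def)
    qed
  qed
  finally show ?thesis .
qed

end

context smooth_manifold
begin

lemma lebesgue_setsD: "E \<in> lebesgue_sets \<A> \<Longrightarrow> c \<in> \<A> \<Longrightarrow> E \<subseteq> fst c \<Longrightarrow> snd c ` E \<in> sets lebesgue"
  unfolding lebesgue_sets_def by (metis (mono_tags, lifting) Int_absorb2 mem_Collect_eq)

lemma sigma_algebra_lebesgue_sets: "sigma_algebra UNIV (lebesgue_sets \<A>)"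
  unfolding sigma_algebra_iff2
proof (intro conjI ballI allI impI)
  show "{} \<in> lebesgue_sets \<A>" by (simp add: lebesgue_sets_def)
  fix E assume E: "E \<in> lebesgue_sets \<A>"
  show "UNIV - E \<in> lebesgue_sets \<A>"
    unfolding lebesgue_sets_def
  proof (intro CollectI ballI)
    fix c assume c: "c \<in> \<A>"
    have "snd c ` ((UNIV - E) \<inter> fst c) = snd c ` fst c - snd c ` (E \<inter> fst c)"
      using chart_inj[OF charts[OF c]] by (auto simp: inj_on_def)
    moreover have "open (snd c ` fst c)" using charts[OF c] by (simp add: is_chart_def)
    ultimately show "snd c ` ((UNIV - E) \<inter> fst c) \<in> sets lebesgue"
      using E c by (auto simp: lebesgue_sets_def borel_open sets_completionI_sets)
  qed
next
  fix E :: "nat \<Rightarrow> 'm set" assume E: "range E \<subseteq> lebesgue_sets \<A>"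
  show "(\<Union>i. E i) \<in> lebesgue_sets \<A>"
    unfolding lebesgue_sets_def
  proof (intro CollectI ballI)
    fix c assume c: "c \<in> \<A>"
    have "snd c ` ((\<Union>i. E i) \<inter> fst c) = (\<Union>i. snd c ` (E i \<inter> fst c))" by auto
    moreover have "snd c ` (E i \<inter> fst c) \<in> sets lebesgue" for i
      using E c by (auto simp: lebesgue_sets_def image_subset_iff)
    ultimately show "snd c ` ((\<Union>i. E i) \<inter> fst c) \<in> sets lebesgue" by auto
  qed
qed simp

interpretation ls: sigma_algebra UNIV "lebesgue_sets \<A>" by (rule sigma_algebra_lebesgue_sets)

lemma open_lebesgue_sets: "open V \<Longrightarrow> V \<in> lebesgue_sets \<A>"
  unfolding lebesgue_sets_def
proof (intro CollectI ballI)
  fix c assume "open V" "c \<in> \<A>"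
  then have "open (snd c ` (V \<inter> fst c))" by (intro chart_open_image open_Int chart_open) auto
  then show "snd c ` (V \<inter> fst c) \<in> sets lebesgue" by (simp add: borel_open sets_completionI_sets)
qed

lemma mnull_lebesgue_sets: "mnull \<A> E \<Longrightarrow> E \<in> lebesgue_sets \<A>"
  unfolding mnull_def lebesgue_sets_def by (auto simp: negligible_iff_null_sets)

text \<open>Reduces statements about global measures and measurability to countably many disjoint
  pieces, each inside a prescribed open set such as a chart domain.\<close>

lemma disjoint_cover:
  assumes "\<And>x. \<exists>i\<in>I. open (V i) \<and> x \<in> V i"
  obtains i :: "nat \<Rightarrow> 'i" and D :: "nat \<Rightarrow> 'm set" where "\<And>n. i n \<in> I" "\<And>n. D n \<subseteq> V (i n)"
    "\<And>n. D n \<in> lebesgue_sets \<A>" "disjoint_family D" "(\<Union>n. D n) = UNIV"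
proof -
  obtain J where J: "countable J" "J \<subseteq> I" "\<And>j. j \<in> J \<Longrightarrow> open (V j)" "(\<Union>j\<in>J. V j) = UNIV"
    using countable_atlas[of I V] assms by blast
  have ne: "J \<noteq> {}" using J(4) by auto
  \<comment> \<open>If \<open>J\<close> is finite the enumeration repeats itself;
    \<open>disjointed\<close> turns the repetitions into empty pieces.\<close>
  define i where "i = from_nat_into J"
  have ran: "range i = J" using range_from_nat_into[OF ne J(1)] by (simp add: i_def)
  show thesis
  proof (rule that[of i "disjointed (\<lambda>n. V (i n))"])
    show "i n \<in> I" for n using ran J(2) by auto
    show "disjointed (\<lambda>n. V (i n)) n \<subseteq> V (i n)" for n by (rule disjointed_subset)
    have "range (\<lambda>n. V (i n)) \<subseteq> lebesgue_sets \<A>"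
      using ran J(3) by (auto intro!: open_lebesgue_sets)
    then show "disjointed (\<lambda>n. V (i n)) n \<in> lebesgue_sets \<A>" for n
      using ls.range_disjointed_sets by blast
    show "disjoint_family (disjointed (\<lambda>n. V (i n)))" by (rule disjoint_family_disjointed)
    have "(\<Union>n. V (i n)) = (\<Union>j\<in>range i. V j)" by blast
    then show "(\<Union>n. disjointed (\<lambda>n. V (i n)) n) = UNIV" using J(4) ran by (simp add: UN_disjointed_eq)
  qed
qed

lemma chart_cover:
  obtains c :: "nat \<Rightarrow> ('m, 'n) chart" and D :: "nat \<Rightarrow> 'm set" where "\<And>n. c n \<in> \<A>" "\<And>n. D n \<subseteq> fst (c n)" "\<And>n. D n \<in> lebesgue_sets \<A>"
     "disjoint_family D" "(\<Union>n. D n) = UNIV"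
proof (rule disjoint_cover[of \<A> fst])
  show "\<exists>c\<in>\<A>. open (fst c) \<and> x \<in> fst c" for x using chart_ex[of x] chart_open[OF charts] by blast
qed (rule that)

lemma chart_density_suminf:
  assumes g: "tensorial \<A> g" and c: "c \<in> \<A>" and E: "\<And>n. E n \<in> lebesgue_sets \<A>" "\<And>n. E n \<subseteq> fst c" "disjoint_family E"
  shows "(\<Sum>n. chart_density g c (E n)) = chart_density g c (\<Union>n. E n)"
proof -
  let ?k = "\<lambda>y. ennreal (sqrt (det (g c (chart_inv c y))))"
  have "(\<Sum>n. chart_density g c (E n)) = (\<integral>\<^sup>+y. (\<Sum>n. ?k y * indicator (snd c ` E n) y) \<partial>lebesgue)"
    unfolding chart_density_def
  proof (rule nn_integral_suminf[symmetric])
    show "(\<lambda>y. ?k y * indicator (snd c ` E n) y) \<in> borel_measurable lebesgue" for n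
      using g c E lebesgue_setsD by (intro chart_density_measurable) (auto simp: tensorial_def)
  qed
  also have "\<dots> = chart_density g c (\<Union>n. E n)"
    unfolding chart_density_def
  proof (rule nn_integral_cong)
    fix y
    have "disjoint_family (\<lambda>n. snd c ` E n)"
      using E(2,3) chart_inj[OF charts[OF c]] unfolding disjoint_family_on_def inj_on_def by blast
    then have "(\<Sum>n. indicator (snd c ` E n) y :: ennreal) = indicator (\<Union>n. snd c ` E n) y"
      by (rule suminf_indicator)
    then show "(\<Sum>n. ?k y * indicator (snd c ` E n) y) = ?k y * indicator (snd c ` (\<Union>n. E n)) y"
      by (simp add: image_UN)
  qed
  finally show ?thesis .
qed

text \<open>With this instance, \<open>chart_density_image\<close> states that the density of a set
  lying in two charts is the same in both.\<close>

lemma metric_iso_id: "tensorial \<A> g \<Longrightarrow> metric_iso \<A> \<A> id id g g {}"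
proof
  assume g: "tensorial \<A> g"
  then show "tensorial \<A> g" .
  show "mnull \<A> {}" by simp
  show "ident.diff_at x" for x
    unfolding ident.diff_at_def using transition_differentiable by simp
  show "g c x = transpose (jacobian id c d x) ** g d (id x) ** jacobian id c d x"
    if "c \<in> \<A>" "d \<in> \<A>" "x \<in> fst c" "id x \<in> fst d" for x c d
    using g[unfolded tensorial_def, THEN conjunct1, rule_format, OF that(1,2), of x] that(3,4) by simp
qed

lemma riem_measure_unique:
  assumes "is_riem_measure \<A> g \<mu>" "is_riem_measure \<A> g \<nu>"
  shows "\<mu> = \<nu>"
proof -
  obtain c :: "nat \<Rightarrow> ('m, 'n) chart" and D :: "nat \<Rightarrow> 'm set" where cD: "\<And>n. c n \<in> \<A>" "\<And>n. D n \<subseteq> fst (c n)" "\<And>n. D n \<in> lebesgue_sets \<A>"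
     "disjoint_family D" "(\<Union>n. D n) = UNIV"
    by (rule chart_cover) (rule that)
  have *: "emeasure \<mu> E = (\<Sum>n. chart_density g (c n) (E \<inter> D n))" if "is_riem_measure \<A> g \<mu>" "E \<in> lebesgue_sets \<A>" for \<mu> E
  proof -
    have s: "sets \<mu> = lebesgue_sets \<A>" using that by (simp add: is_riem_measure_def)
    have "E = (\<Union>n. E \<inter> D n)" using cD(5) by auto
    then have "emeasure \<mu> E = emeasure \<mu> (\<Union>n. E \<inter> D n)" by simp
    also have "\<dots> = (\<Sum>n. emeasure \<mu> (E \<inter> D n))"
    proof (rule suminf_emeasure[symmetric])
      show "disjoint_family (\<lambda>n. E \<inter> D n)" using cD(4) unfolding disjoint_family_on_def by blast
    qed (use cD(3) that(2) s in auto)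
    also have "\<dots> = (\<Sum>n. chart_density g (c n) (E \<inter> D n))"
    proof (rule suminf_cong)
      fix n
      have "E \<inter> D n \<subseteq> fst (c n)" using cD(2)[of n] by auto
      then show "emeasure \<mu> (E \<inter> D n) = chart_density g (c n) (E \<inter> D n)"
        using that(2) cD(3) by (intro is_riem_measureD[OF that(1) cD(1)]) auto
    qed
    finally show ?thesis .
  qed
  show ?thesis
  proof (rule measure_eqI)
    show "sets \<mu> = sets \<nu>" using assms by (simp add: is_riem_measure_def)
    show "emeasure \<mu> E = emeasure \<nu> E" if "E \<in> sets \<mu>" for E
    proof -
      have "E \<in> lebesgue_sets \<A>" using that assms(1) by (simp add: is_riem_measure_def)
      then show ?thesis using *[OF assms(1)] *[OF assms(2)] by simp
    qed
  qed
qed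

text \<open>The measure is the sum of chart densities over a disjoint cover. It has the prescribed
  value in an arbitrary chart \<open>d\<close> because on each piece the density of the covering
  chart may be exchanged for that of \<open>d\<close>.\<close>

lemma riem_measure_exists:
  assumes g: "tensorial \<A> g"
  shows "\<exists>\<mu>. is_riem_measure \<A> g \<mu>"
proof -
  obtain c :: "nat \<Rightarrow> ('m, 'n) chart" and D :: "nat \<Rightarrow> 'm set" where cD: "\<And>n. c n \<in> \<A>" "\<And>n. D n \<subseteq> fst (c n)" "\<And>n. D n \<in> lebesgue_sets \<A>"
     "disjoint_family D" "(\<Union>n. D n) = UNIV"
    by (rule chart_cover) (rule that)
  define m where "m E = (\<Sum>n. chart_density g (c n) (E \<inter> D n))" for E
  define \<mu> where "\<mu> = measure_of UNIV (lebesgue_sets \<A>) m"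
  have s: "sets \<mu> = lebesgue_sets \<A>" "space \<mu> = UNIV"
    unfolding \<mu>_def by (auto simp: ls.sets_measure_of_eq)
  have em: "emeasure \<mu> E = m E" if "E \<in> lebesgue_sets \<A>" for E
  proof (rule emeasure_measure_of[OF \<mu>_def])
    show "positive (sets \<mu>) m" by (simp add: positive_def m_def chart_density_def)
    show "countably_additive (sets \<mu>) m"
    proof (rule countably_additiveI)
      fix E :: "nat \<Rightarrow> 'm set" assume E: "range E \<subseteq> sets \<mu>" "disjoint_family E"
      \<comment> \<open>One of the sums is read as an integral over counting measure, so that the
        double sum may be exchanged.\<close>
      have "(\<Sum>i. m (E i)) = (\<integral>\<^sup>+n. (\<Sum>i. chart_density g (c n) (E i \<inter> D n)) \<partial>count_space UNIV)"
        unfolding m_def by (subst nn_integral_suminf) (auto simp: nn_integral_count_space_nat)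
      also have "\<dots> = (\<integral>\<^sup>+n. chart_density g (c n) (\<Union>i. E i \<inter> D n) \<partial>count_space UNIV)"
      proof (rule nn_integral_cong)
        fix n
        show "(\<Sum>i. chart_density g (c n) (E i \<inter> D n)) = chart_density g (c n) (\<Union>i. E i \<inter> D n)"
        proof (rule chart_density_suminf[OF g cD(1)])
          show "E i \<inter> D n \<in> lebesgue_sets \<A>" for i using E(1) cD(3) s by auto
          show "E i \<inter> D n \<subseteq> fst (c n)" for i using cD(2)[of n] by auto
          show "disjoint_family (\<lambda>i. E i \<inter> D n)" using E(2) unfolding disjoint_family_on_def by blast
        qed
      qed
      also have "\<dots> = m (\<Union>i. E i)"
        unfolding m_def by (simp add: nn_integral_count_space_nat Int_UN_distrib2 flip: UN_extend_simps)
      finally show "(\<Sum>i. m (E i)) = m (\<Union>i. E i)" .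
    qed
    show "E \<in> sets \<mu>" using that s by simp
  qed (simp add: ls.space_closed)
  have "is_riem_measure \<A> g \<mu>"
    unfolding is_riem_measure_def
  proof (intro conjI ballI impI s)
    fix d E assume d: "d \<in> \<A>" and E: "E \<in> lebesgue_sets \<A>" "E \<subseteq> fst d"
    interpret I: metric_iso \<A> \<A> id id g g "{}" by (rule metric_iso_id[OF g])
    have "emeasure \<mu> E = (\<Sum>n. chart_density g (c n) (E \<inter> D n))" using em[OF E(1)] by (simp add: m_def)
    also have "\<dots> = (\<Sum>n. chart_density g d (E \<inter> D n))"
    proof (rule suminf_cong)
      fix n
      show "chart_density g (c n) (E \<inter> D n) = chart_density g d (E \<inter> D n)"
        using I.chart_density_image[OF d cD(1)[of n], of "E \<inter> D n"] E cD(2)[of n] cD(3)[of n] by auto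
    qed
    also have "\<dots> = chart_density g d (\<Union>n. E \<inter> D n)"
    proof (rule chart_density_suminf[OF g d])
      show "disjoint_family (\<lambda>n. E \<inter> D n)" using cD(4) unfolding disjoint_family_on_def by blast
    qed (use E cD(3) in auto)
    also have "(\<Union>n. E \<inter> D n) = E" using cD(5) by auto
    finally show "emeasure \<mu> E = chart_density g d E" .
  qed
  then show ?thesis by blast
qed

lemma riem_measure:
  assumes "tensorial \<A> g"
  shows "space (riem_measure \<A> g) = UNIV" "sets (riem_measure \<A> g) = lebesgue_sets \<A>"
    "c \<in> \<A> \<Longrightarrow> E \<in> lebesgue_sets \<A> \<Longrightarrow> E \<subseteq> fst c \<Longrightarrow> emeasure (riem_measure \<A> g) E = chart_density g c E"
proof -
  have "is_riem_measure \<A> g (riem_measure \<A> g)"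
    unfolding riem_measure_THE
  proof (rule theI')
    obtain \<mu> where "is_riem_measure \<A> g \<mu>" using riem_measure_exists[OF assms] by blast
    then show "\<exists>!\<mu>. is_riem_measure \<A> g \<mu>"
      by (intro ex1I[of _ \<mu>]) (auto intro: riem_measure_unique)
  qed
  then show "space (riem_measure \<A> g) = UNIV" "sets (riem_measure \<A> g) = lebesgue_sets \<A>"
    "c \<in> \<A> \<Longrightarrow> E \<in> lebesgue_sets \<A> \<Longrightarrow> E \<subseteq> fst c \<Longrightarrow> emeasure (riem_measure \<A> g) E = chart_density g c E"
    by (simp_all add: is_riem_measure_def)
qed

end

context metric_iso
begin

text \<open>The cover is indexed by pairs of charts, so that on each piece a single chart serves the
  source and a single chart serves the image.\<close>

lemma emeasure_image:
  assumes E: "E \<in> lebesgue_sets \<A>"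
  shows "emeasure (riem_measure \<B> h) (F ` E) = emeasure (riem_measure \<A> g) E"
proof -
  let ?I = "\<A> \<times> \<B>" and ?V = "\<lambda>(c, d). fst c \<inter> F -` fst d"
  have "\<exists>i\<in>?I. open (?V i) \<and> x \<in> ?V i" for x
    by (rule bexI[of _ "(chart_at \<A> x, chart_at \<B> (F x))"])
      (auto intro!: open_Int open_vimage chart_open cont_F)
  then obtain i and D :: "nat \<Rightarrow> 'm set" where iD: "\<And>n. i n \<in> ?I" "\<And>n. D n \<subseteq> ?V (i n)" "\<And>n. D n \<in> lebesgue_sets \<A>"
     "disjoint_family D" "(\<Union>n. D n) = UNIV"
    by (rule M.disjoint_cover[of ?I ?V]) (rule that)
  interpret ls: sigma_algebra UNIV "lebesgue_sets \<A>" by (rule M.sigma_algebra_lebesgue_sets)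
  note R = M.riem_measure[OF tensorial_g] and R' = N.riem_measure[OF tensorial_h]
  have sub: "D n \<subseteq> fst (fst (i n))" "F ` D n \<subseteq> fst (snd (i n))" "fst (i n) \<in> \<A>" "snd (i n) \<in> \<B>" for n
    using iD(1)[of n] iD(2)[of n] by (auto simp: case_prod_unfold)
  have EU: "(\<Union>n. E \<inter> D n) = E" using iD(5) by auto
  have dj: "disjoint_family (\<lambda>n. E \<inter> D n)" using iD(4) unfolding disjoint_family_on_def by blast
  have ED: "E \<inter> D n \<in> lebesgue_sets \<A>" for n using E iD(3) by auto
  have "emeasure (riem_measure \<B> h) (F ` E) = emeasure (riem_measure \<B> h) (\<Union>n. F ` (E \<inter> D n))"
    by (simp only: image_UN[symmetric] EU)
  also have "\<dots> = (\<Sum>n. emeasure (riem_measure \<B> h) (F ` (E \<inter> D n)))"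
  proof (rule suminf_emeasure[symmetric])
    show "range (\<lambda>n. F ` (E \<inter> D n)) \<subseteq> sets (riem_measure \<B> h)"
      using ED lebesgue_sets_image by (auto simp: R')
    have "inj F" by (metis GF injI)
    then show "disjoint_family (\<lambda>n. F ` (E \<inter> D n))"
      using iD(4) unfolding disjoint_family_on_def inj_on_def by blast
  qed
  also have "\<dots> = (\<Sum>n. emeasure (riem_measure \<A> g) (E \<inter> D n))"
  proof (rule suminf_cong)
    fix n
    have "emeasure (riem_measure \<B> h) (F ` (E \<inter> D n)) = chart_density h (snd (i n)) (F ` (E \<inter> D n))"
      using sub[of n] by (intro R'(3) lebesgue_sets_image ED) auto
    also have "\<dots> = chart_density g (fst (i n)) (E \<inter> D n)"
      using sub[of n] by (intro chart_density_image ED) auto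
    also have "\<dots> = emeasure (riem_measure \<A> g) (E \<inter> D n)"
      using sub[of n] by (intro R(3)[symmetric] ED) auto
    finally show "emeasure (riem_measure \<B> h) (F ` (E \<inter> D n)) = emeasure (riem_measure \<A> g) (E \<inter> D n)" .
  qed
  also have "\<dots> = emeasure (riem_measure \<A> g) (\<Union>n. E \<inter> D n)"
    using ED dj by (intro suminf_emeasure) (auto simp: R)
  also have "(\<Union>n. E \<inter> D n) = E" by (rule EU)
  finally show ?thesis .
qed

lemma image_eq_vimage: "F ` E = G -` E"
proof (intro set_eqI iffI)
  fix y assume "y \<in> G -` E"
  then show "y \<in> F ` E" by (intro image_eqI[of _ _ "G y"]) auto
qed auto

lemma measurable_G: "G \<in> riem_measure \<B> h \<rightarrow>\<^sub>M riem_measure \<A> g"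
proof (rule measurableI)
  fix E assume "E \<in> sets (riem_measure \<A> g)"
  then have "E \<in> lebesgue_sets \<A>" by (simp add: M.riem_measure[OF tensorial_g])
  then have "F ` E \<in> lebesgue_sets \<B>" by (rule lebesgue_sets_image)
  moreover have "F ` E = G -` E" by (rule image_eq_vimage)
  ultimately show "G -` E \<inter> space (riem_measure \<B> h) \<in> sets (riem_measure \<B> h)" by (simp add: N.riem_measure[OF tensorial_h])
qed (simp add: M.riem_measure[OF tensorial_g])

lemma distr_G: "distr (riem_measure \<B> h) (riem_measure \<A> g) G = riem_measure \<A> g"
proof (rule measure_eqI)
  fix E assume "E \<in> sets (distr (riem_measure \<B> h) (riem_measure \<A> g) G)"
  then have E: "E \<in> sets (riem_measure \<A> g)" by simp
  have "G -` E = F ` E" by (rule image_eq_vimage[symmetric])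
  then show "emeasure (distr (riem_measure \<B> h) (riem_measure \<A> g) G) E = emeasure (riem_measure \<A> g) E"
    using E by (simp add: emeasure_distr[OF measurable_G] N.riem_measure[OF tensorial_h] M.riem_measure[OF tensorial_g] emeasure_image)
qed simp

end

subsection \<open>The inner product on covectors\<close>

lemma pull_covector_add: "pull_covector J (\<zeta> + \<eta>) = pull_covector J \<zeta> + pull_covector J \<eta>"
  and pull_covector_diff: "pull_covector J (\<zeta> - \<eta>) = pull_covector J \<zeta> - pull_covector J \<eta>"
  and pull_covector_scale: "pull_covector J (k *s \<zeta>) = k *s pull_covector J \<zeta>"
  and pull_covector_zero [simp]: "pull_covector J 0 = 0"
  by (simp_all add: pull_covector_def vec_eq_iff distrib_left right_diff_distrib sum.distrib sum_subtractf
      sum_distrib_left mult_ac)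

lemma pull_covector_mult: "pull_covector (A ** B) \<zeta> = pull_covector B (pull_covector A \<zeta>)"
proof -
  have "(\<Sum>i\<in>UNIV. complex_of_real ((A ** B) $ i $ j) * \<zeta> $ i)
     = (\<Sum>i\<in>UNIV. complex_of_real (B $ i $ j) * (\<Sum>l\<in>UNIV. complex_of_real (A $ l $ i) * \<zeta> $ l))" for j
  proof -
    have "(\<Sum>i\<in>UNIV. complex_of_real ((A ** B) $ i $ j) * \<zeta> $ i)
      = (\<Sum>i\<in>UNIV. \<Sum>k\<in>UNIV. complex_of_real (B $ k $ j) * (complex_of_real (A $ i $ k) * \<zeta> $ i))"
      by (simp add: matrix_matrix_mult_def sum_distrib_left sum_distrib_right mult_ac)
    also have "\<dots> = (\<Sum>k\<in>UNIV. \<Sum>i\<in>UNIV. complex_of_real (B $ k $ j) * (complex_of_real (A $ i $ k) * \<zeta> $ i))"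
      by (rule sum.swap)
    finally show ?thesis by (simp add: sum_distrib_left)
  qed
  then show ?thesis by (simp add: pull_covector_def vec_eq_iff)
qed

lemma pull_covector_id [simp]: "pull_covector (mat 1) \<zeta> = \<zeta>"
proof -
  have "(\<Sum>i\<in>UNIV. complex_of_real (mat 1 $ i $ j) * \<zeta> $ i) = (\<Sum>i\<in>UNIV. if i = j then \<zeta> $ i else 0)" for j
    by (intro sum.cong) (auto simp: mat_def)
  then show ?thesis by (simp add: pull_covector_def vec_eq_iff)
qed

lemma matrix_inv_works:
  assumes "invertible (G :: real ^ 'n ^ 'n)"
  shows "matrix_inv G ** G = mat 1" "G ** matrix_inv G = mat 1"
proof -
  have "\<exists>H. G ** H = mat 1 \<and> H ** G = mat 1" using assms by (simp add: invertible_def)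
  then have "G ** matrix_inv G = mat 1 \<and> matrix_inv G ** G = mat 1" unfolding matrix_inv_def by (rule someI_ex)
  then show "matrix_inv G ** G = mat 1" "G ** matrix_inv G = mat 1" by auto
qed

lemma matrix_inv_unique_right: "G ** H = mat 1 \<Longrightarrow> matrix_inv (G :: real ^ 'n ^ 'n) = H"
  by (metis invertible_def matrix_inv_works(1) matrix_left_right_inverse matrix_mul_assoc matrix_mul_lid matrix_mul_rid)

text \<open>Covectors are pulled back by the transpose of \<open>J\<close>, and the inverse Gram
  matrix becomes \<open>K ** matrix_inv H ** transpose K\<close>, so all Jacobian factors
  cancel.\<close>

lemma cov_inner_congruence:
  fixes H J K :: "real ^ 'n ^ 'n"
  assumes H: "invertible H" and KJ: "K ** J = mat 1"
  shows "cov_inner (transpose J ** H ** J) (pull_covector J \<zeta>) (pull_covector J \<eta>) = cov_inner H \<zeta> \<eta>"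
proof -
  have JK: "J ** K = mat 1" using KJ matrix_left_right_inverse by blast
  have tt: "transpose J ** transpose K = mat 1" using KJ by (metis matrix_transpose_mul transpose_mat)
  have inv: "matrix_inv (transpose J ** H ** J) = K ** matrix_inv H ** transpose K"
  proof (rule matrix_inv_unique_right)
    have "(transpose J ** H ** J) ** (K ** matrix_inv H ** transpose K)
        = transpose J ** H ** (J ** K) ** matrix_inv H ** transpose K" by (simp add: matrix_mul_assoc)
    also have "\<dots> = transpose J ** (H ** matrix_inv H) ** transpose K" by (simp add: JK matrix_mul_assoc)
    also have "\<dots> = mat 1" by (simp add: matrix_inv_works[OF H] tt)
    finally show "(transpose J ** H ** J) ** (K ** matrix_inv H ** transpose K) = mat 1" .
  qed
  have gen: "cov_inner P \<alpha> \<beta> = (\<Sum>i\<in>UNIV. \<alpha> $ i * cnj (\<Sum>j\<in>UNIV. complex_of_real (matrix_inv P $ i $ j) * \<beta> $ j))"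
    for P :: "real ^ 'n ^ 'n" and \<alpha> \<beta>
    unfolding cov_inner_def by (simp add: sum_distrib_left mult_ac)
  let ?M = "matrix_inv H"
  define vm where "vm A \<alpha> = (\<chi> i. \<Sum>j\<in>UNIV. complex_of_real (A $ i $ j) * \<alpha> $ j)" for A :: "real ^ 'n ^ 'n" and \<alpha> :: "complex ^ 'n"
  have vm_pull: "vm A \<alpha> = pull_covector (transpose A) \<alpha>" for A \<alpha>
    by (simp add: vm_def pull_covector_def transpose_def vec_eq_iff)
  have vm_mult: "vm (A ** B) \<alpha> = vm A (vm B \<alpha>)" for A B \<alpha>
    by (simp add: vm_pull matrix_transpose_mul pull_covector_mult)
  have adj: "(\<Sum>i\<in>UNIV. pull_covector A \<alpha> $ i * cnj (\<beta> $ i)) = (\<Sum>i\<in>UNIV. \<alpha> $ i * cnj (vm A \<beta> $ i))" for A \<alpha> \<beta>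
  proof -
    have "(\<Sum>i\<in>UNIV. pull_covector A \<alpha> $ i * cnj (\<beta> $ i)) = (\<Sum>i\<in>UNIV. \<Sum>l\<in>UNIV. complex_of_real (A $ l $ i) * \<alpha> $ l * cnj (\<beta> $ i))"
      by (simp add: pull_covector_def sum_distrib_right)
    also have "\<dots> = (\<Sum>l\<in>UNIV. \<Sum>i\<in>UNIV. complex_of_real (A $ l $ i) * \<alpha> $ l * cnj (\<beta> $ i))" by (rule sum.swap)
    finally show ?thesis by (simp add: vm_def sum_distrib_left mult_ac)
  qed
  have "cov_inner (transpose J ** H ** J) (pull_covector J \<zeta>) (pull_covector J \<eta>)
      = (\<Sum>i\<in>UNIV. pull_covector J \<zeta> $ i * cnj (vm (K ** ?M ** transpose K) (pull_covector J \<eta>) $ i))"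
    by (simp add: gen inv vm_def)
  also have "\<dots> = (\<Sum>i\<in>UNIV. \<zeta> $ i * cnj (vm J (vm (K ** ?M ** transpose K) (pull_covector J \<eta>)) $ i))"
    by (rule adj)
  also have "vm J (vm (K ** ?M ** transpose K) (pull_covector J \<eta>)) = vm ((J ** K) ** ?M) (pull_covector (J ** K) \<eta>)"
    by (simp add: vm_mult[symmetric] matrix_mul_assoc)
      (simp add: vm_mult vm_pull[of "transpose K"] transpose_transpose pull_covector_mult)
  also have "\<dots> = vm ?M \<eta>" by (simp add: JK)
  finally show ?thesis by (simp add: gen vm_def)
qed

lemma cov_inner_add_left: "cov_inner G (\<zeta> + \<zeta>') \<eta> = cov_inner G \<zeta> \<eta> + cov_inner G \<zeta>' \<eta>"
  and cov_inner_add_right: "cov_inner G \<zeta> (\<eta> + \<eta>') = cov_inner G \<zeta> \<eta> + cov_inner G \<zeta> \<eta>'"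
  and cov_inner_diff_left: "cov_inner G (\<zeta> - \<zeta>') \<eta> = cov_inner G \<zeta> \<eta> - cov_inner G \<zeta>' \<eta>"
  and cov_inner_diff_right: "cov_inner G \<zeta> (\<eta> - \<eta>') = cov_inner G \<zeta> \<eta> - cov_inner G \<zeta> \<eta>'"
  and cov_inner_minus: "cov_inner G (- \<zeta>) (- \<zeta>) = cov_inner G \<zeta> \<zeta>"
  and cov_inner_zero [simp]: "cov_inner G 0 \<eta> = 0"
  by (simp_all add: cov_inner_def distrib_left distrib_right left_diff_distrib right_diff_distrib sum.distrib sum_subtractf)

lemma cov_inner_scale: "cov_inner G (k *s \<zeta>) (k *s \<zeta>) = complex_of_real ((cmod k)\<^sup>2) * cov_inner G \<zeta> \<zeta>"
proof -
  have "k * cnj k = complex_of_real ((cmod k)\<^sup>2)" by (simp only: complex_norm_square)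
  then have *: "complex_of_real (matrix_inv G $ i $ j) * (k * \<zeta> $ i) * cnj (k * \<zeta> $ j)
     = complex_of_real ((cmod k)\<^sup>2) * (complex_of_real (matrix_inv G $ i $ j) * \<zeta> $ i * cnj (\<zeta> $ j))" for i j
    by (simp add: algebra_simps)
  show ?thesis by (simp only: cov_inner_def vector_smult_component sum_distrib_left *)
qed

text \<open>For w = G^{-1} a the form of the inverse at \<open>a\<close> equals the form of
  \<open>G\<close> at w.\<close>

lemma posdef_matrix_inv:
  assumes "posdef (G :: real ^ 'n ^ 'n)"
  shows "transpose (matrix_inv G) = matrix_inv G" "a \<bullet> (matrix_inv G *v a) \<ge> 0" "a \<bullet> (matrix_inv G *v a) = 0 \<Longrightarrow> a = 0"
proof -
  note inv = matrix_inv_works[OF posdef_invertible[OF assms]]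
  have sym: "transpose G = G" using assms by (simp add: posdef_def)
  have "transpose (matrix_inv G) ** G = mat 1" using inv(2) sym by (metis matrix_transpose_mul transpose_mat)
  then show ts: "transpose (matrix_inv G) = matrix_inv G"
    using inv(2) by (metis matrix_mul_assoc matrix_mul_lid matrix_mul_rid)
  let ?w = "matrix_inv G *v a"
  have a: "G *v ?w = a" using inv by (simp add: matrix_vector_mul_assoc)
  then have eq: "a \<bullet> ?w = ?w \<bullet> (G *v ?w)" by (simp add: inner_commute)
  show "a \<bullet> ?w \<ge> 0" unfolding eq using assms by (cases "?w = 0") (auto simp: posdef_def less_imp_le)
  show "a = 0" if "a \<bullet> ?w = 0"
  proof (rule ccontr)
    assume "a \<noteq> 0"
    then have "?w \<noteq> 0" using a by auto
    then show False using that assms unfolding eq posdef_def by force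
  qed
qed

definition re_vec :: "complex ^ 'n \<Rightarrow> real ^ 'n" where "re_vec \<zeta> = (\<chi> i. Re (\<zeta> $ i))"
definition im_vec :: "complex ^ 'n \<Rightarrow> real ^ 'n" where "im_vec \<zeta> = (\<chi> i. Im (\<zeta> $ i))"

text \<open>Symmetry of the inverse cancels the mixed terms, which reduces complex covectors to two
  real ones.\<close>

lemma cov_inner_real_parts:
  assumes "transpose (matrix_inv G) = matrix_inv (G :: real ^ 'n ^ 'n)"
  shows "cov_inner G \<zeta> \<zeta> = complex_of_real (re_vec \<zeta> \<bullet> (matrix_inv G *v re_vec \<zeta>) + im_vec \<zeta> \<bullet> (matrix_inv G *v im_vec \<zeta>))"
proof -
  let ?M = "matrix_inv G"
  have sym: "?M $ i $ j = ?M $ j $ i" for i j using arg_cong[OF assms, of "\<lambda>M. M $ j $ i"] by (simp add: transpose_def)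
  have quad: "a \<bullet> (?M *v b) = (\<Sum>i\<in>UNIV. \<Sum>j\<in>UNIV. ?M $ i $ j * a $ i * b $ j)" for a b
    by (simp add: inner_vec_def matrix_vector_mult_def sum_distrib_left mult_ac)
  have anti: "(\<Sum>i\<in>UNIV. \<Sum>j\<in>UNIV. ?M $ i $ j * Im (\<zeta> $ i) * Re (\<zeta> $ j)) = (\<Sum>i\<in>UNIV. \<Sum>j\<in>UNIV. ?M $ i $ j * Re (\<zeta> $ i) * Im (\<zeta> $ j))"
  proof -
    have *: "?M $ i $ j * Im (\<zeta> $ i) * Re (\<zeta> $ j) = ?M $ j $ i * Re (\<zeta> $ j) * Im (\<zeta> $ i)" for i j
      unfolding sym[of i j] by simp
    show ?thesis by (subst sum.swap) (intro sum.cong refl *)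
  qed
  show ?thesis
  proof (rule complex_eqI)
    show "Re (cov_inner G \<zeta> \<zeta>) = Re (complex_of_real (re_vec \<zeta> \<bullet> (?M *v re_vec \<zeta>) + im_vec \<zeta> \<bullet> (?M *v im_vec \<zeta>)))"
      by (simp add: cov_inner_def quad re_vec_def im_vec_def sum.distrib[symmetric] algebra_simps)
    have "Im (cov_inner G \<zeta> \<zeta>) = (\<Sum>i\<in>UNIV. \<Sum>j\<in>UNIV. ?M $ i $ j * Im (\<zeta> $ i) * Re (\<zeta> $ j)) - (\<Sum>i\<in>UNIV. \<Sum>j\<in>UNIV. ?M $ i $ j * Re (\<zeta> $ i) * Im (\<zeta> $ j))"
      by (simp add: cov_inner_def sum_subtractf[symmetric] algebra_simps)
    then show "Im (cov_inner G \<zeta> \<zeta>) = Im (complex_of_real (re_vec \<zeta> \<bullet> (?M *v re_vec \<zeta>) + im_vec \<zeta> \<bullet> (?M *v im_vec \<zeta>)))"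
      using anti by simp
  qed
qed

lemma posdef_cov_inner:
  assumes "posdef (G :: real ^ 'n ^ 'n)"
  shows "cov_inner G \<zeta> \<zeta> = complex_of_real (Re (cov_inner G \<zeta> \<zeta>))" "Re (cov_inner G \<zeta> \<zeta>) \<ge> 0"
    "Re (cov_inner G \<zeta> \<zeta>) = 0 \<Longrightarrow> \<zeta> = 0"
proof -
  note p = posdef_matrix_inv[OF assms]
  note r = cov_inner_real_parts[OF p(1)]
  show "cov_inner G \<zeta> \<zeta> = complex_of_real (Re (cov_inner G \<zeta> \<zeta>))" by (simp only: r Re_complex_of_real)
  show "Re (cov_inner G \<zeta> \<zeta>) \<ge> 0" unfolding r using p(2) by simp
  assume "Re (cov_inner G \<zeta> \<zeta>) = 0"
  then have "re_vec \<zeta> \<bullet> (matrix_inv G *v re_vec \<zeta>) = 0" "im_vec \<zeta> \<bullet> (matrix_inv G *v im_vec \<zeta>) = 0"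
    unfolding r using p(2)[of "re_vec \<zeta>"] p(2)[of "im_vec \<zeta>"] by auto
  then have "re_vec \<zeta> = 0" "im_vec \<zeta> = 0" using p(3) by auto
  then show "\<zeta> = 0" by (simp add: vec_eq_iff re_vec_def im_vec_def complex_eq_iff)
qed

text \<open>By the parallelogram identity the difference of the two sides is the form at
  \<open>\<zeta> - \<eta>\<close>.\<close>

lemma posdef_cov_inner_quasi:
  assumes "posdef G"
  shows "Re (cov_inner G (\<zeta> + \<eta>) (\<zeta> + \<eta>)) \<le> 2 * Re (cov_inner G \<zeta> \<zeta>) + 2 * Re (cov_inner G \<eta> \<eta>)"
  using posdef_cov_inner(2)[OF assms, of "\<zeta> - \<eta>"]
  by (simp add: cov_inner_add_left cov_inner_add_right cov_inner_diff_left cov_inner_diff_right)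

text \<open>Cramer's rule applied to a unit vector. Unlike the inverse chosen by
  \<open>matrix_inv\<close>, the right-hand side is visibly measurable in \<open>G\<close>.\<close>

lemma matrix_inv_cofactor:
  assumes "det (G :: real ^ 'n ^ 'n) \<noteq> 0"
  shows "matrix_inv G $ i $ j = det (\<chi> k l. if l = i then (if k = j then 1 else 0) else G $ k $ l) / det G"
proof -
  have inv: "G ** matrix_inv G = mat 1" using assms by (intro matrix_inv_works) (simp add: invertible_det_nz)
  have "G *v (matrix_inv G *v axis j 1) = axis j 1" by (simp add: matrix_vector_mul_assoc inv)
  then have "matrix_inv G *v axis j 1 = (\<chi> i. det (\<chi> k l. if l = i then axis j 1 $ k else G $ k $ l) / det G)"
    using cramer[OF assms] by blast
  then have "(matrix_inv G *v axis j 1) $ i = det (\<chi> k l. if l = i then axis j 1 $ k else G $ k $ l) / det G"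
    by simp
  moreover have "(matrix_inv G *v axis j 1) $ i = matrix_inv G $ i $ j"
    by (simp add: matrix_vector_mul_component inner_axis)
  moreover have "(\<chi> k l. if l = i then axis j 1 $ k else G $ k $ l) = (\<chi> k l. if l = i then (if k = j then 1 else 0) else G $ k $ l)"
    by (auto simp: vec_eq_iff axis_def)
  ultimately show ?thesis by simp
qed

subsection \<open>Rough metrics\<close>

text \<open>For symmetric matrices this is, up to the constant, two-sided comparability with the
  Euclidean form. Bounded entries control determinants, and the lower bound on the form controls the
  inverse.\<close>

definition comparable :: "real \<Rightarrow> real ^ 'n ^ 'n \<Rightarrow> bool" where
  "comparable C G \<longleftrightarrow> (\<forall>i j. \<bar>G $ i $ j\<bar> \<le> C) \<and> (\<forall>v. v \<bullet> v \<le> C * (v \<bullet> (G *v v)))"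

text \<open>Symmetry is required everywhere, comparability only off a null set; positive
  definiteness holds where comparability does.\<close>

definition rough_metric :: "('m::topological_space, 'n::finite) chart set \<Rightarrow> ('m, 'n) metric_field \<Rightarrow> bool" where
  "rough_metric \<A> g \<longleftrightarrow> tensorial \<A> g \<and> (\<forall>c\<in>\<A>. \<forall>x\<in>fst c. transpose (g c x) = g c x) \<and>
     (\<forall>x. \<exists>c\<in>\<A>. \<exists>V C. open V \<and> x \<in> V \<and> V \<subseteq> fst c \<and> C > 0 \<and> mnull \<A> {y \<in> V. \<not> comparable C (g c y)})"

lemma comparable_posdef: "comparable C G \<Longrightarrow> C > 0 \<Longrightarrow> transpose G = G \<Longrightarrow> posdef G"
  unfolding comparable_def posdef_def
  by (metis inner_gt_zero_iff less_le_trans zero_less_mult_iff less_asym)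

text \<open>A column \<open>?v\<close> of the inverse is mapped by \<open>G\<close> to a unit
  vector, so the lower bound gives |v|^2 \<le> C |v|.\<close>

lemma comparable_matrix_inv:
  assumes "comparable C (G :: real ^ 'n ^ 'n)" "invertible G"
  shows "\<bar>matrix_inv G $ i $ j\<bar> \<le> C"
proof -
  let ?v = "matrix_inv G *v axis j 1"
  have C: "0 \<le> C" using assms(1) unfolding comparable_def by (meson abs_ge_zero order_trans)
  have Gv: "G *v ?v = axis j 1" using matrix_inv_works[OF assms(2)] by (simp add: matrix_vector_mul_assoc)
  have "(norm ?v)\<^sup>2 \<le> C * (?v \<bullet> axis j 1)"
    using assms(1) Gv unfolding comparable_def power2_norm_eq_inner by metis
  also have "\<dots> \<le> C * norm ?v"
    using norm_cauchy_schwarz[of ?v "axis j 1"] C by (intro mult_left_mono) auto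
  finally have "norm ?v \<le> C"
    by (cases "norm ?v = 0") (use C in \<open>auto simp: power2_eq_square\<close>)
  moreover have "\<bar>?v $ i\<bar> \<le> norm ?v" by (rule component_le_norm_cart)
  moreover have "?v $ i = matrix_inv G $ i $ j" by (simp add: matrix_vector_mul_component inner_axis)
  ultimately show ?thesis by simp
qed

lemma comparable_cov_inner:
  assumes "comparable C (G :: real ^ 'n ^ 'n)" "invertible G"
  shows "Re (cov_inner G \<zeta> \<zeta>) \<le> C * (\<Sum>i\<in>UNIV. norm (\<zeta> $ i))\<^sup>2"
proof -
  have "Re (cov_inner G \<zeta> \<zeta>) \<le> norm (cov_inner G \<zeta> \<zeta>)" by (rule complex_Re_le_cmod)
  also have "\<dots> \<le> (\<Sum>i\<in>UNIV. \<Sum>j\<in>UNIV. C * (norm (\<zeta> $ i) * norm (\<zeta> $ j)))"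
    unfolding cov_inner_def
  proof (intro sum_norm_le)
    fix i j
    have "norm (complex_of_real (matrix_inv G $ i $ j) * \<zeta> $ i * cnj (\<zeta> $ j)) = \<bar>matrix_inv G $ i $ j\<bar> * (norm (\<zeta> $ i) * norm (\<zeta> $ j))"
      by (simp add: norm_mult)
    also have "\<dots> \<le> C * (norm (\<zeta> $ i) * norm (\<zeta> $ j))"
      by (intro mult_right_mono comparable_matrix_inv assms) auto
    finally show "norm (complex_of_real (matrix_inv G $ i $ j) * \<zeta> $ i * cnj (\<zeta> $ j)) \<le> C * (norm (\<zeta> $ i) * norm (\<zeta> $ j))" .
  qed
  also have "\<dots> = C * (\<Sum>i\<in>UNIV. norm (\<zeta> $ i))\<^sup>2"
    unfolding power2_eq_square sum_product by (simp add: sum_distrib_left)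
  finally show ?thesis .
qed

lemma comparable_det: "comparable C (G :: real ^ 'n ^ 'n) \<Longrightarrow> \<bar>det G\<bar> \<le> fact CARD('n) * C ^ CARD('n)"
proof -
  assume a: "comparable C G"
  have C: "0 \<le> C" using a unfolding comparable_def by (meson abs_ge_zero order_trans)
  have "\<bar>det G\<bar> \<le> (\<Sum>p | p permutes (UNIV :: 'n set). \<bar>of_int (sign p) * (\<Prod>i\<in>UNIV. G $ i $ p i)\<bar>)"
    unfolding det_def by (rule sum_abs)
  also have "\<dots> \<le> (\<Sum>p | p permutes (UNIV :: 'n set). C ^ CARD('n))"
  proof (rule sum_mono)
    fix p :: "'n \<Rightarrow> 'n"
    have "(\<Prod>i\<in>UNIV. \<bar>G $ i $ p i\<bar>) \<le> (\<Prod>i\<in>(UNIV::'n set). C)"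
      using a by (intro prod_mono) (auto simp: comparable_def)
    then show "\<bar>of_int (sign p) * (\<Prod>i\<in>UNIV. G $ i $ p i)\<bar> \<le> C ^ CARD('n)"
      by (simp add: abs_mult abs_prod flip: of_int_abs)
  qed
  also have "\<dots> = fact CARD('n) * C ^ CARD('n)" by (simp add: card_permutations[OF refl])
  finally show ?thesis .
qed

lemma measurable_AE_eq:
  assumes "complete_measure M" and f: "f \<in> M \<rightarrow>\<^sub>M N" and ae: "AE x in M. f x = f' x" and sp: "\<And>x. x \<in> space M \<Longrightarrow> f' x \<in> space N"
  shows "f' \<in> M \<rightarrow>\<^sub>M N"
proof (rule measurableI[OF sp])
  interpret complete_measure M by fact
  fix S assume S: "S \<in> sets N"
  obtain Z where Z: "Z \<in> null_sets M" "{x \<in> space M. f x \<noteq> f' x} \<subseteq> Z" using ae by (auto simp: eventually_ae_filter)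
  have "f' -` S \<inter> space M = (f -` S \<inter> space M - Z) \<union> (f' -` S \<inter> space M \<inter> Z)" using Z(2) by auto
  moreover have "f' -` S \<inter> space M \<inter> Z \<in> sets M" using complete Z(1) by (meson Int_lower2)
  ultimately show "f' -` S \<inter> space M \<in> sets M" using measurable_sets[OF f S] null_setsD2[OF Z(1)] by (metis sets.Diff sets.Un)
qed

locale rough_manifold = smooth_manifold \<A>
  for \<A> :: "('m::{t2_space, second_countable_topology}, 'n::finite) chart set" +
  fixes g :: "('m, 'n) metric_field"
  assumes rough: "rough_metric \<A> g"
begin

abbreviation "\<mu> \<equiv> riem_measure \<A> g"

lemma tensorial: "tensorial \<A> g" using rough by (simp add: rough_metric_def)

lemmas space_\<mu> [simp] = riem_measure(1)[OF tensorial]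
lemmas sets_\<mu> = riem_measure(2)[OF tensorial]
lemmas emeasure_\<mu> = riem_measure(3)[OF tensorial]

definition good :: "'m \<Rightarrow> bool" where
  "good x \<longleftrightarrow> (\<forall>c\<in>\<A>. x \<in> fst c \<longrightarrow> posdef (g c x))"

lemma g_change: "c \<in> \<A> \<Longrightarrow> d \<in> \<A> \<Longrightarrow> x \<in> fst c \<Longrightarrow> x \<in> fst d \<Longrightarrow>
    g c x = transpose (jacobian id c d x) ** g d x ** jacobian id c d x"
  using tensorial[unfolded tensorial_def, THEN conjunct1, rule_format, of c d x] by simp

lemma goodI: "c \<in> \<A> \<Longrightarrow> x \<in> fst c \<Longrightarrow> posdef (g c x) \<Longrightarrow> good x"
  unfolding good_def using posdef_congruence[OF _ jacobian_id_inverse] g_change by metis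

lemma mnull_not_good: "mnull \<A> {x. \<not> good x}"
proof (rule mnull_local)
  fix x
  obtain c V C where cV: "c \<in> \<A>" "open V" "x \<in> V" "V \<subseteq> fst c" "C > 0" "mnull \<A> {y \<in> V. \<not> comparable C (g c y)}"
    using rough unfolding rough_metric_def by meson
  have "good y" if "y \<in> V" "comparable C (g c y)" for y
    using that cV rough by (intro goodI[of c] comparable_posdef[of C]) (auto simp: rough_metric_def)
  then have sub: "{x. \<not> good x} \<inter> V \<subseteq> {y \<in> V. \<not> comparable C (g c y)} \<inter> fst c" using cV by auto
  have "negligible (snd c ` ({y \<in> V. \<not> comparable C (g c y)} \<inter> fst c))" using cV(1,6) unfolding mnull_def by blast
  then have "negligible (snd c ` ({x. \<not> good x} \<inter> V))"
    by (rule negligible_subset) (rule image_mono[OF sub])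
  then show "\<exists>c\<in>\<A>. \<exists>V. open V \<and> x \<in> V \<and> V \<subseteq> fst c \<and> negligible (snd c ` ({x. \<not> good x} \<inter> V))"
    using cV by blast
qed

text \<open>The density is positive at good points, and almost all points are good, so a set of
  measure zero has negligible images in all charts.\<close>

lemma null_sets_iff: "E \<in> null_sets \<mu> \<longleftrightarrow> mnull \<A> E"
proof
  assume E: "mnull \<A> E"
  obtain c :: "nat \<Rightarrow> ('m, 'n) chart" and D :: "nat \<Rightarrow> 'm set" where cD: "\<And>n. c n \<in> \<A>" "\<And>n. D n \<subseteq> fst (c n)"
     "\<And>n. D n \<in> lebesgue_sets \<A>" "disjoint_family D" "(\<Union>n. D n) = UNIV"
    by (rule chart_cover) (rule that)
  have "E \<inter> D n \<in> null_sets \<mu>" for n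
  proof (rule null_setsI)
    have m: "mnull \<A> (E \<inter> D n)" by (rule mnull_subset[OF E]) auto
    then have ls: "E \<inter> D n \<in> lebesgue_sets \<A>" by (rule mnull_lebesgue_sets)
    then show "E \<inter> D n \<in> sets \<mu>" by (simp add: sets_\<mu>)
    have "E \<inter> D n \<inter> fst (c n) = E \<inter> D n" using cD(2)[of n] by auto
    then have "snd (c n) ` (E \<inter> D n) \<in> null_sets lebesgue"
      using m cD(1)[of n] unfolding mnull_def negligible_iff_null_sets by metis
    then have "chart_density g (c n) (E \<inter> D n) = 0" unfolding chart_density_def by (rule nn_integral_null_set)
    then show "emeasure \<mu> (E \<inter> D n) = 0" using emeasure_\<mu>[OF cD(1)[of n] ls] cD(2)[of n] by (simp add: le_infI2)
  qed
  then have "(\<Union>n. E \<inter> D n) \<in> null_sets \<mu>" by (rule null_sets_UN)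
  moreover have "(\<Union>n. E \<inter> D n) = E" using cD(5) by auto
  ultimately show "E \<in> null_sets \<mu>" by simp
next
  assume E: "E \<in> null_sets \<mu>"
  show "mnull \<A> E" unfolding mnull_def
  proof
    fix c assume c: "c \<in> \<A>"
    let ?E = "E \<inter> fst c"
    have ls: "?E \<in> lebesgue_sets \<A>"
      using E open_lebesgue_sets[OF chart_open[OF charts[OF c]]] unfolding sets_\<mu>[symmetric] by auto
    have im: "snd c ` ?E \<in> sets lebesgue" by (rule lebesgue_setsD[OF ls c]) auto
    have "emeasure \<mu> ?E = 0" using E ls emeasure_mono[of ?E E \<mu>] by (auto simp: null_sets_def)
    then have "chart_density g c ?E = 0" using emeasure_\<mu>[OF c ls] by simp
    moreover have "(\<lambda>y. ennreal (sqrt (det (g c (chart_inv c y)))) * indicator (snd c ` ?E) y) \<in> borel_measurable lebesgue"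
      using c im tensorial by (intro chart_density_measurable) (auto simp: tensorial_def)
    ultimately have "AE y in lebesgue. ennreal (sqrt (det (g c (chart_inv c y)))) * indicator (snd c ` ?E) y = 0"
      unfolding chart_density_def by (subst (asm) nn_integral_0_iff_AE) auto
    moreover have "snd c ` ({x. \<not> good x} \<inter> fst c) \<in> null_sets lebesgue"
      using mnull_not_good c unfolding mnull_def negligible_iff_null_sets by blast
    then have "AE y in lebesgue. y \<notin> snd c ` ({x. \<not> good x} \<inter> fst c)" by (rule AE_not_in)
    ultimately have "AE y in lebesgue. y \<notin> snd c ` ?E"
    proof eventually_elim
      case (elim y)
      show ?case
      proof
        assume "y \<in> snd c ` ?E"
        then obtain x where x: "x \<in> E" "x \<in> fst c" "y = snd c x" by auto
        then have "good x" using elim(2) by auto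
        then have "det (g c x) > 0" using x c by (intro posdef_det_pos) (auto simp: good_def)
        then show False using elim(1) x c by auto
      qed
    qed
    then show "negligible (snd c ` ?E)"
      unfolding negligible_iff_null_sets using im by (subst AE_iff_null_sets) auto
  qed
qed

lemma AE_iff: "(AE x in \<mu>. P x) \<longleftrightarrow> mnull \<A> {x. \<not> P x}"
proof
  assume "AE x in \<mu>. P x"
  then obtain Z where "Z \<in> null_sets \<mu>" "{x. \<not> P x} \<subseteq> Z" by (auto simp: eventually_ae_filter)
  then show "mnull \<A> {x. \<not> P x}" using null_sets_iff mnull_subset by blast
next
  assume "mnull \<A> {x. \<not> P x}"
  then show "AE x in \<mu>. P x" by (intro AE_I'[of "{x. \<not> P x}"]) (auto simp: null_sets_iff)
qed

lemma AE_good: "AE x in \<mu>. good x"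
  using mnull_not_good by (simp add: AE_iff)

lemma complete_\<mu>: "complete_measure \<mu>"
proof
  fix A B assume "B \<subseteq> A" "A \<in> null_sets \<mu>"
  then have "B \<in> null_sets \<mu>" using null_sets_iff mnull_subset by blast
  then show "B \<in> sets \<mu>" by auto
qed

lemma measurable_iff:
  fixes f :: "'m \<Rightarrow> 'b::topological_space"
  shows "f \<in> borel_measurable \<mu> \<longleftrightarrow> (\<forall>c\<in>\<A>. chart_measurable c f)"
proof -
  have *: "chart_measurable c f \<longleftrightarrow> (\<forall>S\<in>sets borel. snd c ` (f -` S \<inter> fst c) \<in> sets lebesgue)" if c: "c \<in> \<A>" for c
  proof -
    have O: "snd c ` fst c \<in> sets lebesgue" using charts[OF c] by (simp add: is_chart_def borel_open sets_completionI_sets)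
    have "(\<lambda>y. f (chart_inv c y)) -` S \<inter> (snd c ` fst c) = snd c ` (f -` S \<inter> fst c)" for S
      using c by auto
    then show ?thesis
      unfolding chart_measurable_def measurable_def
      using O by (auto simp: sets_restrict_space_iff)
  qed
  show ?thesis
    unfolding measurable_def[of \<mu>] sets_\<mu> lebesgue_sets_def using * by auto
qed

end

section \<open>Square integrable functions and covector fields, and their pullbacks\<close>

subsection \<open>Square integrable functions and covector fields\<close>

text \<open>Common ground for functions and covector fields: \<open>q u v\<close> is the pointwise
  pairing and \<open>P\<close> is measurability. Positivity and the quasi triangle inequality are
  asked almost everywhere because a rough metric is definite only there. \<open>cong\<close>
  expresses definiteness: where the differences have pointwise norm zero, the pairing does not
  change.\<close>

locale integral_form =
  fixes H :: "('v::ab_group_add) hspace" and M :: "'x measure" and q :: "'v \<Rightarrow> 'v \<Rightarrow> 'x \<Rightarrow> complex" and P :: "'v \<Rightarrow> bool"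
  assumes elems: "elems H = {u. P u \<and> integrable M (\<lambda>x. Re (q u u x))}"
    and inn: "inn H = (\<lambda>u v. LINT x|M. q u v x)"
    and P_zero: "P 0" and P_add: "P u \<Longrightarrow> P v \<Longrightarrow> P (u + v)" and P_diff: "P u \<Longrightarrow> P v \<Longrightarrow> P (u - v)"
    and P_scal: "P u \<Longrightarrow> P (scal H k u)"
    and meas: "P u \<Longrightarrow> P v \<Longrightarrow> q u v \<in> borel_measurable M"
    and q0: "q 0 0 x = 0" and qminus: "q (- u) (- u) = q u u"
    and qscal: "q (scal H k u) (scal H k u) x = complex_of_real ((cmod k)\<^sup>2) * q u u x"
    and quasi: "P u \<Longrightarrow> P v \<Longrightarrow> AE x in M. Re (q (u + v) (u + v) x) \<le> 2 * Re (q u u x) + 2 * Re (q v v x)"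
    and real: "P u \<Longrightarrow> AE x in M. q u u x = complex_of_real (Re (q u u x)) \<and> 0 \<le> Re (q u u x)"
    and cong: "P u \<Longrightarrow> P u' \<Longrightarrow> P v \<Longrightarrow> P v' \<Longrightarrow>
      AE x in M. Re (q (u - u') (u - u') x) = 0 \<longrightarrow> Re (q (v - v') (v - v') x) = 0 \<longrightarrow> q u v x = q u' v' x"
    and scal: "scal H k (u - v) = scal H k u - scal H k v" "scal H k (scal H l u) = scal H (k * l) u"
      "scal H 1 u = u"
begin

lemma Re_inn: "u \<in> elems H \<Longrightarrow> Re (inn H u u) = (LINT x|M. Re (q u u x))"
  and semi_hspace: "semi_hspace H"
  and aeq_iff: "\<And>u v. aeq H u v \<longleftrightarrow> u \<in> elems H \<and> v \<in> elems H \<and> (AE x in M. Re (q (u - v) (u - v) x) = 0)"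
proof -
  have PE: "u \<in> elems H \<Longrightarrow> P u" for u using elems by simp
  have Re_inn: "Re (inn H u u) = (LINT x|M. Re (q u u x))" "integrable M (q u u)" if "u \<in> elems H" for u
  proof -
    have i: "integrable M (\<lambda>x. complex_of_real (Re (q u u x)))"
      using that elems by (intro integrable_of_real) auto
    have ae: "AE x in M. complex_of_real (Re (q u u x)) = q u u x"
      using real[OF PE[OF that]] by eventually_elim auto
    show iq: "integrable M (q u u)"
      by (rule integrable_cong_AE_imp[OF i meas[OF PE PE, OF that that]]) (use ae in \<open>eventually_elim, simp\<close>)
    show "Re (inn H u u) = (LINT x|M. Re (q u u x))"
      using integral_Re[OF iq] by (simp add: inn)
  qed
  have nonneg: "AE x in M. 0 \<le> Re (q u u x)" if "P u" for u using real[OF that] by eventually_elim simp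
  have neg: "P (- u)" if "P u" for u using P_diff[OF P_zero that] by simp
  have add: "u + v \<in> elems H" if "u \<in> elems H" "v \<in> elems H" for u v
  proof -
    have "integrable M (\<lambda>x. Re (q (u + v) (u + v) x))"
    proof (rule Bochner_Integration.integrable_bound)
      show "integrable M (\<lambda>x. 2 * Re (q u u x) + 2 * Re (q v v x))" using that elems by auto
      show "(\<lambda>x. Re (q (u + v) (u + v) x)) \<in> borel_measurable M"
        using that by (intro measurable_compose[OF meas borel_measurable_Re] P_add PE)
      show "AE x in M. norm (Re (q (u + v) (u + v) x)) \<le> norm (2 * Re (q u u x) + 2 * Re (q v v x))"
        using quasi[OF PE PE, OF that] nonneg[OF P_add[OF PE PE, OF that]] by eventually_elim auto
    qed
    then show ?thesis using that P_add elems by auto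
  qed
  have negE: "- u \<in> elems H" if "u \<in> elems H" for u using that neg elems qminus by simp
  have diff: "u - v \<in> elems H" if "u \<in> elems H" "v \<in> elems H" for u v
    using add[OF that(1) negE[OF that(2)]] by simp
  have aeq: "aeq H u v \<longleftrightarrow> u \<in> elems H \<and> v \<in> elems H \<and> (AE x in M. Re (q (u - v) (u - v) x) = 0)" for u v
  proof (cases "u \<in> elems H \<and> v \<in> elems H")
    case True
    then have E: "u - v \<in> elems H" using diff by auto
    have "hnorm H (u - v) = 0 \<longleftrightarrow> (LINT x|M. Re (q (u - v) (u - v) x)) = 0"
      by (simp add: hnorm_def Re_inn(1)[OF E])
    also have "\<dots> \<longleftrightarrow> (AE x in M. Re (q (u - v) (u - v) x) = 0)"
      using E elems nonneg by (intro integral_nonneg_eq_0_iff_AE) auto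
    finally show ?thesis using True by (simp add: aeq_def)
  qed (auto simp: aeq_def)
  then show "aeq H u v \<longleftrightarrow> u \<in> elems H \<and> v \<in> elems H \<and> (AE x in M. Re (q (u - v) (u - v) x) = 0)" for u v .
  show "u \<in> elems H \<Longrightarrow> Re (inn H u u) = (LINT x|M. Re (q u u x))" by (rule Re_inn(1))
  show "semi_hspace H"
  proof
    show "0 \<in> elems H" using P_zero q0 elems by simp
    show "u + v \<in> elems H" if "u \<in> elems H" "v \<in> elems H" for u v by (rule add[OF that])
    show "u - v \<in> elems H" if "u \<in> elems H" "v \<in> elems H" for u v by (rule diff[OF that])
    show "scal H k u \<in> elems H" if "u \<in> elems H" for u k using that P_scal elems qscal by simp
    show "0 \<le> Re (inn H u u)" if "u \<in> elems H" for u
      unfolding Re_inn(1)[OF that] by (rule integral_nonneg_AE[OF nonneg[OF PE[OF that]]])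
    have "q 0 0 = (\<lambda>x. 0)" by (rule ext) (rule q0)
    then show "inn H 0 0 = 0" by (simp add: inn)
    show "Re (inn H (u + v) (u + v)) \<le> 2 * Re (inn H u u) + 2 * Re (inn H v v)" if E: "u \<in> elems H" "v \<in> elems H" for u v
    proof -
      have i: "integrable M (\<lambda>x. Re (q u u x))" "integrable M (\<lambda>x. Re (q v v x))" using E elems by auto
      have "(LINT x|M. Re (q (u + v) (u + v) x)) \<le> (LINT x|M. 2 * Re (q u u x) + 2 * Re (q v v x))"
        using add[OF E] i elems quasi[OF PE PE, OF E] by (intro integral_mono_AE) auto
      also have "\<dots> = 2 * (LINT x|M. Re (q u u x)) + 2 * (LINT x|M. Re (q v v x))" using i by simp
      finally show ?thesis using E add by (simp add: Re_inn)
    qed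
    show "inn H (- u) (- u) = inn H u u" for u by (simp add: inn qminus)
    show "Re (inn H (scal H k u) (scal H k u)) = (cmod k)\<^sup>2 * Re (inn H u u)" for u k
    proof -
      have "q (scal H k u) (scal H k u) = (\<lambda>x. complex_of_real ((cmod k)\<^sup>2) * q u u x)" by (rule ext) (rule qscal)
      then show ?thesis by (simp add: inn del: of_real_power)
    qed
    show "inn H u v = inn H u' v'" if a: "aeq H u u'" "aeq H v v'" for u u' v v'
    proof -
      have E: "P u" "P u'" "P v" "P v'" using a PE by (auto simp: aeq_def)
      have "AE x in M. q u v x = q u' v' x"
        using cong[OF E] a[unfolded aeq] by auto
      then show ?thesis unfolding inn using meas E by (intro integral_cong_AE) auto
    qed
  qed (auto simp: scal)
qed

end

lemma norm_add_square_le: "(cmod (a + b))\<^sup>2 \<le> 2 * (cmod a)\<^sup>2 + 2 * (cmod b)\<^sup>2"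
proof -
  have "(cmod (a + b))\<^sup>2 \<le> (cmod a + cmod b)\<^sup>2" by (intro power_mono norm_triangle_ineq) auto
  also have "\<dots> \<le> 2 * (cmod a)\<^sup>2 + 2 * (cmod b)\<^sup>2"
    using sum_squares_bound[of "cmod a" "cmod b"] by (simp add: power2_sum)
  finally show ?thesis .
qed

lemma Re_mult_cnj: "Re (z * cnj z) = (cmod z)\<^sup>2"
  by (simp add: complex_norm_square[symmetric] del: of_real_power)

lemma L2_form: "integral_form (L2 \<A> g) (riem_measure \<A> g) (\<lambda>u v x. u x * cnj (v x)) (\<lambda>u. u \<in> borel_measurable (riem_measure \<A> g))"
proof
  let ?M = "riem_measure \<A> g"
  have qq: "z * cnj z = complex_of_real ((cmod z)\<^sup>2)" for z by (simp only: complex_norm_square)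
  show "elems (L2 \<A> g) = {u. u \<in> borel_measurable ?M \<and> integrable ?M (\<lambda>x. Re (u x * cnj (u x)))}"
    unfolding Re_mult_cnj by (simp add: L2_def)
  show "inn (L2 \<A> g) = (\<lambda>u v. LINT x|?M. u x * cnj (v x))" by (simp add: L2_def)
  fix u v u' v' :: "'a \<Rightarrow> complex" and k l :: complex and x :: 'a
  show "0 \<in> borel_measurable ?M" by (simp add: zero_fun_def)
  show "scal (L2 \<A> g) k (scal (L2 \<A> g) l u) = scal (L2 \<A> g) (k * l) u"
    "scal (L2 \<A> g) k (u - v) = scal (L2 \<A> g) k u - scal (L2 \<A> g) k v" "scal (L2 \<A> g) 1 u = u"
    by (auto simp: L2_def fun_eq_iff right_diff_distrib)
  show "scal (L2 \<A> g) k u x * cnj (scal (L2 \<A> g) k u x) = complex_of_real ((cmod k)\<^sup>2) * (u x * cnj (u x))"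
    unfolding qq by (simp add: L2_def norm_mult power_mult_distrib)
  show "AE x in ?M. u x * cnj (u x) = complex_of_real (Re (u x * cnj (u x))) \<and> 0 \<le> Re (u x * cnj (u x))"
    unfolding Re_mult_cnj qq by simp
  show "AE x in ?M. Re ((u + v) x * cnj ((u + v) x)) \<le> 2 * Re (u x * cnj (u x)) + 2 * Re (v x * cnj (v x))"
    unfolding Re_mult_cnj by (simp add: norm_add_square_le)
  show "AE x in ?M. Re ((u - u') x * cnj ((u - u') x)) = 0 \<longrightarrow> Re ((v - v') x * cnj ((v - v') x)) = 0 \<longrightarrow>
      u x * cnj (v x) = u' x * cnj (v' x)"
    unfolding Re_mult_cnj by simp
  { assume "u \<in> borel_measurable ?M"
    then show "scal (L2 \<A> g) k u \<in> borel_measurable ?M" by (simp add: L2_def) }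
  { assume "u \<in> borel_measurable ?M" "v \<in> borel_measurable ?M"
    then show "u + v \<in> borel_measurable ?M" "u - v \<in> borel_measurable ?M"
      "(\<lambda>x. u x * cnj (v x)) \<in> borel_measurable ?M"
      unfolding plus_fun_def fun_diff_def
      by (auto intro!: borel_measurable_times borel_measurable_continuous_on[OF continuous_on_cnj[OF continuous_on_id]]) }
qed auto

lemma L2_semi_hspace: "semi_hspace (L2 \<A> g)"
  using integral_form.semi_hspace[OF L2_form] .

lemma aeq_L2_iff: "aeq (L2 \<A> g) u v \<longleftrightarrow> u \<in> elems (L2 \<A> g) \<and> v \<in> elems (L2 \<A> g) \<and> (AE x in riem_measure \<A> g. u x = v x)"
  unfolding integral_form.aeq_iff[OF L2_form] Re_mult_cnj by simp

lemma borel_measurable_vec_nth': "f \<in> borel_measurable M \<Longrightarrow> (\<lambda>x. (f x :: 'b::euclidean_space ^ 'n) $ i) \<in> borel_measurable M"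
  by (rule borel_measurable_continuous_on[OF continuous_on_component[OF continuous_on_id]])

lemma borel_measurable_vecI:
  fixes f :: "'x \<Rightarrow> 'b::euclidean_space ^ 'n"
  assumes "\<And>i. (\<lambda>x. f x $ i) \<in> borel_measurable M"
  shows "f \<in> borel_measurable M"
proof (rule borel_measurable_euclidean_space[THEN iffD2], rule ballI)
  fix b :: "'b ^ 'n" assume "b \<in> Basis"
  then obtain i u where "b = axis i u" by (auto simp: Basis_vec_def)
  then show "(\<lambda>x. f x \<bullet> b) \<in> borel_measurable M"
    using assms[of i] by (simp add: inner_axis)
qed

lemma borel_measurable_pull_covector:
  fixes J :: "'x \<Rightarrow> real ^ 'n ^ 'n"
  assumes "\<And>i j. (\<lambda>x. J x $ i $ j) \<in> borel_measurable M" "w \<in> borel_measurable M"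
  shows "(\<lambda>x. pull_covector (J x) (w x)) \<in> borel_measurable M"
  using assms(1) borel_measurable_vec_nth'[OF assms(2)]
  by (intro borel_measurable_vecI) (simp add: pull_covector_def)

lemma borel_measurable_cofactor:
  assumes "G \<in> borel_measurable M"
  shows "(\<lambda>x. det (\<chi> k l. if l = i then (if k = j then 1 else 0) else (G x :: real ^ 'n ^ 'n) $ k $ l)) \<in> borel_measurable M"
proof -
  have "continuous_on UNIV (\<lambda>G :: real ^ 'n ^ 'n. \<chi> k l. if l = i then (if k = j then 1 else 0) else G $ k $ l)"
  proof (intro continuous_on_vec_lambda)
    show "continuous_on UNIV (\<lambda>G :: real ^ 'n ^ 'n. if l = i then (if k = j then 1 else 0) else G $ k $ l)" for k l
      by (cases "l = i"; cases "k = j") (auto intro!: continuous_intros)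
  qed
  from borel_measurable_continuous_on[OF continuous_on_det[OF this] assms] show ?thesis .
qed

text \<open>A rational expression in the entries of \<open>G\<close>, equal to
  \<open>cov_inner\<close> wherever the determinant is nonzero.\<close>

lemma borel_measurable_cov_inner_cofactor:
  fixes G :: "'x \<Rightarrow> real ^ 'n ^ 'n"
  assumes "G \<in> borel_measurable M" "w \<in> borel_measurable M" "v \<in> borel_measurable M"
  shows "(\<lambda>x. \<Sum>i\<in>UNIV. \<Sum>j\<in>UNIV. complex_of_real (det (\<chi> k l. if l = i then (if k = j then 1 else 0) else G x $ k $ l) / det (G x))
      * w x $ i * cnj (v x $ j)) \<in> borel_measurable M"
  using borel_measurable_cofactor[OF assms(1)] borel_measurable_continuous_on[OF continuous_on_det[OF continuous_on_id] assms(1)]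
    borel_measurable_vec_nth'[OF assms(2)] borel_measurable_vec_nth'[OF assms(3)]
    borel_measurable_continuous_on[OF continuous_on_cnj[OF continuous_on_id] borel_measurable_vec_nth'[OF assms(3)]]
  by (intro borel_measurable_sum borel_measurable_times borel_measurable_of_real borel_measurable_divide) auto

context smooth_manifold
begin

lemma lebesgue_sets_local:
  assumes c: "c \<in> \<A>" and E: "E \<subseteq> fst c" "snd c ` E \<in> sets lebesgue"
  shows "E \<in> lebesgue_sets \<A>"
  unfolding lebesgue_sets_def
proof (intro CollectI ballI)
  fix d assume d: "d \<in> \<A>"
  have "snd c ` (fst c \<inter> fst d) \<in> sets lebesgue" using overlap_open[OF c d] by (simp add: borel_open sets_completionI_sets)
  then have "snd c ` E \<inter> snd c ` (fst c \<inter> fst d) \<in> sets lebesgue" using E(2) by auto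
  moreover have "snd c ` E \<inter> snd c ` (fst c \<inter> fst d) = snd c ` (E \<inter> fst d)"
    using chart_inj[OF charts[OF c]] E(1) by (auto simp: inj_on_def)
  ultimately have "snd c ` (E \<inter> fst d) \<in> sets lebesgue" by simp
  then have "local_rep id c d ` (snd c ` (E \<inter> fst d)) \<in> sets lebesgue"
    by (rule lebesgue_image_lipschitz_near) (use E c d in \<open>auto intro!: transition_lipschitz\<close>)
  moreover have "local_rep id c d ` (snd c ` (E \<inter> fst d)) = snd d ` (E \<inter> fst d)"
    unfolding image_image using E(1) c by (intro image_cong refl) (auto simp: local_rep_apply subset_iff)
  ultimately show "snd d ` (E \<inter> fst d) \<in> sets lebesgue" by simp
qed

end

context rough_manifold
begin

lemma measurable_extend_chart:
  fixes f :: "'m \<Rightarrow> 'b::euclidean_space"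
  assumes c: "c \<in> \<A>" and f: "chart_measurable c f"
  shows "(\<lambda>x. if x \<in> fst c then f x else 0) \<in> borel_measurable \<mu>"
proof (rule measurableI)
  fix S :: "'b set" assume S: "S \<in> sets borel"
  interpret ls: sigma_algebra UNIV "lebesgue_sets \<A>" by (rule sigma_algebra_lebesgue_sets)
  have O: "snd c ` fst c \<in> sets lebesgue" using charts[OF c] by (simp add: is_chart_def borel_open sets_completionI_sets)
  have "(\<lambda>y. f (chart_inv c y)) -` S \<inter> space (lebesgue_on (snd c ` fst c)) \<in> sets (lebesgue_on (snd c ` fst c))"
    using f S unfolding chart_measurable_def by (rule measurable_sets)
  then have "(\<lambda>y. f (chart_inv c y)) -` S \<inter> (snd c ` fst c) \<in> sets lebesgue"
    using O by (auto simp: sets_restrict_space_iff)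
  moreover have "(\<lambda>y. f (chart_inv c y)) -` S \<inter> (snd c ` fst c) = snd c ` (f -` S \<inter> fst c)" using c by auto
  ultimately have 1: "f -` S \<inter> fst c \<in> lebesgue_sets \<A>" by (intro lebesgue_sets_local[OF c]) auto
  have 2: "UNIV - fst c \<in> lebesgue_sets \<A>" using open_lebesgue_sets[OF chart_open[OF charts[OF c]]] by blast
  have "(\<lambda>x. if x \<in> fst c then f x else 0) -` S = (f -` S \<inter> fst c) \<union> (if 0 \<in> S then UNIV - fst c else {})"
    by (auto split: if_splits)
  moreover have "\<dots> \<in> lebesgue_sets \<A>" using 1 2 by auto
  ultimately show "(\<lambda>x. if x \<in> fst c then f x else 0) -` S \<inter> space \<mu> \<in> sets \<mu>" by (simp add: sets_\<mu>)
qed simp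

lemma chart_measurable_of_extension:
  assumes c: "c \<in> \<A>" and f: "(\<lambda>x. if x \<in> fst c then f x else 0) \<in> borel_measurable \<mu>"
  shows "chart_measurable c f"
proof -
  have "chart_measurable c (\<lambda>x. if x \<in> fst c then f x else 0)" using f c measurable_iff by blast
  then show ?thesis unfolding chart_measurable_def
    by (rule measurable_cong[THEN iffD1, rotated]) (use c in auto)
qed

lemma cofield_measurable:
  assumes "measurable_cofield \<A> \<omega>" "c \<in> \<A>"
  shows "chart_measurable c (\<omega> c)"
  using assms by (simp add: measurable_cofield_def)

lemma cofield_change:
  assumes "measurable_cofield \<A> \<omega>" "c \<in> \<A>" "d \<in> \<A>" "x \<in> fst c" "x \<in> fst d"
  shows "\<omega> c x = pull_covector (jacobian id c d x) (\<omega> d x)"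
  using assms(1)[unfolded measurable_cofield_def, THEN conjunct1, rule_format, of c d x] assms(2-) by simp

lemma field_inner_chart:
  assumes "measurable_cofield \<A> \<omega>" "measurable_cofield \<A> \<eta>" "good x" "c \<in> \<A>" "x \<in> fst c"
  shows "field_inner \<A> g \<omega> \<eta> x = cov_inner (g c x) (\<omega> c x) (\<eta> c x)"
proof -
  let ?d = "chart_at \<A> x"
  have "posdef (g ?d x)" using assms(3) unfolding good_def by simp
  then have "cov_inner (g c x) (\<omega> c x) (\<eta> c x) = cov_inner (g ?d x) (\<omega> ?d x) (\<eta> ?d x)"
    using cofield_change[OF assms(1,4), of ?d x] cofield_change[OF assms(2,4), of ?d x] g_change[OF assms(4), of ?d x] assms(5)
      cov_inner_congruence[OF posdef_invertible jacobian_id_inverse[OF assms(4), of ?d x]]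
    by simp
  then show ?thesis by (simp add: field_inner_def Let_def)
qed

text \<open>\<open>field_inner\<close> selects a chart at each point without any measurability of
  the selection. At good points any fixed chart gives the same value, and there it equals the
  cofactor expression; completeness of the measure absorbs the rest.\<close>

lemma field_inner_measurable:
  assumes "measurable_cofield \<A> \<omega>" "measurable_cofield \<A> \<eta>"
  shows "field_inner \<A> g \<omega> \<eta> \<in> borel_measurable \<mu>"
  unfolding measurable_iff
proof
  fix c assume c: "c \<in> \<A>"
  let ?f = "\<lambda>G w v. \<Sum>i\<in>UNIV. \<Sum>j\<in>UNIV. complex_of_real (det (\<chi> k l. if l = i then (if k = j then 1 else 0) else G $ k $ l) / det G) * w $ i * cnj (v $ j)"
  let ?e = "\<lambda>f x. if x \<in> fst c then f x else 0"
  have "?e (g c) \<in> borel_measurable \<mu>" "?e (\<omega> c) \<in> borel_measurable \<mu>" "?e (\<eta> c) \<in> borel_measurable \<mu>"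
    using assms c tensorial by (auto intro!: measurable_extend_chart simp: measurable_cofield_def tensorial_def)
  then have m: "(\<lambda>x. ?f (?e (g c) x) (?e (\<omega> c) x) (?e (\<eta> c) x)) \<in> borel_measurable \<mu>"
    by (rule borel_measurable_cov_inner_cofactor)
  have "(\<lambda>x. ?e (field_inner \<A> g \<omega> \<eta>) x) \<in> borel_measurable \<mu>"
  proof (rule measurable_AE_eq[OF complete_\<mu> m])
    show "AE x in \<mu>. ?f (?e (g c) x) (?e (\<omega> c) x) (?e (\<eta> c) x) = ?e (field_inner \<A> g \<omega> \<eta>) x"
      using AE_good
    proof eventually_elim
      case (elim x)
      show ?case
      proof (cases "x \<in> fst c")
        case True
        have "posdef (g c x)" using elim c True by (simp add: good_def)
        then have "det (g c x) \<noteq> 0" using posdef_det_pos by force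
        then show ?thesis using True
          by (simp add: field_inner_chart[OF assms elim c] cov_inner_def matrix_inv_cofactor)
      qed simp
    qed
  qed simp
  then show "chart_measurable c (field_inner \<A> g \<omega> \<eta>)" by (rule chart_measurable_of_extension[OF c])
qed

lemma measurable_cofield_zero: "measurable_cofield \<A> 0"
  by (auto simp: measurable_cofield_def zero_fun_def chart_measurable_def)

lemma measurable_cofield_arith:
  assumes "measurable_cofield \<A> \<omega>" "measurable_cofield \<A> \<eta>"
  shows "measurable_cofield \<A> (\<omega> + \<eta>)" "measurable_cofield \<A> (\<omega> - \<eta>)"
  unfolding measurable_cofield_def
proof (safe)
  fix c d x assume cd: "c \<in> \<A>" "d \<in> \<A>" "x \<in> fst c" "x \<in> fst d"
  show "(\<omega> + \<eta>) c x = pull_covector (jacobian id c d x) ((\<omega> + \<eta>) d x)"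
    "(\<omega> - \<eta>) c x = pull_covector (jacobian id c d x) ((\<omega> - \<eta>) d x)"
    using cofield_change[OF assms(1) cd] cofield_change[OF assms(2) cd]
    by (simp_all add: pull_covector_add pull_covector_diff)
next
  fix c assume c: "c \<in> \<A>"
  show "chart_measurable c ((\<omega> + \<eta>) c)" "chart_measurable c ((\<omega> - \<eta>) c)"
    using cofield_measurable[OF assms(1) c] cofield_measurable[OF assms(2) c] by (simp_all add: chart_measurable_def)
qed

lemma measurable_cofield_scale: "measurable_cofield \<A> \<omega> \<Longrightarrow> measurable_cofield \<A> (\<lambda>c x. k *s \<omega> c x)"
  unfolding measurable_cofield_def
proof (safe)
  assume a: "\<forall>c\<in>\<A>. \<forall>d\<in>\<A>. \<forall>x\<in>fst c \<inter> fst d. \<omega> c x = pull_covector (jacobian id c d x) (\<omega> d x)"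
  show "k *s \<omega> c x = pull_covector (jacobian id c d x) (k *s \<omega> d x)"
    if "c \<in> \<A>" "d \<in> \<A>" "x \<in> fst c" "x \<in> fst d" for c d x
    using a[rule_format, of c d x] that by (simp add: pull_covector_scale)
next
  fix c assume a: "\<forall>c\<in>\<A>. chart_measurable c (\<omega> c)" and c: "c \<in> \<A>"
  have "(\<lambda>y. \<omega> c (chart_inv c y)) \<in> borel_measurable (lebesgue_on (snd c ` fst c))"
    using a c by (simp add: chart_measurable_def)
  from borel_measurable_vec_nth'[OF this] show "chart_measurable c (\<lambda>x. k *s \<omega> c x)"
    unfolding chart_measurable_def by (intro borel_measurable_vecI) simp
qed

lemma L2cov_form: "integral_form (L2cov \<A> g) \<mu> (field_inner \<A> g) (measurable_cofield \<A>)"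
proof
  show "elems (L2cov \<A> g) = {u. measurable_cofield \<A> u \<and> integrable \<mu> (\<lambda>x. Re (field_inner \<A> g u u x))}"
    "inn (L2cov \<A> g) = (\<lambda>u v. LINT x|\<mu>. field_inner \<A> g u v x)"
    by (simp_all add: L2cov_def)
  show "measurable_cofield \<A> 0" by (rule measurable_cofield_zero)
  fix u v u' v' :: "('m, 'n) cofield" and k l :: complex and x :: 'm
  show "field_inner \<A> g 0 0 x = 0" "field_inner \<A> g (- u) (- u) = field_inner \<A> g u u"
    by (auto simp: field_inner_def Let_def fun_eq_iff cov_inner_minus)
  show "field_inner \<A> g (scal (L2cov \<A> g) k u) (scal (L2cov \<A> g) k u) x = complex_of_real ((cmod k)\<^sup>2) * field_inner \<A> g u u x"
    by (simp add: field_inner_def Let_def L2cov_def cov_inner_scale)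
  show "scal (L2cov \<A> g) k (u - v) = scal (L2cov \<A> g) k u - scal (L2cov \<A> g) k v"
    "scal (L2cov \<A> g) k (scal (L2cov \<A> g) l u) = scal (L2cov \<A> g) (k * l) u" "scal (L2cov \<A> g) 1 u = u"
    by (auto simp: L2cov_def fun_eq_iff vec_eq_iff right_diff_distrib)
  have pd: "posdef (g (chart_at \<A> x) x)" if "good x" for x using that by (simp add: good_def)
  { assume u: "measurable_cofield \<A> u"
    show "measurable_cofield \<A> (scal (L2cov \<A> g) k u)" using measurable_cofield_scale[OF u] by (simp add: L2cov_def)
    show "AE x in \<mu>. field_inner \<A> g u u x = complex_of_real (Re (field_inner \<A> g u u x)) \<and> 0 \<le> Re (field_inner \<A> g u u x)"
      using AE_good by eventually_elim (use posdef_cov_inner(1,2)[OF pd] in \<open>simp add: field_inner_def Let_def\<close>)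
    assume v: "measurable_cofield \<A> v"
    show "measurable_cofield \<A> (u + v)" "measurable_cofield \<A> (u - v)" by (rule measurable_cofield_arith[OF u v])+
    show "field_inner \<A> g u v \<in> borel_measurable \<mu>" by (rule field_inner_measurable[OF u v])
    show "AE x in \<mu>. Re (field_inner \<A> g (u + v) (u + v) x) \<le> 2 * Re (field_inner \<A> g u u x) + 2 * Re (field_inner \<A> g v v x)"
      using AE_good by eventually_elim (use posdef_cov_inner_quasi[OF pd] in \<open>simp add: field_inner_def Let_def\<close>) }
  show "AE x in \<mu>. Re (field_inner \<A> g (u - u') (u - u') x) = 0 \<longrightarrow> Re (field_inner \<A> g (v - v') (v - v') x) = 0 \<longrightarrow>
      field_inner \<A> g u v x = field_inner \<A> g u' v' x"
    using AE_good
  proof eventually_elim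
    case (elim x)
    show ?case
    proof (intro impI)
      have z: "Re (cov_inner (g (chart_at \<A> x) x) (a - b) (a - b)) = 0 \<Longrightarrow> a = b" for a b
        using posdef_cov_inner(3)[OF pd[OF elim], of "a - b"] by simp
      assume "Re (field_inner \<A> g (u - u') (u - u') x) = 0" "Re (field_inner \<A> g (v - v') (v - v') x) = 0"
      then have "u (chart_at \<A> x) x = u' (chart_at \<A> x) x" "v (chart_at \<A> x) x = v' (chart_at \<A> x) x"
        by (auto intro!: z simp: field_inner_def Let_def)
      then show "field_inner \<A> g u v x = field_inner \<A> g u' v' x" by (simp add: field_inner_def Let_def)
    qed
  qed
qed

lemma L2cov_semi_hspace: "semi_hspace (L2cov \<A> g)"
  using integral_form.semi_hspace[OF L2cov_form] .

text \<open>At good points definiteness turns vanishing norm into equality in the selected chart,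
  and the transformation law extends it to all charts.\<close>

lemma aeq_L2cov_iff:
  "aeq (L2cov \<A> g) \<omega> \<eta> \<longleftrightarrow> \<omega> \<in> elems (L2cov \<A> g) \<and> \<eta> \<in> elems (L2cov \<A> g) \<and>
     (AE x in \<mu>. \<forall>c\<in>\<A>. x \<in> fst c \<longrightarrow> \<omega> c x = \<eta> c x)"
proof -
  have "(AE x in \<mu>. Re (field_inner \<A> g (\<omega> - \<eta>) (\<omega> - \<eta>) x) = 0) \<longleftrightarrow> (AE x in \<mu>. \<forall>c\<in>\<A>. x \<in> fst c \<longrightarrow> \<omega> c x = \<eta> c x)"
    if m: "measurable_cofield \<A> \<omega>" "measurable_cofield \<A> \<eta>"
  proof (rule eventually_subst)
    show "AE x in \<mu>. (Re (field_inner \<A> g (\<omega> - \<eta>) (\<omega> - \<eta>) x) = 0) = (\<forall>c\<in>\<A>. x \<in> fst c \<longrightarrow> \<omega> c x = \<eta> c x)"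
      using AE_good
    proof eventually_elim
      case (elim x)
      have pd: "posdef (g (chart_at \<A> x) x)" using elim by (simp add: good_def)
      have "(Re (field_inner \<A> g (\<omega> - \<eta>) (\<omega> - \<eta>) x) = 0) \<longleftrightarrow> \<omega> (chart_at \<A> x) x = \<eta> (chart_at \<A> x) x"
        using posdef_cov_inner(3)[OF pd, of "\<omega> (chart_at \<A> x) x - \<eta> (chart_at \<A> x) x"] by (auto simp: field_inner_def Let_def)
      also have "\<dots> \<longleftrightarrow> (\<forall>c\<in>\<A>. x \<in> fst c \<longrightarrow> \<omega> c x = \<eta> c x)"
        using cofield_change[OF m(1)] cofield_change[OF m(2)] by (metis chart_at)
      finally show ?case .
    qed
  qed
  then show ?thesis unfolding integral_form.aeq_iff[OF L2cov_form] by (simp add: L2cov_def cong: conj_cong)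
qed

end

subsection \<open>Pullback of covector fields\<close>

lemma directional_quotients_tendsto:
  fixes f :: "'a::real_normed_vector \<Rightarrow> 'b::real_normed_vector"
  assumes D: "(f has_derivative D) (at x)"
  shows "(\<lambda>n. real (Suc n) *\<^sub>R (f (x + inverse (real (Suc n)) *\<^sub>R v) - f x)) \<longlonglongrightarrow> D v"
proof (rule LIMSEQ_I)
  fix e :: real assume e: "e > 0"
  define e' where "e' = e / (norm v + 1)"
  have e': "e' > 0" "e' * norm v < e"
  proof -
    show "e' > 0" unfolding e'_def using e by (simp add: add_nonneg_pos)
    have "e' * norm v < e' * (norm v + 1)" using \<open>e' > 0\<close> by simp
    also have "\<dots> = e" unfolding e'_def by (simp add: add_nonneg_eq_0_iff)
    finally show "e' * norm v < e" .
  qed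
  obtain d where d: "d > 0" "\<And>y. norm (y - x) < d \<Longrightarrow> norm (f y - f x - D (y - x)) \<le> e' * norm (y - x)"
    using D e'(1) unfolding has_derivative_at_alt by blast
  have lin: "linear D" using D by (rule has_derivative_linear)
  obtain N where N: "inverse (real (Suc N)) < d / (norm v + 1)"
    using reals_Archimedean[of "d / (norm v + 1)"] d(1) by (auto simp: add_nonneg_pos)
  have "norm (real (Suc n) *\<^sub>R (f (x + inverse (real (Suc n)) *\<^sub>R v) - f x) - D v) < e" if "n \<ge> N" for n
  proof -
    let ?t = "inverse (real (Suc n))"
    have t: "?t > 0" "real (Suc n) * ?t = 1" by auto
    have "?t \<le> inverse (real (Suc N))" using that by simp
    then have "?t * norm v < d"
    proof -
      have "?t * norm v \<le> inverse (real (Suc N)) * (norm v + 1)"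
        using \<open>?t \<le> inverse (real (Suc N))\<close> by (intro mult_mono) auto
      also have "\<dots> < d" using N by (simp add: pos_less_divide_eq add_nonneg_pos)
      finally show ?thesis .
    qed
    then have "norm (f (x + ?t *\<^sub>R v) - f x - D (?t *\<^sub>R v)) \<le> e' * (?t * norm v)"
      using d(2)[of "x + ?t *\<^sub>R v"] t(1) by simp
    then have "real (Suc n) * norm (f (x + ?t *\<^sub>R v) - f x - D (?t *\<^sub>R v)) \<le> real (Suc n) * (e' * (?t * norm v))"
      by (rule mult_left_mono) simp
    also have "\<dots> = (real (Suc n) * ?t) * (e' * norm v)" by (simp only: mult_ac)
    also have "\<dots> < e" using e'(2) unfolding t(2) by simp
    finally have "norm (real (Suc n) *\<^sub>R (f (x + ?t *\<^sub>R v) - f x - D (?t *\<^sub>R v))) < e"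
      unfolding norm_scaleR abs_of_nat .
    moreover have "real (Suc n) *\<^sub>R (f (x + ?t *\<^sub>R v) - f x - D (?t *\<^sub>R v)) = real (Suc n) *\<^sub>R (f (x + ?t *\<^sub>R v) - f x) - D v"
      unfolding linear_scale[OF lin] scaleR_diff_right scaleR_scaleR t(2) by simp
    ultimately show ?thesis by (simp only:)
  qed
  then show "\<exists>no. \<forall>n\<ge>no. norm (real (Suc n) *\<^sub>R (f (x + inverse (real (Suc n)) *\<^sub>R v) - f x) - D v) < e" by blast
qed

text \<open>The derivative is a pointwise limit of difference quotients with steps 1/(n+1).
  Extending \<open>f\<close> by zero makes the quotients Borel functions on the whole space and does
  not affect the limit at points of \<open>D\<close>, which lie in the open set
  \<open>S\<close>.\<close>

lemma frechet_derivative_measurable: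
  fixes f :: "'a::euclidean_space \<Rightarrow> 'b::euclidean_space"
  assumes S: "open S" and f: "continuous_on S f" and D: "D \<subseteq> S" "D \<in> sets lebesgue"
    and diff: "\<And>x. x \<in> D \<Longrightarrow> f differentiable (at x)"
  shows "(\<lambda>x. if x \<in> D then frechet_derivative f (at x) v else 0) \<in> borel_measurable lebesgue"
proof -
  define f0 where "f0 x = (if x \<in> S then f x else 0)" for x
  have "f0 \<in> borel_measurable borel"
    unfolding f0_def using S f by (intro borel_measurable_continuous_on_if) auto
  then have m0: "f0 \<in> borel_measurable lborel" by simp
  have m1: "(\<lambda>x. f0 (x + a)) \<in> borel_measurable lborel" for a
    using measurable_compose[of "\<lambda>x. x + a" lborel borel f0 borel] \<open>f0 \<in> borel_measurable borel\<close> by simp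
  let ?q = "\<lambda>n x. real (Suc n) *\<^sub>R (f0 (x + inverse (real (Suc n)) *\<^sub>R v) - f0 x)"
  have q: "?q n \<in> borel_measurable lebesgue" for n
    by (intro measurable_completion borel_measurable_scaleR borel_measurable_diff m0 m1 borel_measurable_const)
  show ?thesis
  proof (rule borel_measurable_LIMSEQ_metric)
    show "(\<lambda>x. if x \<in> D then ?q n x else 0) \<in> borel_measurable lebesgue" for n
      using q D(2) by (intro measurable_If_set) auto
    fix x :: 'a
    show "(\<lambda>n. if x \<in> D then ?q n x else 0) \<longlonglongrightarrow> (if x \<in> D then frechet_derivative f (at x) v else 0)"
    proof (cases "x \<in> D")
      case True
      have "(f has_derivative frechet_derivative f (at x)) (at x)" using diff[OF True] by (simp add: frechet_derivative_works)
      then have "(f0 has_derivative frechet_derivative f (at x)) (at x)"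
        by (rule has_derivative_transform_within_open[OF _ S]) (use True D(1) in \<open>auto simp: f0_def\<close>)
      from directional_quotients_tendsto[OF this] show ?thesis using True by simp
    qed simp
  qed
qed

lemma lipschitz_near_derivative_measurable:
  fixes f :: "'a::euclidean_space \<Rightarrow> 'b::euclidean_space"
  assumes S: "open S" and lip: "\<And>y. y \<in> S \<Longrightarrow> lipschitz_near f y"
  shows "(\<lambda>y. if y \<in> {y \<in> S. f differentiable (at y)} then frechet_derivative f (at y) v else 0) \<in> borel_measurable lebesgue"
proof (rule frechet_derivative_measurable[OF S])
  show "continuous_on S f" using lip by (intro continuous_at_imp_continuous_on ballI lipschitz_near_continuous)
  have "negligible {y \<in> S. \<not> f differentiable (at y)}" using lip by (rule Rademacher)
  then have "S - {y \<in> S. \<not> f differentiable (at y)} \<in> sets lebesgue"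
    using S by (auto simp: negligible_iff_null_sets borel_open sets_completionI_sets)
  moreover have "S - {y \<in> S. \<not> f differentiable (at y)} = {y \<in> S. f differentiable (at y)}" by auto
  ultimately show "{y \<in> S. f differentiable (at y)} \<in> sets lebesgue" by simp
qed auto
context lip_homeo
begin

lemma pullback_cofield_apply:
  assumes \<eta>: "\<And>d d' y. d \<in> \<B> \<Longrightarrow> d' \<in> \<B> \<Longrightarrow> y \<in> fst d \<Longrightarrow> y \<in> fst d' \<Longrightarrow> \<eta> d y = pull_covector (jacobian id d d' y) (\<eta> d' y)"
    and c: "c \<in> \<A>" "x \<in> fst c" and d: "d \<in> \<B>" "F x \<in> fst d"
  shows "pullback_cofield \<B> F \<eta> c x = (if diff_at x then pull_covector (jacobian F c d x) (\<eta> d (F x)) else 0)"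
proof -
  let ?e = "chart_at \<B> (F x)"
  have iff: "local_rep F c ?e differentiable (at (snd c x)) \<longleftrightarrow> diff_at x"
    using diff_atI[OF c, of ?e] diff_atD[of x, OF _ c, of ?e] by auto
  show ?thesis
  proof (cases "diff_at x")
    case True
    have "jacobian F c ?e x = jacobian id d ?e (F x) ** jacobian F c d x ** jacobian id c c x"
      using change_charts(2)[OF c(1) c(1) c(2) c(2) d(1) _ d(2), of ?e] diff_atD[OF True c d] by simp
    then have "jacobian F c ?e x = jacobian id d ?e (F x) ** jacobian F c d x"
      by (simp add: M.jacobian_id_self[OF c])
    then show ?thesis
      using True iff \<eta>[OF d(1) _ d(2), of ?e] by (simp add: pullback_cofield_def Let_def pull_covector_mult)
  qed (use iff in \<open>simp add: pullback_cofield_def Let_def\<close>)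
qed

lemma pullback_cofield_change:
  assumes \<eta>: "\<And>d d' y. d \<in> \<B> \<Longrightarrow> d' \<in> \<B> \<Longrightarrow> y \<in> fst d \<Longrightarrow> y \<in> fst d' \<Longrightarrow> \<eta> d y = pull_covector (jacobian id d d' y) (\<eta> d' y)"
    and c: "c \<in> \<A>" "c' \<in> \<A>" "x \<in> fst c" "x \<in> fst c'"
  shows "pullback_cofield \<B> F \<eta> c x = pull_covector (jacobian id c c' x) (pullback_cofield \<B> F \<eta> c' x)"
proof -
  let ?d = "chart_at \<B> (F x)"
  have d: "?d \<in> \<B>" "F x \<in> fst ?d" by simp_all
  note ap = pullback_cofield_apply[of \<eta>, OF \<eta>]
  show ?thesis
  proof (cases "diff_at x")
    case True
    have "jacobian F c ?d x = jacobian id ?d ?d (F x) ** jacobian F c' ?d x ** jacobian id c c' x"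
      using change_charts(2)[OF c(2,1,4,3) d(1,1,2,2)] diff_atD[OF True c(2,4) d] by simp
    then have "jacobian F c ?d x = jacobian F c' ?d x ** jacobian id c c' x"
      by (simp add: N.jacobian_id_self[OF d])
    then show ?thesis
      using ap[OF _ _ _ _ c(1,3) d] ap[OF _ _ _ _ c(2,4) d] True by (simp add: pull_covector_mult)
  next
    case False
    then show ?thesis using ap[OF _ _ _ _ c(1,3) d] ap[OF _ _ _ _ c(2,4) d] by simp
  qed
qed

lemma jacobian_measurable:
  assumes c: "c \<in> \<A>" and d: "d \<in> \<B>"
  shows "chart_measurable c (\<lambda>x. if F x \<in> fst d \<and> diff_at x then jacobian F c d x $ i $ j else 0)" (is "chart_measurable c ?j")
proof -
  let ?f = "local_rep F c d" and ?O = "snd c ` (fst c \<inter> F -` fst d)" and ?S = "snd c ` fst c"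
  have oO: "open ?O" by (rule open_chart_overlap) (use c d cont_F in auto)
  have lipO: "lipschitz_near ?f y" if "y \<in> ?O" for y using that c d by (auto intro!: lip_F)
  have "(\<lambda>y. if y \<in> ?S then ?j (chart_inv c y) else 0) \<in> borel_measurable lebesgue"
  proof (rule measurable_cong[THEN iffD1, rotated, OF borel_measurable_vec_nth'[OF lipschitz_near_derivative_measurable[OF oO lipO, of "axis j 1"], of i]])
    fix y
    show "(if y \<in> {y \<in> ?O. ?f differentiable (at y)} then frechet_derivative ?f (at y) (axis j 1) else 0) $ i =
       (if y \<in> ?S then ?j (chart_inv c y) else 0)"
    proof (cases "y \<in> ?S")
      case True
      then obtain x where x: "x \<in> fst c" "y = snd c x" by auto
      have yO: "y \<in> ?O \<longleftrightarrow> F x \<in> fst d" using x chart_inj[OF M.charts[OF c]] by (auto simp: inj_on_def)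
      have "F x \<in> fst d \<Longrightarrow> diff_at x \<longleftrightarrow> ?f differentiable (at y)"
        using diff_atI[OF c x(1) d] diff_atD[OF _ c x(1) d] x(2) by blast
      then show ?thesis using x yO c by (cases "F x \<in> fst d"; simp add: jacobian_def matrix_def)
    qed auto
  qed
  then show ?thesis using chart_measurable_iff[OF M.charts[OF c]] by blast
qed

lemma jacobian_inverse:
  assumes x: "diff_at x" and y: "lip_homeo.diff_at \<B> \<A> G (F x)"
    and c: "c \<in> \<A>" "x \<in> fst c" and d: "d \<in> \<B>" "F x \<in> fst d"
  shows "jacobian G d c (F x) ** jacobian F c d x = mat 1"
proof -
  interpret sw: lip_homeo \<B> \<A> G F by (rule swap)
  have "G \<circ> F = id" by auto
  then have "jacobian id c c x = jacobian G d c (F x) ** jacobian F c d x"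
    using jacobian_compose(2)[of c d F x G c] diff_atD[OF x c d] sw.diff_atD[OF y d c(1)] c d cont_F by simp
  then show ?thesis by (simp add: M.jacobian_id_self[OF c])
qed

end

locale rough_iso = metric_iso \<A> \<B> F G g h Z + R: rough_manifold \<A> g + S: rough_manifold \<B> h
  for \<A> :: "('m::{t2_space, second_countable_topology}, 'n::finite) chart set"
    and \<B> :: "('k::{t2_space, second_countable_topology}, 'n) chart set" and F G g h Z
begin

text \<open>Off the enlarged exceptional set both maps are differentiable at corresponding points,
  so their Jacobians are mutually inverse and the isometry relation can be solved for
  \<open>h\<close>.\<close>

lemma swap_iso: "rough_iso \<B> \<A> G F h g (F ` Z \<union> {y. \<not> lip_homeo.diff_at \<B> \<A> G y})"
proof -
  interpret sw: lip_homeo \<B> \<A> G F by (rule swap)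
  show ?thesis
  proof
    show "mnull \<B> (F ` Z \<union> {y. \<not> sw.diff_at y})" by (intro mnull_Un mnull_image Z sw.mnull_not_diff)
    show "sw.diff_at y" if "y \<notin> F ` Z \<union> {y. \<not> sw.diff_at y}" for y using that by simp
    show "h d y = transpose (jacobian G d c y) ** g c (G y) ** jacobian G d c y"
      if y: "y \<notin> F ` Z \<union> {y. \<not> sw.diff_at y}" and dc: "d \<in> \<B>" "c \<in> \<A>" "y \<in> fst d" "G y \<in> fst c" for y d c
    proof -
      have xZ: "G y \<notin> Z" using y by (metis FG UnI1 imageI)
      let ?J = "jacobian F c d (G y)" and ?K = "jacobian G d c y"
      have "?K ** ?J = mat 1" using jacobian_inverse[of "G y" c d] diff_off_Z[OF xZ] y dc by simp
      then have JK: "?J ** ?K = mat 1" using matrix_left_right_inverse by blast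
      then have KJ: "transpose ?K ** transpose ?J = mat 1" by (metis matrix_transpose_mul transpose_mat)
      have "g c (G y) = transpose ?J ** h d y ** ?J" using isometry[OF xZ dc(2,1,4)] dc by simp
      then have "transpose ?K ** g c (G y) ** ?K = (transpose ?K ** transpose ?J) ** h d y ** (?J ** ?K)"
        by (simp add: matrix_mul_assoc)
      then show ?thesis by (simp add: JK KJ)
    qed
  qed (rule tensorial_h tensorial_g)+
qed

lemma measurable_F: "F \<in> R.\<mu> \<rightarrow>\<^sub>M S.\<mu>"
  and distr_F: "distr R.\<mu> S.\<mu> F = S.\<mu>"
proof -
  interpret sw: rough_iso \<B> \<A> G F h g "F ` Z \<union> {y. \<not> lip_homeo.diff_at \<B> \<A> G y}" by (rule swap_iso)
  show "F \<in> R.\<mu> \<rightarrow>\<^sub>M S.\<mu>" by (rule sw.measurable_G)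
  show "distr R.\<mu> S.\<mu> F = S.\<mu>" by (rule sw.distr_G)
qed

lemma integral_F:
  fixes f :: "'k \<Rightarrow> 'b::{banach, second_countable_topology}"
  assumes "f \<in> borel_measurable S.\<mu>"
  shows "integrable R.\<mu> (\<lambda>x. f (F x)) \<longleftrightarrow> integrable S.\<mu> f"
    "(LINT x|R.\<mu>. f (F x)) = (LINT y|S.\<mu>. f y)"
  using integrable_distr_eq[OF measurable_F assms] integral_distr[OF measurable_F assms] by (simp_all add: distr_F)

lemma AE_F: "(AE y in S.\<mu>. Q y) \<Longrightarrow> (AE x in R.\<mu>. Q (F x))"
proof -
  assume "AE y in S.\<mu>. Q y"
  then have m: "mnull \<B> {y. \<not> Q y}" by (simp add: S.AE_iff)
  interpret sw: lip_homeo \<B> \<A> G F by (rule swap)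
  have "mnull \<A> (G ` {y. \<not> Q y})" by (rule sw.mnull_image[OF m])
  moreover have "{x. \<not> Q (F x)} \<subseteq> G ` {y. \<not> Q y}"
  proof
    fix x assume "x \<in> {x. \<not> Q (F x)}"
    then show "x \<in> G ` {y. \<not> Q y}" by (intro image_eqI[of _ _ "F x"]) auto
  qed
  ultimately show ?thesis unfolding R.AE_iff by (rule mnull_subset)
qed

lemma AE_diff: "AE x in R.\<mu>. diff_at x" "AE x in R.\<mu>. x \<notin> Z"
  "AE x in R.\<mu>. lip_homeo.diff_at \<B> \<A> G (F x)"
proof -
  interpret sw: lip_homeo \<B> \<A> G F by (rule swap)
  show "AE x in R.\<mu>. diff_at x" unfolding R.AE_iff by (rule mnull_not_diff)
  show "AE x in R.\<mu>. x \<notin> Z" unfolding R.AE_iff using Z by simp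
  have "AE y in S.\<mu>. sw.diff_at y" unfolding S.AE_iff by (rule sw.mnull_not_diff)
  then show "AE x in R.\<mu>. sw.diff_at (F x)" by (rule AE_F)
qed

lemma L2_unitary: "unitary_map (L2 \<B> h) (L2 \<A> g) (\<lambda>u. u \<circ> F) (\<lambda>u. u \<circ> G)"
proof -
  interpret sw: rough_iso \<B> \<A> G F h g "F ` Z \<union> {y. \<not> lip_homeo.diff_at \<B> \<A> G y}" by (rule swap_iso)
  interpret HA: semi_hspace "L2 \<A> g" by (rule L2_semi_hspace)
  interpret HB: semi_hspace "L2 \<B> h" by (rule L2_semi_hspace)
  have el: "u \<circ> F \<in> elems (L2 \<A> g)" if "u \<in> elems (L2 \<B> h)" for u
  proof -
    have u: "u \<in> borel_measurable S.\<mu>" "integrable S.\<mu> (\<lambda>x. (cmod (u x))\<^sup>2)"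
      using that by (auto simp: L2_def)
    have "integrable R.\<mu> (\<lambda>x. (cmod (u (F x)))\<^sup>2)"
      using integral_F(1)[of "\<lambda>x. (cmod (u x))\<^sup>2"] u by simp
    then show ?thesis using measurable_comp[OF measurable_F u(1)] by (simp add: L2_def o_def)
  qed
  have el': "u \<circ> G \<in> elems (L2 \<B> h)" if "u \<in> elems (L2 \<A> g)" for u
  proof -
    have u: "u \<in> borel_measurable R.\<mu>" "integrable R.\<mu> (\<lambda>x. (cmod (u x))\<^sup>2)"
      using that by (auto simp: L2_def)
    have "integrable S.\<mu> (\<lambda>x. (cmod (u (G x)))\<^sup>2)"
      using sw.integral_F(1)[of "\<lambda>x. (cmod (u x))\<^sup>2"] u by simp
    then show ?thesis using measurable_comp[OF sw.measurable_F u(1)] by (simp add: L2_def o_def)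
  qed
  show ?thesis
  proof
    fix u v assume uv: "u \<in> elems (L2 \<B> h)" "v \<in> elems (L2 \<B> h)"
    then have "(\<lambda>x. u x * cnj (v x)) \<in> borel_measurable S.\<mu>"
      by (intro integral_form.meas[OF L2_form]) (auto simp: L2_def)
    from integral_F(2)[OF this]
    show "inn (L2 \<A> g) (u \<circ> F) (v \<circ> F) = inn (L2 \<B> h) u v" by (simp add: L2_def)
  next
    fix u assume u: "u \<in> elems (L2 \<A> g)"
    have "(u \<circ> G) \<circ> F = u" by auto
    then show "aeq (L2 \<A> g) ((u \<circ> G) \<circ> F) u" using HA.aeq_refl[OF u] by simp
  next
    show "u \<circ> F \<in> elems (L2 \<A> g)" if "u \<in> elems (L2 \<B> h)" for u by (rule el[OF that])
    show "u \<circ> G \<in> elems (L2 \<B> h)" if "u \<in> elems (L2 \<A> g)" for u by (rule el'[OF that])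
  qed (auto simp: L2_def fun_eq_iff)
qed

text \<open>The target chart varies with the point. On each piece of a countable disjoint cover one
  target chart \<open>e n\<close> can be kept fixed, and there the pullback is built from measurable
  Jacobian entries and from \<eta> composed with \<open>F\<close>.\<close>

lemma pullback_measurable:
  assumes \<eta>: "measurable_cofield \<B> \<eta>"
  shows "measurable_cofield \<A> (pullback_cofield \<B> F \<eta>)"
proof -
  note ch = S.cofield_change[OF \<eta>]
  have "chart_measurable c (pullback_cofield \<B> F \<eta> c)" if c: "c \<in> \<A>" for c
  proof (rule R.chart_measurable_of_extension[OF c])
    let ?I = \<B> and ?V = "\<lambda>d. F -` fst d"
    have "\<exists>d\<in>\<B>. open (?V d) \<and> x \<in> ?V d" for x
      by (rule bexI[of _ "chart_at \<B> (F x)"]) (auto intro!: open_vimage chart_open cont_F)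
    then obtain e and D :: "nat \<Rightarrow> 'm set" where eD: "\<And>n. e n \<in> \<B>" "\<And>n. D n \<subseteq> ?V (e n)"
      "\<And>n. D n \<in> lebesgue_sets \<A>" "disjoint_family D" "(\<Union>n. D n) = UNIV"
      by (rule M.disjoint_cover[of ?I ?V]) (rule that)
    let ?w = "\<lambda>x. if x \<in> fst c then pullback_cofield \<B> F \<eta> c x else 0"
    define J where "J d x = (if x \<in> fst c then if F x \<in> fst d \<and> diff_at x then jacobian F c d x else 0 else 0)" for d x
    have Jm: "(\<lambda>x. J d x $ i $ j) \<in> borel_measurable R.\<mu>" if d: "d \<in> \<B>" for d i j
      using R.measurable_extend_chart[OF c jacobian_measurable[OF c d, of i j]]
      by (rule measurable_cong[THEN iffD1, rotated]) (auto simp: J_def)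
    have Wm: "(\<lambda>x. if F x \<in> fst d then \<eta> d (F x) else 0) \<in> borel_measurable R.\<mu>" if d: "d \<in> \<B>" for d
      using measurable_compose[OF measurable_F S.measurable_extend_chart[OF d S.cofield_measurable[OF \<eta> d]]] .
    have fm: "(\<lambda>x. pull_covector (J d x) (if F x \<in> fst d then \<eta> d (F x) else 0)) \<in> borel_measurable R.\<mu>" if "d \<in> \<B>" for d
      by (intro borel_measurable_pull_covector Jm Wm that)
    have pull0: "pull_covector 0 \<zeta> = 0" for \<zeta> :: "complex ^ 'n" by (simp add: pull_covector_def vec_eq_iff)
    have eq: "?w x = pull_covector (J (e n) x) (if F x \<in> fst (e n) then \<eta> (e n) (F x) else 0)" if "x \<in> D n" for x n
    proof -
      have Fx: "F x \<in> fst (e n)" using that eD(2) by auto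
      show ?thesis
        using pullback_cofield_apply[of \<eta> c x "e n", OF ch c _ eD(1) Fx] Fx by (simp add: J_def pull0)
    qed
    show "?w \<in> borel_measurable R.\<mu>"
    proof (rule measurable_piecewise_restrict[of "range D"])
      show "space R.\<mu> \<subseteq> \<Union> (range D)" using eD(5) by auto
      show "\<Omega> \<inter> space R.\<mu> \<in> sets R.\<mu>" if "\<Omega> \<in> range D" for \<Omega>
        using that eD(3) by (auto simp: R.sets_\<mu>)
      fix \<Omega> assume "\<Omega> \<in> range D"
      then obtain n where n: "\<Omega> = D n" by auto
      have "(\<lambda>x. pull_covector (J (e n) x) (if F x \<in> fst (e n) then \<eta> (e n) (F x) else 0)) \<in> borel_measurable (restrict_space R.\<mu> (D n))"
        by (rule measurable_restrict_space1[OF fm[OF eD(1)]])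
      then show "?w \<in> borel_measurable (restrict_space R.\<mu> \<Omega>)"
        unfolding n by (rule measurable_cong[THEN iffD1, rotated]) (simp add: eq space_restrict_space)
    qed simp
  qed
  moreover have "pullback_cofield \<B> F \<eta> c x = pull_covector (jacobian id c c' x) (pullback_cofield \<B> F \<eta> c' x)"
    if "c \<in> \<A>" "c' \<in> \<A>" "x \<in> fst c \<inter> fst c'" for c c' x
    using that by (intro pullback_cofield_change ch) auto
  ultimately show ?thesis unfolding measurable_cofield_def by blast
qed

lemma field_inner_pullback:
  assumes \<eta>: "measurable_cofield \<B> \<eta>" and \<zeta>: "measurable_cofield \<B> \<zeta>"
  shows "AE x in R.\<mu>. field_inner \<A> g (pullback_cofield \<B> F \<eta>) (pullback_cofield \<B> F \<zeta>) x = field_inner \<B> h \<eta> \<zeta> (F x)"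
  using AE_diff AE_F[OF S.AE_good]
proof eventually_elim
  case (elim x)
  let ?c = "chart_at \<A> x" and ?d = "chart_at \<B> (F x)"
  have c: "?c \<in> \<A>" "x \<in> fst ?c" and d: "?d \<in> \<B>" "F x \<in> fst ?d" by simp_all
  have KJ: "jacobian G ?d ?c (F x) ** jacobian F ?c ?d x = mat 1" by (rule jacobian_inverse[OF elim(1,3) c d])
  have "invertible (h ?d (F x))" using elim(4) by (intro posdef_invertible) (simp add: S.good_def)
  from cov_inner_congruence[OF this KJ] isometry[OF elim(2) c(1) d(1) c(2) d(2)]
  show ?case
    using pullback_cofield_apply[of \<eta> ?c x ?d, OF S.cofield_change[OF \<eta>] c d]
      pullback_cofield_apply[of \<zeta> ?c x ?d, OF S.cofield_change[OF \<zeta>] c d] elim(1)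
    by (simp add: field_inner_def Let_def)
qed

lemma pullback_elems:
  assumes "\<eta> \<in> elems (L2cov \<B> h)"
  shows "pullback_cofield \<B> F \<eta> \<in> elems (L2cov \<A> g)"
proof -
  have m: "measurable_cofield \<B> \<eta>" and i: "integrable S.\<mu> (\<lambda>x. Re (field_inner \<B> h \<eta> \<eta> x))"
    using assms by (auto simp: L2cov_def)
  have pm: "measurable_cofield \<A> (pullback_cofield \<B> F \<eta>)" by (rule pullback_measurable[OF m])
  have "integrable R.\<mu> (\<lambda>x. Re (field_inner \<B> h \<eta> \<eta> (F x)))"
    using i by (subst integral_F(1)) auto
  then have "integrable R.\<mu> (\<lambda>x. Re (field_inner \<A> g (pullback_cofield \<B> F \<eta>) (pullback_cofield \<B> F \<eta>) x))"
  proof (rule integrable_cong_AE_imp)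
    show "(\<lambda>x. Re (field_inner \<A> g (pullback_cofield \<B> F \<eta>) (pullback_cofield \<B> F \<eta>) x)) \<in> borel_measurable R.\<mu>"
      by (rule measurable_compose[OF R.field_inner_measurable[OF pm pm] borel_measurable_Re])
    show "AE x in R.\<mu>. Re (field_inner \<B> h \<eta> \<eta> (F x)) = Re (field_inner \<A> g (pullback_cofield \<B> F \<eta>) (pullback_cofield \<B> F \<eta>) x)"
      using field_inner_pullback[OF m m] by eventually_elim simp
  qed
  then show ?thesis using pm by (simp add: L2cov_def)
qed

lemma L2cov_unitary: "unitary_map (L2cov \<B> h) (L2cov \<A> g) (pullback_cofield \<B> F) (pullback_cofield \<A> G)"
proof -
  interpret sw: rough_iso \<B> \<A> G F h g "F ` Z \<union> {y. \<not> lip_homeo.diff_at \<B> \<A> G y}" by (rule swap_iso)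
  interpret HA: semi_hspace "L2cov \<A> g" by (rule R.L2cov_semi_hspace)
  interpret HB: semi_hspace "L2cov \<B> h" by (rule S.L2cov_semi_hspace)
  show ?thesis
  proof
    show "pullback_cofield \<B> F \<eta> \<in> elems (L2cov \<A> g)" if "\<eta> \<in> elems (L2cov \<B> h)" for \<eta> by (rule pullback_elems[OF that])
    show "pullback_cofield \<A> G \<omega> \<in> elems (L2cov \<B> h)" if "\<omega> \<in> elems (L2cov \<A> g)" for \<omega> by (rule sw.pullback_elems[OF that])
    show "aeq (L2cov \<A> g) (pullback_cofield \<B> F (pullback_cofield \<A> G \<omega>)) \<omega>" if \<omega>: "\<omega> \<in> elems (L2cov \<A> g)" for \<omega>
      unfolding R.aeq_L2cov_iff
    proof (intro conjI \<omega>)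
      show "pullback_cofield \<B> F (pullback_cofield \<A> G \<omega>) \<in> elems (L2cov \<A> g)"
        using \<omega> by (intro pullback_elems sw.pullback_elems)
      have m: "measurable_cofield \<A> \<omega>" using \<omega> by (simp add: L2cov_def)
      have pm: "measurable_cofield \<B> (pullback_cofield \<A> G \<omega>)" by (rule sw.pullback_measurable[OF m])
      \<comment> \<open>Both \<open>F\<close> at \<open>x\<close> and \<open>G\<close> at
        \<open>F x\<close> have to be differentiable; elsewhere the convention in
        \<open>pullback_cofield\<close> makes the double pullback zero.\<close>
      show "AE x in R.\<mu>. \<forall>c\<in>\<A>. x \<in> fst c \<longrightarrow> pullback_cofield \<B> F (pullback_cofield \<A> G \<omega>) c x = \<omega> c x"
        using AE_diff(1,3)
      proof eventually_elim
        case (elim x)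
        show ?case
        proof (intro ballI impI)
          fix c assume c: "c \<in> \<A>" "x \<in> fst c"
          let ?d = "chart_at \<B> (F x)"
          have d: "?d \<in> \<B>" "F x \<in> fst ?d" by simp_all
          have c': "G (F x) \<in> fst c" using c by simp
          show "pullback_cofield \<B> F (pullback_cofield \<A> G \<omega>) c x = \<omega> c x"
            using pullback_cofield_apply[of "pullback_cofield \<A> G \<omega>" c x ?d, OF S.cofield_change[OF pm] c d]
              sw.pullback_cofield_apply[of \<omega> ?d "F x" c, OF R.cofield_change[OF m] d c(1) c'] elim
              jacobian_inverse[OF elim c d]
            by (simp flip: pull_covector_mult)
        qed
      qed
    qed
    show "inn (L2cov \<A> g) (pullback_cofield \<B> F \<eta>) (pullback_cofield \<B> F \<zeta>) = inn (L2cov \<B> h) \<eta> \<zeta>"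
      if "\<eta> \<in> elems (L2cov \<B> h)" "\<zeta> \<in> elems (L2cov \<B> h)" for \<eta> \<zeta>
    proof -
      have m: "measurable_cofield \<B> \<eta>" "measurable_cofield \<B> \<zeta>" using that by (auto simp: L2cov_def)
      note fm = S.field_inner_measurable[OF m]
      have "(LINT x|R.\<mu>. field_inner \<A> g (pullback_cofield \<B> F \<eta>) (pullback_cofield \<B> F \<zeta>) x)
          = (LINT x|R.\<mu>. field_inner \<B> h \<eta> \<zeta> (F x))"
        by (rule integral_cong_AE)
          (auto intro!: R.field_inner_measurable pullback_measurable m field_inner_pullback measurable_compose[OF measurable_F fm])
      then show ?thesis using integral_F(2)[OF fm] by (simp add: L2cov_def)
    qed
    show "pullback_cofield \<B> F (\<eta> - \<zeta>) = pullback_cofield \<B> F \<eta> - pullback_cofield \<B> F \<zeta>" for \<eta> \<zeta> :: "('k, 'n) cofield"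
      by (auto simp: fun_eq_iff pullback_cofield_def Let_def pull_covector_diff)
    show "pullback_cofield \<B> F (scal (L2cov \<B> h) k \<eta>) = scal (L2cov \<A> g) k (pullback_cofield \<B> F \<eta>)" for k \<eta>
      by (auto simp: fun_eq_iff pullback_cofield_def Let_def L2cov_def pull_covector_scale)
  qed
qed

end

section \<open>Lipschitz functions in the domain of the closed gradient\<close>

subsection \<open>Lipschitz functions with compact support\<close>

text \<open>Compactness gives a single constant on a closed ball whose interior contains the
  support. The nearest-point projection sends outer points to the boundary sphere, where
  \<open>f\<close> vanishes, so composing with it does not change \<open>f\<close>.\<close>

lemma lipschitz_near_compact_support:
  fixes f :: "'a::euclidean_space \<Rightarrow> 'b::real_normed_vector"
  assumes lip: "\<And>x. lipschitz_near f x" and K: "bounded K" "\<And>x. x \<notin> K \<Longrightarrow> f x = 0"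
  obtains L where "L-lipschitz_on UNIV f"
proof -
  obtain R where R: "R > 0" "K \<subseteq> ball 0 R" using bounded_subset_ballD[OF K(1), of 0] by auto
  let ?C = "cball 0 R :: 'a set" and ?p = "closest_point (cball 0 R :: 'a set)"
  have loc: "local_lipschitz {0::real} ?C (\<lambda>_. f)"
  proof (rule local_lipschitzI)
    fix x :: 'a and t :: real
    obtain r L where r: "r > 0" "L-lipschitz_on (ball x r) f" using lip[of x] by (auto simp: lipschitz_near_def)
    have "L-lipschitz_on (cball x (r/2) \<inter> ?C) f" by (rule lipschitz_on_subset[OF r(2)]) (use r(1) in auto)
    then show "\<exists>u>0. \<exists>L. \<forall>t\<in>cball t u \<inter> {0}. L-lipschitz_on (cball x u \<inter> ?C) f"
      using r(1) by (intro exI[of _ "r/2"]) auto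
  qed
  obtain L where "\<And>t. t \<in> {0::real} \<Longrightarrow> L-lipschitz_on ?C f"
    by (rule local_lipschitz_compact_implies_lipschitz[OF loc]) auto
  then have L: "L-lipschitz_on ?C f" by simp
  have pf: "f (?p x) = f x" for x
  proof (cases "x \<in> ?C")
    case True then show ?thesis by (simp add: closest_point_self)
  next
    case False
    have x0: "norm x > R" "x \<noteq> 0" using False R(1) by auto
    have "dist x (?p x) \<le> dist x ((R / norm x) *\<^sub>R x)"
      using R x0 by (intro closest_point_le) (auto simp: field_simps)
    also have "\<dots> = norm ((1 - R / norm x) *\<^sub>R x)" by (simp add: dist_norm scaleR_left_diff_distrib)
    also have "\<dots> = (1 - R / norm x) * norm x"
      unfolding norm_scaleR using R x0 by (subst abs_of_nonneg) (auto simp: field_simps)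
    also have "\<dots> = norm x - R" using R x0 by (simp add: field_simps)
    finally have "norm (?p x) \<ge> R" using norm_triangle_ineq2[of x "?p x"] by (simp add: dist_norm)
    then have "?p x \<notin> K" using R by auto
    moreover have "x \<notin> K" using False R by auto
    ultimately show ?thesis using K(2) by simp
  qed
  have "L-lipschitz_on UNIV f"
  proof (rule lipschitz_onI)
    fix x y :: 'a
    have "?p x \<in> ?C" "?p y \<in> ?C" using closest_point_in_set[of ?C x] closest_point_in_set[of ?C y] R by auto
    then have "dist (f (?p x)) (f (?p y)) \<le> L * dist (?p x) (?p y)" using L by (intro lipschitz_onD) auto
    also have "\<dots> \<le> L * dist x y"
      using closest_point_lipschitz[of ?C x y] R lipschitz_on_nonneg[OF L] by (intro mult_left_mono) auto
    finally show "dist (f x) (f y) \<le> L * dist x y" by (simp only: pf)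
  qed (rule lipschitz_on_nonneg[OF L])
  then show thesis by (rule that)
qed

lemma lipschitz_near_arith:
  fixes f :: "'a::metric_space \<Rightarrow> 'b::real_normed_algebra"
  assumes f: "lipschitz_near f x" and g: "lipschitz_near g x"
  shows "lipschitz_near (\<lambda>y. f y + g y) x" "lipschitz_near (\<lambda>y. f y * g y) x"
proof -
  obtain r L where r: "r > 0" "L-lipschitz_on (ball x r) f" using f by (auto simp: lipschitz_near_def)
  obtain s M where s: "s > 0" "M-lipschitz_on (ball x s) g" using g by (auto simp: lipschitz_near_def)
  let ?B = "ball x (min r s)"
  have L: "L-lipschitz_on ?B f" "M-lipschitz_on ?B g"
    by (rule lipschitz_on_subset[OF r(2)], auto, rule lipschitz_on_subset[OF s(2)], auto)
  then have "(L + M)-lipschitz_on ?B (\<lambda>y. f y + g y)" by (rule lipschitz_on_add)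
  then show "lipschitz_near (\<lambda>y. f y + g y) x" using r s by (intro lipschitz_nearI[of "L + M" x "min r s"]) auto
  have L0: "L \<ge> 0" "M \<ge> 0" using L lipschitz_on_nonneg by blast+
  define a where "a = norm (f x) + L * min r s"
  define b where "b = norm (g x) + M * min r s"
  have bd: "norm (f y) \<le> a" "norm (g y) \<le> b" if "y \<in> ?B" for y
  proof -
    have d: "dist y x \<le> min r s" using that by (simp add: dist_commute)
    have x: "x \<in> ?B" using r s by auto
    have "norm (f y) \<le> norm (f x) + dist (f y) (f x)" by (simp add: dist_norm norm_triangle_sub)
    also have "dist (f y) (f x) \<le> L * dist y x" by (rule lipschitz_onD[OF L(1) that x])
    also have "\<dots> \<le> L * min r s" using d L0 by (intro mult_left_mono)
    finally show "norm (f y) \<le> a" by (simp add: a_def)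
    have "norm (g y) \<le> norm (g x) + dist (g y) (g x)" by (simp add: dist_norm norm_triangle_sub)
    also have "dist (g y) (g x) \<le> M * dist y x" by (rule lipschitz_onD[OF L(2) that x])
    also have "\<dots> \<le> M * min r s" using d L0 by (intro mult_left_mono)
    finally show "norm (g y) \<le> b" by (simp add: b_def)
  qed
  have ab: "0 \<le> a" "0 \<le> b" using L0 r s by (auto simp: a_def b_def)
  have "(a * M + L * b)-lipschitz_on ?B (\<lambda>y. f y * g y)"
  proof (rule lipschitz_onI)
    fix y z assume y: "y \<in> ?B" and z: "z \<in> ?B"
    have "f y * g y - f z * g z = f y * (g y - g z) + (f y - f z) * g z" by (simp add: algebra_simps)
    then have "dist (f y * g y) (f z * g z) \<le> norm (f y * (g y - g z)) + norm ((f y - f z) * g z)"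
      by (simp add: dist_norm norm_triangle_ineq)
    also have "\<dots> \<le> norm (f y) * dist (g y) (g z) + dist (f y) (f z) * norm (g z)"
      by (simp add: dist_norm add_mono norm_mult_ineq)
    also have "\<dots> \<le> a * (M * dist y z) + (L * dist y z) * b"
      using bd y z ab L0 lipschitz_onD[OF L(1) y z] lipschitz_onD[OF L(2) y z]
      by (intro add_mono mult_mono) auto
    finally show "dist (f y * g y) (f z * g z) \<le> (a * M + L * b) * dist y z" by (simp add: algebra_simps)
  qed (use ab L0 in auto)
  then show "lipschitz_near (\<lambda>y. f y * g y) x" using r s by (intro lipschitz_nearI[of "a * M + L * b" x "min r s"]) auto
qed

lemma lipschitz_near_const: "lipschitz_near (\<lambda>_. c) x"
  by (rule lipschitz_nearI[OF lipschitz_on_constant, of 1]) simp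

text \<open>A local condition in charts that refers to no metric; in a single chart, compact support
  turns it into a global Lipschitz bound.\<close>

definition lip_fun :: "('m, 'n::finite) chart set \<Rightarrow> ('m \<Rightarrow> complex) \<Rightarrow> bool" where
  "lip_fun \<A> u \<longleftrightarrow> (\<forall>c\<in>\<A>. \<forall>x\<in>fst c. lipschitz_near (u \<circ> chart_inv c) (snd c x))"

text \<open>Unlike \<open>ext_deriv\<close>, this is a tensor field even where the function is not differentiable.\<close>

definition lip_deriv :: "('m \<Rightarrow> complex) \<Rightarrow> ('m, 'n::finite) cofield" where
  "lip_deriv u c x = (if (u \<circ> chart_inv c) differentiable (at (snd c x)) then ext_deriv u c x else 0)"

lemma ext_deriv_eqI:
  "((u \<circ> chart_inv c) has_derivative D) (at (snd c x)) \<Longrightarrow> ext_deriv u c x = (\<chi> i. D (axis i 1))"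
  unfolding ext_deriv_def by (simp add: frechet_derivative_eqI)

context lip_homeo
begin

lemma ext_deriv_compose:
  assumes c: "c \<in> \<A>" "x \<in> fst c" and d: "d \<in> \<B>" "F x \<in> fst d"
    and F: "local_rep F c d differentiable (at (snd c x))" and u: "(u \<circ> chart_inv d) differentiable (at (snd d (F x)))"
  shows "(u \<circ> F \<circ> chart_inv c) differentiable (at (snd c x))"
    "ext_deriv (u \<circ> F) c x = pull_covector (jacobian F c d x) (ext_deriv u d (F x))"
proof -
  let ?D = "frechet_derivative (u \<circ> chart_inv d) (at (snd d (F x)))" and ?J = "jacobian F c d x"
  have uD: "((u \<circ> chart_inv d) has_derivative ?D) (at (snd d (F x)))" using u by (simp add: frechet_derivative_works)
  have "((\<lambda>y. (u \<circ> chart_inv d) (local_rep F c d y)) has_derivative (\<lambda>v. ?D (?J *v v))) (at (snd c x))"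
    by (rule has_derivative_compose[OF local_rep_has_jacobian[OF F]]) (simp only: local_rep_apply[OF M.charts[OF c(1)] c(2)] uD)
  then have D: "(u \<circ> F \<circ> chart_inv c has_derivative (\<lambda>v. ?D (?J *v v))) (at (snd c x))"
    by (rule has_derivative_transform_within_open[OF _ open_chart_overlap[of c d F]])
      (use c d cont_F in \<open>auto simp: local_rep_def\<close>)
  then show "(u \<circ> F \<circ> chart_inv c) differentiable (at (snd c x))" by (auto simp: differentiable_def)
  have lin: "linear ?D" using uD by (rule has_derivative_linear)
  have "?D (?J *v axis j 1) = (\<Sum>i\<in>UNIV. complex_of_real (?J $ i $ j) * ?D (axis i 1))" for j
  proof -
    have "?J *v axis j 1 = (\<Sum>i\<in>UNIV. (?J $ i $ j) *\<^sub>R axis i 1)"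
    proof -
      have "(?J *v axis j 1) $ i = ?J $ i $ j" for i by (simp add: matrix_vector_mul_component inner_axis)
      moreover have "(\<Sum>k\<in>UNIV. (?J $ k $ j) *\<^sub>R axis k 1) $ i = ?J $ i $ j" for i
        by (simp add: axis_def if_distrib cong: if_cong)
      ultimately show ?thesis by (simp add: vec_eq_iff)
    qed
    then have "?D (?J *v axis j 1) = (\<Sum>i\<in>UNIV. (?J $ i $ j) *\<^sub>R ?D (axis i 1))"
      by (simp only: linear_sum[OF lin] linear_scale[OF lin])
    then show ?thesis by (simp only: scaleR_conv_of_real)
  qed
  moreover have D': "(u \<circ> F) \<circ> chart_inv c = u \<circ> F \<circ> chart_inv c" by (simp add: o_assoc)
  ultimately show "ext_deriv (u \<circ> F) c x = pull_covector ?J (ext_deriv u d (F x))"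
    using ext_deriv_eqI[of "u \<circ> F" c, OF D] by (simp add: pull_covector_def ext_deriv_def vec_eq_iff)
qed

end

context smooth_manifold
begin

lemma ext_deriv_change:
  assumes "c \<in> \<A>" "x \<in> fst c" "d \<in> \<A>" "x \<in> fst d" "(u \<circ> chart_inv d) differentiable (at (snd d x))"
  shows "(u \<circ> chart_inv c) differentiable (at (snd c x))"
    "ext_deriv u c x = pull_covector (jacobian id c d x) (ext_deriv u d x)"
  using ident.ext_deriv_compose[of c x d u] assms transition_differentiable[of c d x] by simp_all

lemma lip_deriv_change:
  assumes "c \<in> \<A>" "x \<in> fst c" "d \<in> \<A>" "x \<in> fst d"
  shows "lip_deriv u c x = pull_covector (jacobian id c d x) (lip_deriv u d x)"
  using ext_deriv_change[OF assms, of u] ext_deriv_change(1)[OF assms(3,4,1,2), of u]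
  by (auto simp: lip_deriv_def)

lemma lip_deriv_measurable:
  assumes u: "lip_fun \<A> u"
  shows "measurable_cofield \<A> (lip_deriv u)"
  unfolding measurable_cofield_def
proof (intro conjI ballI)
  show "lip_deriv u c x = pull_covector (jacobian id c d x) (lip_deriv u d x)"
    if "c \<in> \<A>" "d \<in> \<A>" "x \<in> fst c \<inter> fst d" for c d x
    using lip_deriv_change that by blast
  fix c assume c: "c \<in> \<A>"
  let ?S = "snd c ` fst c" and ?f = "u \<circ> chart_inv c"
  have oS: "open ?S" using charts[OF c] by (simp add: is_chart_def)
  have lipS: "lipschitz_near ?f y" if "y \<in> ?S" for y using that u c unfolding lip_fun_def by blast
  note m = lipschitz_near_derivative_measurable[OF oS lipS]
  have "(\<lambda>y. if y \<in> ?S then lip_deriv u c (chart_inv c y) else 0) \<in> borel_measurable lebesgue"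
  proof (rule borel_measurable_vecI)
    fix i
    show "(\<lambda>y. (if y \<in> ?S then lip_deriv u c (chart_inv c y) else 0) $ i) \<in> borel_measurable lebesgue"
      by (rule measurable_cong[THEN iffD1, OF _ m[of "axis i 1"]]) (use c in \<open>auto simp: lip_deriv_def ext_deriv_def\<close>)
  qed
  then show "chart_measurable c (lip_deriv u c)" using chart_measurable_iff[OF charts[OF c]] by blast
qed

lemma mnull_lip_fun_not_diff:
  assumes u: "lip_fun \<A> u"
  shows "mnull \<A> {x. \<not> (\<forall>c\<in>\<A>. x \<in> fst c \<longrightarrow> (u \<circ> chart_inv c) differentiable (at (snd c x)))}"
  unfolding mnull_def
proof
  fix c assume c: "c \<in> \<A>"
  have "lipschitz_near (u \<circ> chart_inv c) y" if "y \<in> snd c ` fst c" for y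
    using that u c unfolding lip_fun_def by blast
  then have "negligible {y \<in> snd c ` fst c. \<not> (u \<circ> chart_inv c) differentiable (at y)}" by (rule Rademacher)
  then show "negligible (snd c ` ({x. \<not> (\<forall>c\<in>\<A>. x \<in> fst c \<longrightarrow> (u \<circ> chart_inv c) differentiable (at (snd c x)))} \<inter> fst c))"
    by (rule negligible_subset) (use ext_deriv_change(1)[of _ _ c] c in blast)
qed

lemma lip_fun_smooth:
  assumes "smooth_fun \<A> u"
  shows "lip_fun \<A> u" "c \<in> \<A> \<Longrightarrow> x \<in> fst c \<Longrightarrow> (u \<circ> chart_inv c) differentiable (at (snd c x))"
    "c \<in> \<A> \<Longrightarrow> x \<in> fst c \<Longrightarrow> lip_deriv u c x = ext_deriv u c x"
proof -
  have sm: "smooth_on (snd c ` fst c) (u \<circ> chart_inv c)" if "c \<in> \<A>" for c using assms that by (simp add: smooth_fun_def)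
  have op: "open (snd c ` fst c)" if "c \<in> \<A>" for c using charts[OF that] by (simp add: is_chart_def)
  show "lip_fun \<A> u" unfolding lip_fun_def using smooth_lipschitz_near[OF op _ sm] by blast
  show d: "(u \<circ> chart_inv c) differentiable (at (snd c x))" if "c \<in> \<A>" "x \<in> fst c" for c x
    using smooth_on_has_derivative[OF sm[OF that(1)], of "snd c x"] that(2) by (auto simp: differentiable_def)
  show "lip_deriv u c x = ext_deriv u c x" if "c \<in> \<A>" "x \<in> fst c" for c x using d[OF that] by (simp add: lip_deriv_def)
qed

lemma measurable_cofield_cong:
  assumes "\<And>c x. c \<in> \<A> \<Longrightarrow> x \<in> fst c \<Longrightarrow> \<omega> c x = \<eta> c x" and m: "measurable_cofield \<A> \<omega>"
  shows "measurable_cofield \<A> \<eta>"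
  unfolding measurable_cofield_def
proof (intro conjI ballI)
  fix c d x assume cd: "c \<in> \<A>" "d \<in> \<A>" "x \<in> fst c \<inter> fst d"
  then show "\<eta> c x = pull_covector (jacobian id c d x) (\<eta> d x)"
    using m[unfolded measurable_cofield_def, THEN conjunct1, rule_format, OF cd] assms(1)[of c x] assms(1)[of d x] by simp
next
  fix c assume c: "c \<in> \<A>"
  then have "chart_measurable c (\<omega> c)" using m by (simp add: measurable_cofield_def)
  then show "chart_measurable c (\<eta> c)"
    unfolding chart_measurable_def by (rule measurable_cong[THEN iffD1, rotated]) (use c assms(1) in auto)
qed

lemma ext_deriv_measurable: "smooth_fun \<A> u \<Longrightarrow> measurable_cofield \<A> (ext_deriv u)"
  by (rule measurable_cofield_cong[OF _ lip_deriv_measurable[OF lip_fun_smooth(1)]]) (simp_all add: lip_fun_smooth(3))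

lemma lip_fun_times_add:
  assumes "lip_fun \<A> u" "lip_fun \<A> v"
  shows "lip_fun \<A> (\<lambda>x. u x + v x)" "lip_fun \<A> (\<lambda>x. u x * v x)"
  using assms lipschitz_near_arith unfolding lip_fun_def o_def by blast+

definition chart_extend :: "('m, 'n) chart \<Rightarrow> (real ^ 'n \<Rightarrow> complex) \<Rightarrow> 'm \<Rightarrow> complex" where
  "chart_extend c \<phi> x = (if x \<in> fst c then \<phi> (snd c x) else 0)"

lemma chart_inv_image_compact:
  assumes c: "c \<in> \<A>" and L: "compact L" "L \<subseteq> snd c ` fst c"
  shows "compact (chart_inv c ` L)"
  by (rule compact_continuous_image[OF continuous_on_subset[OF chart_inv_cont[OF charts[OF c]] L(2)] L(1)])

text \<open>The image of the compact set is closed since the manifold is Hausdorff, so each chart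
  domain is a union of two open sets: on one the extension is a composition with a transition map,
  on the other it is zero. Smooth and Lipschitz functions are glued by this same argument.\<close>

lemma chart_extend_near:
  assumes c: "c \<in> \<A>" and L: "compact L" "L \<subseteq> snd c ` fst c" and \<phi>: "\<forall>y. y \<notin> L \<longrightarrow> \<phi> y = 0"
    and d: "d \<in> \<A>"
  defines "W1 \<equiv> snd d ` (fst d \<inter> fst c)" and "W2 \<equiv> snd d ` (fst d - chart_inv c ` L)"
  shows "open W1" "open W2" "W1 \<union> W2 = snd d ` fst d"
    "\<And>y. y \<in> W1 \<Longrightarrow> (chart_extend c \<phi> \<circ> chart_inv d) y = \<phi> (local_rep id d c y)"
    "\<And>y. y \<in> W2 \<Longrightarrow> (chart_extend c \<phi> \<circ> chart_inv d) y = 0"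
proof -
  show "open W1" unfolding W1_def by (rule overlap_open[OF d c])
  have "closed (chart_inv c ` L)" by (rule compact_imp_closed[OF chart_inv_image_compact[OF c L]])
  then show "open W2" unfolding W2_def
    by (intro chart_open_image[OF charts[OF d]] open_Diff chart_open[OF charts[OF d]]) auto
  have "chart_inv c ` L \<subseteq> fst c" using L(2) c by auto
  then have "(fst d \<inter> fst c) \<union> (fst d - chart_inv c ` L) = fst d" by blast
  then show "W1 \<union> W2 = snd d ` fst d" by (simp only: W1_def W2_def image_Un[symmetric])
  show "(chart_extend c \<phi> \<circ> chart_inv d) y = \<phi> (local_rep id d c y)" if "y \<in> W1" for y
    using that d by (auto simp: W1_def chart_extend_def local_rep_def)
  show "(chart_extend c \<phi> \<circ> chart_inv d) y = 0" if y: "y \<in> W2" for y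
  proof -
    obtain x where x: "x \<in> fst d" "x \<notin> chart_inv c ` L" "y = snd d x" using y by (auto simp: W2_def)
    have "snd c x \<notin> L" if "x \<in> fst c"
    proof
      assume "snd c x \<in> L"
      then have "x \<in> chart_inv c ` L" using that c by (intro image_eqI[of _ _ "snd c x"]) auto
      then show False using x(2) by blast
    qed
    then show ?thesis using x d \<phi> by (simp add: chart_extend_def)
  qed
qed

lemma chart_extend_support:
  assumes "c \<in> \<A>" "\<And>y. y \<notin> L \<Longrightarrow> \<phi> y = 0" "x \<notin> chart_inv c ` L"
  shows "chart_extend c \<phi> x = 0"
proof -
  have "\<phi> (snd c x) = 0" if "x \<in> fst c"
  proof (rule assms(2), rule notI)
    assume "snd c x \<in> L"
    then show False using assms(1,3) that by (metis charts chart_inv_left imageI)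
  qed
  then show ?thesis by (simp add: chart_extend_def)
qed

lemma smooth_chart_extend:
  assumes c: "c \<in> \<A>" and L: "compact L" "L \<subseteq> snd c ` fst c" "\<forall>y. y \<notin> L \<longrightarrow> \<phi> y = 0"
    and \<phi>: "smooth_on UNIV \<phi>"
  shows "smooth_fun \<A> (chart_extend c \<phi>)"
  unfolding smooth_fun_def
proof
  fix d assume d: "d \<in> \<A>"
  note W = chart_extend_near[OF c L d]
  let ?W1 = "snd d ` (fst d \<inter> fst c)" and ?W2 = "snd d ` (fst d - chart_inv c ` L)"
  have s1: "smooth_on ?W1 (\<lambda>y. \<phi> (local_rep id d c y))"
    by (rule smooth_on_compose[OF W(1) open_UNIV subset_UNIV transition_smooth[OF d c] \<phi>])
  have 1: "smooth_on ?W1 (chart_extend c \<phi> \<circ> chart_inv d)" by (rule smooth_on_cong[OF W(1) W(4)[symmetric] s1])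
  have s2: "smooth_on ?W2 (\<lambda>_. 0 :: complex)" by (rule smooth_on_const[OF W(2)])
  have 2: "smooth_on ?W2 (chart_extend c \<phi> \<circ> chart_inv d)" by (rule smooth_on_cong[OF W(2) W(5)[symmetric] s2])
  show "smooth_on (snd d ` fst d) (chart_extend c \<phi> \<circ> chart_inv d)"
    using smooth_on_Un[OF W(1,2) 1 2] by (simp only: W(3))
qed

lemma lip_chart_extend:
  assumes c: "c \<in> \<A>" and L: "compact L" "L \<subseteq> snd c ` fst c" "\<forall>y. y \<notin> L \<longrightarrow> \<phi> y = 0"
    and \<phi>: "\<And>y. lipschitz_near \<phi> y"
  shows "lip_fun \<A> (chart_extend c \<phi>)"
  unfolding lip_fun_def
proof (intro ballI)
  fix d x assume d: "d \<in> \<A>" and x: "x \<in> fst d"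
  note W = chart_extend_near[OF c L d]
  let ?W1 = "snd d ` (fst d \<inter> fst c)" and ?W2 = "snd d ` (fst d - chart_inv c ` L)"
  consider "snd d x \<in> ?W1" | "snd d x \<in> ?W2" using W(3) x by blast
  then show "lipschitz_near (chart_extend c \<phi> \<circ> chart_inv d) (snd d x)"
  proof cases
    case 1
    have "x \<in> fst c" using 1 x chart_inj[OF charts[OF d]] by (auto simp: inj_on_def)
    then have "lipschitz_near (\<lambda>y. \<phi> (local_rep id d c y)) (snd d x)"
      by (intro lipschitz_near_compose[OF _ \<phi>] transition_lipschitz d c x)
    then show ?thesis by (rule lipschitz_near_eventually[OF _ W(1) 1]) (simp only: W(4))
  next
    case 2
    show ?thesis by (rule lipschitz_near_eventually[OF lipschitz_near_const[of 0] W(2) 2]) (simp only: W(5))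
  qed
qed

end

subsection \<open>Approximation of Lipschitz functions by smooth functions\<close>

locale rough_patch = rough_manifold \<A> g
  for \<A> :: "('m::{t2_space, second_countable_topology}, 'n::finite) chart set" and g +
  fixes c :: "('m, 'n) chart" and V :: "'m set" and C :: real
  assumes c: "c \<in> \<A>" and V: "open V" "V \<subseteq> fst c" and C: "C > 0"
    and comparable: "mnull \<A> {y \<in> V. \<not> comparable C (g c y)}"
begin

text \<open>A comparable matrix has determinant at most \<open>fact CARD('n) * C ^ CARD('n)\<close>,
  which bounds the density on the patch and gives compact sets finite measure.\<close>

lemma compact_patch:
  assumes "compact L" "L \<subseteq> snd c ` V"
  shows "chart_inv c ` L \<subseteq> V" "snd c ` chart_inv c ` L = L" "compact (chart_inv c ` L)"
    "chart_inv c ` L \<in> lebesgue_sets \<A>" "emeasure \<mu> (chart_inv c ` L) < \<infinity>"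
proof -
  have ci: "chart_inv c y \<in> V \<and> snd c (chart_inv c y) = y" if "y \<in> L" for y
    using that assms(2) V(2) c by (auto simp: subset_iff)
  then show sub: "chart_inv c ` L \<subseteq> V" by auto
  show im: "snd c ` chart_inv c ` L = L" using ci by (auto simp: image_iff)
  show "compact (chart_inv c ` L)" using assms V(2) by (intro chart_inv_image_compact[OF c]) auto
  have Lm: "L \<in> sets lebesgue" using assms(1) by (simp add: borel_compact sets_completionI_sets)
  show ls: "chart_inv c ` L \<in> lebesgue_sets \<A>"
    using sub V(2) im Lm by (intro lebesgue_sets_local[OF c]) auto
  let ?b = "sqrt (fact CARD('n) * C ^ CARD('n))"
  have "emeasure \<mu> (chart_inv c ` L) = (\<integral>\<^sup>+y. ennreal (sqrt (det (g c (chart_inv c y)))) * indicator L y \<partial>lebesgue)"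
    using emeasure_\<mu>[OF c ls] sub V(2) by (simp add: chart_density_def im)
  also have "\<dots> \<le> (\<integral>\<^sup>+y. ennreal ?b * indicator L y \<partial>lebesgue)"
  proof (rule nn_integral_mono_AE)
    have "snd c ` ({y \<in> V. \<not> comparable C (g c y)} \<inter> fst c) \<in> null_sets lebesgue"
      using comparable c unfolding mnull_def negligible_iff_null_sets by blast
    then have "AE y in lebesgue. y \<notin> snd c ` ({y \<in> V. \<not> comparable C (g c y)} \<inter> fst c)" by (rule AE_not_in)
    then show "AE y in lebesgue. ennreal (sqrt (det (g c (chart_inv c y)))) * indicator L y \<le> ennreal ?b * indicator L y"
    proof eventually_elim
      case (elim y)
      show ?case
      proof (cases "y \<in> L")
        case True
        then have "chart_inv c y \<in> V \<inter> fst c" "y = snd c (chart_inv c y)" using ci V(2) by auto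
        then have "comparable C (g c (chart_inv c y))" using elim by blast
        then have "det (g c (chart_inv c y)) \<le> fact CARD('n) * C ^ CARD('n)" using comparable_det by fastforce
        then show ?thesis by (auto simp: indicator_def intro!: ennreal_leI)
      qed simp
    qed
  qed
  also have "\<dots> = ennreal ?b * emeasure lebesgue L" using Lm by (simp add: nn_integral_cmult_indicator)
  also have "\<dots> < \<infinity>"
    using emeasure_bounded_finite[OF compact_imp_bounded[OF assms(1)]] assms(1)
    by (simp add: ennreal_mult_less_top emeasure_completion borel_compact)
  finally show "emeasure \<mu> (chart_inv c ` L) < \<infinity>" .
qed

lemma AE_comparable: "AE x in \<mu>. x \<in> V \<longrightarrow> comparable C (g c x)"
  unfolding AE_iff using comparable by (rule mnull_subset) auto

text \<open>On the patch the inverse Gram matrix has entries bounded by \<open>C\<close> almost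
  everywhere; off \<open>Q\<close> the field vanishes.\<close>

lemma field_inner_le:
  assumes w: "measurable_cofield \<A> w" and Q: "Q \<subseteq> V" and off: "\<forall>x e. x \<notin> Q \<longrightarrow> e \<in> \<A> \<longrightarrow> x \<in> fst e \<longrightarrow> w e x = 0"
  shows "AE x in \<mu>. 0 \<le> Re (field_inner \<A> g w w x) \<and> Re (field_inner \<A> g w w x) \<le> C * (\<Sum>i\<in>UNIV. norm (w c x $ i))\<^sup>2 * indicator Q x"
  using AE_good AE_comparable
proof eventually_elim
  case (elim x)
  show ?case
  proof (cases "x \<in> Q")
    case True
    then have x: "x \<in> V" "x \<in> fst c" using Q V by auto
    have pd: "posdef (g c x)" using elim(1) c x by (simp add: good_def)
    show ?thesis
      using field_inner_chart[OF w w elim(1) c x(2)] posdef_cov_inner(2)[OF pd] comparable_cov_inner[OF _ posdef_invertible[OF pd]] elim(2) x True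
      by simp
  next
    case False
    then show ?thesis using off[rule_format, OF False chart_at] by (simp add: field_inner_def Let_def)
  qed
qed

lemma bounded_elems:
  assumes w: "measurable_cofield \<A> w" and Q: "Q \<subseteq> V" "Q \<in> lebesgue_sets \<A>" "emeasure \<mu> Q < \<infinity>"
    and off: "\<forall>x e. x \<notin> Q \<longrightarrow> e \<in> \<A> \<longrightarrow> x \<in> fst e \<longrightarrow> w e x = 0"
    and b: "\<And>x i. x \<in> Q \<Longrightarrow> norm (w c x $ i) \<le> b i"
  shows "AE x in \<mu>. norm (Re (field_inner \<A> g w w x)) \<le> C * (\<Sum>i\<in>UNIV. b i)\<^sup>2 * indicator Q x"
    and "w \<in> elems (L2cov \<A> g)"
proof -
  show ae: "AE x in \<mu>. norm (Re (field_inner \<A> g w w x)) \<le> C * (\<Sum>i\<in>UNIV. b i)\<^sup>2 * indicator Q x"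
    using field_inner_le[OF w Q(1) off]
  proof eventually_elim
    case (elim x)
    have "C * (\<Sum>i\<in>UNIV. norm (w c x $ i))\<^sup>2 * indicator Q x \<le> C * (\<Sum>i\<in>UNIV. b i)\<^sup>2 * indicator Q x"
    proof (cases "x \<in> Q")
      case True
      have "(\<Sum>i\<in>UNIV. norm (w c x $ i))\<^sup>2 \<le> (\<Sum>i\<in>UNIV. b i)\<^sup>2"
        using b[OF True] by (intro power_mono sum_mono) (auto simp: sum_nonneg)
      then show ?thesis using C True by simp
    qed simp
    then show ?case using elim by simp
  qed
  have "integrable \<mu> (\<lambda>x. C * (\<Sum>i\<in>UNIV. b i)\<^sup>2 * indicator Q x)"
    using Q by (intro integrable_mult_right integrable_real_indicator) (auto simp: sets_\<mu>)
  then have "integrable \<mu> (\<lambda>x. Re (field_inner \<A> g w w x))"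
  proof (rule Bochner_Integration.integrable_bound)
    show "(\<lambda>x. Re (field_inner \<A> g w w x)) \<in> borel_measurable \<mu>"
      by (rule measurable_compose[OF field_inner_measurable[OF w w] borel_measurable_Re])
    show "AE x in \<mu>. norm (Re (field_inner \<A> g w w x)) \<le> norm (C * (\<Sum>i\<in>UNIV. b i)\<^sup>2 * indicator Q x)"
      using ae by eventually_elim auto
  qed
  then show "w \<in> elems (L2cov \<A> g)" using w by (simp add: L2cov_def)
qed

lemma bounded_elems_L2:
  assumes u: "lip_fun \<A> u" and Q: "Q \<in> lebesgue_sets \<A>" "emeasure \<mu> Q < \<infinity>"
    and off: "\<And>x. x \<notin> Q \<Longrightarrow> u x = 0" and b: "\<And>x. norm (u x) \<le> b"
  shows "u \<in> elems (L2 \<A> g)"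
proof -
  have m: "u \<in> borel_measurable \<mu>"
    unfolding measurable_iff
  proof
    fix d assume d: "d \<in> \<A>"
    have "lipschitz_near (u \<circ> chart_inv d) y" if "y \<in> snd d ` fst d" for y
      using that u d unfolding lip_fun_def by blast
    then have "continuous_on (snd d ` fst d) (u \<circ> chart_inv d)"
      by (intro continuous_at_imp_continuous_on ballI lipschitz_near_continuous)
    moreover have "open (snd d ` fst d)" using charts[OF d] by (simp add: is_chart_def)
    ultimately show "chart_measurable d u"
      unfolding chart_measurable_def o_def[symmetric]
      by (intro continuous_imp_measurable_on_sets_lebesgue) (simp_all add: borel_open sets_completionI_sets)
  qed
  have "integrable \<mu> (\<lambda>x. b\<^sup>2 * indicator Q x)"
    using Q by (intro integrable_mult_right integrable_real_indicator) (auto simp: sets_\<mu>)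
  then have "integrable \<mu> (\<lambda>x. (cmod (u x))\<^sup>2)"
  proof (rule Bochner_Integration.integrable_bound)
    show "AE x in \<mu>. norm ((cmod (u x))\<^sup>2) \<le> norm (b\<^sup>2 * indicator Q x)"
    proof (rule AE_I2)
      fix x
      show "norm ((cmod (u x))\<^sup>2) \<le> norm (b\<^sup>2 * indicator Q x)"
        using power_mono[OF b[of x], of 2] off[of x] by (cases "x \<in> Q") auto
    qed
  qed (use m in auto)
  then show ?thesis using m by (simp add: L2_def)
qed

end

definition test_graph :: "('m::topological_space, 'n::finite) chart set \<Rightarrow> (('m \<Rightarrow> complex) \<times> ('m, 'n) cofield) set" where
  "test_graph \<A> = {(u, ext_deriv u) | u. smooth_fun \<A> u \<and> (\<exists>K. compact K \<and> (\<forall>x. x \<notin> K \<longrightarrow> u x = 0))}"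

lemma grad_c_test_graph: "grad_c \<A> g = hclosure (L2pair \<A> g) (test_graph \<A>)"
  by (simp add: grad_c_def test_graph_def)

context rough_patch
begin

text \<open>In the chart, mollifications converge uniformly and their derivatives converge almost
  everywhere under a common bound, all supported in one compact part of the patch. Comparability
  turns this into convergence of the graph norms by dominated convergence.\<close>

lemma lip_approximation:
  assumes v: "lip_fun \<A> v" and K: "compact K" "K \<subseteq> V" "\<And>x. x \<notin> K \<Longrightarrow> v x = 0"
  shows "(v, lip_deriv v) \<in> grad_c \<A> g"
proof -
  define \<phi> where "\<phi> y = (if y \<in> snd c ` fst c then v (chart_inv c y) else 0)" for y
  define K' where "K' = snd c ` K"
  have oS: "open (snd c ` fst c)" using charts[OF c] by (simp add: is_chart_def)
  have Kc: "K \<subseteq> fst c" using K V by auto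
  have K': "compact K'" "K' \<subseteq> snd c ` V"
    unfolding K'_def using K Kc chart_cont[OF charts[OF c]] by (auto intro!: compact_continuous_image intro: continuous_on_subset)
  have \<phi>0: "\<phi> y = 0" if "y \<notin> K'" for y
  proof (cases "y \<in> snd c ` fst c")
    case True
    then have "chart_inv c y \<notin> K" using that c unfolding K'_def by (metis charts chart_inv_right imageI)
    then show ?thesis using K(3) by (simp add: \<phi>_def)
  qed (simp add: \<phi>_def)
  have \<phi>eq: "(v \<circ> chart_inv c) y = \<phi> y" if "y \<in> snd c ` fst c" for y using that by (simp add: \<phi>_def)
  have lip\<phi>: "lipschitz_near \<phi> y" for y
  proof (cases "y \<in> snd c ` fst c")
    case True
    then have "lipschitz_near (v \<circ> chart_inv c) y" using v c unfolding lip_fun_def by blast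
    then show ?thesis by (rule lipschitz_near_eventually[OF _ oS True \<phi>eq])
  next
    case False
    have "K' \<subseteq> snd c ` fst c" using K'(2) V(2) by auto
    then have "y \<in> - K'" using False by auto
    then show ?thesis
      using compact_imp_closed[OF K'(1)] \<phi>0
      by (intro lipschitz_near_eventually[OF lipschitz_near_const[of 0 y], of "- K'"]) auto
  qed
  obtain L where L: "L-lipschitz_on UNIV \<phi>"
    by (rule lipschitz_near_compact_support[OF lip\<phi> compact_imp_bounded[OF K'(1)] \<phi>0])
  obtain \<Phi> :: "nat \<Rightarrow> real ^ 'n \<Rightarrow> complex" and B where \<Phi>:
    "\<And>k. smooth_on UNIV (\<Phi> k)"
    "\<And>k x. norm (\<Phi> k x - \<phi> x) \<le> L * inverse (real (Suc k))"
    "\<And>k x. \<forall>y. dist y x \<le> inverse (real (Suc k)) \<longrightarrow> \<phi> y = 0 \<Longrightarrow> \<Phi> k x = 0"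
    "\<And>k x v. norm (frechet_derivative (\<Phi> k) (at x) v) \<le> B v"
    "\<And>x v. \<phi> differentiable (at x) \<Longrightarrow> (\<lambda>k. frechet_derivative (\<Phi> k) (at x) v) \<longlonglongrightarrow> frechet_derivative \<phi> (at x) v"
    apply (rule mollification[OF L])
    subgoal premises p for \<Phi> B by (rule that[of \<Phi> B]; (rule p; blast)?)
    done
  have oV: "open (snd c ` V)" by (rule chart_open_image[OF charts[OF c] V])
  have "closed (- (snd c ` V))" "K' \<inter> - (snd c ` V) = {}" using oV K'(2) by (auto simp only: closed_Compl)
  from separate_compact_closed[OF K'(1) this]
  obtain \<delta> where \<delta>: "\<delta> > 0" "\<And>x y. x \<in> K' \<Longrightarrow> y \<in> - (snd c ` V) \<Longrightarrow> \<delta> \<le> dist x y" by blast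
  \<comment> \<open>The closed \<delta>/2-neighbourhood of the support, where \<delta> is its
    distance from the complement of the patch. It is compact, stays in the patch and leaves room for
    mollification.\<close>
  define N where "N = (\<Union>x\<in>K'. \<Union>y\<in>cball 0 (\<delta>/2). {x + y})"
  have Nc: "compact N" unfolding N_def by (rule compact_sums'[OF K'(1) compact_cball])
  have Nin: "y \<in> N" if "z \<in> K'" "dist z y \<le> \<delta>/2" for y z
    unfolding N_def using that by (intro UN_I[of z] UN_I[of "y - z"]) (auto simp: dist_norm norm_minus_commute)
  have NV: "N \<subseteq> snd c ` V"
  proof
    fix w assume "w \<in> N"
    then obtain z y where zy: "z \<in> K'" "norm y \<le> \<delta>/2" "w = z + y" by (auto simp: N_def)
    show "w \<in> snd c ` V"
    proof (rule ccontr)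
      assume "w \<notin> snd c ` V"
      then have "\<delta> \<le> dist z w" using \<delta>(2) zy(1) by auto
      then show False using zy \<delta>(1) by (simp add: dist_norm)
    qed
  qed
  \<comment> \<open>Shifting the index by \<open>k0\<close> keeps all mollification radii below
    \<delta>/2, hence all supports in \<open>N\<close>.\<close>
  obtain k0 where k0: "inverse (real (Suc k0)) < \<delta>/2" using reals_Archimedean[of "\<delta>/2"] \<delta>(1) by auto
  define \<Psi> where "\<Psi> k = \<Phi> (k + k0)" for k
  have \<Psi>0: "\<forall>y. y \<notin> N \<longrightarrow> \<Psi> k y = 0" for k
  proof (intro allI impI)
    fix y assume y: "y \<notin> N"
    show "\<Psi> k y = 0" unfolding \<Psi>_def
    proof (rule \<Phi>(3), intro allI impI)
      fix z assume z: "dist z y \<le> inverse (real (Suc (k + k0)))"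
      have "inverse (real (Suc (k + k0))) \<le> inverse (real (Suc k0))" by simp
      then have "dist z y \<le> \<delta>/2" using z k0 by linarith
      then show "\<phi> z = 0" using Nin y \<phi>0 by blast
    qed
  qed
  let ?Q = "chart_inv c ` N"
  note Q = compact_patch[OF Nc NV]
  define u where "u k = chart_extend c (\<Psi> k)" for k
  have Nfc: "N \<subseteq> snd c ` fst c" using NV V(2) by auto
  have su: "smooth_fun \<A> (u k)" for k
    unfolding u_def by (rule smooth_chart_extend[OF c Nc Nfc \<Psi>0]) (simp add: \<Psi>_def \<Phi>(1))
  have u0: "u k x = 0" if "x \<notin> ?Q" for k x
    unfolding u_def by (rule chart_extend_support[OF c _ that]) (use \<Psi>0 in blast)
  have KQ: "K \<subseteq> ?Q"
  proof
    fix x assume x: "x \<in> K"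
    then have "snd c x \<in> N" using Nin[of "snd c x" "snd c x"] \<delta>(1) by (auto simp: K'_def)
    then show "x \<in> ?Q" using x Kc c by (intro image_eqI[of _ _ "snd c x"]) auto
  qed
  have v0: "v x = 0" if "x \<notin> ?Q" for x using that KQ K(3) by auto
  have v0': "\<forall>x. x \<notin> ?Q \<longrightarrow> v x = 0" and u0': "\<forall>x. x \<notin> ?Q \<longrightarrow> u k x = 0" for k using v0 u0 by auto
  have clQ: "closed ?Q" by (rule compact_imp_closed[OF Q(3)])
  have vlip: "lip_fun \<A> (u k)" for k using lip_fun_smooth(1)[OF su] .
  \<comment> \<open>Since \<open>?Q\<close> is closed, a function vanishing outside it is zero near
    every outside point, and so is its derivative there.\<close>
  have off: "\<forall>x e. x \<notin> ?Q \<longrightarrow> e \<in> \<A> \<longrightarrow> x \<in> fst e \<longrightarrow> lip_deriv f e x = 0"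
    if f: "\<forall>x. x \<notin> ?Q \<longrightarrow> f x = 0" for f :: "'m \<Rightarrow> complex"
  proof (intro allI impI)
    fix x e assume x: "x \<notin> ?Q" "e \<in> \<A>" "x \<in> fst e"
    have op: "open (snd e ` (fst e - ?Q))"
      by (intro chart_open_image[OF charts[OF x(2)]] open_Diff chart_open[OF charts[OF x(2)]] clQ) auto
    have "((\<lambda>_. 0::complex) has_derivative (\<lambda>_. 0)) (at (snd e x))" by simp
    then have "((f \<circ> chart_inv e) has_derivative (\<lambda>_. 0)) (at (snd e x))"
      by (rule has_derivative_transform_within_open[OF _ op]) (use x f in auto)
    then show "lip_deriv f e x = 0" by (simp add: lip_deriv_def ext_deriv_eqI vec_eq_iff)
  qed
  have uD: "lip_deriv (u k) c x $ i = frechet_derivative (\<Psi> k) (at (snd c x)) (axis i 1)" if "x \<in> fst c" for k x i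
  proof -
    have "(\<Psi> k has_derivative frechet_derivative (\<Psi> k) (at (snd c x))) (at (snd c x))"
      unfolding \<Psi>_def by (rule smooth_on_has_derivative[OF \<Phi>(1)]) simp
    then have "((u k \<circ> chart_inv c) has_derivative frechet_derivative (\<Psi> k) (at (snd c x))) (at (snd c x))"
      by (rule has_derivative_transform_within_open[OF _ oS]) (use that c in \<open>auto simp: u_def chart_extend_def\<close>)
    then show ?thesis using lip_fun_smooth(3)[OF su c that] ext_deriv_eqI[of "u k" c] by simp
  qed
  have vD: "(v \<circ> chart_inv c) differentiable (at (snd c x)) \<longleftrightarrow> \<phi> differentiable (at (snd c x))"
    "\<phi> differentiable (at (snd c x)) \<Longrightarrow> lip_deriv v c x $ i = frechet_derivative \<phi> (at (snd c x)) (axis i 1)" if "x \<in> fst c" for x i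
  proof -
    have xS: "snd c x \<in> snd c ` fst c" using that by auto
    note 1 = frechet_derivative_cong_open[of _ _ "v \<circ> chart_inv c" \<phi>, OF oS xS \<phi>eq]
    note 2 = frechet_derivative_cong_open[of _ _ \<phi> "v \<circ> chart_inv c", OF oS xS \<phi>eq[symmetric]]
    show iff: "(v \<circ> chart_inv c) differentiable (at (snd c x)) \<longleftrightarrow> \<phi> differentiable (at (snd c x))"
      using 1(1) 2(1) by blast
    assume d: "\<phi> differentiable (at (snd c x))"
    show "lip_deriv v c x $ i = frechet_derivative \<phi> (at (snd c x)) (axis i 1)"
      using 2[OF _ d] by (simp add: lip_deriv_def ext_deriv_def)
  qed
  let ?b = "\<lambda>i. B (axis i 1)"
  have Bu: "norm (lip_deriv (u k) c x $ i) \<le> ?b i" if "x \<in> ?Q" for k x i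
  proof -
    have xc: "x \<in> fst c" using that Q(1) V(2) by blast
    show ?thesis unfolding uD[OF xc] \<Psi>_def by (rule \<Phi>(4))
  qed
  have Psilim: "(\<lambda>k. frechet_derivative (\<Psi> k) (at y) w) \<longlonglongrightarrow> frechet_derivative \<phi> (at y) w" if "\<phi> differentiable (at y)" for y w
    unfolding \<Psi>_def using LIMSEQ_ignore_initial_segment[OF \<Phi>(5)[OF that, of w], of k0] by simp
  have B0: "0 \<le> B w" for w using order_trans[OF norm_ge_zero \<Phi>(4)] .
  \<comment> \<open>The bound passes to the limit where \<phi> is differentiable; elsewhere
    \<open>lip_deriv\<close> is zero by convention and only nonnegativity of the bound is
    used.\<close>
  have Bv: "norm (lip_deriv v c x $ i) \<le> ?b i" if "x \<in> ?Q" for x i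
  proof (cases "\<phi> differentiable (at (snd c x))")
    case True
    have xc: "x \<in> fst c" using that Q(1) V(2) by blast
    have "norm (frechet_derivative \<phi> (at (snd c x)) (axis i 1)) \<le> ?b i"
      by (rule LIMSEQ_le_const2[OF tendsto_norm[OF Psilim[OF True]]]) (use \<Phi>(4) in \<open>auto simp: \<Psi>_def\<close>)
    then show ?thesis using vD(2)[OF xc True] by simp
  next
    case False
    have xc: "x \<in> fst c" using that Q(1) V(2) by blast
    then show ?thesis using vD(1)[OF xc] False B0 by (simp add: lip_deriv_def)
  qed
  note m = lip_deriv_measurable[OF v] lip_deriv_measurable[OF vlip]
  have \<phi>b: "\<exists>b. \<forall>y. norm (\<phi> y) \<le> b"
  proof -
    have "bounded (\<phi> ` K')"
      by (rule compact_imp_bounded[OF compact_continuous_image[OF continuous_on_subset[OF lipschitz_on_continuous_on[OF L] subset_UNIV] K'(1)]])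
    then obtain b where b: "\<forall>z\<in>\<phi> ` K'. norm z \<le> b" unfolding bounded_iff by blast
    have "norm (\<phi> y) \<le> max b 0" for y
    proof (cases "y \<in> K'")
      case True
      then have "norm (\<phi> y) \<le> b" using b by blast
      then show ?thesis by linarith
    qed (simp add: \<phi>0)
    then show ?thesis by blast
  qed
  then obtain b where b: "\<And>y. norm (\<phi> y) \<le> b" by blast
  have L0: "L \<ge> 0" using L lipschitz_on_nonneg by blast
  have uv: "norm (u k x - v x) \<le> L * inverse (real (Suc k))" for k x
  proof (cases "x \<in> fst c")
    case True
    then have "v x = \<phi> (snd c x)" using c by (simp add: \<phi>_def)
    then have "norm (u k x - v x) \<le> L * inverse (real (Suc (k + k0)))" using \<Phi>(2)[of "k + k0" "snd c x"] True by (simp add: u_def chart_extend_def \<Psi>_def del: of_nat_add of_nat_Suc)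
    also have "\<dots> \<le> L * inverse (real (Suc k))" using L0 by (intro mult_left_mono) auto
    finally show ?thesis .
  next
    case False
    then have "x \<notin> ?Q" using Q(1) V(2) by blast
    then show ?thesis using u0[of x k] v0[of x] L0 by simp
  qed
  have vb: "norm (v x) \<le> b" for x
  proof (cases "x \<in> fst c")
    case True then show ?thesis using b[of "snd c x"] c by (simp add: \<phi>_def)
  next
    case False
    then have "x \<notin> ?Q" using Q(1) V(2) by blast
    then show ?thesis using v0[of x] order_trans[OF norm_ge_zero b] by simp
  qed
  have ub: "norm (u k x) \<le> b + L" for k x
  proof -
    have "norm (u k x) \<le> norm (v x) + norm (u k x - v x)" by (rule norm_triangle_sub)
    moreover have "L * inverse (real (Suc k)) \<le> L * 1" using L0 by (intro mult_left_mono) (simp_all add: inverse_le_1_iff)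
    ultimately show ?thesis using vb[of x] uv[of k x] by linarith
  qed
  have vE: "v \<in> elems (L2 \<A> g)" by (rule bounded_elems_L2[OF v Q(4,5) v0 vb])
  have uE: "u k \<in> elems (L2 \<A> g)" for k by (rule bounded_elems_L2[OF vlip Q(4,5) u0 ub])
  have dvE: "lip_deriv v \<in> elems (L2cov \<A> g)" by (rule bounded_elems(2)[OF m(1) Q(1,4,5) off[OF v0'] Bv])
  have luE: "lip_deriv (u k) \<in> elems (L2cov \<A> g)" for k by (rule bounded_elems(2)[OF m(2) Q(1,4,5) off[OF u0'] Bu])
  \<comment> \<open>The test graph contains \<open>ext_deriv\<close>, the estimates are for
    \<open>lip_deriv\<close>. The two agree in charts of the atlas at points of their domains, which
    makes them equal up to \<open>aeq\<close>.\<close>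
  have duE: "ext_deriv (u k) \<in> elems (L2cov \<A> g) \<and> aeq (L2cov \<A> g) (lip_deriv (u k)) (ext_deriv (u k))" for k
  proof -
    have eq: "lip_deriv (u k) e x = ext_deriv (u k) e x" if "e \<in> \<A>" "x \<in> fst e" for e x by (rule lip_fun_smooth(3)[OF su that])
    have "field_inner \<A> g (lip_deriv (u k)) (lip_deriv (u k)) = field_inner \<A> g (ext_deriv (u k)) (ext_deriv (u k))"
      by (auto simp: field_inner_def Let_def eq)
    then have "ext_deriv (u k) \<in> elems (L2cov \<A> g)"
      using luE[of k] ext_deriv_measurable[OF su[of k]] by (simp add: L2cov_def)
    then show ?thesis unfolding aeq_L2cov_iff using luE eq by auto
  qed
  interpret H1: semi_hspace "L2 \<A> g" by (rule L2_semi_hspace)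
  interpret H2: semi_hspace "L2cov \<A> g" by (rule L2cov_semi_hspace)
  interpret H: semi_hspace "L2pair \<A> g" by (rule semi_hspace_hsum[OF L2_semi_hspace L2cov_semi_hspace])
  let ?w = "\<lambda>k. lip_deriv (u k) - lip_deriv v"
  have wm: "measurable_cofield \<A> (?w k)" for k by (rule measurable_cofield_arith(2)[OF m(2) m(1)])
  have woff: "\<forall>x e. x \<notin> ?Q \<longrightarrow> e \<in> \<A> \<longrightarrow> x \<in> fst e \<longrightarrow> ?w k e x = 0" for k
    using off[OF u0'] off[OF v0'] by auto
  have wb: "norm (?w k c x $ i) \<le> 2 * ?b i" if "x \<in> ?Q" for k x i
  proof -
    have "norm (?w k c x $ i) \<le> norm (lip_deriv (u k) c x $ i) + norm (lip_deriv v c x $ i)"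
      by (simp add: norm_triangle_ineq4)
    then show ?thesis using Bu[OF that, of k i] Bv[OF that, of i] by linarith
  qed
  have AEd: "AE x in \<mu>. x \<in> fst c \<longrightarrow> \<phi> differentiable (at (snd c x))"
    unfolding AE_iff using mnull_lip_fun_not_diff[OF v] by (rule mnull_subset) (use vD(1) c in auto)
  \<comment> \<open>The integrands are dominated by a constant on the set \<open>?Q\<close> of
    finite measure and tend to 0 wherever \<phi> is differentiable, which by \<open>AEd\<close> is
    almost everywhere.\<close>
  have lim1: "(\<lambda>k. LINT x|\<mu>. Re (field_inner \<A> g (?w k) (?w k) x)) \<longlonglongrightarrow> (LINT x|\<mu>. 0)"
  proof (rule integral_dominated_convergence)
    show "integrable \<mu> (\<lambda>x. C * (\<Sum>i\<in>UNIV. 2 * ?b i)\<^sup>2 * indicator ?Q x)"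
      using Q(4,5) by (intro integrable_mult_right integrable_real_indicator) (auto simp: sets_\<mu>)
    show "AE x in \<mu>. norm (Re (field_inner \<A> g (?w k) (?w k) x)) \<le> C * (\<Sum>i\<in>UNIV. 2 * ?b i)\<^sup>2 * indicator ?Q x" for k
      by (rule bounded_elems(1)[OF wm Q(1,4,5) woff wb])
    show "(\<lambda>x. Re (field_inner \<A> g (?w k) (?w k) x)) \<in> borel_measurable \<mu>" for k
      by (rule measurable_compose[OF field_inner_measurable[OF wm wm] borel_measurable_Re])
    have "AE x in \<mu>. \<forall>k. 0 \<le> Re (field_inner \<A> g (?w k) (?w k) x) \<and>
        Re (field_inner \<A> g (?w k) (?w k) x) \<le> C * (\<Sum>i\<in>UNIV. norm (?w k c x $ i))\<^sup>2 * indicator ?Q x"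
      unfolding AE_all_countable using field_inner_le[OF wm Q(1) woff] by blast
    then show "AE x in \<mu>. (\<lambda>k. Re (field_inner \<A> g (?w k) (?w k) x)) \<longlonglongrightarrow> 0"
      using AEd
    proof eventually_elim
      case (elim x)
      show ?case
      proof (rule tendsto_sandwich[OF _ _ tendsto_const])
        show "\<forall>\<^sub>F k in sequentially. 0 \<le> Re (field_inner \<A> g (?w k) (?w k) x)" using elim(1) by simp
        show "\<forall>\<^sub>F k in sequentially. Re (field_inner \<A> g (?w k) (?w k) x) \<le> C * (\<Sum>i\<in>UNIV. norm (?w k c x $ i))\<^sup>2 * indicator ?Q x"
          using elim(1) by simp
        show "(\<lambda>k. C * (\<Sum>i\<in>UNIV. norm (?w k c x $ i))\<^sup>2 * indicator ?Q x) \<longlonglongrightarrow> 0"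
        proof (cases "x \<in> ?Q")
          case True
          then have xc: "x \<in> fst c" using Q(1) V(2) by blast
          then have d: "\<phi> differentiable (at (snd c x))" using elim(2) by simp
          have "(\<lambda>k. norm (?w k c x $ i)) \<longlonglongrightarrow> 0" for i
          proof -
            have "(\<lambda>k. norm (frechet_derivative (\<Psi> k) (at (snd c x)) (axis i 1) - frechet_derivative \<phi> (at (snd c x)) (axis i 1))) \<longlonglongrightarrow> 0"
              using Psilim[OF d, of "axis i 1"] by (intro tendsto_norm_zero) (simp add: LIM_zero)
            then show ?thesis using uD[OF xc] vD(2)[OF xc d] by simp
          qed
          then have "(\<lambda>k. C * (\<Sum>i\<in>UNIV. norm (?w k c x $ i))\<^sup>2 * indicator ?Q x) \<longlonglongrightarrow> C * (\<Sum>i\<in>(UNIV::'n set). 0)\<^sup>2 * indicator ?Q x"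
            by (intro tendsto_intros)
          then show ?thesis by simp
        qed simp
      qed
    qed
  qed simp
  have lim2: "(\<lambda>k. LINT x|\<mu>. (cmod (u k x - v x))\<^sup>2) \<longlonglongrightarrow> (LINT x|\<mu>. 0)"
  proof (rule integral_dominated_convergence)
    show "integrable \<mu> (\<lambda>x. L\<^sup>2 * indicator ?Q x)"
      using Q(4,5) by (intro integrable_mult_right integrable_real_indicator) (auto simp: sets_\<mu>)
    show "AE x in \<mu>. norm ((cmod (u k x - v x))\<^sup>2) \<le> L\<^sup>2 * indicator ?Q x" for k
    proof (rule AE_I2)
      fix x
      have "L * inverse (real (Suc k)) \<le> L * 1" using L0 by (intro mult_left_mono) (auto simp: inverse_le_1_iff)
      then have "cmod (u k x - v x) \<le> L" using uv[of k x] by linarith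
      then have "(cmod (u k x - v x))\<^sup>2 \<le> L\<^sup>2" by (intro power_mono) auto
      then show "norm ((cmod (u k x - v x))\<^sup>2) \<le> L\<^sup>2 * indicator ?Q x"
        using u0[of x k] v0[of x] by (cases "x \<in> ?Q") auto
    qed
    show "(\<lambda>x. (cmod (u k x - v x))\<^sup>2) \<in> borel_measurable \<mu>" for k
      using uE[of k] vE by (auto simp: L2_def)
    have "(\<lambda>k. u k x - v x) \<longlonglongrightarrow> 0" for x
    proof (rule Lim_null_comparison)
      show "\<forall>\<^sub>F k in sequentially. norm (u k x - v x) \<le> L * inverse (real (Suc k))" using uv by simp
      have "(\<lambda>k. L * inverse (real (Suc k))) \<longlonglongrightarrow> L * 0" by (intro tendsto_intros LIMSEQ_inverse_real_of_nat)
      then show "(\<lambda>k. L * inverse (real (Suc k))) \<longlonglongrightarrow> 0" by simp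
    qed
    then have "(\<lambda>k. (cmod (u k x - v x))\<^sup>2) \<longlonglongrightarrow> 0" for x using tendsto_norm_zero tendsto_null_power by fastforce
    then show "AE x in \<mu>. (\<lambda>k. (cmod (u k x - v x))\<^sup>2) \<longlonglongrightarrow> 0" by simp
  qed simp
  have nrm: "(hnorm (L2pair \<A> g) ((u k, ext_deriv (u k)) - (v, lip_deriv v)))\<^sup>2
      = (LINT x|\<mu>. (cmod (u k x - v x))\<^sup>2) + (LINT x|\<mu>. Re (field_inner \<A> g (?w k) (?w k) x))" for k
  proof -
    have E: "u k - v \<in> elems (L2 \<A> g)" "?w k \<in> elems (L2cov \<A> g)" using H1.diff_elems[OF uE vE] H2.diff_elems[OF luE dvE] by auto
    have "aeq (L2cov \<A> g) (?w k) (ext_deriv (u k) - lip_deriv v)" using duE[of k] by (intro H2.aeq_minus H2.aeq_refl dvE) auto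
    then have eq: "inn (L2cov \<A> g) (ext_deriv (u k) - lip_deriv v) (ext_deriv (u k) - lip_deriv v) = inn (L2cov \<A> g) (?w k) (?w k)"
      using H2.inn_cong H2.aeq_sym by blast
    have "Re (inn (L2 \<A> g) (u k - v) (u k - v)) = (LINT x|\<mu>. (cmod (u k x - v x))\<^sup>2)"
    proof -
      have sq: "Re (z * cnj z) = (cmod z)\<^sup>2" for z by (simp only: complex_norm_square[symmetric] Re_complex_of_real)
      show ?thesis using integral_form.Re_inn(1)[OF L2_form E(1)] by (simp only: sq minus_apply)
    qed
    moreover have "Re (inn (L2cov \<A> g) (?w k) (?w k)) = (LINT x|\<mu>. Re (field_inner \<A> g (?w k) (?w k) x))"
      by (rule integral_form.Re_inn(1)[OF L2cov_form E(2)])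
    moreover have "0 \<le> Re (inn (L2 \<A> g) (u k - v) (u k - v))" "0 \<le> Re (inn (L2cov \<A> g) (?w k) (?w k))"
      by (rule H1.inn_nonneg[OF E(1)], rule H2.inn_nonneg[OF E(2)])
    ultimately show ?thesis by (simp add: hnorm_def eq)
  qed
  have "(\<lambda>k. sqrt ((LINT x|\<mu>. (cmod (u k x - v x))\<^sup>2) + (LINT x|\<mu>. Re (field_inner \<A> g (?w k) (?w k) x)))) \<longlonglongrightarrow> sqrt ((LINT x|\<mu>. 0) + (LINT x|\<mu>. 0))"
    by (intro tendsto_real_sqrt tendsto_add lim1 lim2)
  moreover have "hnorm (L2pair \<A> g) ((u k, ext_deriv (u k)) - (v, lip_deriv v)) \<ge> 0" for k
    using uE vE duE dvE by (intro H.hnorm_nonneg H.diff_elems) auto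
  ultimately have "(\<lambda>k. hnorm (L2pair \<A> g) ((u k, ext_deriv (u k)) - (v, lip_deriv v))) \<longlonglongrightarrow> 0"
    unfolding nrm[symmetric] by simp
  moreover have "range (\<lambda>k. (u k, ext_deriv (u k))) \<subseteq> test_graph \<A> \<inter> elems (L2pair \<A> g)"
  proof -
    have "\<exists>K. compact K \<and> (\<forall>x. x \<notin> K \<longrightarrow> u k x = 0)" for k using Q(3) u0' by blast
    then show ?thesis unfolding test_graph_def using su uE duE by auto
  qed
  ultimately show ?thesis
    unfolding grad_c_test_graph hclosure_def using vE dvE by (auto intro!: exI[of _ "\<lambda>k. (u k, ext_deriv (u k))"])
qed

end

lemma grad_c_elems: "(u, w) \<in> grad_c \<A> g \<Longrightarrow> u \<in> elems (L2 \<A> g)" "(u, w) \<in> grad_c \<A> g \<Longrightarrow> w \<in> elems (L2cov \<A> g)"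
  by (auto simp: grad_c_def hclosure_def)

context rough_manifold
begin

lemma L2_AE_cong:
  assumes u: "u \<in> elems (L2 \<A> g)" and eq: "AE x in \<mu>. u x = v x"
  shows "aeq (L2 \<A> g) u v"
proof -
  have um: "u \<in> borel_measurable \<mu>" and ui: "integrable \<mu> (\<lambda>x. (cmod (u x))\<^sup>2)" using u by (auto simp: L2_def)
  have vm: "v \<in> borel_measurable \<mu>" by (rule measurable_AE_eq[OF complete_\<mu> um eq]) simp
  have "integrable \<mu> (\<lambda>x. (cmod (v x))\<^sup>2)"
    by (rule integrable_cong_AE_imp[OF ui]) (use vm eq in auto)
  then show ?thesis unfolding aeq_L2_iff using u vm eq by (simp add: L2_def)
qed

lemma L2cov_AE_cong:
  assumes w: "\<omega> \<in> elems (L2cov \<A> g)" and m: "measurable_cofield \<A> \<eta>"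
    and eq: "AE x in \<mu>. \<forall>c\<in>\<A>. x \<in> fst c \<longrightarrow> \<omega> c x = \<eta> c x"
  shows "aeq (L2cov \<A> g) \<omega> \<eta>"
proof -
  have "integrable \<mu> (\<lambda>x. Re (field_inner \<A> g \<omega> \<omega> x))" using w by (simp add: L2cov_def)
  then have "integrable \<mu> (\<lambda>x. Re (field_inner \<A> g \<eta> \<eta> x))"
  proof (rule integrable_cong_AE_imp)
    show "(\<lambda>x. Re (field_inner \<A> g \<eta> \<eta> x)) \<in> borel_measurable \<mu>"
      by (rule measurable_compose[OF field_inner_measurable[OF m m] borel_measurable_Re])
    show "AE x in \<mu>. Re (field_inner \<A> g \<omega> \<omega> x) = Re (field_inner \<A> g \<eta> \<eta> x)"
      using eq by eventually_elim (simp add: field_inner_def Let_def)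
  qed
  then have "\<eta> \<in> elems (L2cov \<A> g)" using m by (simp add: L2cov_def)
  then show ?thesis unfolding aeq_L2cov_iff using w eq by blast
qed

lemma measurable_cofield_AE_cong:
  assumes w: "measurable_cofield \<A> \<omega>" and eq: "AE x in \<mu>. \<forall>c\<in>\<A>. x \<in> fst c \<longrightarrow> \<omega> c x = \<eta> c x"
    and ch: "\<And>c d x. c \<in> \<A> \<Longrightarrow> d \<in> \<A> \<Longrightarrow> x \<in> fst c \<Longrightarrow> x \<in> fst d \<Longrightarrow> \<eta> c x = pull_covector (jacobian id c d x) (\<eta> d x)"
  shows "measurable_cofield \<A> \<eta>"
  unfolding measurable_cofield_def
proof (intro conjI ballI)
  show "\<eta> c x = pull_covector (jacobian id c d x) (\<eta> d x)" if "c \<in> \<A>" "d \<in> \<A>" "x \<in> fst c \<inter> fst d" for c d x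
    using ch[OF that(1,2)] that(3) by blast
  fix c assume c: "c \<in> \<A>"
  have "(\<lambda>x. if x \<in> fst c then \<omega> c x else 0) \<in> borel_measurable \<mu>"
    by (rule measurable_extend_chart[OF c cofield_measurable[OF w c]])
  then have "(\<lambda>x. if x \<in> fst c then \<eta> c x else 0) \<in> borel_measurable \<mu>"
    by (rule measurable_AE_eq[OF complete_\<mu>]) (use eq c in \<open>auto elim!: eventually_mono\<close>)
  then show "chart_measurable c (\<eta> c)" by (rule chart_measurable_of_extension[OF c])
qed

lemma L2pair_semi_hspace: "semi_hspace (L2pair \<A> g)"
  by (rule semi_hspace_hsum[OF L2_semi_hspace L2cov_semi_hspace])

lemma aeq_L2pair: "aeq (L2pair \<A> g) (u, w) (u', w') \<longleftrightarrow> aeq (L2 \<A> g) u u' \<and> aeq (L2cov \<A> g) w w'"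
  by (rule aeq_hsum[OF L2_semi_hspace L2cov_semi_hspace])

lemma ext_deriv_add:
  assumes "(u \<circ> chart_inv c) differentiable (at (snd c x))" "(v \<circ> chart_inv c) differentiable (at (snd c x))"
  shows "((u + v) \<circ> chart_inv c) differentiable (at (snd c x))"
    "ext_deriv (u + v) c x = ext_deriv u c x + ext_deriv v c x"
proof -
  let ?D = "\<lambda>u. frechet_derivative (u \<circ> chart_inv c) (at (snd c x))"
  have "((u + v) \<circ> chart_inv c has_derivative (\<lambda>h. ?D u h + ?D v h)) (at (snd c x))"
    using has_derivative_add[of "u \<circ> chart_inv c" "?D u" "at (snd c x)" "v \<circ> chart_inv c" "?D v"] assms
    by (simp add: frechet_derivative_works o_def)
  then show "((u + v) \<circ> chart_inv c) differentiable (at (snd c x))" "ext_deriv (u + v) c x = ext_deriv u c x + ext_deriv v c x"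
    by (auto simp: differentiable_def ext_deriv_eqI, simp add: ext_deriv_eqI ext_deriv_def vec_eq_iff)
qed

lemma grad_c_add:
  assumes "x \<in> grad_c \<A> g" "y \<in> grad_c \<A> g"
  shows "x + y \<in> grad_c \<A> g"
proof -
  interpret H1: semi_hspace "L2 \<A> g" by (rule L2_semi_hspace)
  interpret H2: semi_hspace "L2cov \<A> g" by (rule L2cov_semi_hspace)
  interpret H: semi_hspace "L2pair \<A> g" by (rule L2pair_semi_hspace)
  show ?thesis
    using assms unfolding grad_c_test_graph
  proof (rule H.hclosure_add)
    fix a b assume a: "a \<in> test_graph \<A> \<inter> elems (L2pair \<A> g)" and b: "b \<in> test_graph \<A> \<inter> elems (L2pair \<A> g)"
    obtain u K where u: "a = (u, ext_deriv u)" "smooth_fun \<A> u" "compact K" "\<forall>x. x \<notin> K \<longrightarrow> u x = 0"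
      using a by (auto simp: test_graph_def)
    obtain v L where v: "b = (v, ext_deriv v)" "smooth_fun \<A> v" "compact L" "\<forall>x. x \<notin> L \<longrightarrow> v x = 0"
      using b by (auto simp: test_graph_def)
    have E: "u \<in> elems (L2 \<A> g)" "v \<in> elems (L2 \<A> g)" "ext_deriv u \<in> elems (L2cov \<A> g)" "ext_deriv v \<in> elems (L2cov \<A> g)"
      using a b u(1) v(1) by auto
    have s: "smooth_fun \<A> (u + v)"
      unfolding smooth_fun_def
    proof
      fix c assume c: "c \<in> \<A>"
      have "open (snd c ` fst c)" using charts[OF c] by (simp add: is_chart_def)
      moreover have "smooth_on (snd c ` fst c) (u \<circ> chart_inv c)" "smooth_on (snd c ` fst c) (v \<circ> chart_inv c)"
        using c u(2) v(2) unfolding smooth_fun_def by blast+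
      ultimately have "smooth_on (snd c ` fst c) (\<lambda>y. (u \<circ> chart_inv c) y + (v \<circ> chart_inv c) y)"
        by (rule smooth_on_add)
      then show "smooth_on (snd c ` fst c) ((u + v) \<circ> chart_inv c)" by (simp add: o_def)
    qed
    have "compact (K \<union> L)" "\<forall>x. x \<notin> K \<union> L \<longrightarrow> (u + v) x = 0" using u v by auto
    then have "(u + v, ext_deriv (u + v)) \<in> test_graph \<A>" using s unfolding test_graph_def by blast
    moreover have "aeq (L2cov \<A> g) (ext_deriv u + ext_deriv v) (ext_deriv (u + v))"
    proof (rule L2cov_AE_cong[OF H2.add_elems[OF E(3,4)] ext_deriv_measurable[OF s]], rule AE_I2, intro ballI impI)
      fix x c assume c: "c \<in> \<A>" "x \<in> fst c"
      show "(ext_deriv u + ext_deriv v) c x = ext_deriv (u + v) c x"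
        using ext_deriv_add(2)[OF lip_fun_smooth(2)[OF u(2) c] lip_fun_smooth(2)[OF v(2) c]] by simp
    qed
    moreover have "aeq (L2 \<A> g) (u + v) (u + v)" by (rule H1.aeq_refl[OF H1.add_elems[OF E(1,2)]])
    ultimately show "\<exists>z\<in>test_graph \<A>. aeq (L2pair \<A> g) (a + b) z"
      unfolding u(1) v(1) by (intro bexI[of _ "(u + v, ext_deriv (u + v))"]) (simp_all add: aeq_L2pair)
  qed
qed

text \<open>\<open>lip_deriv\<close> is additive only where both functions are differentiable: a sum
  may be differentiable where its summands are not. Rademacher's theorem makes the difference
  invisible to \<open>aeq\<close>.\<close>

lemma lip_fun_sum_in_grad_c:
  assumes u: "lip_fun \<A> u" "(u, lip_deriv u) \<in> grad_c \<A> g" and v: "lip_fun \<A> v" "(v, lip_deriv v) \<in> grad_c \<A> g"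
  shows "(u + v, lip_deriv (u + v)) \<in> grad_c \<A> g"
proof -
  interpret H1: semi_hspace "L2 \<A> g" by (rule L2_semi_hspace)
  interpret H2: semi_hspace "L2cov \<A> g" by (rule L2cov_semi_hspace)
  interpret H: semi_hspace "L2pair \<A> g" by (rule L2pair_semi_hspace)
  have sum: "(u + v, lip_deriv u + lip_deriv v) \<in> grad_c \<A> g" using grad_c_add[OF u(2) v(2)] by simp
  note E = grad_c_elems[OF this]
  have uv: "lip_fun \<A> (u + v)" using lip_fun_times_add(1)[OF u(1) v(1)] by (simp add: plus_fun_def)
  have "AE x in \<mu>. \<forall>c\<in>\<A>. x \<in> fst c \<longrightarrow> (u \<circ> chart_inv c) differentiable (at (snd c x))"
    "AE x in \<mu>. \<forall>c\<in>\<A>. x \<in> fst c \<longrightarrow> (v \<circ> chart_inv c) differentiable (at (snd c x))"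
    unfolding AE_iff by (rule mnull_lip_fun_not_diff[OF u(1)], rule mnull_lip_fun_not_diff[OF v(1)])
  then have "AE x in \<mu>. \<forall>c\<in>\<A>. x \<in> fst c \<longrightarrow> (lip_deriv u + lip_deriv v) c x = lip_deriv (u + v) c x"
  proof eventually_elim
    case (elim x)
    show ?case
    proof (intro ballI impI)
      fix c assume c: "c \<in> \<A>" "x \<in> fst c"
      note d = elim(1)[rule_format, OF c] elim(2)[rule_format, OF c]
      show "(lip_deriv u + lip_deriv v) c x = lip_deriv (u + v) c x"
        using ext_deriv_add[OF d] d by (simp add: lip_deriv_def)
    qed
  qed
  then have "aeq (L2cov \<A> g) (lip_deriv u + lip_deriv v) (lip_deriv (u + v))"
    by (rule L2cov_AE_cong[OF E(2) lip_deriv_measurable[OF uv]])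
  then have q: "aeq (L2pair \<A> g) (u + v, lip_deriv u + lip_deriv v) (u + v, lip_deriv (u + v))"
    using H1.aeq_refl[OF E(1)] by (simp add: aeq_L2pair)
  show ?thesis using H.hclosure_aeq[OF _ q] sum unfolding grad_c_test_graph by blast
qed

text \<open>A Lipschitz cutoff suffices, because its products with Lipschitz functions are
  approximated by mollification afterwards.\<close>

lemma cutoff:
  obtains \<rho> N where "lip_fun \<A> \<rho>" "open N" "x \<in> N" "\<And>y. y \<in> N \<Longrightarrow> \<rho> y = 1"
    "\<And>v. lip_fun \<A> v \<Longrightarrow> (\<lambda>y. \<rho> y * v y, lip_deriv (\<lambda>y. \<rho> y * v y)) \<in> grad_c \<A> g"
proof -
  obtain c V C where c: "c \<in> \<A>" and W: "open V" "x \<in> V" "V \<subseteq> fst c" "C > 0" "mnull \<A> {y \<in> V. \<not> comparable C (g c y)}"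
    using rough unfolding rough_metric_def by blast
  interpret rough_patch \<A> g c V C by unfold_locales (use c W in auto)
  let ?y = "snd c x"
  have "open (snd c ` V)" "?y \<in> snd c ` V" using chart_open_image[OF charts[OF c] W(1,3)] W(2) by auto
  then obtain e where e: "e > 0" "cball ?y e \<subseteq> snd c ` V" by (meson open_contains_cball)
  \<comment> \<open>The cutoff equals 1 up to distance \<open>r\<close> and falls linearly to 0 at
    distance \<open>2 * r\<close>; halving \<open>e\<close> keeps this larger ball in the
    patch.\<close>
  define r where "r = e / 2"
  have r: "r > 0" "cball ?y (2 * r) \<subseteq> snd c ` V" using e by (auto simp: r_def)
  define \<phi> where "\<phi> y = complex_of_real (max 0 (min 1 (2 - dist y ?y / r)))" for y
  let ?L = "cball ?y (2 * r)"
  have L: "compact ?L" "?L \<subseteq> snd c ` fst c" using r(2) W(3) by auto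
  have \<phi>0: "\<forall>y. y \<notin> ?L \<longrightarrow> \<phi> y = 0"
  proof (intro allI impI)
    fix y assume "y \<notin> ?L"
    then have "2 < dist y ?y / r" using r(1) by (simp add: pos_less_divide_eq dist_commute)
    then show "\<phi> y = 0" by (simp add: \<phi>_def)
  qed
  have \<phi>1: "\<phi> y = 1" if "y \<in> ball ?y r" for y
  proof -
    have "dist y ?y / r < 1" using that r(1) by (simp add: dist_commute)
    then show ?thesis by (simp add: \<phi>_def)
  qed
  have "(1 / r)-lipschitz_on UNIV \<phi>"
  proof (rule lipschitz_onI)
    fix y z :: "real ^ 'n"
    have "dist (\<phi> y) (\<phi> z) = \<bar>max 0 (min 1 (2 - dist y ?y / r)) - max 0 (min 1 (2 - dist z ?y / r))\<bar>"
      unfolding \<phi>_def dist_of_real by (simp add: dist_real_def)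
    also have "\<dots> \<le> \<bar>dist y ?y / r - dist z ?y / r\<bar>" by linarith
    also have "\<dots> = \<bar>dist y ?y - dist z ?y\<bar> / r" using r(1) by (simp add: diff_divide_distrib[symmetric])
    also have "\<dots> \<le> dist y z / r" using r(1) abs_dist_diff_le[of y ?y z] by (intro divide_right_mono) (simp_all add: dist_commute)
    finally show "dist (\<phi> y) (\<phi> z) \<le> 1 / r * dist y z" by simp
  qed (use r in auto)
  then have \<phi>l: "lipschitz_near \<phi> y" for y by (intro lipschitz_nearI[OF lipschitz_on_subset, of _ UNIV _ _ 1]) auto
  show thesis
  proof (rule that[of "chart_extend c \<phi>" "fst c \<inter> snd c -` ball ?y r"])
    show lip: "lip_fun \<A> (chart_extend c \<phi>)" by (rule lip_chart_extend[OF c L \<phi>0 \<phi>l])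
    show "open (fst c \<inter> snd c -` ball ?y r)" by (rule chart_open_vimage[OF charts[OF c] open_ball])
    show "x \<in> fst c \<inter> snd c -` ball ?y r" using W r by auto
    show "chart_extend c \<phi> y = 1" if "y \<in> fst c \<inter> snd c -` ball ?y r" for y
      using that \<phi>1 by (simp add: chart_extend_def)
    fix v assume v: "lip_fun \<A> v"
    note Q = compact_patch[OF L(1) r(2)]
    show "(\<lambda>y. chart_extend c \<phi> y * v y, lip_deriv (\<lambda>y. chart_extend c \<phi> y * v y)) \<in> grad_c \<A> g"
    proof (rule lip_approximation[OF lip_fun_times_add(2)[OF lip v] Q(3,1)])
      fix z assume z: "z \<notin> chart_inv c ` ?L"
      have "chart_extend c \<phi> z = 0" by (rule chart_extend_support[OF c _ z]) (use \<phi>0 in blast)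
      then show "chart_extend c \<phi> z * v z = 0" by simp
    qed
  qed
qed

text \<open>In place of a partition of unity, the neighbourhoods covering the support are peeled off
  one at a time: \<open>v\<close> splits into its product with a cutoff and a remainder that
  vanishes on that neighbourhood, so the remainder needs one neighbourhood less.\<close>

lemma lip_fun_in_grad_c:
  assumes v: "lip_fun \<A> v" and K: "compact K" "\<forall>x. x \<notin> K \<longrightarrow> v x = 0"
  shows "(v, lip_deriv v) \<in> grad_c \<A> g"
proof -
  have "\<forall>x. \<exists>\<rho> N. lip_fun \<A> \<rho> \<and> open N \<and> x \<in> N \<and> (\<forall>y\<in>N. \<rho> y = 1) \<and>
      (\<forall>v. lip_fun \<A> v \<longrightarrow> (\<lambda>y. \<rho> y * v y, lip_deriv (\<lambda>y. \<rho> y * v y)) \<in> grad_c \<A> g)"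
    apply (rule allI)
    subgoal for x
    apply (rule cutoff[of x])
    subgoal premises p for \<rho> N by (intro exI[of _ \<rho>] exI[of _ N] conjI ballI allI impI p)
    done
    done
  then have "\<exists>\<rho> N. \<forall>x. lip_fun \<A> (\<rho> x) \<and> open (N x) \<and> x \<in> N x \<and> (\<forall>y\<in>N x. \<rho> x y = 1) \<and>
      (\<forall>v. lip_fun \<A> v \<longrightarrow> (\<lambda>y. \<rho> x y * v y, lip_deriv (\<lambda>y. \<rho> x y * v y)) \<in> grad_c \<A> g)"
    by (simp only: choice_iff)
  then obtain \<rho> N where \<rho>: "\<And>x. lip_fun \<A> (\<rho> x)" "\<And>x. open (N x)" "\<And>x. x \<in> N x" "\<And>x y. y \<in> N x \<Longrightarrow> \<rho> x y = 1"
      "\<And>x v. lip_fun \<A> v \<Longrightarrow> (\<lambda>y. \<rho> x y * v y, lip_deriv (\<lambda>y. \<rho> x y * v y)) \<in> grad_c \<A> g" by blast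
  have const: "lip_fun \<A> (\<lambda>_. k)" for k unfolding lip_fun_def o_def by (simp add: lipschitz_near_const)
  have main: "lip_fun \<A> v \<Longrightarrow> \<forall>x. x \<notin> (\<Union>a\<in>D. N a) \<longrightarrow> v x = 0 \<Longrightarrow> (v, lip_deriv v) \<in> grad_c \<A> g" if "finite D" for D v
    using that
  proof (induction D arbitrary: v)
    case empty
    then have v0: "v = (\<lambda>_. 0)" by auto
    \<comment> \<open>The zero function is its own product with a cutoff, which places it in the
      closure.\<close>
    then show ?case using \<rho>(5)[OF empty.prems(1)] by (simp add: v0)
  next
    case (insert a D)
    \<comment> \<open>The complementary factor is written with a constant, a product and a sum,
      matching the closure properties of \<open>lip_fun\<close>.\<close>
    let ?u = "\<lambda>y. \<rho> a y * v y" and ?w = "\<lambda>y. (1 + (-1) * \<rho> a y) * v y"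
    have lw: "lip_fun \<A> ?w" by (intro lip_fun_times_add const \<rho>(1) insert.prems(1))
    have lu: "lip_fun \<A> ?u" by (intro lip_fun_times_add \<rho>(1) insert.prems(1))
    have "?w x = 0" if "x \<notin> (\<Union>a\<in>D. N a)" for x
      using that insert.prems(2) \<rho>(4)[of x a] by (cases "x \<in> N a") auto
    then have "(?w, lip_deriv ?w) \<in> grad_c \<A> g" by (intro insert.IH lw) blast
    from lip_fun_sum_in_grad_c[OF lu \<rho>(5)[OF insert.prems(1)] lw this]
    have "(?u + ?w, lip_deriv (?u + ?w)) \<in> grad_c \<A> g" .
    moreover have "?u + ?w = v" by (auto simp: fun_eq_iff algebra_simps)
    ultimately show ?case by simp
  qed
  have "K \<subseteq> (\<Union>a\<in>UNIV. N a)" using \<rho>(3) by auto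
  then obtain D where D: "finite D" "K \<subseteq> (\<Union>a\<in>D. N a)"
    by (rule compactE_image[OF K(1) \<rho>(2)]) (rule that)
  show ?thesis by (rule main[OF D(1) v]) (use D(2) K(2) in blast)
qed

end

section \<open>Correspondence of the first order operators\<close>

subsection \<open>The first order operators under pullback\<close>

lemma (in unitary_map) map_hclosure:
  assumes x: "x \<in> hclosure H X" and X: "\<And>y. y \<in> X \<Longrightarrow> y \<in> elems H \<Longrightarrow> \<phi> y \<in> hclosure K Y"
  shows "\<phi> x \<in> hclosure K Y"
proof -
  obtain s where s: "range s \<subseteq> X \<inter> elems H" "(\<lambda>n. hnorm H (s n - x)) \<longlonglongrightarrow> 0" and xe: "x \<in> elems H"
    using x by (auto simp: hclosure_def)
  have se: "s n \<in> X" "s n \<in> elems H" for n using s(1) by auto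
  have "hnorm K (\<phi> (s n) - \<phi> x) = hnorm H (s n - x)" for n
    using map_hnorm[OF H.diff_elems[OF se(2) xe]] map_diff[OF se(2) xe] by simp
  then have "\<phi> x \<in> hclosure K (\<phi> ` (X \<inter> elems H))"
    using s(2) se xe map_elems unfolding hclosure_def by (auto intro!: exI[of _ "\<lambda>n. \<phi> (s n)"])
  moreover have "hclosure K (\<phi> ` (X \<inter> elems H)) \<subseteq> hclosure K Y" by (rule K.hclosure_subset) (use X in auto)
  ultimately show ?thesis by blast
qed

lemma U_hsum:
  assumes "unitary_map H K \<phi> \<psi>" "unitary_map H' K' \<phi>' \<psi>'"
  shows "((x, y), (x', y')) \<in> unitary_map.U (hsum H H') (hsum K K') (map_prod \<phi> \<phi>') \<longleftrightarrow>
    (x, x') \<in> unitary_map.U H K \<phi> \<and> (y, y') \<in> unitary_map.U H' K' \<phi>'"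
proof -
  interpret a: unitary_map H K \<phi> \<psi> by fact
  interpret b: unitary_map H' K' \<phi>' \<psi>' by fact
  interpret ab: unitary_map "hsum H H'" "hsum K K'" "map_prod \<phi> \<phi>'" "map_prod \<psi> \<psi>'" by (rule unitary_map_hsum[OF assms])
  show ?thesis
    unfolding ab.U_def a.U_def b.U_def
    by (auto simp: aeq_hsum[OF a.K.semi_hspace_axioms b.K.semi_hspace_axioms])
qed

lemma (in lip_homeo) lip_fun_pullback:
  assumes u: "lip_fun \<B> u"
  shows "lip_fun \<A> (u \<circ> F)"
  unfolding lip_fun_def
proof (intro ballI)
  fix c x assume c: "c \<in> \<A>" "x \<in> fst c"
  let ?d = "chart_at \<B> (F x)"
  have "lipschitz_near (u \<circ> chart_inv ?d) (snd ?d (F x))" using u unfolding lip_fun_def by simp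
  then have "lipschitz_near (u \<circ> chart_inv ?d) (local_rep F c ?d (snd c x))" using c by (simp add: local_rep_apply)
  then have "lipschitz_near (\<lambda>y. (u \<circ> chart_inv ?d) (local_rep F c ?d y)) (snd c x)"
    by (rule lipschitz_near_compose[OF lip_F[OF c(1) _ c(2)], rotated 2]) simp_all
  then show "lipschitz_near (u \<circ> F \<circ> chart_inv c) (snd c x)"
    by (rule lipschitz_near_eventually[OF _ open_chart_overlap[of c ?d F]])
      (use c cont_F in \<open>auto simp: local_rep_def\<close>)
qed

context rough_iso
begin

text \<open>The chain rule needs \<open>F\<close> differentiable at \<open>x\<close> and
  \<open>u\<close> differentiable at \<open>F x\<close>. The second condition holds for almost every
  \<open>x\<close> because the inverse map preserves null sets.\<close>

lemma lip_deriv_pullback: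
  assumes u: "lip_fun \<B> u"
  shows "AE x in R.\<mu>. \<forall>c\<in>\<A>. x \<in> fst c \<longrightarrow> lip_deriv (u \<circ> F) c x = pullback_cofield \<B> F (lip_deriv u) c x"
proof -
  have "AE y in S.\<mu>. \<forall>d\<in>\<B>. y \<in> fst d \<longrightarrow> (u \<circ> chart_inv d) differentiable (at (snd d y))"
    unfolding S.AE_iff by (rule N.mnull_lip_fun_not_diff[OF u])
  from AE_F[OF this] AE_diff(1) show ?thesis
  proof eventually_elim
    case (elim x)
    show ?case
    proof (intro ballI impI)
      fix c assume c: "c \<in> \<A>" "x \<in> fst c"
      let ?d = "chart_at \<B> (F x)"
      have d: "?d \<in> \<B>" "F x \<in> fst ?d" by simp_all
      note D = diff_atD[OF elim(2) c d] elim(1)[rule_format, OF d]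
      show "lip_deriv (u \<circ> F) c x = pullback_cofield \<B> F (lip_deriv u) c x"
        using ext_deriv_compose[OF c d D] D by (simp add: lip_deriv_def pullback_cofield_def Let_def)
    qed
  qed
qed

sublocale pair: unitary_map "L2pair \<B> h" "L2pair \<A> g"
    "map_prod (\<lambda>u. u \<circ> F) (pullback_cofield \<B> F)" "map_prod (\<lambda>u. u \<circ> G) (pullback_cofield \<A> G)"
  by (rule unitary_map_hsum[OF L2_unitary L2cov_unitary])

text \<open>It suffices to place the images of test functions in the target closure: an isometric
  map followed by a second closure leads no further.\<close>

lemma grad_c_pullback:
  assumes "(u, w) \<in> grad_c \<B> h"
  shows "(u \<circ> F, pullback_cofield \<B> F w) \<in> grad_c \<A> g"
proof -
  interpret A1: semi_hspace "L2 \<A> g" by (rule L2_semi_hspace)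
  have "map_prod (\<lambda>u. u \<circ> F) (pullback_cofield \<B> F) y \<in> hclosure (L2pair \<A> g) (test_graph \<A>)"
    if y: "y \<in> test_graph \<B>" "y \<in> elems (L2pair \<B> h)" for y
  proof -
    obtain v K where v: "y = (v, ext_deriv v)" "smooth_fun \<B> v" "compact K" "\<forall>x. x \<notin> K \<longrightarrow> v x = 0"
      using y(1) by (auto simp: test_graph_def)
    have ext: "lip_deriv v d z = ext_deriv v d z" if "d \<in> \<B>" "z \<in> fst d" for d z by (rule N.lip_fun_smooth(3)[OF v(2) that])
    have lv: "lip_fun \<B> v" by (rule N.lip_fun_smooth(1)[OF v(2)])
    have "compact (G ` K)" by (rule compact_continuous_image[OF continuous_on_subset[OF cont_G] v(3)]) simp
    moreover have "\<forall>x. x \<notin> G ` K \<longrightarrow> (v \<circ> F) x = 0"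
      using v(4) by (metis GF comp_apply imageI)
    ultimately have g: "(v \<circ> F, lip_deriv (v \<circ> F)) \<in> grad_c \<A> g"
      by (rule R.lip_fun_in_grad_c[OF lip_fun_pullback[OF lv]])
    note e = grad_c_elems[OF this]
    have "pullback_cofield \<B> F (lip_deriv v) = pullback_cofield \<B> F (ext_deriv v)"
      by (auto simp: fun_eq_iff pullback_cofield_def Let_def ext)
    then have "aeq (L2cov \<A> g) (lip_deriv (v \<circ> F)) (pullback_cofield \<B> F (ext_deriv v))"
      using lip_deriv_pullback[OF lv] pullback_measurable[OF N.ext_deriv_measurable[OF v(2)]]
      by (intro R.L2cov_AE_cong[OF e(2)]) simp_all
    then have "aeq (L2pair \<A> g) (v \<circ> F, lip_deriv (v \<circ> F)) (v \<circ> F, pullback_cofield \<B> F (ext_deriv v))"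
      using A1.aeq_refl[OF e(1)] by (simp add: R.aeq_L2pair)
    then show ?thesis using pair.K.hclosure_aeq g unfolding grad_c_test_graph v(1) by fastforce
  qed
  from pair.map_hclosure[OF assms[unfolded grad_c_test_graph] this] show ?thesis
    unfolding grad_c_test_graph by simp
qed

text \<open>The inclusion above for both directions; saturation of closures replaces an explicit
  pullback by any related representative.\<close>

lemma grad_c_corr:
  assumes "((u, w), (u', w')) \<in> pair.U"
  shows "(u, w) \<in> grad_c \<B> h \<longleftrightarrow> (u', w') \<in> grad_c \<A> g"
proof -
  interpret sw: rough_iso \<B> \<A> G F h g "F ` Z \<union> {y. \<not> lip_homeo.diff_at \<B> \<A> G y}" by (rule swap_iso)
  have e: "(u, w) \<in> elems (L2pair \<B> h)" "(u', w') \<in> elems (L2pair \<A> g)" using pair.U_elems[OF assms] by auto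
  have 1: "aeq (L2pair \<A> g) (u \<circ> F, pullback_cofield \<B> F w) (u', w')"
    using pair.U_unique_right[OF pair.U_map[OF e(1)] assms] by simp
  have 2: "aeq (L2pair \<B> h) (u' \<circ> G, pullback_cofield \<A> G w') (u, w)"
    using pair.U_unique_left[OF pair.U_inv[OF e(2)] assms] by simp
  show ?thesis
    using pair.K.hclosure_aeq[OF _ 1, of "test_graph \<A>"] pair.H.hclosure_aeq[OF _ 2, of "test_graph \<B>"]
      grad_c_pullback[of u w] sw.grad_c_pullback[of u' w'] unfolding grad_c_test_graph by blast
qed

sublocale triple: unitary_map "HH \<B> h" "HH \<A> g"
    "map_prod (\<lambda>u. u \<circ> F) (map_prod (\<lambda>u. u \<circ> F) (pullback_cofield \<B> F))"
    "map_prod (\<lambda>u. u \<circ> G) (map_prod (\<lambda>u. u \<circ> G) (pullback_cofield \<A> G))"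
  unfolding HH_def by (rule unitary_map_hsum[OF L2_unitary pair.unitary_map_axioms])

lemma Gamma_corr: "triple.corr (Gamma_op \<B> h) (Gamma_op \<A> g)"
proof -
  interpret L: unitary_map "L2 \<B> h" "L2 \<A> g" "\<lambda>u. u \<circ> F" "\<lambda>u. u \<circ> G" by (rule L2_unitary)
  note U2 = U_hsum[OF L2_unitary L2cov_unitary]
  note U3 = U_hsum[OF L2_unitary pair.unitary_map_axioms, folded HH_def]
  have z: "(0, 0) \<in> L.U"
  proof -
    have "(0 :: 'k \<Rightarrow> complex) \<circ> F = 0" by auto
    then show ?thesis using L.U_map[OF L.H.zero_elems] by simp
  qed
  have iff: "(x, y) \<in> Gamma_op \<B> h \<longleftrightarrow> (x', y') \<in> Gamma_op \<A> g" if xy: "(x, x') \<in> triple.U" "(y, y') \<in> triple.U" for x x' y y'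
  proof -
    obtain u s p v w where x: "x = (u, s)" "y = (p, v, w)" by (metis prod.exhaust)
    obtain u' s' p' v' w' where x': "x' = (u', s')" "y' = (p', v', w')" by (metis prod.exhaust)
    have 1: "(u, u') \<in> L.U" "(s, s') \<in> pair.U" "(p, p') \<in> L.U" "(v, v') \<in> L.U"
      "((u, w), (u', w')) \<in> pair.U"
      using xy unfolding x x' U3 U2 by (auto simp: U2)
    show ?thesis
      using pair.U_elems[OF 1(2)] L.U_aeq[OF 1(3) z] L.U_aeq[OF 1(4) 1(1)] grad_c_corr[OF 1(5)]
      by (simp add: x x' Gamma_op_def S_op_def)
  qed
  have sub: "Gamma_op \<B> h \<subseteq> elems (HH \<B> h) \<times> elems (HH \<B> h)" "Gamma_op \<A> g \<subseteq> elems (HH \<A> g) \<times> elems (HH \<A> g)"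
    by (auto simp: Gamma_op_def S_op_def HH_def aeq_def dest: grad_c_elems)
  show ?thesis by (rule triple.corrI[OF sub]) (use iff in blast)+
qed

text \<open>\<open>Phi_op\<close> pulls back along the inverse of its map, while the relation here
  pulls back along \<open>F\<close>; hence it is the \<open>Phi_op\<close> of
  \<open>G\<close>.\<close>

lemma Phi_op_eq: "Phi_op \<B> h \<A> g G = triple.U"
proof -
  have "inv G = F" by (rule inv_equality) simp_all
  then show ?thesis by (auto simp: Phi_op_def triple.U_def)
qed

end

subsection \<open>Multiplication operators\<close>

context rough_manifold
begin

lemma HH_semi_hspace: "semi_hspace (HH \<A> g)"
  unfolding HH_def by (rule semi_hspace_hsum[OF L2_semi_hspace L2pair_semi_hspace])

lemma aeq_HH: "aeq (HH \<A> g) (u, s) (u', s') \<longleftrightarrow> aeq (L2 \<A> g) u u' \<and> aeq (L2pair \<A> g) s s'"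
  unfolding HH_def by (rule aeq_hsum[OF L2_semi_hspace L2pair_semi_hspace])

lemma B1_saturated: "semi_hspace.saturated (HH \<A> g) (B1_op \<A> g a)"
proof -
  interpret H: semi_hspace "HH \<A> g" by (rule HH_semi_hspace)
  interpret H1: semi_hspace "L2 \<A> g" by (rule L2_semi_hspace)
  interpret H2: semi_hspace "L2pair \<A> g" by (rule L2pair_semi_hspace)
  show ?thesis
    unfolding H.saturated_def
  proof (intro conjI allI impI)
    show "B1_op \<A> g a \<subseteq> elems (HH \<A> g) \<times> elems (HH \<A> g)"
      by (auto simp: B1_op_def HH_def aeq_def)
    fix x y x' y' assume B: "(x, y) \<in> B1_op \<A> g a" and xx: "aeq (HH \<A> g) x x'" and yy: "aeq (HH \<A> g) y y'"
    obtain u s p q where xy: "x = (u, s)" "y = (p, q)" by (metis prod.exhaust)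
    obtain u' s' p' q' where xy': "x' = (u', s')" "y' = (p', q')" by (metis prod.exhaust)
    have B: "aeq (L2 \<A> g) p (\<lambda>x. a x * u x)" "aeq (L2pair \<A> g) q 0" using B by (auto simp: B1_op_def xy)
    have e: "aeq (L2 \<A> g) u u'" "aeq (L2pair \<A> g) s s'" "aeq (L2 \<A> g) p p'" "aeq (L2pair \<A> g) q q'"
      using xx yy by (auto simp: xy xy' aeq_HH)
    have "AE x in \<mu>. u x = u' x" using e(1) by (simp add: aeq_L2_iff)
    then have "aeq (L2 \<A> g) (\<lambda>x. a x * u x) (\<lambda>x. a x * u' x)"
      by (intro L2_AE_cong[OF H1.aeq_elems(2)[OF B(1)]]) (auto elim!: eventually_mono)
    then have "aeq (L2 \<A> g) p' (\<lambda>x. a x * u' x)" using B(1) e(3) H1.aeq_trans H1.aeq_sym by blast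
    moreover have "aeq (L2pair \<A> g) q' 0" using B(2) e(4) H2.aeq_trans H2.aeq_sym by blast
    ultimately show "(x', y') \<in> B1_op \<A> g a"
      using H1.aeq_elems(2)[OF e(1)] H2.aeq_elems(2)[OF e(2)] by (simp add: B1_op_def xy')
  qed
qed

text \<open>That the image of \<open>s\<close> lies in the space is part of membership in the graph
  \<open>B2_op\<close>. The image of \<open>s'\<close> inherits integrability from almost everywhere
  equality and tensoriality from the transformation law of \<open>A\<close>.\<close>

lemma endo_app_aeq:
  assumes A: "measurable_endo_field \<A> A" and s: "aeq (L2pair \<A> g) s s'" and e: "endo_app \<A> A s \<in> elems (L2pair \<A> g)"
  shows "aeq (L2pair \<A> g) (endo_app \<A> A s) (endo_app \<A> A s')"
proof -
  obtain u w u' w' where ss: "s = (u, w)" "s' = (u', w')" by (metis prod.exhaust)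
  have eq: "aeq (L2 \<A> g) u u'" "aeq (L2cov \<A> g) w w'" using s by (auto simp: ss aeq_L2pair)
  have "AE x in \<mu>. u x = u' x" "AE x in \<mu>. \<forall>c\<in>\<A>. x \<in> fst c \<longrightarrow> w c x = w' c x"
    using eq by (auto simp: aeq_L2_iff aeq_L2cov_iff)
  then have ae: "AE x in \<mu>. u x = u' x \<and> (\<forall>c\<in>\<A>. x \<in> fst c \<longrightarrow> w c x = w' c x)" by eventually_elim blast
  let ?p = "\<lambda>u w x. fst (A (chart_at \<A> x) x (u x, w (chart_at \<A> x) x))"
  let ?q = "\<lambda>(u :: 'm \<Rightarrow> complex) (w :: ('m, 'n) cofield) c x. snd (A c x (u x, w c x))"
  have app: "endo_app \<A> A (u, w) = (?p u w, ?q u w)" for u w by (simp add: endo_app_def Let_def)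
  have e': "?p u w \<in> elems (L2 \<A> g)" "?q u w \<in> elems (L2cov \<A> g)" using e by (auto simp: ss app)
  have wm: "measurable_cofield \<A> w'" "measurable_cofield \<A> (?q u w)" using eq(2) e'(2) by (auto simp: aeq_def L2cov_def)
  have "aeq (L2 \<A> g) (?p u w) (?p u' w')"
  proof (rule L2_AE_cong[OF e'(1)])
    show "AE x in \<mu>. ?p u w x = ?p u' w' x" using ae by eventually_elim simp
  qed
  moreover have "aeq (L2cov \<A> g) (?q u w) (?q u' w')"
  proof (rule L2cov_AE_cong[OF e'(2)])
    show q: "AE x in \<mu>. \<forall>c\<in>\<A>. x \<in> fst c \<longrightarrow> ?q u w c x = ?q u' w' c x"
      using ae by eventually_elim simp
    show "measurable_cofield \<A> (?q u' w')"
    proof (rule measurable_cofield_AE_cong[OF wm(2) q])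
      fix c d x assume cd: "c \<in> \<A>" "d \<in> \<A>" "x \<in> fst c" "x \<in> fst d"
      have "A c x (u' x, pull_covector (jacobian id c d x) (w' d x)) =
          (fst (A d x (u' x, w' d x)), pull_covector (jacobian id c d x) (snd (A d x (u' x, w' d x))))"
        using A[unfolded measurable_endo_field_def, THEN conjunct2, THEN conjunct1, rule_format, OF cd(1,2), of x] cd(3,4) by blast
      then show "?q u' w' c x = pull_covector (jacobian id c d x) (?q u' w' d x)"
        using cofield_change[OF wm(1) cd] by simp
    qed
  qed
  ultimately show ?thesis by (simp add: ss app aeq_L2pair)
qed

lemma B2_saturated:
  assumes A: "measurable_endo_field \<A> A"
  shows "semi_hspace.saturated (HH \<A> g) (B2_op \<A> g A)"
proof -
  interpret H: semi_hspace "HH \<A> g" by (rule HH_semi_hspace)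
  interpret H1: semi_hspace "L2 \<A> g" by (rule L2_semi_hspace)
  interpret H2: semi_hspace "L2pair \<A> g" by (rule L2pair_semi_hspace)
  show ?thesis
    unfolding H.saturated_def
  proof (intro conjI allI impI)
    show "B2_op \<A> g A \<subseteq> elems (HH \<A> g) \<times> elems (HH \<A> g)"
      by (auto simp: B2_op_def HH_def aeq_def)
    fix x y x' y' assume B: "(x, y) \<in> B2_op \<A> g A" and xx: "aeq (HH \<A> g) x x'" and yy: "aeq (HH \<A> g) y y'"
    obtain u s p q where xy: "x = (u, s)" "y = (p, q)" by (metis prod.exhaust)
    obtain u' s' p' q' where xy': "x' = (u', s')" "y' = (p', q')" by (metis prod.exhaust)
    have B: "aeq (L2 \<A> g) p 0" "aeq (L2pair \<A> g) q (endo_app \<A> A s)" using B unfolding xy B2_op_def by blast+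
    have e: "aeq (L2 \<A> g) u u'" "aeq (L2pair \<A> g) s s'" "aeq (L2 \<A> g) p p'" "aeq (L2pair \<A> g) q q'"
      using xx yy unfolding xy xy' aeq_HH by blast+
    have "aeq (L2pair \<A> g) (endo_app \<A> A s) (endo_app \<A> A s')" by (rule endo_app_aeq[OF A e(2) H2.aeq_elems(2)[OF B(2)]])
    then have "aeq (L2pair \<A> g) q' (endo_app \<A> A s')" using B(2) e(4) H2.aeq_trans H2.aeq_sym by blast
    moreover have "aeq (L2 \<A> g) p' 0" using B(1) e(3) H1.aeq_trans H1.aeq_sym by blast
    ultimately show "(x', y') \<in> B2_op \<A> g A"
      using H1.aeq_elems(2)[OF e(1)] H2.aeq_elems(2)[OF e(2)] unfolding B2_op_def xy' by blast
  qed
qed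

end

text \<open>The multipliers live on the target manifold and are conjugated to the source, where the
  correspondence of \<open>Gamma_op\<close> carries over to \<open>Pi_op\<close> through adjoints,
  compositions and sums.\<close>

theorem (in rough_iso) quadratic_estimate_transfer:
  assumes A: "measurable_endo_field \<B> A"
  shows "quadratic_estimate (HH \<B> h) (Pi_op \<B> h (B1_op \<B> h a) (B2_op \<B> h A)) \<longleftrightarrow>
    quadratic_estimate (HH \<A> g) (Pi_op \<A> g (conj_op (Phi_op \<B> h \<A> g G) (B1_op \<B> h a)) (conj_op (Phi_op \<B> h \<A> g G) (B2_op \<B> h A)))"
  unfolding Phi_op_eq Pi_op_def
  by (intro triple.corr_quadratic_estimate triple.corr_plus triple.corr_relcomp triple.corr_adjoint triple.corr_conj Gamma_corr
      S.B1_saturated S.B2_saturated A)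

section \<open>Local Lipeomorphisms as almost everywhere isometries of rough metrics\<close>

subsection \<open>Continuous metrics and their pullbacks\<close>

lemma matrix_inner_sum: "(a :: real ^ 'n) \<bullet> (H *v b) = (\<Sum>i\<in>UNIV. \<Sum>j\<in>UNIV. a $ i * (H $ i $ j * b $ j))"
  by (simp add: inner_vec_def matrix_vector_mult_def sum_distrib_left)

lemma matrix_entry_inner: "(H :: real ^ 'n ^ 'n) $ i $ j = axis i 1 \<bullet> (H *v axis j 1)"
  by (simp add: inner_axis' matrix_vector_mul_component inner_axis)

text \<open>On the compact product with the unit sphere the quadratic form attains a positive
  minimum \<open>m\<close>. Homogeneity gives the lower bound with constant \<open>1 / m\<close>,
  and boundedness of the image controls the entries.\<close>

lemma comparable_compact:
  fixes H :: "'a::topological_space \<Rightarrow> real ^ 'n ^ 'n"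
  assumes K: "compact K" and H: "continuous_on K H" and pd: "\<And>y. y \<in> K \<Longrightarrow> posdef (H y)"
  obtains C where "C > 0" "\<And>y. y \<in> K \<Longrightarrow> comparable C (H y)"
proof (cases "K = {}")
  case True
  then show thesis using that[of 1] by simp
next
  case False
  let ?S = "sphere 0 1 :: (real ^ 'n) set"
  let ?q = "\<lambda>p. snd p \<bullet> (H (fst p) *v snd p)"
  have "axis undefined 1 \<in> ?S" by (simp add: norm_axis_1)
  then have ne: "K \<times> ?S \<noteq> {}" using False by blast
  have Hf: "continuous_on (K \<times> ?S) (\<lambda>p. H (fst p))"
    by (rule continuous_on_compose2[OF H continuous_on_fst[OF continuous_on_id]]) auto
  have "continuous_on (K \<times> ?S) ?q"
    unfolding matrix_inner_sum
    by (intro continuous_on_sum continuous_on_mult continuous_on_component continuous_on_snd continuous_on_id Hf)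
  then obtain p where p: "p \<in> K \<times> ?S" "\<And>p'. p' \<in> K \<times> ?S \<Longrightarrow> ?q p \<le> ?q p'"
    using continuous_attains_inf[OF compact_Times[OF K compact_sphere] ne] by blast
  define m where "m = ?q p"
  have "snd p \<noteq> 0" "fst p \<in> K" using p(1) by auto
  then have m: "m > 0" unfolding m_def using pd[of "fst p"] by (simp add: posdef_def)
  have "bounded (H ` K)" by (rule compact_imp_bounded[OF compact_continuous_image[OF H K]])
  then obtain b where b: "\<And>y. y \<in> K \<Longrightarrow> norm (H y) \<le> b" unfolding bounded_iff by blast
  show thesis
  proof (rule that[of "max b (1 / m)"])
    show "max b (1 / m) > 0" using m by (simp add: less_max_iff_disj)
    fix y assume y: "y \<in> K"
    have "\<bar>H y $ i $ j\<bar> \<le> max b (1 / m)" for i j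
      using b[OF y] Finite_Cartesian_Product.norm_nth_le[of "H y" i] Finite_Cartesian_Product.norm_nth_le[of "H y $ i" j] by simp
    moreover have "v \<bullet> v \<le> max b (1 / m) * (v \<bullet> (H y *v v))" for v
    proof (cases "v = 0")
      case False
      define u where "u = v /\<^sub>R norm v"
      have v: "v = norm v *\<^sub>R u" and u: "u \<in> ?S" using False by (simp_all add: u_def)
      have "m \<le> u \<bullet> (H y *v u)" using p(2)[of "(y, u)"] y u by (simp add: m_def)
      then have "(norm v)\<^sup>2 * m \<le> (norm v)\<^sup>2 * (u \<bullet> (H y *v u))" by (intro mult_left_mono) auto
      also have "\<dots> = (norm v *\<^sub>R u) \<bullet> (H y *v (norm v *\<^sub>R u))"
        by (simp add: matrix_vector_mult_scaleR power2_eq_square)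
      finally have le: "(norm v)\<^sup>2 * m \<le> v \<bullet> (H y *v v)" using v by simp
      then have "v \<bullet> v \<le> (1 / m) * (v \<bullet> (H y *v v))" using m by (simp add: field_simps power2_norm_eq_inner)
      also have "\<dots> \<le> max b (1 / m) * (v \<bullet> (H y *v v))"
        using le m by (intro mult_right_mono) (auto intro: order_trans[rotated])
      finally show ?thesis .
    qed simp
    ultimately show "comparable (max b (1 / m)) (H y)" by (simp add: comparable_def)
  qed
qed

context smooth_manifold
begin

lemma continuous_metricD:
  assumes "continuous_metric \<A> h"
  shows "c \<in> \<A> \<Longrightarrow> d \<in> \<A> \<Longrightarrow> x \<in> fst c \<Longrightarrow> x \<in> fst d \<Longrightarrow>
      h c x = transpose (jacobian id c d x) ** h d x ** jacobian id c d x"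
    "c \<in> \<A> \<Longrightarrow> continuous_on (fst c) (h c)" "c \<in> \<A> \<Longrightarrow> x \<in> fst c \<Longrightarrow> posdef (h c x)"
  using assms[unfolded continuous_metric_def, THEN conjunct1, rule_format, of c d x]
    assms[unfolded continuous_metric_def, THEN conjunct2, rule_format, of c] by (auto simp: posdef_def)

lemma continuous_metric_tensorial:
  assumes h: "continuous_metric \<A> h"
  shows "tensorial \<A> h"
  unfolding tensorial_def
proof (intro conjI ballI)
  show "h c x = transpose (jacobian id c d x) ** h d x ** jacobian id c d x" if "c \<in> \<A>" "d \<in> \<A>" "x \<in> fst c \<inter> fst d" for c d x
    using continuous_metricD(1)[OF h that(1,2)] that(3) by blast
  fix c assume c: "c \<in> \<A>"
  have "continuous_on (snd c ` fst c) (\<lambda>y. h c (chart_inv c y))"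
    by (rule continuous_on_compose2[OF continuous_metricD(2)[OF h c] chart_inv_cont[OF charts[OF c]]]) (use c in auto)
  moreover have "open (snd c ` fst c)" using charts[OF c] by (simp add: is_chart_def)
  ultimately show "chart_measurable c (h c)"
    unfolding chart_measurable_def
    by (intro continuous_imp_measurable_on_sets_lebesgue) (simp_all add: borel_open sets_completionI_sets)
qed

lemma continuous_metric_comparable:
  assumes h: "continuous_metric \<A> h" and c: "c \<in> \<A>" "x \<in> fst c"
  obtains V C where "open V" "x \<in> V" "V \<subseteq> fst c" "C > 0" "\<And>y. y \<in> V \<Longrightarrow> comparable C (h c y)"
proof -
  let ?S = "snd c ` fst c"
  have S: "open ?S" "snd c x \<in> ?S" using charts[OF c(1)] c(2) by (auto simp: is_chart_def)
  then obtain r where r: "r > 0" "cball (snd c x) r \<subseteq> ?S" by (meson open_contains_cball)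
  have ch: "chart_inv c y \<in> fst c" if "y \<in> cball (snd c x) r" for y using that r(2) c(1) by auto
  have cont: "continuous_on (cball (snd c x) r) (\<lambda>y. h c (chart_inv c y))"
    by (rule continuous_on_compose2[OF continuous_metricD(2)[OF h c(1)] continuous_on_subset[OF chart_inv_cont[OF charts[OF c(1)]] r(2)]])
      (use ch in auto)
  obtain C where C: "C > 0" "\<And>y. y \<in> cball (snd c x) r \<Longrightarrow> comparable C (h c (chart_inv c y))"
    by (rule comparable_compact[OF compact_cball cont continuous_metricD(3)[OF h c(1) ch]], assumption) (rule that)
  show thesis
  proof (rule that[of "fst c \<inter> snd c -` ball (snd c x) r" C])
    show "open (fst c \<inter> snd c -` ball (snd c x) r)" by (rule chart_open_vimage[OF charts[OF c(1)] open_ball])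
    show "comparable C (h c y)" if "y \<in> fst c \<inter> snd c -` ball (snd c x) r" for y
      using C(2)[of "snd c y"] that c(1) by simp
  qed (use c r C in auto)
qed

lemma continuous_metric_rough:
  assumes h: "continuous_metric \<A> h"
  shows "rough_metric \<A> h"
  unfolding rough_metric_def
proof (intro conjI allI ballI)
  show "tensorial \<A> h" by (rule continuous_metric_tensorial[OF h])
  show "transpose (h c x) = h c x" if "c \<in> \<A>" "x \<in> fst c" for c x
    using continuous_metricD(3)[OF h that] by (simp add: posdef_def)
  fix x
  obtain V C where V: "open V" "x \<in> V" "V \<subseteq> fst (chart_at \<A> x)" "C > 0" "\<And>y. y \<in> V \<Longrightarrow> comparable C (h (chart_at \<A> x) y)"
    by (rule continuous_metric_comparable[OF h chart_at]) (rule that)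
  then have "{y \<in> V. \<not> comparable C (h (chart_at \<A> x) y)} = {}" by blast
  then have "mnull \<A> {y \<in> V. \<not> comparable C (h (chart_at \<A> x) y)}" by (simp only: mnull_empty)
  then show "\<exists>c\<in>\<A>. \<exists>V C. open V \<and> x \<in> V \<and> V \<subseteq> fst c \<and> C > 0 \<and> mnull \<A> {y \<in> V. \<not> comparable C (h c y)}"
    using V(1-4) by (intro bexI[of _ "chart_at \<A> x"] exI[of _ V] exI[of _ C] conjI) simp_all
qed

end

context lip_homeo
begin

lemma pullback_metric_apply:
  assumes h: "continuous_metric \<B> h" and c: "c \<in> \<A>" "x \<in> fst c" and d: "d \<in> \<B>" "F x \<in> fst d"
  shows "pullback_metric \<B> F h c x =
    (if diff_at x then transpose (jacobian F c d x) ** h d (F x) ** jacobian F c d x else 0)"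
proof -
  let ?e = "chart_at \<B> (F x)"
  have iff: "local_rep F c ?e differentiable (at (snd c x)) \<longleftrightarrow> diff_at x"
    using diff_atI[OF c, of ?e] diff_atD[of x, OF _ c, of ?e] by auto
  show ?thesis
  proof (cases "diff_at x")
    case True
    let ?T = "jacobian id d ?e (F x)"
    have "jacobian F c ?e x = ?T ** jacobian F c d x ** jacobian id c c x"
      using change_charts(2)[OF c(1) c(1) c(2) c(2) d(1) _ d(2), of ?e] diff_atD[OF True c d] by simp
    then have J: "jacobian F c ?e x = ?T ** jacobian F c d x" by (simp add: M.jacobian_id_self[OF c])
    have "h d (F x) = transpose ?T ** h ?e (F x) ** ?T" by (rule N.continuous_metricD(1)[OF h d(1) _ d(2)]) simp_all
    then show ?thesis
      using True iff by (simp add: pullback_metric_def Let_def J matrix_transpose_mul matrix_mul_assoc)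
  qed (use iff in \<open>simp add: pullback_metric_def Let_def\<close>)
qed

lemma pullback_metric_change:
  assumes h: "continuous_metric \<B> h" and c: "c \<in> \<A>" "c' \<in> \<A>" "x \<in> fst c" "x \<in> fst c'"
  shows "pullback_metric \<B> F h c x =
    transpose (jacobian id c c' x) ** pullback_metric \<B> F h c' x ** jacobian id c c' x"
proof -
  let ?d = "chart_at \<B> (F x)"
  have d: "?d \<in> \<B>" "F x \<in> fst ?d" by simp_all
  show ?thesis
  proof (cases "diff_at x")
    case True
    have "jacobian F c ?d x = jacobian id ?d ?d (F x) ** jacobian F c' ?d x ** jacobian id c c' x"
      using change_charts(2)[OF c(2,1,4,3) d(1,1,2,2)] diff_atD[OF True c(2,4) d] by simp
    then have "jacobian F c ?d x = jacobian F c' ?d x ** jacobian id c c' x"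
      by (simp add: N.jacobian_id_self[OF d])
    then show ?thesis
      using pullback_metric_apply[OF h c(1,3) d] pullback_metric_apply[OF h c(2,4) d] True
      by (simp add: matrix_transpose_mul matrix_mul_assoc)
  next
    case False
    then show ?thesis using pullback_metric_apply[OF h c(1,3) d] pullback_metric_apply[OF h c(2,4) d] by simp
  qed
qed

text \<open>Each piece of a countable cover uses one target chart. Setting the Jacobian to zero off
  the points of differentiability reproduces the convention of
  \<open>pullback_metric\<close>.\<close>

lemma pullback_metric_measurable:
  assumes h: "continuous_metric \<B> h" and c: "c \<in> \<A>"
  shows "chart_measurable c (pullback_metric \<B> F h c)"
proof -
  have "\<exists>d\<in>\<B>. open (F -` fst d) \<and> x \<in> F -` fst d" for x
    by (rule bexI[of _ "chart_at \<B> (F x)"]) (auto intro!: open_vimage chart_open cont_F)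
  then obtain e and D :: "nat \<Rightarrow> 'm set" where eD: "\<And>n. e n \<in> \<B>" "\<And>n. D n \<subseteq> F -` fst (e n)"
    "\<And>n. D n \<in> lebesgue_sets \<A>" "disjoint_family D" "(\<Union>n. D n) = UNIV"
    by (rule M.disjoint_cover[of \<B> "\<lambda>d. F -` fst d"]) (rule that)
  let ?S = "snd c ` fst c"
  have oS: "open ?S" using M.charts[OF c] by (simp add: is_chart_def)
  define J where "J d y = (if y \<in> ?S then if F (chart_inv c y) \<in> fst d \<and> diff_at (chart_inv c y)
    then jacobian F c d (chart_inv c y) else 0 else 0)" for d y
  define Hd where "Hd d y = (if y \<in> snd c ` (fst c \<inter> F -` fst d) then h d (F (chart_inv c y)) else 0)" for d y
  have Jm: "(\<lambda>y. J d y $ i $ j) \<in> borel_measurable lebesgue" if d: "d \<in> \<B>" for d i j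
    using jacobian_measurable[OF c d, of i j] unfolding chart_measurable_iff[OF M.charts[OF c]]
    by (rule measurable_cong[THEN iffD1, rotated]) (auto simp: J_def)
  have Hm: "(\<lambda>y. Hd d y $ i $ j) \<in> borel_measurable lebesgue" if d: "d \<in> \<B>" for d i j
  proof -
    let ?O = "snd c ` (fst c \<inter> F -` fst d)"
    have oO: "open ?O" by (rule open_chart_overlap) (use c d cont_F in auto)
    have "continuous_on ?O (chart_inv c)" by (rule continuous_on_subset[OF chart_inv_cont[OF M.charts[OF c]]]) auto
    then have "continuous_on ?O (\<lambda>y. F (chart_inv c y))" by (intro continuous_on_compose2[OF cont_F]) auto
    then have "continuous_on ?O (\<lambda>y. h d (F (chart_inv c y)))"
      by (rule continuous_on_compose2[OF N.continuous_metricD(2)[OF h d]]) (use c in auto)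
    then have "Hd d \<in> borel_measurable borel" unfolding Hd_def
      by (intro borel_measurable_continuous_on_if) (use oO in auto)
    then have "Hd d \<in> borel_measurable lebesgue" by (intro measurable_completion) simp
    then show ?thesis by (intro borel_measurable_vec_nth')
  qed
  have "(\<lambda>y. (transpose (J d y) ** Hd d y ** J d y) $ i $ j) \<in> borel_measurable lebesgue" if "d \<in> \<B>" for d i j
    unfolding matrix_matrix_mult_def transpose_def
    using Jm[OF that] Hm[OF that] by simp
  then have fm: "(\<lambda>y. transpose (J d y) ** Hd d y ** J d y) \<in> borel_measurable lebesgue" if "d \<in> \<B>" for d
    using that by (intro borel_measurable_vecI)
  let ?p = "\<lambda>y. if y \<in> ?S then pullback_metric \<B> F h c (chart_inv c y) else 0"
  let ?E = "\<lambda>n. snd c ` (D n \<inter> fst c)"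
  have E: "?E n \<in> sets lebesgue" for n using eD(3)[of n] c by (simp add: lebesgue_sets_def)
  have eq: "?p y = transpose (J (e n) y) ** Hd (e n) y ** J (e n) y" if y: "y \<in> ?E n" for y n
  proof -
    obtain x where x: "x \<in> D n" "x \<in> fst c" "y = snd c x" using y by blast
    have Fx: "F x \<in> fst (e n)" using x(1) eD(2) by auto
    have O: "snd c x \<in> snd c ` (fst c \<inter> F -` fst (e n))" using x(2) Fx by blast
    show ?thesis
      using pullback_metric_apply[OF h c x(2) eD(1) Fx] x c O Fx by (simp add: J_def Hd_def)
  qed
  have "?p \<in> borel_measurable lebesgue"
  proof (rule measurable_piecewise_restrict[of "insert (- ?S) (range ?E)"])
    show "countable (insert (- ?S) (range ?E))" by simp
    have "y \<in> (\<Union>n. ?E n)" if y: "y \<in> ?S" for y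
    proof -
      obtain x where x: "x \<in> fst c" "y = snd c x" using y by blast
      have "x \<in> (\<Union>n. D n)" using eD(5) by simp
      then obtain n where "x \<in> D n" by blast
      then show ?thesis using x by blast
    qed
    then show "space lebesgue \<subseteq> \<Union> (insert (- ?S) (range ?E))" by blast
    have "- ?S \<in> sets lebesgue" using oS by (simp add: borel_closed sets_completionI_sets)
    then show "\<Omega> \<inter> space lebesgue \<in> sets lebesgue" if "\<Omega> \<in> insert (- ?S) (range ?E)" for \<Omega>
      using that E by auto
    fix \<Omega> assume "\<Omega> \<in> insert (- ?S) (range ?E)"
    then consider "\<Omega> = - ?S" | n where "\<Omega> = ?E n" by blast
    then show "?p \<in> borel_measurable (restrict_space lebesgue \<Omega>)"
    proof cases
      case 1
      have "(\<lambda>_. 0) \<in> borel_measurable (restrict_space lebesgue \<Omega>)" by simp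
      then show ?thesis by (rule measurable_cong[THEN iffD1, rotated]) (simp add: 1 space_restrict_space)
    next
      case (2 n)
      show ?thesis
        by (rule measurable_cong[THEN iffD1, rotated, OF measurable_restrict_space1[OF fm[OF eD(1)[of n]]]])
          (use eq[of _ n] in \<open>simp add: 2 space_restrict_space\<close>)
    qed
  qed
  then show ?thesis using chart_measurable_iff[OF M.charts[OF c]] by blast
qed

lemma pullback_metric_tensorial:
  assumes h: "continuous_metric \<B> h"
  shows "tensorial \<A> (pullback_metric \<B> F h)"
  unfolding tensorial_def
proof (intro conjI ballI)
  show "pullback_metric \<B> F h c x = transpose (jacobian id c d x) ** pullback_metric \<B> F h d x ** jacobian id c d x"
    if "c \<in> \<A>" "d \<in> \<A>" "x \<in> fst c \<inter> fst d" for c d x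
    using pullback_metric_change[OF h that(1,2)] that(3) by blast
qed (rule pullback_metric_measurable[OF h])

lemma pullback_metric_iso:
  assumes h: "continuous_metric \<B> h"
  shows "metric_iso \<A> \<B> F G (pullback_metric \<B> F h) h {x. \<not> diff_at x}"
proof
  show "tensorial \<A> (pullback_metric \<B> F h)" by (rule pullback_metric_tensorial[OF h])
  show "tensorial \<B> h" by (rule N.continuous_metric_tensorial[OF h])
  show "mnull \<A> {x. \<not> diff_at x}" by (rule mnull_not_diff)
  show "diff_at x" if "x \<notin> {x. \<not> diff_at x}" for x using that by simp
  show "pullback_metric \<B> F h c x = transpose (jacobian F c d x) ** h d (F x) ** jacobian F c d x"
    if "x \<notin> {x. \<not> diff_at x}" "c \<in> \<A>" "d \<in> \<B>" "x \<in> fst c" "F x \<in> fst d" for x c d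
    using pullback_metric_apply[OF h that(2,4,3,5)] that(1) by simp
qed

end

subsection \<open>Local Lipeomorphisms\<close>

text \<open>Both bounds survive the limit of difference quotients. This is the source of the
  comparability of the pulled back metric.\<close>

lemma bilipschitz_derivative:
  fixes f :: "'a::real_normed_vector \<Rightarrow> 'b::real_normed_vector"
  assumes D: "(f has_derivative D) (at x)" and S: "open S" "x \<in> S"
    and lower: "\<And>y. y \<in> S \<Longrightarrow> inverse C * norm (y - x) \<le> norm (f y - f x)"
    and upper: "\<And>y. y \<in> S \<Longrightarrow> norm (f y - f x) \<le> C * norm (y - x)"
  shows "inverse C * norm v \<le> norm (D v)" "norm (D v) \<le> C * norm v"
proof -
  let ?t = "\<lambda>n. inverse (real (Suc n))"
  let ?q = "\<lambda>n. real (Suc n) *\<^sub>R (f (x + ?t n *\<^sub>R v) - f x)"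
  have lim: "(\<lambda>n. norm (?q n)) \<longlonglongrightarrow> norm (D v)" by (intro tendsto_norm directional_quotients_tendsto[OF D])
  have "(\<lambda>n. x + ?t n *\<^sub>R v) \<longlonglongrightarrow> x + 0 *\<^sub>R v" by (intro tendsto_intros LIMSEQ_inverse_real_of_nat)
  then have ev: "eventually (\<lambda>n. x + ?t n *\<^sub>R v \<in> S) sequentially" using topological_tendstoD[OF _ S(1)] S(2) by simp
  have n1: "norm (?q n) = real (Suc n) * norm (f (x + ?t n *\<^sub>R v) - f x)" for n by (simp only: norm_scaleR abs_of_nat)
  have n2: "norm (x + ?t n *\<^sub>R v - x) = ?t n * norm v" for n by simp
  have n3: "real (Suc n) * (k * (?t n * norm v)) = k * norm v" for n k by (simp add: field_simps del: of_nat_Suc)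
  show "norm (D v) \<le> C * norm v"
  proof (rule tendsto_upperbound[OF lim])
    show "eventually (\<lambda>n. norm (?q n) \<le> C * norm v) sequentially"
      using ev
    proof eventually_elim
      case (elim m)
      show ?case using mult_left_mono[OF upper[OF elim], of "real (Suc m)"] unfolding n1 n2 n3 by simp
    qed
  qed simp
  show "inverse C * norm v \<le> norm (D v)"
  proof (rule tendsto_lowerbound[OF lim])
    show "eventually (\<lambda>n. inverse C * norm v \<le> norm (?q n)) sequentially"
      using ev
    proof eventually_elim
      case (elim m)
      show ?case using mult_left_mono[OF lower[OF elim], of "real (Suc m)"] unfolding n1 n2 n3 by simp
    qed
  qed simp
qed

text \<open>An entry of the product is a sum of \<open>CARD('n)\<close> squared many terms, each at
  most \<open>C * (K * C)\<close>. The lower bound needs only \<open>K * C\<^sup>2\<close>, which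
  the factor from the entries can only enlarge.\<close>

lemma comparable_congruence:
  fixes J H :: "real ^ 'n ^ 'n"
  assumes H: "comparable K H" "K > 0" and C: "C > 0"
    and J: "\<And>v. inverse C * norm v \<le> norm (J *v v)" "\<And>v. norm (J *v v) \<le> C * norm v"
  shows "comparable (real CARD('n) ^ 2 * K * C\<^sup>2) (transpose J ** H ** J)"
  unfolding comparable_def
proof (intro conjI allI)
  fix i j
  let ?a = "J *v axis i 1" and ?b = "J *v axis j 1"
  have ab: "\<bar>?a $ k\<bar> \<le> C" "\<bar>?b $ k\<bar> \<le> C" for k
    using J(2)[of "axis i 1"] J(2)[of "axis j 1"] component_le_norm_cart[of ?a k] component_le_norm_cart[of ?b k]
    by (simp_all add: norm_axis_1)
  have "(transpose J ** H ** J) $ i $ j = axis i 1 \<bullet> (transpose J *v (H *v ?b))"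
    unfolding matrix_entry_inner[of "transpose J ** H ** J"] by (simp only: matrix_vector_mul_assoc matrix_mul_assoc)
  then have "(transpose J ** H ** J) $ i $ j = ?a \<bullet> (H *v ?b)"
    by (simp only: inner_transpose[of _ "transpose J"] transpose_transpose)
  moreover have "\<bar>?a \<bullet> (H *v ?b)\<bar> \<le> (\<Sum>k\<in>(UNIV::'n set). \<Sum>l\<in>(UNIV::'n set). C * (K * C))"
    unfolding matrix_inner_sum
  proof (intro order_trans[OF sum_abs] sum_mono)
    fix k l :: 'n
    show "\<bar>?a $ k * (H $ k $ l * ?b $ l)\<bar> \<le> C * (K * C)"
      unfolding abs_mult using ab H C by (intro mult_mono) (auto simp: comparable_def)
  qed
  moreover have "\<dots> = real CARD('n) ^ 2 * K * C\<^sup>2" by (simp add: power2_eq_square)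
  ultimately show "\<bar>(transpose J ** H ** J) $ i $ j\<bar> \<le> real CARD('n) ^ 2 * K * C\<^sup>2" by (simp only:)
next
  fix v :: "real ^ 'n"
  let ?w = "J *v v"
  have "norm v \<le> C * norm ?w" using J(1)[of v] C by (simp add: field_simps)
  then have "(norm v)\<^sup>2 \<le> (C * norm ?w)\<^sup>2" by (intro power_mono) auto
  then have "v \<bullet> v \<le> C\<^sup>2 * (?w \<bullet> ?w)" by (simp add: power_mult_distrib power2_norm_eq_inner)
  also have "\<dots> \<le> C\<^sup>2 * (K * (?w \<bullet> (H *v ?w)))" using H(1) by (intro mult_left_mono) (auto simp: comparable_def)
  also have "\<dots> = 1 * (K * C\<^sup>2 * (?w \<bullet> (H *v ?w)))" by simp
  also have "\<dots> \<le> real CARD('n) ^ 2 * (K * C\<^sup>2 * (?w \<bullet> (H *v ?w)))"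
  proof (rule mult_right_mono)
    have "0 \<le> K * (?w \<bullet> (H *v ?w))" using H(1) order_trans[OF inner_ge_zero[of ?w]] unfolding comparable_def by blast
    then have "0 \<le> ?w \<bullet> (H *v ?w)" using H(2) by (simp add: zero_le_mult_iff)
    then show "0 \<le> K * C\<^sup>2 * (?w \<bullet> (H *v ?w))" using H(2) by simp
    have "1 \<le> real CARD('n)" using zero_less_card_finite[where 'a='n] by linarith
    then show "1 \<le> real CARD('n) ^ 2" by simp
  qed
  finally show "v \<bullet> v \<le> real CARD('n) ^ 2 * K * C\<^sup>2 * (v \<bullet> ((transpose J ** H ** J) *v v))"
    unfolding congruence_quadratic by (simp add: mult.assoc)
qed

lemma lipschitz_near_change_charts:
  assumes sm: "smooth_structure \<A>" "smooth_structure \<B>" and F: "continuous_on UNIV F"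
    and c: "c \<in> \<A>" "c' \<in> \<A>" "x \<in> fst c" "x \<in> fst c'" and d: "d \<in> \<B>" "d' \<in> \<B>" "F x \<in> fst d" "F x \<in> fst d'"
    and lip: "lipschitz_near (local_rep F c d) (snd c x)"
  shows "lipschitz_near (local_rep F c' d') (snd c' x)"
proof -
  interpret M: smooth_manifold \<A> by unfold_locales (rule sm)
  interpret N: smooth_manifold \<B> by unfold_locales (rule sm)
  have cc: "local_rep id c' c (snd c' x) = snd c x" "local_rep F c d (snd c x) = snd d (F x)"
    using c by (simp_all add: local_rep_apply)
  have "lipschitz_near (\<lambda>y. local_rep F c d (local_rep id c' c y)) (snd c' x)"
    by (rule lipschitz_near_compose[OF M.transition_lipschitz[OF c(2,1,4,3)]]) (simp only: cc lip)
  then have l: "lipschitz_near (\<lambda>y. local_rep id d d' (local_rep F c d (local_rep id c' c y))) (snd c' x)"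
    by (rule lipschitz_near_compose) (simp only: cc N.transition_lipschitz[OF d])
  let ?O = "fst c' \<inter> (fst c \<inter> F -` fst d)"
  show ?thesis
  proof (rule lipschitz_near_eventually[OF l])
    show "open (snd c' ` ?O)"
      by (intro chart_open_image[OF M.charts[OF c(2)]] open_Int open_vimage chart_open M.charts N.charts c d F) auto
    show "snd c' x \<in> snd c' ` ?O" using c d by blast
    fix y assume "y \<in> snd c' ` ?O"
    then obtain z where "y = snd c' z" "z \<in> fst c'" "z \<in> fst c" "F z \<in> fst d" by blast
    then show "local_rep id d d' (local_rep F c d (local_rep id c' c y)) = local_rep F c' d' y"
      using c d by (simp add: local_rep_def)
  qed
qed

text \<open>The two-sided estimate in one pair of charts makes \<open>F\<close> and its inverse
  locally Lipschitz there, and smooth transitions extend this to all pairs. Its infinitesimal form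
  bounds the Jacobian above and below, so the pulled back metric is comparable to the Euclidean one
  wherever \<open>F\<close> is differentiable.\<close>

lemma local_lipeomorphism_rough_iso:
  fixes \<A> :: "('m::{t2_space, second_countable_topology}, 'n::finite) chart set"
    and \<B> :: "('k::{t2_space, second_countable_topology}, 'n) chart set"
  assumes sm: "smooth_structure \<A>" "smooth_structure \<B>" and h: "continuous_metric \<B> h"
    and F: "local_lipeomorphism \<A> \<B> F"
  obtains Z where "rough_iso \<A> \<B> F (inv F) (pullback_metric \<B> F h) h Z"
proof -
  interpret M: smooth_manifold \<A> by unfold_locales (rule sm)
  interpret N: smooth_manifold \<B> by unfold_locales (rule sm)
  obtain G where hom: "homeomorphism UNIV UNIV F G" using F by (auto simp: local_lipeomorphism_def)
  have FG: "G (F x) = x" "F (G y) = y" for x y using hom by (auto simp: homeomorphism_def)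
  have G: "inv F = G" by (rule inv_equality) (simp_all add: FG)
  have cont: "continuous_on UNIV F" "continuous_on UNIV G" using hom by (auto simp: homeomorphism_def)
  define bil :: "('m, 'n) chart \<Rightarrow> ('k, 'n) chart \<Rightarrow> real \<Rightarrow> bool" where "bil c d C \<longleftrightarrow> C \<ge> 1 \<and>
    (\<forall>x'\<in>snd c ` (fst c \<inter> F -` fst d). \<forall>y'\<in>snd c ` (fst c \<inter> F -` fst d).
           inverse C * norm (x' - y') \<le> norm (local_rep F c d x' - local_rep F c d y') \<and>
           norm (local_rep F c d x' - local_rep F c d y') \<le> C * norm (x' - y'))" for c d C
  have ex: "\<exists>c\<in>\<A>. \<exists>d\<in>\<B>. x \<in> fst c \<and> F x \<in> fst d \<and> (\<exists>C. bil c d C)" for x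
    using F unfolding local_lipeomorphism_def bil_def by blast
  have oS: "open (snd c ` (fst c \<inter> F -` fst d))" if "c \<in> \<A>" "d \<in> \<B>" for c d
    using open_chart_overlap[OF M.charts[OF that(1)] N.charts[OF that(2)] cont(1)] .
  have lipF: "lipschitz_near (local_rep F c d) (snd c x)" if c: "c \<in> \<A>" "x \<in> fst c" and d: "d \<in> \<B>" "F x \<in> fst d" for c d x
  proof -
    obtain c0 d0 C where cd: "c0 \<in> \<A>" "d0 \<in> \<B>" "x \<in> fst c0" "F x \<in> fst d0" and b: "bil c0 d0 C" using ex[of x] by blast
    let ?S = "snd c0 ` (fst c0 \<inter> F -` fst d0)"
    have "snd c0 x \<in> ?S" using cd by blast
    then obtain r where r: "r > 0" "ball (snd c0 x) r \<subseteq> ?S" using oS[OF cd(1,2)] open_contains_ball by blast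
    have "C-lipschitz_on ?S (local_rep F c0 d0)"
      using b unfolding bil_def by (intro lipschitz_onI) (auto simp: dist_norm)
    then have "lipschitz_near (local_rep F c0 d0) (snd c0 x)" by (rule lipschitz_nearI[OF lipschitz_on_subset[OF _ r(2)] r(1)])
    then show ?thesis by (rule lipschitz_near_change_charts[OF sm cont(1) cd(1) c(1) cd(3) c(2) cd(2) d(1) cd(4) d(2)])
  qed
  have lipG: "lipschitz_near (local_rep G d c) (snd d y)" if c: "c \<in> \<A>" "G y \<in> fst c" and d: "d \<in> \<B>" "y \<in> fst d" for c d y
  proof -
    obtain c0 d0 C where cd: "c0 \<in> \<A>" "d0 \<in> \<B>" "G y \<in> fst c0" "y \<in> fst d0" and b: "bil c0 d0 C"
      using ex[of "G y"] unfolding FG by blast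
    let ?S = "snd d0 ` (fst d0 \<inter> G -` fst c0)"
    have "open ?S" by (rule open_chart_overlap[OF N.charts[OF cd(2)] M.charts[OF cd(1)] cont(2)])
    moreover have "snd d0 y \<in> ?S" using cd by blast
    ultimately obtain r where r: "r > 0" "ball (snd d0 y) r \<subseteq> ?S" using open_contains_ball by blast
    have C: "C \<ge> 1" using b by (simp add: bil_def)
    \<comment> \<open>The lower estimate for \<open>F\<close> read backwards is the Lipschitz bound
      for \<open>G\<close>, with the same constant.\<close>
    have "C-lipschitz_on ?S (local_rep G d0 c0)"
    proof (rule lipschitz_onI)
      fix y1 y2 assume "y1 \<in> ?S" "y2 \<in> ?S"
      then obtain z1 z2 where z: "y1 = snd d0 z1" "z1 \<in> fst d0" "G z1 \<in> fst c0" "y2 = snd d0 z2" "z2 \<in> fst d0" "G z2 \<in> fst c0" by blast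
      have S: "snd c0 (G z1) \<in> snd c0 ` (fst c0 \<inter> F -` fst d0)" "snd c0 (G z2) \<in> snd c0 ` (fst c0 \<inter> F -` fst d0)"
        using z FG by auto
      have "inverse C * norm (snd c0 (G z1) - snd c0 (G z2)) \<le> norm (y1 - y2)"
        using b[unfolded bil_def, THEN conjunct2, rule_format, OF S, THEN conjunct1]
        by (simp only: local_rep_apply[OF M.charts[OF cd(1)] z(3)] local_rep_apply[OF M.charts[OF cd(1)] z(6)] FG z)
      then have "norm (snd c0 (G z1) - snd c0 (G z2)) \<le> C * norm (y1 - y2)" using C by (simp add: field_simps)
      then show "dist (local_rep G d0 c0 y1) (local_rep G d0 c0 y2) \<le> C * dist y1 y2"
        using z cd by (simp add: local_rep_apply dist_norm)
    qed (use C in simp)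
    then have "lipschitz_near (local_rep G d0 c0) (snd d0 y)" by (rule lipschitz_nearI[OF lipschitz_on_subset[OF _ r(2)] r(1)])
    then show ?thesis by (rule lipschitz_near_change_charts[OF sm(2,1) cont(2) cd(2) d(1) cd(4) d(2) cd(1) c(1) cd(3) c(2)])
  qed
  interpret L: lip_homeo \<A> \<B> F G
    by unfold_locales (rule cont FG lipF lipG; assumption)+
  interpret I: metric_iso \<A> \<B> F G "pullback_metric \<B> F h" h "{x. \<not> L.diff_at x}" by (rule L.pullback_metric_iso[OF h])
  have "rough_metric \<A> (pullback_metric \<B> F h)"
    unfolding rough_metric_def
  proof (intro conjI allI ballI)
    show "tensorial \<A> (pullback_metric \<B> F h)" by (rule I.tensorial_g)
    show "transpose (pullback_metric \<B> F h c x) = pullback_metric \<B> F h c x" if c: "c \<in> \<A>" "x \<in> fst c" for c x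
    proof -
      have "transpose (h (chart_at \<B> (F x)) (F x)) = h (chart_at \<B> (F x)) (F x)"
        using N.continuous_metricD(3)[OF h, of "chart_at \<B> (F x)" "F x"] by (simp add: posdef_def)
      moreover have "transpose (0 :: real ^ 'n ^ 'n) = 0" by (simp add: transpose_def vec_eq_iff)
      ultimately show ?thesis by (simp add: pullback_metric_def Let_def transpose_congruence)
    qed
    fix x
    obtain c d C where cd: "c \<in> \<A>" "d \<in> \<B>" "x \<in> fst c" "F x \<in> fst d" and b: "bil c d C" using ex[of x] by blast
    obtain V K where V: "open V" "F x \<in> V" "V \<subseteq> fst d" "K > 0" "\<And>y. y \<in> V \<Longrightarrow> comparable K (h d y)"
      by (rule N.continuous_metric_comparable[OF h cd(2,4)]) (rule that)
    let ?V = "fst c \<inter> F -` V" and ?K = "real CARD('n) ^ 2 * K * C\<^sup>2"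
    have C: "C \<ge> 1" using b by (simp add: bil_def)
    have "comparable ?K (pullback_metric \<B> F h c y)" if y: "y \<in> ?V" "L.diff_at y" for y
    proof -
      have yc: "y \<in> fst c" and yV: "F y \<in> V" and yd: "F y \<in> fst d" using y V(3) by auto
      let ?J = "jacobian F c d y"
      have D: "(local_rep F c d has_derivative (*v) ?J) (at (snd c y))"
        by (rule local_rep_has_jacobian[OF L.diff_atD[OF y(2) cd(1) yc cd(2) yd]])
      have yS: "snd c y \<in> snd c ` (fst c \<inter> F -` fst d)" using yc yd by blast
      have bd: "inverse C * norm (z - snd c y) \<le> norm (local_rep F c d z - local_rep F c d (snd c y))"
        "norm (local_rep F c d z - local_rep F c d (snd c y)) \<le> C * norm (z - snd c y)"
        if "z \<in> snd c ` (fst c \<inter> F -` fst d)" for z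
        using b[unfolded bil_def, THEN conjunct2, rule_format, OF that yS] by auto
      note J = bilipschitz_derivative[OF D oS[OF cd(1,2)] yS bd]
      have "comparable ?K (transpose ?J ** h d (F y) ** ?J)"
        by (rule comparable_congruence[OF V(5)[OF yV] V(4) _ J]) (use C in auto)
      then show ?thesis using L.pullback_metric_apply[OF h cd(1) yc cd(2) yd] y(2) by simp
    qed
    then have "{y \<in> ?V. \<not> comparable ?K (pullback_metric \<B> F h c y)} \<subseteq> {x. \<not> L.diff_at x}" by blast
    then have mn: "mnull \<A> {y \<in> ?V. \<not> comparable ?K (pullback_metric \<B> F h c y)}"
      by (rule mnull_subset[OF L.mnull_not_diff])
    have "open ?V" by (intro open_Int open_vimage chart_open M.charts cd V(1) cont(1))
    moreover have "x \<in> ?V" "?V \<subseteq> fst c" using cd V(2) by auto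
    moreover have "?K > 0" using V(4) C by (intro mult_pos_pos) auto
    ultimately have "\<exists>V C. open V \<and> x \<in> V \<and> V \<subseteq> fst c \<and> C > 0 \<and> mnull \<A> {y \<in> V. \<not> comparable C (pullback_metric \<B> F h c y)}"
      using mn by (intro exI[of _ ?V] exI[of _ ?K] conjI)
    then show "\<exists>c\<in>\<A>. \<exists>V C. open V \<and> x \<in> V \<and> V \<subseteq> fst c \<and> C > 0 \<and> mnull \<A> {y \<in> V. \<not> comparable C (pullback_metric \<B> F h c y)}"
      by (rule bexI[OF _ cd(1)])
  qed
  then have "rough_iso \<A> \<B> F G (pullback_metric \<B> F h) h {x. \<not> L.diff_at x}"
    using N.continuous_metric_rough[OF h] by unfold_locales
  then show thesis using that by (simp only: G)
qed

theorem theorem5p15: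
  fixes \<A> :: "('m::{t2_space, second_countable_topology}, 'n::finite) chart set"
    and \<B> :: "('k::{t2_space, second_countable_topology}, 'n) chart set"
    and h :: "('k, 'n) metric_field" and g :: "('m, 'n) metric_field"
    and F :: "'m \<Rightarrow> 'k"
    and a :: "'m \<Rightarrow> complex" and A :: "('m, 'n) endo_field"
    and \<kappa>1 \<kappa>2 :: real
  assumes "smooth_structure \<A>" and "smooth_structure \<B>"
    and "continuous_metric \<B> h" and "complete_metric \<B> h"
    and "local_lipeomorphism \<A> \<B> F"
    and "g = pullback_metric \<B> F h"
    and "ess_bounded_fun \<A> g a"
    and "measurable_endo_field \<A> A" and "ess_bounded_endo \<A> g A"
    and "\<kappa>1 > 0" and "\<kappa>2 > 0"
    and "\<forall>v\<in>W12 \<A> g. \<forall>s. (v, s) \<in> S_op \<A> g \<longrightarrow>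
           Re (inn (L2pair \<A> g) (endo_app \<A> A s) s) \<ge> \<kappa>1 * (W12_norm \<A> g v)\<^sup>2"
    and "\<forall>u\<in>elems (L2 \<A> g).
           Re (inn (L2 \<A> g) (\<lambda>x. a x * u x) u) \<ge> \<kappa>2 * (hnorm (L2 \<A> g) u)\<^sup>2"
  shows "quadratic_estimate (HH \<A> g) (Pi_op \<A> g (B1_op \<A> g a) (B2_op \<A> g A)) \<longleftrightarrow>
         quadratic_estimate (HH \<B> h)
           (Pi_op \<B> h (conj_op (Phi_op \<A> g \<B> h F) (B1_op \<A> g a))
                      (conj_op (Phi_op \<A> g \<B> h F) (B2_op \<A> g A)))"
proof -
  obtain Z where "rough_iso \<A> \<B> F (inv F) g h Z"
    by (rule local_lipeomorphism_rough_iso[OF assms(1,2,3,5)]) (use assms(6) in simp)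
  then interpret I: rough_iso \<A> \<B> F "inv F" g h Z .
  \<comment> \<open>The transfer moves multipliers from target to source, and here they live on the
    source of \<open>F\<close>; it is therefore applied to the swapped isometry, whose map is
    \<open>inv F\<close>.\<close>
  show ?thesis by (rule rough_iso.quadratic_estimate_transfer[OF I.swap_iso assms(8)])
qed

end
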